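(* There is a randomized algorithm that solves the single-source shortest paths problem on directed graphs with $n$ vertices and real-valued (possibly negative) edge weights in $O(n^{2.5}\log^{4.5} n)$ time.
   Context: Single-source shortest paths problem with real weights: the input is a directed graph $G=(V,E)$ with $n=|V|$ vertices, $m=|E|$ edges, an edge weight function $w:E\to\mathbb{R}$ (weights may be negative), and a source $s\in V$. The algorithm must either report that $G$ contains a negative-weight cycle, or output the shortest-path distance $d(s,v)$ for every $v\in V$. "Randomized" means the output is correct with high probability (probability at least $1-1/n^c$ for a constant $c$). *)

theory Defs
  imports
    "HOL-Probability.Probability"
    "HOL-Library.Landau_Symbols"
    "Graph_Theory.Graph_Theory"
begin

section \<open>The problem\<close>

text \<open>
  The distance is the library's \<open>wf_digraph.\<mu>\<close>, the infimum in the extended reals of the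
  weights of all walks: it is \<open>\<infinity>\<close> for unreachable vertices and \<open>-\<infinity>\<close> for vertices that are
  reachable through a negative-weight cycle.
\<close>

definition has_negative_cycle :: "nat pair_pre_digraph \<Rightarrow> (nat \<times> nat \<Rightarrow> real) \<Rightarrow> bool" where
  "has_negative_cycle G w \<longleftrightarrow>
     (\<exists>p. pre_digraph.cycle (with_proj G) p \<and> wf_digraph.awalk_cost w p < 0)"

definition sssp_dist :: "nat pair_pre_digraph \<Rightarrow> (nat \<times> nat \<Rightarrow> real) \<Rightarrow> nat \<Rightarrow> nat \<Rightarrow> ereal" where
  "sssp_dist G w s v = wf_digraph.\<mu> (with_proj G) w s v"

text \<open>As inputs of a machine, the vertices are the numbers below \<open>n\<close>.\<close>

definition sssp_instance :: "nat \<Rightarrow> nat pair_pre_digraph \<Rightarrow> nat \<Rightarrow> bool" where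
  "sssp_instance n G s \<longleftrightarrow> pair_fin_digraph G \<and> pverts G = {..<n} \<and> s \<in> pverts G"

datatype sssp_answer = Negative_Cycle | Distances "nat \<Rightarrow> ereal"

fun correct_answer ::
  "nat pair_pre_digraph \<Rightarrow> (nat \<times> nat \<Rightarrow> real) \<Rightarrow> nat \<Rightarrow> sssp_answer \<Rightarrow> bool" where
  "correct_answer G w s Negative_Cycle \<longleftrightarrow> has_negative_cycle G w"
| "correct_answer G w s (Distances d) \<longleftrightarrow> (\<forall>v\<in>pverts G. d v = sssp_dist G w s v)"


section \<open>Randomized real RAM\<close>

text \<open>
  A machine has finitely many named scalars and random-access arrays (all those that the program
  mentions), each either of words or of real numbers. A word is a natural number below a bound
  \<open>M\<close>, and word arithmetic wraps around at \<open>M\<close> (subtraction is truncated at 0). On real numbers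
  the only operations are addition, subtraction and comparison; in particular there is no
  rounding and no conversion between real numbers and words.
\<close>

record machine_state =
  wvar :: "string \<Rightarrow> nat"
  warr :: "string \<Rightarrow> nat \<Rightarrow> nat"
  rvar :: "string \<Rightarrow> real"
  rarr :: "string \<Rightarrow> nat \<Rightarrow> real"

datatype wexp =
    WConst nat
  | WVar string
  | WArr string wexp
  | WAdd wexp wexp
  | WSub wexp wexp
  | WMult wexp wexp
  | WDiv wexp wexp
  | WMod wexp wexp

datatype rexp =
    RZero
  | RVar string
  | RArr string wexp
  | RAdd rexp rexp
  | RSub rexp rexp

datatype bexp =
    WLess wexp wexp
  | WEq wexp wexp
  | RLess rexp rexp
  | BNot bexp
  | BAnd bexp bexp

datatype com =
    Skip
  | WAssign string wexp
  | WStore string wexp wexp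
  | RAssign string rexp
  | RStore string wexp rexp
  | Random string wexp
  | Seq com com
  | Cond bexp com com
  | Loop bexp com

primrec wval :: "nat \<Rightarrow> machine_state \<Rightarrow> wexp \<Rightarrow> nat" where
  "wval M \<sigma> (WConst k) = k mod M"
| "wval M \<sigma> (WVar x) = wvar \<sigma> x"
| "wval M \<sigma> (WArr a i) = warr \<sigma> a (wval M \<sigma> i)"
| "wval M \<sigma> (WAdd e f) = (wval M \<sigma> e + wval M \<sigma> f) mod M"
| "wval M \<sigma> (WSub e f) = wval M \<sigma> e - wval M \<sigma> f"
| "wval M \<sigma> (WMult e f) = (wval M \<sigma> e * wval M \<sigma> f) mod M"
| "wval M \<sigma> (WDiv e f) = wval M \<sigma> e div wval M \<sigma> f"
| "wval M \<sigma> (WMod e f) = wval M \<sigma> e mod wval M \<sigma> f"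

primrec rval :: "nat \<Rightarrow> machine_state \<Rightarrow> rexp \<Rightarrow> real" where
  "rval M \<sigma> RZero = 0"
| "rval M \<sigma> (RVar x) = rvar \<sigma> x"
| "rval M \<sigma> (RArr a i) = rarr \<sigma> a (wval M \<sigma> i)"
| "rval M \<sigma> (RAdd e f) = rval M \<sigma> e + rval M \<sigma> f"
| "rval M \<sigma> (RSub e f) = rval M \<sigma> e - rval M \<sigma> f"

primrec bval :: "nat \<Rightarrow> machine_state \<Rightarrow> bexp \<Rightarrow> bool" where
  "bval M \<sigma> (WLess e f) \<longleftrightarrow> wval M \<sigma> e < wval M \<sigma> f"
| "bval M \<sigma> (WEq e f) \<longleftrightarrow> wval M \<sigma> e = wval M \<sigma> f"
| "bval M \<sigma> (RLess e f) \<longleftrightarrow> rval M \<sigma> e < rval M \<sigma> f"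
| "bval M \<sigma> (BNot b) \<longleftrightarrow> \<not> bval M \<sigma> b"
| "bval M \<sigma> (BAnd b b') \<longleftrightarrow> bval M \<sigma> b \<and> bval M \<sigma> b'"

text \<open>
  Time is the number of steps. The expressions in a step are part of the fixed program, so a step
  stands for a number of elementary operations that is bounded independently of the input.
  \<open>Random x e\<close> draws \<open>x\<close> uniformly from the numbers below the value of \<open>e\<close>, using fresh
  randomness (if that value is 0, then \<open>x\<close> becomes 0).
\<close>

primrec step :: "nat \<Rightarrow> com \<Rightarrow> machine_state \<Rightarrow> (com \<times> machine_state) pmf" where
  "step M Skip \<sigma> = return_pmf (Skip, \<sigma>)"
| "step M (WAssign x e) \<sigma> =
     return_pmf (Skip, \<sigma>\<lparr>wvar := (wvar \<sigma>)(x := wval M \<sigma> e)\<rparr>)"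
| "step M (WStore a i e) \<sigma> =
     return_pmf (Skip, \<sigma>\<lparr>warr := (warr \<sigma>)(a := (warr \<sigma> a)(wval M \<sigma> i := wval M \<sigma> e))\<rparr>)"
| "step M (RAssign x e) \<sigma> =
     return_pmf (Skip, \<sigma>\<lparr>rvar := (rvar \<sigma>)(x := rval M \<sigma> e)\<rparr>)"
| "step M (RStore a i e) \<sigma> =
     return_pmf (Skip, \<sigma>\<lparr>rarr := (rarr \<sigma>)(a := (rarr \<sigma> a)(wval M \<sigma> i := rval M \<sigma> e))\<rparr>)"
| "step M (Random x e) \<sigma> =
     map_pmf (\<lambda>k. (Skip, \<sigma>\<lparr>wvar := (wvar \<sigma>)(x := k)\<rparr>))
       (pmf_of_set {..<max 1 (wval M \<sigma> e)})"
| "step M (Seq c d) \<sigma> =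
     (if c = Skip then return_pmf (d, \<sigma>)
      else map_pmf (\<lambda>(c', \<sigma>'). (Seq c' d, \<sigma>')) (step M c \<sigma>))"
| "step M (Cond b c d) \<sigma> = return_pmf (if bval M \<sigma> b then c else d, \<sigma>)"
| "step M (Loop b c) \<sigma> =
     return_pmf (if bval M \<sigma> b then Seq c (Loop b c) else Skip, \<sigma>)"

primrec run :: "nat \<Rightarrow> nat \<Rightarrow> com \<Rightarrow> machine_state \<Rightarrow> (com \<times> machine_state) pmf" where
  "run M 0 c \<sigma> = return_pmf (c, \<sigma>)"
| "run M (Suc t) c \<sigma> = bind_pmf (step M c \<sigma>) (\<lambda>(c', \<sigma>'). run M t c' \<sigma>')"


section \<open>Algorithms for the problem\<close>

text \<open>
  The input is given by its adjacency matrix and its weight matrix, stored row by row in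
  arrays; all other memory is 0. The weights enter as exact real numbers.
\<close>

definition sssp_input ::
  "nat \<Rightarrow> nat pair_pre_digraph \<Rightarrow> (nat \<times> nat \<Rightarrow> real) \<Rightarrow> nat \<Rightarrow> machine_state" where
  "sssp_input n G w s =
     \<lparr>wvar = (\<lambda>_. 0)(''n'' := n, ''s'' := s),
      warr = (\<lambda>_ _. 0)(''edge'' := (\<lambda>i. if (i div n, i mod n) \<in> parcs G then 1 else 0)),
      rvar = (\<lambda>_. 0),
      rarr = (\<lambda>_ _. 0)(''weight'' :=
        (\<lambda>i. if (i div n, i mod n) \<in> parcs G then w (i div n, i mod n) else 0))\<rparr>"

definition sssp_output :: "machine_state \<Rightarrow> sssp_answer" where
  "sssp_output \<sigma> =
     (if wvar \<sigma> ''negative_cycle'' \<noteq> 0 then Negative_Cycle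
      else Distances (\<lambda>v. if warr \<sigma> ''reachable'' v \<noteq> 0 then ereal (rarr \<sigma> ''dist'' v) else \<infinity>))"

text \<open>Words have \<open>O(log n)\<close> bits: the constant factor \<open>k\<close> is chosen with the program.\<close>

definition word_bound :: "nat \<Rightarrow> nat \<Rightarrow> nat" where
  "word_bound k n = (n + 1) ^ k"

definition runs_in_time :: "nat \<Rightarrow> com \<Rightarrow> (nat \<Rightarrow> nat) \<Rightarrow> bool" where
  "runs_in_time k P T \<longleftrightarrow>
     (\<forall>n G w s. sssp_instance n G s \<longrightarrow>
        (\<forall>(c, \<sigma>) \<in> set_pmf (run (word_bound k n) (T n) P (sssp_input n G w s)). c = Skip))"

text \<open>
  Final configurations are fixed points of \<^const>\<open>step\<close>, so for programs that run in time \<open>T\<close>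
  the configuration after \<open>T n\<close> steps is the final one.
\<close>

definition solves_sssp_whp :: "nat \<Rightarrow> com \<Rightarrow> (nat \<Rightarrow> nat) \<Rightarrow> real \<Rightarrow> bool" where
  "solves_sssp_whp k P T c \<longleftrightarrow>
     (\<forall>n G w s. sssp_instance n G s \<longrightarrow>
        measure_pmf.prob (run (word_bound k n) (T n) P (sssp_input n G w s))
          {(C, \<sigma>). C = Skip \<and> correct_answer G w s (sssp_output \<sigma>)}
        \<ge> 1 - 1 / real n powr c)"

end

theory Submission
  imports Defs
begin

text \<open>
  A round works on a complete weighted graph on \<open>N = O(n log n)\<close> nodes, the vertices and
  auxiliary nodes, for which the sought distances are feasible potentials. It halves the number
  \<open>k\<close> of tight edges, outside of walks over nonnegative edges, by which every vertex is reached
  from the source. About \<open>\<surd>n\<close> random hubs are made to have nonnegative distances from and to all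
  nodes, with respect to walks of an arbitrary edge, nonnegative edges and an arbitrary edge.
  After the corresponding reweighting, with high probability only \<open>m = O(\<surd>n log\<^sup>2 n)\<close> nodes lie on
  such a walk of negative weight between any two nodes. So for all vertices together it is cheap to
  explore the walks with negative prefixes, and shortcuts along these walks halve \<open>k\<close>. A pair of
  shortcuts \<open>u \<rightarrow> w \<rightarrow> t\<close> of nonnegative total weight has to become a walk over nonnegative edges.
  For that every vertex \<open>w\<close> has auxiliary nodes, one for each position \<open>2\<^sup>k\<close> in the sorted list of its
  shortcuts \<open>w \<rightarrow> t\<close>: they shift weight from one shortcut to the other. The pairs that they do not
  serve are, up to a constant factor, as few as those of negative weight and are added explicitly.
  After \<open>log n\<close> rounds, two runs of Dijkstra's algorithm give the distances, and if the result is
  not a feasible potential for the input, then there is a negative cycle.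
\<close>

section \<open>Big-step semantics\<close>

text \<open>The number of hubs balances two costs. With \<open>q\<close> about sqrt n,
  \<open>l\<close> about log n and \<open>N = q^2 l\<close>, the runs of Dijkstra's algorithm for
  \<open>q\<close> hubs take \<open>O(q N^2)\<close>, that is \<open>O(q^5 l^2)\<close>, steps. For
  \<open>q\<close> hubs to serve all pairs of nodes with high probability, \<open>m\<close> is taken
  of order \<open>l N / q\<close>, and then the explorations from all vertices relax
  \<open>O(n N m)\<close>, that is \<open>O(q^5 l^3)\<close>, edges. So \<open>l\<close> rounds fit
  into \<open>O(n^2.5 log^4 n)\<close>. The obstacle is that Dijkstra's algorithm needs a set of
  nonnegative edges while all weights are being shifted. This set is fixed by the matrix of the
  round; the potential of every hub is closed under these edges, so they stay nonnegative. The
  sought distances \<open>h\<close> are unknown to the program, but if there is no negative cycle,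
  their existence bounds all computed values from below. Lower bounds are therefore proved by
  comparison with functions that are closed under the edges in question, not by decomposing walks.
  If there is a negative cycle, only the time of the rounds matters.\<close>

inductive bs :: "nat \<Rightarrow> com \<Rightarrow> machine_state \<Rightarrow> nat \<Rightarrow> machine_state \<Rightarrow> bool" for M where
  bs_Skip: "bs M Skip \<sigma> 0 \<sigma>"
| bs_WAssign: "bs M (WAssign x e) \<sigma> 1 (\<sigma>\<lparr>wvar := (wvar \<sigma>)(x := wval M \<sigma> e)\<rparr>)"
| bs_WStore: "bs M (WStore a i e) \<sigma> 1
    (\<sigma>\<lparr>warr := (warr \<sigma>)(a := (warr \<sigma> a)(wval M \<sigma> i := wval M \<sigma> e))\<rparr>)"
| bs_RAssign: "bs M (RAssign x r) \<sigma> 1 (\<sigma>\<lparr>rvar := (rvar \<sigma>)(x := rval M \<sigma> r)\<rparr>)"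
| bs_RStore: "bs M (RStore a i r) \<sigma> 1
    (\<sigma>\<lparr>rarr := (rarr \<sigma>)(a := (rarr \<sigma> a)(wval M \<sigma> i := rval M \<sigma> r))\<rparr>)"
| bs_Seq: "bs M c \<sigma> t \<sigma>' \<Longrightarrow> bs M d \<sigma>' u \<sigma>'' \<Longrightarrow> bs M (Seq c d) \<sigma> (t + 1 + u) \<sigma>''"
| bs_Cond: "bs M (if bval M \<sigma> b then c else d) \<sigma> t \<sigma>' \<Longrightarrow> bs M (Cond b c d) \<sigma> (1 + t) \<sigma>'"
| bs_LoopF: "\<not> bval M \<sigma> b \<Longrightarrow> bs M (Loop b c) \<sigma> 1 \<sigma>"
| bs_LoopT: "bval M \<sigma> b \<Longrightarrow> bs M c \<sigma> t \<sigma>' \<Longrightarrow> bs M (Loop b c) \<sigma>' u \<sigma>'' \<Longrightarrow>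
    bs M (Loop b c) \<sigma> (t + u + 2) \<sigma>''"

inductive_cases bs_SkipE: "bs M Skip \<sigma> t \<sigma>'"
inductive_cases bs_WAssignE: "bs M (WAssign x e) \<sigma> t \<sigma>'"
inductive_cases bs_WStoreE: "bs M (WStore a i e) \<sigma> t \<sigma>'"
inductive_cases bs_RAssignE: "bs M (RAssign x r) \<sigma> t \<sigma>'"
inductive_cases bs_RStoreE: "bs M (RStore a i r) \<sigma> t \<sigma>'"
inductive_cases bs_SeqE: "bs M (Seq c d) \<sigma> t \<sigma>'"
inductive_cases bs_CondE: "bs M (Cond b c d) \<sigma> t \<sigma>'"
inductive_cases bs_LoopE: "bs M (Loop b c) \<sigma> t \<sigma>'"

section \<open>Distributions of terminated runs\<close>

lemma run_Skip: "run M t Skip \<sigma> = return_pmf (Skip, \<sigma>)"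
  by (induction t) (simp_all add: bind_return_pmf)

lemma run_add: "run M (t + u) c \<sigma> = bind_pmf (run M t c \<sigma>) (\<lambda>(c', \<sigma>'). run M u c' \<sigma>')"
  by (induction t arbitrary: c \<sigma>)
     (auto simp: bind_return_pmf bind_assoc_pmf intro!: bind_pmf_cong)

text \<open>Equality with the image under \<open>Pair Skip\<close> says two things at once: every
  random outcome has terminated within \<open>t\<close> steps, and \<open>p\<close> is the
  distribution of the final states.\<close>

definition halts :: "nat \<Rightarrow> nat \<Rightarrow> com \<Rightarrow> machine_state \<Rightarrow> machine_state pmf \<Rightarrow> bool" where
  "halts M t c \<sigma> p \<longleftrightarrow> run M t c \<sigma> = map_pmf (Pair Skip) p"

lemma halts_mono:
  assumes "halts M t c \<sigma> p" and "t \<le> u"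
  shows "halts M u c \<sigma> p"
proof -
  obtain d where u: "u = t + d" using assms(2) le_iff_add by blast
  show ?thesis
    using assms(1) unfolding halts_def u run_add
    by (simp add: bind_map_pmf run_Skip map_pmf_def bind_assoc_pmf bind_return_pmf)
qed

lemma halts_Suc:
  assumes "\<And>c' \<sigma>'. (c', \<sigma>') \<in> set_pmf (step M c \<sigma>) \<Longrightarrow> halts M t c' \<sigma>' (g (c', \<sigma>'))"
  shows "halts M (Suc t) c \<sigma> (bind_pmf (step M c \<sigma>) g)"
proof -
  have "run M (Suc t) c \<sigma> = bind_pmf (step M c \<sigma>) (\<lambda>x. map_pmf (Pair Skip) (g x))"
    using assms by (auto simp: halts_def intro!: bind_pmf_cong)
  then show ?thesis by (simp add: halts_def map_bind_pmf)
qed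

text \<open>The outcomes of \<open>c\<close> may end at different times before \<open>t\<close>, and
  \<open>d\<close> starts at once in each of them. So the first \<open>t\<close> steps cannot be
  separated from the rest. The induction peels off single steps of \<open>c\<close> instead and
  treats \<open>p\<close> as a mixture of the distributions that remain after the first
  step.\<close>

lemma halts_Seq:
  assumes "halts M t c \<sigma> p" and "\<And>\<sigma>'. \<sigma>' \<in> set_pmf p \<Longrightarrow> halts M u d \<sigma>' (g \<sigma>')"
  shows "halts M (t + 1 + u) (Seq c d) \<sigma> (bind_pmf p g)"
  using assms
proof (induction t arbitrary: c \<sigma> p)
  case 0
  then have eq: "return_pmf (c, \<sigma>) = map_pmf (Pair Skip) p" by (simp add: halts_def)
  then have "set_pmf (return_pmf (c, \<sigma>)) = Pair Skip ` set_pmf p" by simp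
  then have c: "c = Skip" by auto
  have "map_pmf snd (map_pmf (Pair Skip) p) = return_pmf \<sigma>" unfolding eq[symmetric] by simp
  then have p': "p = return_pmf \<sigma>" by (simp add: map_pmf_comp)
  then have p: "set_pmf p = {\<sigma>}" by simp
  have "halts M u d \<sigma> (g \<sigma>)" using 0 p by auto
  then show ?case by (simp add: halts_def c p' bind_return_pmf)
next
  case (Suc t)
  show ?case
  proof (cases "c = Skip")
    case True
    then have "map_pmf (Pair Skip) p = return_pmf (Skip, \<sigma>)"
      using Suc.prems(1) by (simp add: halts_def run_Skip bind_return_pmf)
    then have "map_pmf snd (map_pmf (Pair Skip) p) = return_pmf \<sigma>" by simp
    then have p: "p = return_pmf \<sigma>" by (simp add: map_pmf_comp)
    have "halts M (Suc u) (Seq c d) \<sigma> (g \<sigma>)"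
      using Suc.prems(2)[of \<sigma>] True p by (simp add: halts_def bind_return_pmf)
    then show ?thesis using halts_mono by (auto simp: p bind_return_pmf)
  next
    case False
    define S where "S = step M c \<sigma>"
    have r: "bind_pmf S (\<lambda>(c', \<sigma>'). run M t c' \<sigma>') = map_pmf (Pair Skip) p"
      using Suc.prems(1) by (simp add: halts_def S_def)
    \<comment> \<open>\<open>P x\<close> is the distribution of the final states after the first
      step has led to the configuration \<open>x\<close>; \<open>p\<close> is the mixture of
      these.\<close>
    define P where "P = (\<lambda>x. map_pmf snd (run M t (fst x) (snd x)))"
    have hx: "halts M t (fst x) (snd x) (P x)" and px: "set_pmf (P x) \<subseteq> set_pmf p"
      if "x \<in> set_pmf S" for x
    proof -
      have sub: "set_pmf (run M t (fst x) (snd x)) \<subseteq> Pair Skip ` set_pmf p"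
      proof -
        have "set_pmf (bind_pmf S (\<lambda>(c', \<sigma>'). run M t c' \<sigma>')) = Pair Skip ` set_pmf p"
          by (simp add: r)
        then show ?thesis using that by (fastforce simp: case_prod_beta)
      qed
      have "map_pmf (Pair Skip) (P x) = map_pmf (\<lambda>y. y) (run M t (fst x) (snd x))"
        unfolding P_def map_pmf_comp using sub by (intro map_pmf_cong) auto
      then show "halts M t (fst x) (snd x) (P x)" by (simp add: halts_def map_pmf_ident)
      show "set_pmf (P x) \<subseteq> set_pmf p" unfolding P_def using sub by auto
    qed
    have pS: "p = bind_pmf S P"
    proof -
      have "map_pmf snd (map_pmf (Pair Skip) p) = bind_pmf S P"
        unfolding r[symmetric] by (simp add: map_bind_pmf P_def case_prod_beta)
      then show ?thesis by (simp add: map_pmf_comp)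
    qed
    have "halts M (t + 1 + u) (Seq (fst x) d) (snd x) (bind_pmf (P x) g)" if "x \<in> set_pmf S" for x
      using Suc.IH[OF hx[OF that]] Suc.prems(2) px[OF that] by blast
    \<comment> \<open>The continuation has to be a function of the configuration alone, so it reads
      the rest of \<open>c\<close> off the configuration; the default case never occurs.\<close>
    then have "halts M (Suc (t + 1 + u)) (Seq c d) \<sigma>
       (bind_pmf (step M (Seq c d) \<sigma>) (\<lambda>(c', \<sigma>').
          case c' of Seq c'' _ \<Rightarrow> bind_pmf (P (c'', \<sigma>')) g | _ \<Rightarrow> return_pmf \<sigma>))"
      using False by (intro halts_Suc) (auto simp: S_def)
    then show ?thesis
      using False by (simp add: bind_map_pmf case_prod_beta pS S_def bind_assoc_pmf)
  qed
qed

text \<open>The constants in the rules of \<open>bs\<close> are those of the small steps: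
  \<open>Seq\<close> takes one step to drop a finished \<open>Skip\<close>, and an iteration of a
  loop takes in addition the step of the test. \<open>Random\<close> has no rule, so
  \<open>bs\<close> describes only executions that draw no random numbers.\<close>

lemma bs_halts: "bs M c \<sigma> t \<sigma>' \<Longrightarrow> halts M t c \<sigma> (return_pmf \<sigma>')"
proof (induction rule: bs.induct)
  case (bs_Seq c \<sigma> t \<sigma>' d u \<sigma>'')
  then show ?case
    using halts_Seq[of M t c \<sigma> "return_pmf \<sigma>'" u d "\<lambda>_. return_pmf \<sigma>''"]
    by (simp add: bind_return_pmf)
next
  case (bs_LoopT \<sigma> b c t \<sigma>' u \<sigma>'')
  then have "halts M (t + 1 + u) (Seq c (Loop b c)) \<sigma> (return_pmf \<sigma>'')"
    using halts_Seq[of M t c \<sigma> "return_pmf \<sigma>'" u "Loop b c" "\<lambda>_. return_pmf \<sigma>''"]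
    by (simp add: bind_return_pmf)
  then show ?case using bs_LoopT by (simp add: halts_def bind_return_pmf)
qed (auto simp: halts_def bind_return_pmf split: if_splits)

section \<open>Write sets and frame conditions\<close>

primrec ww :: "com \<Rightarrow> string set" where
  "ww Skip = {}" | "ww (WAssign x e) = {x}" | "ww (WStore a i e) = {}" | "ww (RAssign x r) = {}"
| "ww (RStore a i r) = {}" | "ww (Random x e) = {x}" | "ww (Seq c d) = ww c \<union> ww d"
| "ww (Cond b c d) = ww c \<union> ww d" | "ww (Loop b c) = ww c"

primrec wa :: "com \<Rightarrow> string set" where
  "wa Skip = {}" | "wa (WAssign x e) = {}" | "wa (WStore a i e) = {a}" | "wa (RAssign x r) = {}"
| "wa (RStore a i r) = {}" | "wa (Random x e) = {}" | "wa (Seq c d) = wa c \<union> wa d"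
| "wa (Cond b c d) = wa c \<union> wa d" | "wa (Loop b c) = wa c"

primrec rv :: "com \<Rightarrow> string set" where
  "rv Skip = {}" | "rv (WAssign x e) = {}" | "rv (WStore a i e) = {}" | "rv (RAssign x r) = {x}"
| "rv (RStore a i r) = {}" | "rv (Random x e) = {}" | "rv (Seq c d) = rv c \<union> rv d"
| "rv (Cond b c d) = rv c \<union> rv d" | "rv (Loop b c) = rv c"

primrec ra :: "com \<Rightarrow> string set" where
  "ra Skip = {}" | "ra (WAssign x e) = {}" | "ra (WStore a i e) = {}" | "ra (RAssign x r) = {}"
| "ra (RStore a i r) = {a}" | "ra (Random x e) = {}" | "ra (Seq c d) = ra c \<union> ra d"
| "ra (Cond b c d) = ra c \<union> ra d" | "ra (Loop b c) = ra c"

definition fr :: "com \<Rightarrow> machine_state \<Rightarrow> machine_state \<Rightarrow> bool" where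
  "fr c \<sigma> \<sigma>' \<longleftrightarrow> (\<forall>x. x \<notin> ww c \<longrightarrow> wvar \<sigma>' x = wvar \<sigma> x) \<and> (\<forall>x. x \<notin> wa c \<longrightarrow> warr \<sigma>' x = warr \<sigma> x) \<and>
     (\<forall>x. x \<notin> rv c \<longrightarrow> rvar \<sigma>' x = rvar \<sigma> x) \<and> (\<forall>x. x \<notin> ra c \<longrightarrow> rarr \<sigma>' x = rarr \<sigma> x)"

lemma frw: "fr c \<sigma> \<sigma>' \<Longrightarrow> x \<notin> ww c \<Longrightarrow> wvar \<sigma>' x = wvar \<sigma> x"
  and frwa: "fr c \<sigma> \<sigma>' \<Longrightarrow> x \<notin> wa c \<Longrightarrow> warr \<sigma>' x = warr \<sigma> x"
  and frr: "fr c \<sigma> \<sigma>' \<Longrightarrow> x \<notin> rv c \<Longrightarrow> rvar \<sigma>' x = rvar \<sigma> x"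
  and frra: "fr c \<sigma> \<sigma>' \<Longrightarrow> x \<notin> ra c \<Longrightarrow> rarr \<sigma>' x = rarr \<sigma> x"
  by (auto simp: fr_def)

lemma fr_refl: "fr c \<sigma> \<sigma>"
  by (simp add: fr_def)

lemma bs_fr: "bs M c \<sigma> t \<sigma>' \<Longrightarrow> fr c \<sigma> \<sigma>'"
  by (induction rule: bs.induct) (auto simp: fr_def split: if_splits)

section \<open>Partial correctness\<close>

text \<open>Correctness and time are separated: this speaks of all derivations, while the time
  bounds supply one derivation. \<open>TM_wlp\<close> joins the two.\<close>

definition wlp :: "nat \<Rightarrow> com \<Rightarrow> (machine_state \<Rightarrow> bool) \<Rightarrow> machine_state \<Rightarrow> bool" where
  "wlp M c Q \<sigma> \<longleftrightarrow> (\<forall>t \<sigma>'. bs M c \<sigma> t \<sigma>' \<longrightarrow> Q \<sigma>')"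

lemma wlp_Skip [simp]: "wlp M Skip Q \<sigma> = Q \<sigma>"
  by (auto simp: wlp_def intro: bs.intros elim: bs_SkipE)
lemma wlp_WAssign [simp]:
  "wlp M (WAssign x e) Q \<sigma> = Q (\<sigma>\<lparr>wvar := (wvar \<sigma>)(x := wval M \<sigma> e)\<rparr>)"
  by (auto simp: wlp_def intro: bs.intros elim: bs_WAssignE)
lemma wlp_WStore [simp]: "wlp M (WStore a i e) Q \<sigma> =
  Q (\<sigma>\<lparr>warr := (warr \<sigma>)(a := (warr \<sigma> a)(wval M \<sigma> i := wval M \<sigma> e))\<rparr>)"
  by (auto simp: wlp_def intro: bs.intros elim: bs_WStoreE)
lemma wlp_RAssign [simp]:
  "wlp M (RAssign x r) Q \<sigma> = Q (\<sigma>\<lparr>rvar := (rvar \<sigma>)(x := rval M \<sigma> r)\<rparr>)"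
  by (auto simp: wlp_def intro: bs.intros elim: bs_RAssignE)
lemma wlp_RStore [simp]: "wlp M (RStore a i r) Q \<sigma> =
  Q (\<sigma>\<lparr>rarr := (rarr \<sigma>)(a := (rarr \<sigma> a)(wval M \<sigma> i := rval M \<sigma> r))\<rparr>)"
  by (auto simp: wlp_def intro: bs.intros elim: bs_RStoreE)
lemma wlp_Seq [simp]: "wlp M (Seq c d) Q \<sigma> = wlp M c (wlp M d Q) \<sigma>"
  unfolding wlp_def by (blast intro: bs_Seq elim: bs_SeqE)
lemma wlp_Cond [simp]:
  "wlp M (Cond b c d) Q \<sigma> = (if bval M \<sigma> b then wlp M c Q \<sigma> else wlp M d Q \<sigma>)"
proof -
  have "wlp M (Cond b c d) Q \<sigma> = wlp M (if bval M \<sigma> b then c else d) Q \<sigma>"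
    unfolding wlp_def by (blast intro: bs_Cond elim: bs_CondE)
  then show ?thesis by simp
qed

text \<open>The frame condition is added to the postcondition for free, so specifications mention
  only what a program changes.\<close>

lemma wlp_conseq:
  assumes "wlp M c Q \<sigma>" and "\<And>\<sigma>'. Q \<sigma>' \<Longrightarrow> fr c \<sigma> \<sigma>' \<Longrightarrow> Q' \<sigma>'"
  shows "wlp M c Q' \<sigma>"
  using assms bs_fr unfolding wlp_def by blast

lemma wlp_Loop:
  assumes I0: "I \<sigma>"
    and step: "\<And>\<tau>. I \<tau> \<Longrightarrow> fr c \<sigma> \<tau> \<Longrightarrow> bval M \<tau> b \<Longrightarrow> wlp M c I \<tau>"
    and exit: "\<And>\<tau>. I \<tau> \<Longrightarrow> fr c \<sigma> \<tau> \<Longrightarrow> \<not> bval M \<tau> b \<Longrightarrow> Q \<tau>"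
  shows "wlp M (Loop b c) Q \<sigma>"
proof -
  have "Q \<sigma>'" if "bs M (Loop b c) \<tau> t \<sigma>'" "I \<tau>" "fr c \<sigma> \<tau>" for \<tau> t \<sigma>'
    using that
  proof (induction "Loop b c" \<tau> t \<sigma>' rule: bs.induct)
    case (bs_LoopT \<tau> t \<sigma>' u \<sigma>'')
    have "fr c \<tau> \<sigma>'" using bs_LoopT bs_fr by blast
    then have "fr c \<sigma> \<sigma>'" using bs_LoopT.prems(2) by (auto simp: fr_def)
    moreover have "I \<sigma>'" using step[of \<tau>] bs_LoopT by (auto simp: wlp_def)
    ultimately show ?case using bs_LoopT by auto
  qed (use exit in auto)
  then show ?thesis using I0 fr_refl unfolding wlp_def by blast
qed

section \<open>Counting loops and loops with fuel\<close>

definition FOR :: "string \<Rightarrow> string \<Rightarrow> com \<Rightarrow> com" where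
  "FOR i X c = Seq (WAssign i (WConst 0))
     (Loop (WLess (WVar i) (WVar X)) (Seq c (WAssign i (WAdd (WVar i) (WConst 1)))))"

lemma FOR_writes [simp]:
  "ww (FOR i X c) = insert i (ww c)" "wa (FOR i X c) = wa c" "rv (FOR i X c) = rv c" "ra (FOR i X c) = ra c"
  by (auto simp: FOR_def)

abbreviation wset :: "string \<Rightarrow> nat \<Rightarrow> machine_state \<Rightarrow> machine_state" where
  "wset x v \<sigma> \<equiv> \<sigma>\<lparr>wvar := (wvar \<sigma>)(x := v)\<rparr>"

text \<open>The invariant is evaluated with the counter already advanced, which is the state at the
  head of the loop. The bound \<open>wvar \<sigma> X < M\<close> keeps the increment, which is taken
  modulo \<open>M\<close>, from wrapping around.\<close>

lemma wlp_FOR: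
  assumes X: "wvar \<sigma> X < M" and i: "i \<notin> ww c" "X \<notin> ww c" "i \<noteq> X"
    and I0: "I 0 (wset i 0 \<sigma>)"
    and step: "\<And>k \<tau>. k < wvar \<sigma> X \<Longrightarrow> I k \<tau> \<Longrightarrow> fr (FOR i X c) \<sigma> \<tau> \<Longrightarrow> wvar \<tau> i = k \<Longrightarrow>
      wlp M c (\<lambda>\<tau>'. I (Suc k) (wset i (Suc k) \<tau>')) \<tau>"
    and exit: "\<And>\<tau>. I (wvar \<sigma> X) \<tau> \<Longrightarrow> fr (FOR i X c) \<sigma> \<tau> \<Longrightarrow> Q \<tau>"
  shows "wlp M (FOR i X c) Q \<sigma>"
proof -
  let ?b = "Seq c (WAssign i (WAdd (WVar i) (WConst 1)))"
  let ?\<sigma> = "wset i (0 mod M) \<sigma>"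
  have fr': "fr (FOR i X c) \<sigma> \<tau>" if "fr ?b ?\<sigma> \<tau>" for \<tau>
    using that by (auto simp: fr_def)
  have "wlp M (Loop (WLess (WVar i) (WVar X)) ?b) Q ?\<sigma>"
  proof (rule wlp_Loop[where I = "\<lambda>\<tau>. wvar \<tau> i \<le> wvar \<sigma> X \<and> I (wvar \<tau> i) \<tau>"])
    show "wvar ?\<sigma> i \<le> wvar \<sigma> X \<and> I (wvar ?\<sigma> i) ?\<sigma>" using I0 by simp
  next
    fix \<tau> assume a: "wvar \<tau> i \<le> wvar \<sigma> X \<and> I (wvar \<tau> i) \<tau>" "fr ?b ?\<sigma> \<tau>"
      "bval M \<tau> (WLess (WVar i) (WVar X))"
    have X': "wvar \<tau> X = wvar \<sigma> X" using frw[OF a(2), of X] i by simp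
    then have lt: "wvar \<tau> i < wvar \<sigma> X" using a(3) by simp
    have "wlp M c (\<lambda>\<tau>'. I (Suc (wvar \<tau> i)) (wset i (Suc (wvar \<tau> i)) \<tau>')) \<tau>"
      by (rule step[OF lt]) (use a fr' in auto)
    then have "wlp M c (\<lambda>\<tau>'. wvar \<tau>' i = wvar \<tau> i \<and> I (Suc (wvar \<tau> i)) (wset i (Suc (wvar \<tau> i)) \<tau>')) \<tau>"
      by (rule wlp_conseq) (use i frw in auto)
    then have "wlp M c (\<lambda>\<tau>'. wvar \<tau>' i = wvar \<tau> i \<and>
         I (Suc (wvar \<tau> i)) (wset i ((wvar \<tau>' i + 1 mod M) mod M) \<tau>')) \<tau>"
      by (rule wlp_conseq) (use lt X in \<open>auto simp: mod_simps\<close>)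
    then show "wlp M ?b (\<lambda>\<tau>. wvar \<tau> i \<le> wvar \<sigma> X \<and> I (wvar \<tau> i) \<tau>) \<tau>"
      unfolding wlp_Seq by (rule wlp_conseq) (use lt X in \<open>auto simp: mod_simps\<close>)
  next
    fix \<tau> assume a: "wvar \<tau> i \<le> wvar \<sigma> X \<and> I (wvar \<tau> i) \<tau>" "fr ?b ?\<sigma> \<tau>"
      "\<not> bval M \<tau> (WLess (WVar i) (WVar X))"
    have X': "wvar \<tau> X = wvar \<sigma> X" using frw[OF a(2), of X] i by simp
    then show "Q \<tau>" using exit[OF _ fr'] a by auto
  qed
  then show ?thesis by (simp add: FOR_def)
qed

definition WHILEF :: "bexp \<Rightarrow> com \<Rightarrow> com" where
  "WHILEF b c = Loop (BAnd (WLess (WConst 0) (WVar ''f'')) b)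
     (Seq (WAssign ''f'' (WSub (WVar ''f'') (WConst 1))) c)"

lemma WHILEF_writes [simp]:
  "ww (WHILEF b c) = insert ''f'' (ww c)" "wa (WHILEF b c) = wa c" "rv (WHILEF b c) = rv c"
  "ra (WHILEF b c) = ra c"
  by (auto simp: WHILEF_def)

section \<open>The program\<close>

text \<open>
  The arrays \<open>M\<close>, \<open>H\<close>, \<open>W\<close>, \<open>A\<close>, \<open>S\<close> hold matrices over \<open>N\<close> nodes row by row, and \<open>P\<close> accumulates the
  potentials of all reweightings. The nodes below \<open>n\<close> are the vertices, and the node
  \<open>(k + 1) n + w\<close> is the auxiliary node of level \<open>k\<close> of the vertex \<open>w\<close>. The variable \<open>f\<close> is the
  fuel of the loops whose length depends on the data: it bounds the time even if the hubs are bad.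
\<close>

definition ix :: "string \<Rightarrow> string \<Rightarrow> wexp" where
  "ix a b = WAdd (WMult (WVar a) (WVar ''N'')) (WVar b)"

text \<open>\<open>d\<close> marks the elements that have been deleted from the queue,
  \<open>K\<close> holds the keys. A deleted element counts as having an infinite key.\<close>

definition BETTER :: "string \<Rightarrow> string \<Rightarrow> bexp" where
  "BETTER a b = BAnd (WEq (WArr ''d'' (WVar a)) (WConst 0))
     (BNot (BAnd (WEq (WArr ''d'' (WVar b)) (WConst 0))
        (BNot (RLess (RArr ''K'' (WVar a)) (RArr ''K'' (WVar b))))))"

text \<open>The queue consists of \<open>B\<close> blocks of \<open>q\<close> elements, and
  \<open>b\<close> stores a leader with the least key for each block. Extracting a minimum inspects
  the \<open>B\<close> leaders and rebuilds one block, in \<open>O(q l)\<close> steps; decreasing a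
  key concerns one leader only, in \<open>O(1)\<close> steps. As extractions are much rarer than
  relaxations, this simple queue suffices for the time bound.\<close>

definition BLK :: com where
  "BLK = Seq (WAssign ''o'' (WMult (WVar ''j'') (WVar ''q'')))
    (Seq (FOR ''y'' ''q''
       (Seq (WAssign ''e'' (WAdd (WMult (WVar ''j'') (WVar ''q'')) (WVar ''y'')))
            (Cond (BETTER ''e'' ''o'') (WAssign ''o'' (WVar ''e'')) Skip)))
     (WStore ''b'' (WVar ''j'') (WVar ''o'')))"

definition EXTRACT :: com where
  "EXTRACT = Seq (WAssign ''p'' (WArr ''b'' (WConst 0)))
    (Seq (FOR ''y'' ''B''
       (Seq (WAssign ''e'' (WArr ''b'' (WVar ''y'')))
            (Cond (BETTER ''e'' ''p'') (WAssign ''p'' (WVar ''e'')) Skip)))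
    (Seq (WStore ''d'' (WVar ''p'') (WConst 1))
    (Seq (WAssign ''j'' (WDiv (WVar ''p'') (WVar ''q''))) BLK)))"

definition INITQ :: "string \<Rightarrow> com" where
  "INITQ X = Seq
    (FOR ''x'' ''N'' (Cond (WLess (WVar ''x'') (WVar X))
       (WStore ''d'' (WVar ''x'') (WConst 0)) (WStore ''d'' (WVar ''x'') (WConst 1))))
    (FOR ''j'' ''B'' BLK)"

definition DECR :: com where
  "DECR = Seq (WAssign ''j'' (WDiv (WVar ''w'') (WVar ''q'')))
    (Seq (WAssign ''o'' (WArr ''b'' (WVar ''j'')))
      (Cond (BETTER ''w'' ''o'') (WStore ''b'' (WVar ''j'') (WVar ''w'')) Skip))"

text \<open>The sign of an edge is read in \<open>G\<close> and its weight in \<open>X\<close>, as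
  the weights may have been shifted while the nonnegative edges remain those of the matrix of the
  round. \<open>K\<close> holds the keys of Dijkstra's algorithm, which follows nonnegative edges
  only; \<open>R\<close> records what one last edge of any sign achieves.\<close>

definition RELAX :: "string \<Rightarrow> string \<Rightarrow> wexp \<Rightarrow> com" where
  "RELAX G X e = Seq (RAssign ''x'' (RAdd (RVar ''v'') (RArr X e)))
    (Seq (Cond (RLess (RVar ''x'') (RArr ''R'' (WVar ''w''))) (RStore ''R'' (WVar ''w'') (RVar ''x'')) Skip)
      (Cond (BAnd (BNot (RLess (RArr G e) RZero)) (RLess (RVar ''x'') (RArr ''K'' (WVar ''w''))))
        (Seq (RStore ''K'' (WVar ''w'') (RVar ''x'')) DECR) Skip))"

definition DIJ :: "com \<Rightarrow> com" where
  "DIJ c = Seq (FOR ''x'' ''N'' (RStore ''R'' (WVar ''x'') (RArr ''K'' (WVar ''x''))))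
    (Seq (INITQ ''N'')
      (FOR ''c'' ''N'' (Seq EXTRACT (Seq (RAssign ''v'' (RArr ''K'' (WVar ''p''))) c))))"

definition FULL :: "string \<Rightarrow> wexp \<Rightarrow> com" where
  "FULL G e = FOR ''w'' ''N'' (RELAX G G e)"

text \<open>In a sorted row the edges that keep the prefix negative come first, so the loop spends
  fuel only on edges that it relaxes.\<close>

definition SCAN :: com where
  "SCAN = Seq (WAssign ''i'' (WConst 0))
    (WHILEF (BAnd (WLess (WVar ''i'') (WVar ''N'')) (BAnd (RLess (RVar ''v'') RZero)
        (RLess (RAdd (RVar ''v'') (RArr ''W'' (WAdd (WMult (WVar ''p'') (WVar ''N'')) (WArr ''S'' (ix ''p'' ''i''))))) RZero)))
      (Seq (WAssign ''w'' (WArr ''S'' (ix ''p'' ''i'')))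
        (Seq (RELAX ''M'' ''W'' (ix ''p'' ''w''))
          (WAssign ''i'' (WAdd (WVar ''i'') (WConst 1))))))"

definition ROWK :: "string \<Rightarrow> wexp \<Rightarrow> com" where
  "ROWK X e = FOR ''x'' ''N'' (RStore ''K'' (WVar ''x'') (RArr X e))"

definition SORT :: "string \<Rightarrow> string \<Rightarrow> com" where
  "SORT X e = FOR ''r'' e (Seq (ROWK X (ix ''r'' ''x'')) (Seq (INITQ e)
     (FOR ''c'' e (Seq EXTRACT (WStore ''S'' (ix ''r'' ''c'') (WVar ''p''))))))"

section \<open>The stages of a round\<close>

definition COPY :: com where
  "COPY = FOR ''r'' ''N'' (FOR ''x'' ''N''
     (Seq (RStore ''H'' (ix ''r'' ''x'') (RArr ''M'' (ix ''r'' ''x'')))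
          (RStore ''W'' (ix ''r'' ''x'') (RArr ''M'' (ix ''r'' ''x'')))))"

definition SHIFT :: "string \<Rightarrow> com" where
  "SHIFT X = RStore X (ix ''a'' ''x'')
     (RAdd (RSub (RArr X (ix ''a'' ''x'')) (RArr ''V'' (WVar ''a''))) (RArr ''V'' (WVar ''x'')))"

text \<open>The distances to and from the hub \<open>r\<close> are entered into \<open>H\<close> as
  edges first, so that they are shifted with all others. \<open>W\<close> gets no such edges: it
  remains a pure reweighting of the matrix of the round.\<close>

definition REWEIGHT :: com where
  "REWEIGHT = Seq (FOR ''x'' ''N'' (RStore ''H'' (ix ''x'' ''r'') (RArr ''V'' (WVar ''x''))))
    (Seq (FOR ''x'' ''N'' (RStore ''H'' (ix ''r'' ''x'') (RArr ''R'' (WVar ''x''))))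
    (Seq (FOR ''a'' ''N'' (FOR ''x'' ''N'' (Seq (SHIFT ''H'') (SHIFT ''W''))))
      (FOR ''x'' ''n'' (RStore ''P'' (WVar ''x'') (RAdd (RArr ''P'' (WVar ''x'')) (RArr ''V'' (WVar ''x'')))))))"

text \<open>The first reverse run leaves in \<open>R\<close> the walks to \<open>r\<close> of an
  arbitrary edge, nonnegative edges and an arbitrary edge. The second one closes these values under
  nonnegative edges; only this makes them a potential that keeps such edges nonnegative. The
  distances from \<open>r\<close> serve merely as edges, hence a single run for them.\<close>

definition HUB :: com where
  "HUB = Seq (WAssign ''r'' (WArr ''h'' (WVar ''h'')))
    (Seq (ROWK ''H'' (ix ''x'' ''r'')) (Seq (DIJ (FULL ''H'' (ix ''w'' ''p'')))
    (Seq (ROWK ''R'' (WVar ''x'')) (Seq (DIJ (FULL ''H'' (ix ''w'' ''p'')))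
    (Seq (FOR ''x'' ''N'' (RStore ''V'' (WVar ''x'') (RArr ''K'' (WVar ''x''))))
    (Seq (ROWK ''H'' (ix ''r'' ''x'')) (Seq (DIJ (FULL ''H'' (ix ''p'' ''w''))) REWEIGHT)))))))"

definition EXPLORE :: com where
  "EXPLORE = FOR ''u'' ''n'' (Seq (ROWK ''W'' (ix ''u'' ''x'')) (Seq (DIJ SCAN)
     (FOR ''x'' ''n'' (RStore ''A'' (ix ''u'' ''x'') (RArr ''R'' (WVar ''x''))))))"

definition BASE :: com where
  "BASE = Seq (RAssign ''g'' RZero)
    (Seq (FOR ''u'' ''n'' (FOR ''w'' ''n'' (Seq
        (Cond (RLess (RVar ''g'') (RArr ''A'' (ix ''u'' ''w''))) (RAssign ''g'' (RArr ''A'' (ix ''u'' ''w''))) Skip)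
        (Cond (RLess (RVar ''g'') (RSub RZero (RArr ''A'' (ix ''u'' ''w''))))
           (RAssign ''g'' (RSub RZero (RArr ''A'' (ix ''u'' ''w'')))) Skip))))
    (Seq (RAssign ''g'' (RAdd (RVar ''g'') (RAdd (RVar ''g'') (RVar ''g''))))
      (FOR ''u'' ''N'' (FOR ''w'' ''N'' (Cond (WEq (WVar ''u'') (WVar ''w''))
         (RStore ''M'' (ix ''u'' ''w'') RZero)
         (Cond (BAnd (WLess (WVar ''u'') (WVar ''n'')) (WLess (WVar ''w'') (WVar ''n'')))
            (RStore ''M'' (ix ''u'' ''w'') (RArr ''A'' (ix ''u'' ''w'')))
            (RStore ''M'' (ix ''u'' ''w'') (RVar ''g''))))))))"

definition EXPL :: com where
  "EXPL = Seq (WAssign ''i'' (WConst 0)) (WHILEF (WLess (WVar ''i'') (WVar ''o''))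
     (Seq (WAssign ''t'' (WArr ''S'' (ix ''w'' ''i'')))
     (Seq (RAssign ''x'' (RAdd (RArr ''A'' (ix ''u'' ''w'')) (RArr ''A'' (ix ''w'' ''t''))))
     (Seq (Cond (RLess (RVar ''x'') (RArr ''M'' (ix ''u'' ''t''))) (RStore ''M'' (ix ''u'' ''t'') (RVar ''x'')) Skip)
       (WAssign ''i'' (WAdd (WVar ''i'') (WConst 1)))))))"

text \<open>The pivot of level \<open>k\<close> is the shortcut from \<open>w\<close> at the
  position \<open>j = 2^k - 1\<close> of its sorted row, or at the last position; \<open>z\<close>
  is its weight. A pair from \<open>u\<close> over \<open>w\<close> to \<open>t\<close> becomes a
  walk over the auxiliary node with the weights \<open>A u w + z\<close> and
  \<open>A w t - z\<close>, if both are nonnegative. If the first is negative, then so are the pairs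
  for all positions up to the pivot, and the pairs for all positions before the next pivot are
  entered explicitly.\<close>

definition LEVEL :: com where
  "LEVEL = Seq (WAssign ''a'' (WAdd (WMult (WAdd (WVar ''k'') (WConst 1)) (WVar ''n'')) (WVar ''w'')))
    (Seq (RAssign ''z'' (RArr ''A'' (WAdd (WMult (WVar ''w'') (WVar ''N'')) (WArr ''S'' (ix ''w'' ''j'')))))
    (Seq (WAssign ''o'' (WAdd (WAdd (WVar ''j'') (WVar ''j'')) (WConst 1)))
    (Seq (Cond (WLess (WVar ''o'') (WVar ''n'')) Skip (WAssign ''o'' (WSub (WVar ''n'') (WConst 1))))
    (Seq (FOR ''t'' ''n'' (Cond (RLess (RArr ''A'' (ix ''w'' ''t'')) (RVar ''z'')) Skip
        (RStore ''M'' (ix ''a'' ''t'') (RSub (RArr ''A'' (ix ''w'' ''t'')) (RVar ''z'')))))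
    (Seq (FOR ''u'' ''n'' (Seq (RAssign ''x'' (RAdd (RArr ''A'' (ix ''u'' ''w'')) (RVar ''z'')))
        (Cond (RLess (RVar ''x'') RZero) EXPL (RStore ''M'' (ix ''u'' ''a'') (RVar ''x'')))))
      (WAssign ''j'' (WVar ''o'')))))))"

definition FILL :: com where
  "FILL = FOR ''w'' ''n'' (Seq (WAssign ''j'' (WConst 0)) (FOR ''k'' ''E'' LEVEL))"

definition FUEL :: "string \<Rightarrow> com" where
  "FUEL X = WAssign ''f'' (WVar X)"

definition ROUND :: com where
  "ROUND = Seq COPY (Seq (FOR ''h'' ''q'' HUB) (Seq (SORT ''W'' ''N'') (Seq (FUEL ''ce'') (Seq EXPLORE
     (Seq (SORT ''A'' ''n'') (Seq BASE (Seq (FUEL ''cf'') FILL)))))))"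

section \<open>Sampling, sizes, input and output\<close>

definition SAMPLE :: com where
  "SAMPLE = FOR ''h'' ''q'' (Seq (Random ''x'' (WVar ''N'')) (WStore ''h'' (WVar ''h'') (WVar ''x'')))"

text \<open>The roundings up of the logarithm and of the square root are found by loops of exactly
  \<open>n\<close> iterations that stop changing anything once the value is reached.
  \<open>l\<close> exceeds the logarithm by two.\<close>

definition SIZES :: "nat \<Rightarrow> com" where
  "SIZES C = Seq (WAssign ''p'' (WConst 1)) (Seq (WAssign ''l'' (WConst 2))
    (Seq (FOR ''x'' ''n'' (Cond (WLess (WVar ''p'') (WVar ''n''))
        (Seq (WAssign ''p'' (WAdd (WVar ''p'') (WVar ''p''))) (WAssign ''l'' (WAdd (WVar ''l'') (WConst 1)))) Skip))
    (Seq (WAssign ''q'' (WConst 0))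
    (Seq (FOR ''x'' ''n'' (Cond (WLess (WMult (WVar ''q'') (WVar ''q'')) (WVar ''n''))
        (WAssign ''q'' (WAdd (WVar ''q'') (WConst 1))) Skip))
    (Seq (WAssign ''B'' (WMult (WVar ''q'') (WVar ''l'')))
    (Seq (WAssign ''N'' (WMult (WVar ''q'') (WVar ''B'')))
    (Seq (WAssign ''E'' (WSub (WVar ''l'') (WConst 1)))
    (Seq (WAssign ''m'' (WMult (WConst C) (WMult (WVar ''l'') (WVar ''B''))))
    (Seq (WAssign ''ce'' (WMult (WVar ''n'') (WMult (WVar ''N'') (WVar ''m''))))
      (WAssign ''cf'' (WMult (WVar ''n'') (WMult (WMult (WConst 2) (WVar ''E'')) (WMult (WVar ''n'') (WVar ''m''))))))))))))))"

definition ex :: "string \<Rightarrow> string \<Rightarrow> wexp" where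
  "ex a b = WAdd (WMult (WVar a) (WVar ''n'')) (WVar b)"

definition LOAD :: com where
  "LOAD = Seq (RAssign ''z'' RZero)
    (Seq (FOR ''x'' ''n'' (FOR ''y'' ''n'' (Cond (RLess (RArr ''weight'' (ex ''x'' ''y'')) RZero)
       (RAssign ''z'' (RSub (RVar ''z'') (RArr ''weight'' (ex ''x'' ''y''))))
       (RAssign ''z'' (RAdd (RVar ''z'') (RArr ''weight'' (ex ''x'' ''y'')))))))
    (Seq (RAssign ''z'' (RAdd (RVar ''z'') (RVar ''z'')))
      (FOR ''x'' ''n'' (FOR ''y'' ''n'' (Cond (WEq (WVar ''x'') (WVar ''y''))
         (RStore ''A'' (ix ''x'' ''y'') RZero)
         (Cond (WEq (WArr ''edge'' (ex ''x'' ''y'')) (WConst 0))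
            (RStore ''A'' (ix ''x'' ''y'') (RVar ''z''))
            (RStore ''A'' (ix ''x'' ''y'') (RArr ''weight'' (ex ''x'' ''y'')))))))))"

definition DIST :: com where
  "DIST = Seq (ROWK ''M'' (ix ''s'' ''x'')) (Seq (DIJ (FULL ''M'' (ix ''p'' ''w'')))
    (Seq (ROWK ''R'' (WVar ''x'')) (Seq (DIJ (FULL ''M'' (ix ''p'' ''w'')))
      (FOR ''x'' ''n'' (RStore ''dist'' (WVar ''x'')
         (RAdd (RSub (RArr ''K'' (WVar ''x'')) (RArr ''P'' (WVar ''x''))) (RArr ''P'' (WVar ''s''))))))))"

definition SEARCH :: com where
  "SEARCH = Seq (WStore ''reachable'' (WVar ''s'') (WConst 1)) (FOR ''c'' ''n''
    (Seq (WAssign ''p'' (WVar ''n''))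
    (Seq (FOR ''x'' ''n'' (Cond (BAnd (BNot (WEq (WArr ''reachable'' (WVar ''x'')) (WConst 0)))
           (WEq (WArr ''D'' (WVar ''x'')) (WConst 0))) (WAssign ''p'' (WVar ''x'')) Skip))
      (Cond (WLess (WVar ''p'') (WVar ''n''))
        (Seq (WStore ''D'' (WVar ''p'') (WConst 1))
          (FOR ''x'' ''n'' (Cond (WEq (WArr ''edge'' (ex ''p'' ''x'')) (WConst 0)) Skip
             (WStore ''reachable'' (WVar ''x'') (WConst 1))))) Skip))))"

definition VERIFY :: com where
  "VERIFY = FOR ''x'' ''n'' (FOR ''y'' ''n'' (Cond (BAnd (BNot (WEq (WArr ''edge'' (ex ''x'' ''y'')) (WConst 0)))
     (RLess (RAdd (RArr ''dist'' (WVar ''x'')) (RArr ''weight'' (ex ''x'' ''y''))) (RArr ''dist'' (WVar ''y''))))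
     (WAssign ''negative_cycle'' (WConst 1)) Skip))"

section \<open>Variables written by the subprograms\<close>

lemma BLK_writes [simp]: "ww BLK = {''o'', ''y'', ''e''}" "wa BLK = {''b''}" "rv BLK = {}" "ra BLK = {}"
  by (auto simp: BLK_def)
lemma EXTRACT_writes [simp]: "ww EXTRACT = {''p'', ''y'', ''e'', ''j'', ''o''}" "wa EXTRACT = {''b'', ''d''}"
  "rv EXTRACT = {}" "ra EXTRACT = {}"
  by (auto simp: EXTRACT_def)
lemma INITQ_writes [simp]: "ww (INITQ X) = {''x'', ''j'', ''o'', ''y'', ''e''}" "wa (INITQ X) = {''b'', ''d''}"
  "rv (INITQ X) = {}" "ra (INITQ X) = {}"
  by (auto simp: INITQ_def)
lemma DECR_writes [simp]: "ww DECR = {''j'', ''o''}" "wa DECR = {''b''}" "rv DECR = {}" "ra DECR = {}"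
  by (auto simp: DECR_def)
lemma RELAX_writes [simp]: "ww (RELAX G X e) = {''j'', ''o''}" "wa (RELAX G X e) = {''b''}"
  "rv (RELAX G X e) = {''x''}" "ra (RELAX G X e) = {''R'', ''K''}"
  by (auto simp: RELAX_def)
lemma DIJ_writes [simp]: "ww (DIJ c) = {''x'', ''p'', ''y'', ''e'', ''j'', ''o'', ''c''} \<union> ww c"
  "wa (DIJ c) = {''b'', ''d''} \<union> wa c" "rv (DIJ c) = {''v''} \<union> rv c" "ra (DIJ c) = {''R''} \<union> ra c"
  by (auto simp: DIJ_def)
lemma FULL_writes [simp]: "ww (FULL G e) = {''j'', ''o'', ''w''}" "wa (FULL G e) = {''b''}"
  "rv (FULL G e) = {''x''}" "ra (FULL G e) = {''R'', ''K''}"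
  by (auto simp: FULL_def)
lemma SCAN_writes [simp]: "ww SCAN = {''j'', ''o'', ''w'', ''i'', ''f''}" "wa SCAN = {''b''}"
  "rv SCAN = {''x''}" "ra SCAN = {''R'', ''K''}"
  by (auto simp: SCAN_def)
lemma ROWK_writes [simp]: "ww (ROWK X e) = {''x''}" "wa (ROWK X e) = {}" "rv (ROWK X e) = {}" "ra (ROWK X e) = {''K''}"
  by (auto simp: ROWK_def)
lemma SORT_writes [simp]: "ww (SORT X e) = {''r'', ''c'', ''x'', ''p'', ''y'', ''e'', ''j'', ''o''}"
  "wa (SORT X e) = {''b'', ''d'', ''S''}" "rv (SORT X e) = {}" "ra (SORT X e) = {''K''}"
  by (auto simp: SORT_def)
lemma COPY_writes [simp]: "ww COPY = {''r'', ''x''}" "wa COPY = {}" "rv COPY = {}" "ra COPY = {''H'', ''W''}"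
  by (auto simp: COPY_def)
lemma REWEIGHT_writes [simp]: "ww REWEIGHT = {''a'', ''x''}" "wa REWEIGHT = {}" "rv REWEIGHT = {}"
  "ra REWEIGHT = {''H'', ''W'', ''P''}"
  by (auto simp: REWEIGHT_def SHIFT_def)
lemma HUB_writes [simp]: "ww HUB = {''r'', ''a'', ''x'', ''p'', ''y'', ''e'', ''j'', ''o'', ''c'', ''w''}"
  "wa HUB = {''b'', ''d''}" "rv HUB = {''v'', ''x''}" "ra HUB = {''H'', ''W'', ''P'', ''V'', ''K'', ''R''}"
  by (auto simp: HUB_def)
lemma EXPLORE_writes [simp]: "ww EXPLORE = {''u'', ''x'', ''p'', ''y'', ''e'', ''j'', ''o'', ''c'', ''w'', ''i'', ''f''}"
  "wa EXPLORE = {''b'', ''d''}" "rv EXPLORE = {''v'', ''x''}" "ra EXPLORE = {''A'', ''K'', ''R''}"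
  by (auto simp: EXPLORE_def)
lemma BASE_writes [simp]: "ww BASE = {''u'', ''w''}" "wa BASE = {}" "rv BASE = {''g''}" "ra BASE = {''M''}"
  by (auto simp: BASE_def)
lemma EXPL_writes [simp]: "ww EXPL = {''i'', ''t'', ''f''}" "wa EXPL = {}" "rv EXPL = {''x''}" "ra EXPL = {''M''}"
  by (auto simp: EXPL_def)
lemma LEVEL_writes [simp]: "ww LEVEL = {''a'', ''i'', ''t'', ''f'', ''o'', ''u'', ''j''}" "wa LEVEL = {}"
  "rv LEVEL = {''x'', ''z''}" "ra LEVEL = {''M''}"
  by (auto simp: LEVEL_def)
lemma FILL_writes [simp]: "ww FILL = {''w'', ''k'', ''a'', ''i'', ''t'', ''f'', ''o'', ''u'', ''j''}" "wa FILL = {}"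
  "rv FILL = {''x'', ''z''}" "ra FILL = {''M''}"
  by (auto simp: FILL_def)
lemma FUEL_writes [simp]: "ww (FUEL X) = {''f''}" "wa (FUEL X) = {}" "rv (FUEL X) = {}" "ra (FUEL X) = {}"
  by (auto simp: FUEL_def)
lemma ROUND_writes [simp]: "ww ROUND = {''h'', ''w'', ''k'', ''a'', ''i'', ''t'', ''f'', ''o'', ''u'', ''j'',
   ''r'', ''c'', ''x'', ''p'', ''y'', ''e''}"
  "wa ROUND = {''b'', ''d'', ''S''}" "rv ROUND = {''x'', ''z'', ''g'', ''v''}"
  "ra ROUND = {''M'', ''A'', ''H'', ''W'', ''P'', ''V'', ''K'', ''R''}"
  by (auto simp: ROUND_def)
lemma SAMPLE_writes [simp]: "ww SAMPLE = {''h'', ''x''}" "wa SAMPLE = {''h''}" "rv SAMPLE = {}" "ra SAMPLE = {}"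
  by (auto simp: SAMPLE_def)
lemma LOAD_writes [simp]: "ww LOAD = {''x'', ''y''}" "wa LOAD = {}" "rv LOAD = {''z''}" "ra LOAD = {''A''}"
  by (auto simp: LOAD_def)
lemma DIST_writes [simp]: "ww DIST = {''x'', ''p'', ''y'', ''e'', ''j'', ''o'', ''c'', ''w''}"
  "wa DIST = {''b'', ''d''}" "rv DIST = {''v'', ''x''}" "ra DIST = {''R'', ''K'', ''dist''}"
  by (auto simp: DIST_def)
lemma SEARCH_writes [simp]: "ww SEARCH = {''c'', ''p'', ''x''}" "wa SEARCH = {''reachable'', ''D''}" "rv SEARCH = {}"
  "ra SEARCH = {}"
  by (auto simp: SEARCH_def)
lemma VERIFY_writes [simp]: "ww VERIFY = {''x'', ''y'', ''negative_cycle''}" "wa VERIFY = {}" "rv VERIFY = {}" "ra VERIFY = {}"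
  by (auto simp: VERIFY_def)

section \<open>Running time\<close>

text \<open>\<open>MM\<close> is the word bound. The last three assumptions keep the amounts of fuel
  and the indices of matrix entries below it, so that no arithmetic of the program wraps around. The
  exponent \<open>l - 2\<close> is such that \<open>l - 1\<close> levels of pivots reach the last
  position of a row.\<close>

locale sizes =
  fixes MM n s q l C :: nat
  assumes n1: "1 \<le> n" and s_less: "s < n" and n_le: "n \<le> q * q" and q_le: "q \<le> n"
    and l2: "2 \<le> l" and n_pow: "n \<le> 2 ^ (l - 2)"
    and ce_less: "n * (q * (q * l) * (C * (l * (q * l)))) < MM"
    and cf_less: "n * (2 * (l - 1) * (n * (C * (l * (q * l))))) < MM"
    and NN_less: "(q * (q * l)) * (q * (q * l)) < MM"
begin

definition "nb = q * l"
definition "N = q * nb"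
definition "lv = l - 1"
definition "m = C * (l * nb)"
definition "ce = n * (N * m)"
definition "cf = n * (2 * lv * (n * m))"

lemma q1: "1 \<le> q" using n1 n_le by (cases q) auto

definition cns :: "string set" where
  "cns = {''n'', ''s'', ''q'', ''l'', ''N'', ''B'', ''E'', ''ce'', ''cf''}"

definition ok :: "machine_state \<Rightarrow> bool" where
  "ok \<sigma> \<longleftrightarrow> wvar \<sigma> ''n'' = n \<and> wvar \<sigma> ''s'' = s \<and> wvar \<sigma> ''q'' = q \<and> wvar \<sigma> ''l'' = l \<and>
     wvar \<sigma> ''N'' = N \<and> wvar \<sigma> ''B'' = nb \<and> wvar \<sigma> ''E'' = lv \<and> wvar \<sigma> ''ce'' = ce \<and> wvar \<sigma> ''cf'' = cf"

lemma ok_fr: "fr c \<sigma> \<sigma>' \<Longrightarrow> ok \<sigma> \<Longrightarrow> ww c \<inter> cns = {} \<Longrightarrow> ok \<sigma>'"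
  by (auto simp: ok_def cns_def fr_def)

text \<open>Amortized time: every unit of fuel that is used up pays for 50 steps.\<close>

definition TM :: "nat \<Rightarrow> nat \<Rightarrow> nat \<Rightarrow> com \<Rightarrow> bool" where
  "TM k i j c \<longleftrightarrow> ww c \<inter> cns = {} \<and> (\<forall>\<sigma>. ok \<sigma> \<longrightarrow>
     (\<exists>t \<sigma>'. bs MM c \<sigma> t \<sigma>' \<and> t + 50 * wvar \<sigma>' ''f'' \<le> k * q ^ i * l ^ j + 50 * wvar \<sigma> ''f''))"

lemma ql_mono:
  assumes "k \<le> k'" "i \<le> i'" "j \<le> j'"
  shows "k * q ^ i * l ^ j \<le> k' * q ^ i' * l ^ j'"
  using assms q1 l2 by (intro mult_mono power_increasing) auto

lemma TM_le: "TM k i j c \<Longrightarrow> k \<le> k' \<Longrightarrow> i \<le> i' \<Longrightarrow> j \<le> j' \<Longrightarrow> TM k' i' j' c"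
  unfolding TM_def using ql_mono[of k k' i i' j j'] by (meson add_le_mono1 le_trans)

lemma TM_Skip: "TM 0 0 0 Skip"
  unfolding TM_def using bs_Skip by fastforce
lemma TM_WAssign: "x \<notin> cns \<Longrightarrow> x \<noteq> ''f'' \<Longrightarrow> TM 1 0 0 (WAssign x e)"
  unfolding TM_def by (auto intro!: exI[of _ 1] exI bs_WAssign[unfolded One_nat_def])
lemma TM_WStore: "TM 1 0 0 (WStore x i e)"
  unfolding TM_def by (fastforce intro: bs_WStore)
lemma TM_RAssign: "TM 1 0 0 (RAssign x e)"
  unfolding TM_def by (fastforce intro: bs_RAssign)
lemma TM_RStore: "TM 1 0 0 (RStore x i e)"
  unfolding TM_def by (fastforce intro: bs_RStore)

lemma TM_Seq:
  assumes "TM k1 i1 j1 c" "TM k2 i2 j2 d"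
  shows "TM (k1 + k2 + 1) (max i1 i2) (max j1 j2) (Seq c d)"
proof -
  let ?i = "max i1 i2" and ?j = "max j1 j2"
  have c: "TM k1 ?i ?j c" and d: "TM k2 ?i ?j d" using assms TM_le by auto
  have one: "1 \<le> q ^ ?i * l ^ ?j" using q1 l2 by simp
  show ?thesis
    unfolding TM_def
  proof (intro conjI allI impI)
    show "ww (Seq c d) \<inter> cns = {}" using c d by (auto simp: TM_def)
    fix \<sigma> assume ok: "ok \<sigma>"
    obtain t \<sigma>' where t: "bs MM c \<sigma> t \<sigma>'" "t + 50 * wvar \<sigma>' ''f'' \<le> k1 * q ^ ?i * l ^ ?j + 50 * wvar \<sigma> ''f''"
      using c ok unfolding TM_def by blast
    have "ok \<sigma>'" using ok_fr[OF bs_fr[OF t(1)] ok] c by (auto simp: TM_def)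
    then obtain u \<sigma>'' where u: "bs MM d \<sigma>' u \<sigma>''"
      "u + 50 * wvar \<sigma>'' ''f'' \<le> k2 * q ^ ?i * l ^ ?j + 50 * wvar \<sigma>' ''f''"
      using d unfolding TM_def by blast
    have "t + 1 + u + 50 * wvar \<sigma>'' ''f'' \<le> (k1 + k2 + 1) * q ^ ?i * l ^ ?j + 50 * wvar \<sigma> ''f''"
    proof -
      define Z where "Z = q ^ ?i * l ^ ?j"
      show ?thesis using t(2) u(2) one unfolding mult.assoc Z_def[symmetric] by (simp add: algebra_simps)
    qed
    then show "\<exists>t \<sigma>'. bs MM (Seq c d) \<sigma> t \<sigma>' \<and>
      t + 50 * wvar \<sigma>' ''f'' \<le> (k1 + k2 + 1) * q ^ ?i * l ^ ?j + 50 * wvar \<sigma> ''f''"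
      using bs_Seq[OF t(1) u(1)] by blast
  qed
qed

lemma TM_Cond:
  assumes "TM k1 i1 j1 c" "TM k2 i2 j2 d"
  shows "TM (k1 + k2 + 1) (max i1 i2) (max j1 j2) (Cond b c d)"
proof -
  let ?i = "max i1 i2" and ?j = "max j1 j2"
  have cd: "TM (k1 + k2) ?i ?j (if x then c else d)" for x using assms TM_le by auto
  have one: "1 \<le> q ^ ?i * l ^ ?j" using q1 l2 by simp
  show ?thesis
    unfolding TM_def
  proof (intro conjI allI impI)
    show "ww (Cond b c d) \<inter> cns = {}" using assms by (auto simp: TM_def)
    fix \<sigma> assume ok: "ok \<sigma>"
    obtain t \<sigma>' where t: "bs MM (if bval MM \<sigma> b then c else d) \<sigma> t \<sigma>'"
       "t + 50 * wvar \<sigma>' ''f'' \<le> (k1 + k2) * q ^ ?i * l ^ ?j + 50 * wvar \<sigma> ''f''"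
      using cd[of "bval MM \<sigma> b"] ok unfolding TM_def by blast
    have "1 + t + 50 * wvar \<sigma>' ''f'' \<le> (k1 + k2 + 1) * q ^ ?i * l ^ ?j + 50 * wvar \<sigma> ''f''"
    proof -
      define Z where "Z = q ^ ?i * l ^ ?j"
      show ?thesis using t(2) one unfolding mult.assoc Z_def[symmetric] by (simp add: algebra_simps)
    qed
    then show "\<exists>t \<sigma>'. bs MM (Cond b c d) \<sigma> t \<sigma>' \<and>
      t + 50 * wvar \<sigma>' ''f'' \<le> (k1 + k2 + 1) * q ^ ?i * l ^ ?j + 50 * wvar \<sigma> ''f''"
      using bs_Cond[OF t(1)] by blast
  qed
qed

lemma N_less: "N < MM" and nb_less: "nb < MM" and q_less: "q < MM" and n_less: "n < MM"
  and lv_less: "lv < MM" and l_less: "l < MM" and n_le_N: "n \<le> N" and nb_le_N: "nb \<le> N"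
  and q_le_N: "q \<le> N" and N1: "1 \<le> N" and l_le_N: "l \<le> N"
proof -
  show N1: "1 \<le> N" using q1 l2 by (simp add: N_def nb_def)
  have "N * 1 \<le> N * N" using N1 by (intro mult_mono) auto
  then have "N \<le> N * N" by simp
  also have "\<dots> < MM" using NN_less unfolding N_def nb_def .
  finally show N: "N < MM" .
  show nb: "nb \<le> N" using q1 by (simp add: N_def)
  have "n * 1 \<le> (q * q) * l" using n_le l2 by (intro mult_mono) auto
  then show n: "n \<le> N" by (simp add: N_def nb_def ac_simps)
  have "q * 1 \<le> q * l" using l2 by (intro mult_mono) auto
  then show q: "q \<le> N" using nb unfolding nb_def by linarith
  have "1 * l \<le> q * l" using q1 by (intro mult_mono) auto
  then show ll: "l \<le> N" using nb unfolding nb_def by linarith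
  show "nb < MM" "q < MM" "n < MM" "lv < MM" "l < MM"
    using nb q n ll N by (auto simp: lv_def)
qed

lemma TM_FOR_aux:
  assumes c: "TM k i j c" and X: "X \<in> cns" and v: "v \<notin> cns" "v \<notin> ww c" "v \<noteq> ''f''"
    and e: "\<And>\<sigma>. ok \<sigma> \<Longrightarrow> wvar \<sigma> X \<le> q ^ a * l ^ b \<and> wvar \<sigma> X < MM"
  shows "TM (k + 7) (a + i) (b + j) (FOR v X c)"
proof -
  define A where "A = k * q ^ i * l ^ j"
  have vX: "v \<noteq> X" "X \<notin> ww c" using X v c by (auto simp: TM_def)
  have lp: "\<exists>t \<sigma>'. bs MM (Loop (WLess (WVar v) (WVar X)) (Seq c (WAssign v (WAdd (WVar v) (WConst 1))))) \<sigma> t \<sigma>' \<and>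
     t + 50 * wvar \<sigma>' ''f'' \<le> (wvar \<sigma> X - wvar \<sigma> v) * (A + 4) + 1 + 50 * wvar \<sigma> ''f''"
    if "ok \<sigma>" for \<sigma>
    using that
  proof (induction "wvar \<sigma> X - wvar \<sigma> v" arbitrary: \<sigma>)
    case 0
    then show ?case by (intro exI[of _ 1] exI[of _ \<sigma>]) (auto intro!: bs_LoopF[unfolded One_nat_def])
  next
    case (Suc d)
    obtain t \<sigma>' where t: "bs MM c \<sigma> t \<sigma>'" "t + 50 * wvar \<sigma>' ''f'' \<le> A + 50 * wvar \<sigma> ''f''"
      using c Suc.prems unfolding TM_def A_def by blast
    let ?\<tau> = "wset v (wval MM \<sigma>' (WAdd (WVar v) (WConst 1))) \<sigma>'"
    have w: "wvar \<sigma>' v = wvar \<sigma> v" "wvar \<sigma>' X = wvar \<sigma> X" using bs_fr[OF t(1)] v vX by (auto dest: frw)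
    have lt: "wvar \<sigma> v < wvar \<sigma> X" using Suc.hyps(2) by simp
    have v': "wvar ?\<tau> v = Suc (wvar \<sigma> v)" "wvar ?\<tau> X = wvar \<sigma> X"
      using lt e[OF Suc.prems] w vX by (auto simp: mod_simps)
    have ok: "ok ?\<tau>"
      by (rule ok_fr[OF _ Suc.prems, of "Seq c (WAssign v (WConst 0))"])
         (use bs_fr[OF t(1)] v c in \<open>auto simp: fr_def TM_def\<close>)
    have b: "bs MM (Seq c (WAssign v (WAdd (WVar v) (WConst 1)))) \<sigma> (t + 1 + 1) ?\<tau>"
      by (intro bs_Seq[OF t(1)] bs_WAssign)
    have "d = wvar ?\<tau> X - wvar ?\<tau> v" using Suc.hyps(2) v' by simp
    from Suc.hyps(1)[OF this ok] obtain u \<sigma>'' where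
      u: "bs MM (Loop (WLess (WVar v) (WVar X)) (Seq c (WAssign v (WAdd (WVar v) (WConst 1))))) ?\<tau> u \<sigma>''"
      "u + 50 * wvar \<sigma>'' ''f'' \<le> d * (A + 4) + 1 + 50 * wvar ?\<tau> ''f''"
      using Suc.hyps(2) v' by (metis diff_Suc_Suc diff_Suc_1 Suc_diff_Suc lt)
    have "bs MM (Loop (WLess (WVar v) (WVar X)) (Seq c (WAssign v (WAdd (WVar v) (WConst 1))))) \<sigma> (t + 1 + 1 + u + 2) \<sigma>''"
      by (rule bs_LoopT[OF _ b u(1)]) (use lt in simp)
    moreover have "t + 1 + 1 + u + 2 + 50 * wvar \<sigma>'' ''f'' \<le> (wvar \<sigma> X - wvar \<sigma> v) * (A + 4) + 1 + 50 * wvar \<sigma> ''f''"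
      using t(2) u(2) v Suc.hyps(2)[symmetric] by (simp add: algebra_simps)
    ultimately show ?case by blast
  qed
  show ?thesis
    unfolding TM_def
  proof (intro conjI allI impI)
    show "ww (FOR v X c) \<inter> cns = {}" using c v by (auto simp: TM_def)
    fix \<sigma> assume ok: "ok \<sigma>"
    let ?\<tau> = "wset v (0 mod MM) \<sigma>"
    have ok': "ok ?\<tau>" by (rule ok_fr[OF _ ok, of "WAssign v (WConst 0)"]) (use v in \<open>auto simp: fr_def\<close>)
    from lp[OF this] obtain t \<sigma>' where
      t: "bs MM (Loop (WLess (WVar v) (WVar X)) (Seq c (WAssign v (WAdd (WVar v) (WConst 1))))) ?\<tau> t \<sigma>'"
      "t + 50 * wvar \<sigma>' ''f'' \<le> (wvar ?\<tau> X - wvar ?\<tau> v) * (A + 4) + 1 + 50 * wvar ?\<tau> ''f''" by blast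
    have "bs MM (FOR v X c) \<sigma> (1 + 1 + t) \<sigma>'"
      unfolding FOR_def using bs_Seq[OF bs_WAssign[of MM v "WConst 0" \<sigma>]] t(1) by simp
    moreover have "1 + 1 + t + 50 * wvar \<sigma>' ''f'' \<le> (k + 7) * q ^ (a + i) * l ^ (b + j) + 50 * wvar \<sigma> ''f''"
    proof -
      let ?Q = "q ^ a * l ^ b" and ?R = "q ^ i * l ^ j"
      have one: "1 \<le> ?R" "1 \<le> ?Q" using q1 l2 by auto
      have "(wvar ?\<tau> X - wvar ?\<tau> v) * (A + 4) \<le> ?Q * (k * ?R + 4 * ?R)"
        using e[OF ok] vX one by (intro mult_mono) (auto simp: A_def algebra_simps)
      also have "\<dots> + 3 * 1 \<le> ?Q * (k * ?R + 4 * ?R) + 3 * (?Q * ?R)"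
        using one mult_mono[OF one(2) one(1)] by (intro add_mono mult_mono) auto
      also have "\<dots> = (k + 7) * q ^ (a + i) * l ^ (b + j)" by (simp add: power_add algebra_simps)
      finally show ?thesis using t(2) v by simp
    qed
    ultimately show "\<exists>t \<sigma>'. bs MM (FOR v X c) \<sigma> t \<sigma>' \<and>
      t + 50 * wvar \<sigma>' ''f'' \<le> (k + 7) * q ^ (a + i) * l ^ (b + j) + 50 * wvar \<sigma> ''f''" by blast
  qed
qed

lemma TM_FOR_n: "TM k i j c \<Longrightarrow> v \<notin> cns \<Longrightarrow> v \<notin> ww c \<Longrightarrow> v \<noteq> ''f'' \<Longrightarrow> TM (k + 7) (2 + i) (0 + j) (FOR v ''n'' c)"
  by (rule TM_FOR_aux) (use n_le n_less in \<open>auto simp: cns_def ok_def power2_eq_square\<close>)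
lemma TM_FOR_N: "TM k i j c \<Longrightarrow> v \<notin> cns \<Longrightarrow> v \<notin> ww c \<Longrightarrow> v \<noteq> ''f'' \<Longrightarrow> TM (k + 7) (2 + i) (1 + j) (FOR v ''N'' c)"
  by (rule TM_FOR_aux) (use N_less in \<open>auto simp: cns_def ok_def power2_eq_square N_def nb_def\<close>)
lemma TM_FOR_B: "TM k i j c \<Longrightarrow> v \<notin> cns \<Longrightarrow> v \<notin> ww c \<Longrightarrow> v \<noteq> ''f'' \<Longrightarrow> TM (k + 7) (1 + i) (1 + j) (FOR v ''B'' c)"
  by (rule TM_FOR_aux) (use nb_less in \<open>auto simp: cns_def ok_def nb_def\<close>)
lemma TM_FOR_q: "TM k i j c \<Longrightarrow> v \<notin> cns \<Longrightarrow> v \<notin> ww c \<Longrightarrow> v \<noteq> ''f'' \<Longrightarrow> TM (k + 7) (1 + i) (0 + j) (FOR v ''q'' c)"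
  by (rule TM_FOR_aux) (use q_less in \<open>auto simp: cns_def ok_def\<close>)
lemma TM_FOR_E: "TM k i j c \<Longrightarrow> v \<notin> cns \<Longrightarrow> v \<notin> ww c \<Longrightarrow> v \<noteq> ''f'' \<Longrightarrow> TM (k + 7) (0 + i) (1 + j) (FOR v ''E'' c)"
  by (rule TM_FOR_aux) (use lv_less in \<open>auto simp: cns_def ok_def lv_def\<close>)

text \<open>An iteration takes at most \<open>k + 4\<close> steps, which the 50 steps paid by its
  unit of fuel cover. What remains to be charged is the last test.\<close>

lemma TM_WHILEF:
  assumes "TM k i j c" "i = 0" "j = 0" and k: "k \<le> 40" and f: "''f'' \<notin> ww c"
  shows "TM 1 0 0 (WHILEF b c)"
proof -
  let ?b = "BAnd (WLess (WConst 0) (WVar ''f'')) b"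
  let ?c = "Seq (WAssign ''f'' (WSub (WVar ''f'') (WConst 1))) c"
  have c: "TM k 0 0 c" using assms by simp
  have MM1: "1 < MM" using NN_less N1 by (cases "MM = 1") (auto simp: N_def nb_def)
  have "\<exists>t \<sigma>'. bs MM (Loop ?b ?c) \<sigma> t \<sigma>' \<and> t + 50 * wvar \<sigma>' ''f'' \<le> 1 + 50 * F"
    if "ok \<sigma>" "wvar \<sigma> ''f'' = F" for \<sigma> F
    using that
  proof (induction F arbitrary: \<sigma>)
    case 0
    then show ?case by (intro exI[of _ 1] exI[of _ \<sigma>]) (auto intro!: bs_LoopF[unfolded One_nat_def])
  next
    case (Suc F)
    show ?case
    proof (cases "bval MM \<sigma> ?b")
      case False
      then show ?thesis using Suc.prems
        by (intro exI[of _ 1] exI[of _ \<sigma>]) (auto intro!: bs_LoopF[unfolded One_nat_def])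
    next
      case True
      let ?\<tau> = "wset ''f'' (wval MM \<sigma> (WSub (WVar ''f'') (WConst 1))) \<sigma>"
      have ok': "ok ?\<tau>" by (rule ok_fr[OF _ Suc.prems(1), of "WAssign ''f'' (WConst 0)"])
           (auto simp: fr_def cns_def)
      obtain t \<sigma>' where t: "bs MM c ?\<tau> t \<sigma>'" "t + 50 * wvar \<sigma>' ''f'' \<le> k * q ^ 0 * l ^ 0 + 50 * wvar ?\<tau> ''f''"
        using c ok' unfolding TM_def by blast
      have ok2: "ok \<sigma>'" using ok_fr[OF bs_fr[OF t(1)] ok'] c by (auto simp: TM_def)
      have f\<tau>: "wvar ?\<tau> ''f'' = F" using Suc.prems(2) MM1 by simp
      then have f': "wvar \<sigma>' ''f'' = F" using frw[OF bs_fr[OF t(1)] f] by simp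
      from Suc.IH[OF ok2 f'] obtain u \<sigma>'' where u: "bs MM (Loop ?b ?c) \<sigma>' u \<sigma>''"
        "u + 50 * wvar \<sigma>'' ''f'' \<le> 1 + 50 * F" by blast
      have cc: "bs MM ?c \<sigma> (1 + 1 + t) \<sigma>'" using bs_Seq[OF bs_WAssign t(1)] .
      have "bs MM (Loop ?b ?c) \<sigma> (1 + 1 + t + u + 2) \<sigma>''" by (rule bs_LoopT[OF True cc u(1)])
      moreover have "1 + 1 + t + u + 2 + 50 * wvar \<sigma>'' ''f'' \<le> 1 + 50 * Suc F"
        using t(2) u(2) k unfolding f\<tau> f' by simp
      ultimately show ?thesis by blast
    qed
  qed
  then show ?thesis unfolding TM_def WHILEF_def using c by (auto simp: TM_def cns_def)
qed

text \<open>Filling up the fuel is charged with all later steps that the fuel pays for. This is the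
  dominating term \<open>q ^ 5 * l ^ 3\<close> of a round.\<close>

lemma TM_FUEL_ce: "TM (1 + 50 * C) 5 3 (FUEL ''ce'')"
  unfolding TM_def FUEL_def
proof (intro conjI allI impI)
  fix \<sigma> assume ok: "ok \<sigma>"
  have "ce \<le> (q * q) * (N * m)" unfolding ce_def by (intro mult_mono n_le) auto
  also have "\<dots> = C * q ^ 5 * l ^ 3" by (simp add: N_def nb_def m_def power_numeral_reduce)
  finally have ce: "ce \<le> C * q ^ 5 * l ^ 3" .
  have "1 * 1 \<le> q ^ 5 * l ^ 3" using q1 l2 by (intro mult_mono) auto
  then have "1 + 50 * ce \<le> (1 + 50 * C) * q ^ 5 * l ^ 3" using ce unfolding mult.assoc
    by (simp only: algebra_simps)
  then show "\<exists>t \<sigma>'. bs MM (WAssign ''f'' (WVar ''ce'')) \<sigma> t \<sigma>' \<and>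
     t + 50 * wvar \<sigma>' ''f'' \<le> (1 + 50 * C) * q ^ 5 * l ^ 3 + 50 * wvar \<sigma> ''f''"
    using ok bs_WAssign[of MM "''f''" "WVar ''ce''" \<sigma>] by (intro exI[of _ 1] exI[of _ "wset ''f'' ce \<sigma>"]) (simp add: ok_def)
qed (simp add: cns_def)

lemma TM_FUEL_cf: "TM (1 + 100 * C) 5 3 (FUEL ''cf'')"
  unfolding TM_def FUEL_def
proof (intro conjI allI impI)
  fix \<sigma> assume ok: "ok \<sigma>"
  have "cf \<le> (q * q) * (2 * l * ((q * q) * m))" unfolding cf_def lv_def by (intro mult_mono n_le) auto
  also have "\<dots> = 2 * C * q ^ 5 * l ^ 3" by (simp add: nb_def m_def power_numeral_reduce)
  finally have cf: "cf \<le> 2 * C * q ^ 5 * l ^ 3" .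
  have "1 * 1 \<le> q ^ 5 * l ^ 3" using q1 l2 by (intro mult_mono) auto
  then have "1 + 50 * cf \<le> (1 + 100 * C) * q ^ 5 * l ^ 3" using cf unfolding mult.assoc
    by (simp only: algebra_simps)
  then show "\<exists>t \<sigma>'. bs MM (WAssign ''f'' (WVar ''cf'')) \<sigma> t \<sigma>' \<and>
     t + 50 * wvar \<sigma>' ''f'' \<le> (1 + 100 * C) * q ^ 5 * l ^ 3 + 50 * wvar \<sigma> ''f''"
    using ok bs_WAssign[of MM "''f''" "WVar ''cf''" \<sigma>] by (intro exI[of _ 1] exI[of _ "wset ''f'' cf \<sigma>"]) (simp add: ok_def)
qed (simp add: cns_def)

lemmas TM_intros = TM_Skip TM_WAssign TM_WStore TM_RAssign TM_RStore TM_Seq TM_Cond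
  TM_FOR_n TM_FOR_N TM_FOR_B TM_FOR_q TM_FOR_E

text \<open>Here and below the rules compute the bound of the program text in schematic variables,
  and the stated constants are generous roundings of it.\<close>

lemma TM_BLK: "TM 30 1 0 BLK"
  unfolding BLK_def by (rule TM_le, (rule TM_intros | (simp add: cns_def; fail))+)
lemma TM_EXTRACT: "TM 100 1 1 EXTRACT"
  unfolding EXTRACT_def by (rule TM_le, (rule TM_intros TM_BLK | (simp add: cns_def; fail))+)
lemma TM_INITQ: "TM 100 2 1 (INITQ X)"
  unfolding INITQ_def by (rule TM_le, (rule TM_intros TM_BLK | (simp add: cns_def; fail))+)
lemma TM_DECR: "TM 10 0 0 DECR"
  unfolding DECR_def by (rule TM_le, (rule TM_intros | (simp add: cns_def; fail))+)
lemma TM_RELAX: "TM 20 0 0 (RELAX G X e)"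
  unfolding RELAX_def by (rule TM_le, (rule TM_intros TM_DECR | (simp add: cns_def; fail))+)
lemma TM_FULL: "TM 30 2 1 (FULL G e)"
  unfolding FULL_def by (rule TM_le, (rule TM_intros TM_RELAX | (simp add: cns_def; fail))+)
lemma TM_SCAN: "TM 10 0 0 SCAN"
  unfolding SCAN_def by (rule TM_le, (rule TM_intros TM_RELAX TM_WHILEF | (simp add: cns_def; fail))+)
lemma TM_DIJ_FULL: "TM 300 4 2 (DIJ (FULL G e))"
  unfolding DIJ_def by (rule TM_le, (rule TM_intros TM_FULL TM_INITQ TM_EXTRACT | (simp add: cns_def; fail))+)
lemma TM_DIJ_SCAN: "TM 300 3 2 (DIJ SCAN)"
  unfolding DIJ_def by (rule TM_le, (rule TM_intros TM_SCAN TM_INITQ TM_EXTRACT | (simp add: cns_def; fail))+)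
lemma TM_ROWK: "TM 10 2 1 (ROWK X e)"
  unfolding ROWK_def by (rule TM_le, (rule TM_intros | (simp add: cns_def; fail))+)
lemma TM_SORT_N: "TM 300 5 3 (SORT X ''N'')"
  unfolding SORT_def by (rule TM_le, (rule TM_intros TM_ROWK TM_INITQ TM_EXTRACT | (simp add: cns_def; fail))+)
lemma TM_SORT_n: "TM 300 5 1 (SORT X ''n'')"
  unfolding SORT_def by (rule TM_le, (rule TM_intros TM_ROWK TM_INITQ TM_EXTRACT | (simp add: cns_def; fail))+)
lemma TM_COPY: "TM 30 4 2 COPY"
  unfolding COPY_def by (rule TM_le, (rule TM_intros | (simp add: cns_def; fail))+)
lemma TM_REWEIGHT: "TM 100 4 2 REWEIGHT"
  unfolding REWEIGHT_def SHIFT_def by (rule TM_le, (rule TM_intros | (simp add: cns_def; fail))+)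
lemma TM_HUB: "TM 2000 4 2 HUB"
  unfolding HUB_def by (rule TM_le, (rule TM_intros TM_ROWK TM_DIJ_FULL TM_REWEIGHT | (simp add: cns_def; fail))+)
lemma TM_EXPLORE: "TM 500 5 2 EXPLORE"
  unfolding EXPLORE_def by (rule TM_le, (rule TM_intros TM_ROWK TM_DIJ_SCAN | (simp add: cns_def; fail))+)
lemma TM_BASE: "TM 100 4 2 BASE"
  unfolding BASE_def by (rule TM_le, (rule TM_intros | (simp add: cns_def; fail))+)
lemma TM_EXPL: "TM 10 0 0 EXPL"
  unfolding EXPL_def by (rule TM_le, (rule TM_intros TM_WHILEF | (simp add: cns_def; fail))+)
lemma TM_LEVEL: "TM 100 2 0 LEVEL"
  unfolding LEVEL_def by (rule TM_le, (rule TM_intros TM_EXPL | (simp add: cns_def; fail))+)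
lemma TM_FILL: "TM 200 4 1 FILL"
  unfolding FILL_def by (rule TM_le, (rule TM_intros TM_LEVEL | (simp add: cns_def; fail))+)
text \<open>The summand \<open>150 * C\<close> is the fuel, \<open>50 * C\<close> for the
  exploration and \<open>100 * C\<close> for the explicit pairs.\<close>

lemma TM_ROUND: "TM (5000 + 150 * C) 5 3 ROUND"
  unfolding ROUND_def by (rule TM_le, (rule TM_intros TM_COPY TM_HUB TM_SORT_N TM_SORT_n TM_EXPLORE TM_BASE TM_FILL
    TM_FUEL_ce TM_FUEL_cf | (simp add: cns_def; fail))+)
lemma TM_LOAD: "TM 100 4 0 LOAD"
  unfolding LOAD_def by (rule TM_le, (rule TM_intros | (simp add: cns_def; fail))+)
lemma TM_DIST: "TM 1000 4 2 DIST"
  unfolding DIST_def by (rule TM_le, (rule TM_intros TM_ROWK TM_DIJ_FULL | (simp add: cns_def; fail))+)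
lemma TM_SEARCH: "TM 100 4 0 SEARCH"
  unfolding SEARCH_def by (rule TM_le, (rule TM_intros | (simp add: cns_def; fail))+)
lemma TM_VERIFY: "TM 100 4 0 VERIFY"
  unfolding VERIFY_def by (rule TM_le, (rule TM_intros | (simp add: cns_def; fail))+)

end

section \<open>Closures under nonnegative edges\<close>

definition closed_under :: "nat \<Rightarrow> (nat \<Rightarrow> nat \<Rightarrow> real) \<Rightarrow> (nat \<Rightarrow> real) \<Rightarrow> bool" where
  "closed_under N M c \<longleftrightarrow> (\<forall>x<N. \<forall>y<N. 0 \<le> M x y \<longrightarrow> c y \<le> c x + M x y)"

text \<open>The length of a shortest walk that starts at any node \<open>x\<close> at the price
  \<open>a x\<close> and follows nonnegative edges. It is described from below, as the greatest
  closed function that does not exceed \<open>a\<close>, because all its uses compare it with closed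
  functions.\<close>

definition Kc :: "nat \<Rightarrow> (nat \<Rightarrow> nat \<Rightarrow> real) \<Rightarrow> (nat \<Rightarrow> real) \<Rightarrow> nat \<Rightarrow> real" where
  "Kc N M a y = Sup {c y | c. closed_under N M c \<and> (\<forall>x<N. c x \<le> a x)}"

lemma Kc_greatest:
  assumes "closed_under N M c" "\<And>x. x < N \<Longrightarrow> c x \<le> a x" "y < N"
  shows "c y \<le> Kc N M a y"
  unfolding Kc_def
  by (rule cSup_upper) (use assms in \<open>auto intro!: bdd_aboveI[where M = "a y"]\<close>)

text \<open>A constant function is closed because only nonnegative edges count. Hence
  \<open>Kc\<close> is finite no matter which negative edges the matrix has.\<close>

lemma Kc_nonempty: "\<exists>c. closed_under N M c \<and> (\<forall>x<N. c x \<le> a x)"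
  by (rule exI[of _ "\<lambda>_. Min (a ` {..<N})"]) (auto simp: closed_under_def)

lemma Kc_least:
  assumes "\<And>c. closed_under N M c \<Longrightarrow> (\<forall>x<N. c x \<le> a x) \<Longrightarrow> c y \<le> b"
  shows "Kc N M a y \<le> b"
  unfolding Kc_def by (rule cSup_least) (use Kc_nonempty[of N M a] assms in auto)

lemma Kc_le: "y < N \<Longrightarrow> Kc N M a y \<le> a y"
  by (rule Kc_least) auto

lemma Kc_step: "x < N \<Longrightarrow> y < N \<Longrightarrow> 0 \<le> M x y \<Longrightarrow> Kc N M a y \<le> Kc N M a x + M x y"
  by (rule Kc_least) (smt (verit) Kc_greatest closed_under_def)

text \<open>The shortest walks that consist of an arbitrary edge, nonnegative edges and an arbitrary edge.\<close>

definition T :: "nat \<Rightarrow> (nat \<Rightarrow> nat \<Rightarrow> real) \<Rightarrow> nat \<Rightarrow> nat \<Rightarrow> real" where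
  "T N M x y = Min ((\<lambda>p. Kc N M (M x) p + M p y) ` {..<N})"

lemma T_le: "p < N \<Longrightarrow> T N M x y \<le> Kc N M (M x) p + M p y"
  unfolding T_def by (rule Min_le) auto

lemma T_ge: "0 < N \<Longrightarrow> (\<And>p. p < N \<Longrightarrow> c \<le> Kc N M (M x) p + M p y) \<Longrightarrow> c \<le> T N M x y"
  unfolding T_def by (subst Min_ge_iff) auto

lemma T_le_edge: "x < N \<Longrightarrow> y < N \<Longrightarrow> M x x = 0 \<Longrightarrow> T N M x y \<le> M x y"
  using T_le[of x N M x y] Kc_le[of x N M "M x"] by simp

lemma T_le_Kc: "p < N \<Longrightarrow> M p p = 0 \<Longrightarrow> T N M x p \<le> Kc N M (M x) p"
  using T_le[of p N M x p] by simp

text \<open>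
  What Dijkstra's algorithm started with the keys \<open>a\<close> guarantees for the final keys \<open>f\<close> and for
  the keys \<open>R\<close> that result from relaxing all edges once more. If \<open>full\<close> is false, then only
  negative keys are propagated.
\<close>

definition dij :: "nat \<Rightarrow> (nat \<Rightarrow> nat \<Rightarrow> real) \<Rightarrow> (nat \<Rightarrow> nat \<Rightarrow> real) \<Rightarrow> bool \<Rightarrow> (nat \<Rightarrow> real) \<Rightarrow>
    (nat \<Rightarrow> real) \<Rightarrow> (nat \<Rightarrow> real) \<Rightarrow> bool" where
  "dij N G X full a f R \<longleftrightarrow> (\<forall>y<N. f y \<le> a y) \<and> (\<forall>y<N. R y \<le> a y) \<and>
     (\<forall>p<N. \<forall>w<N. full \<or> f p < 0 \<and> f p + X p w < 0 \<longrightarrow>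
        R w \<le> f p + X p w \<and> (0 \<le> G p w \<longrightarrow> f w \<le> f p + X p w)) \<and>
     (\<forall>c. (\<forall>y<N. c y \<le> a y) \<and> (\<forall>x<N. \<forall>y<N. 0 \<le> G x y \<longrightarrow> c y \<le> c x + X x y) \<longrightarrow> (\<forall>y<N. c y \<le> f y)) \<and>
     (\<forall>y<N. R y = a y \<or> (\<exists>p<N. R y = f p + X p y))"

lemma dijD:
  assumes "dij N G X full a f R"
  shows "y < N \<Longrightarrow> f y \<le> a y" "y < N \<Longrightarrow> R y \<le> a y"
    "p < N \<Longrightarrow> w < N \<Longrightarrow> full \<or> f p < 0 \<and> f p + X p w < 0 \<Longrightarrow> R w \<le> f p + X p w"
    "p < N \<Longrightarrow> w < N \<Longrightarrow> full \<or> f p < 0 \<and> f p + X p w < 0 \<Longrightarrow> 0 \<le> G p w \<Longrightarrow> f w \<le> f p + X p w"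
    "(\<And>y. y < N \<Longrightarrow> c y \<le> a y) \<Longrightarrow> (\<And>x y. x < N \<Longrightarrow> y < N \<Longrightarrow> 0 \<le> G x y \<Longrightarrow> c y \<le> c x + X x y) \<Longrightarrow>
       y < N \<Longrightarrow> c y \<le> f y"
    "y < N \<Longrightarrow> R y = a y \<or> (\<exists>p<N. R y = f p + X p y)"
proof -
  note d = assms[unfolded dij_def]
  show "y < N \<Longrightarrow> f y \<le> a y" "y < N \<Longrightarrow> R y \<le> a y" using d by simp_all
  show "R w \<le> f p + X p w" if "p < N" "w < N" "full \<or> f p < 0 \<and> f p + X p w < 0"
    using conjunct1[OF conjunct2[OF conjunct2[OF d]]] that by blast
  show "f w \<le> f p + X p w" if "p < N" "w < N" "full \<or> f p < 0 \<and> f p + X p w < 0" "0 \<le> G p w"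
    using conjunct1[OF conjunct2[OF conjunct2[OF d]]] that by blast
  show "c y \<le> f y" if "\<And>y. y < N \<Longrightarrow> c y \<le> a y"
    "\<And>x y. x < N \<Longrightarrow> y < N \<Longrightarrow> 0 \<le> G x y \<Longrightarrow> c y \<le> c x + X x y" "y < N"
    using spec[OF conjunct1[OF conjunct2[OF conjunct2[OF conjunct2[OF d]]]], of c] that by simp
  show "y < N \<Longrightarrow> R y = a y \<or> (\<exists>p<N. R y = f p + X p y)" using d by simp
qed

text \<open>Feasibility for all edges, not only for the nonnegative ones, carries the bound from the
  keys across the last edge.\<close>

lemma dij_R_ge:
  assumes d: "dij N G X full a f R" and a: "\<And>y. y < N \<Longrightarrow> c y \<le> a y"
    and X: "\<And>x y. x < N \<Longrightarrow> y < N \<Longrightarrow> c y \<le> c x + X x y" and y: "y < N"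
  shows "c y \<le> R y"
proof -
  have f: "c p \<le> f p" if "p < N" for p
    by (rule dijD(5)[OF d]) (use a X that in auto)
  show ?thesis
  proof (cases "R y = a y")
    case True
    then show ?thesis using a[OF y] by simp
  next
    case False
    then obtain p where p: "p < N" "R y = f p + X p y" using dijD(6)[OF d y] by blast
    then show ?thesis using f[OF p(1)] X[OF p(1) y] by simp
  qed
qed

section \<open>Hubs\<close>

text \<open>\<open>H\<close> is the matrix reweighted by \<open>\<phi>\<close>, with entries
  possibly lowered by shortcuts. At a processed hub \<open>r\<close> the shortcuts are nonnegative
  and at most the reweighted \<open>T\<close>; so the walks measured by \<open>T\<close> are
  nonnegative from and to \<open>r\<close>. The clause on \<open>h\<close> keeps shortcuts from
  undercutting the sought distances, and the clause on \<open>M\<close> keeps Dijkstra's algorithm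
  applicable to the next hub.\<close>

definition hubinv :: "nat \<Rightarrow> (nat \<Rightarrow> nat \<Rightarrow> real) \<Rightarrow> (nat \<Rightarrow> real) \<Rightarrow> (nat \<Rightarrow> real) \<Rightarrow>
    (nat \<Rightarrow> nat \<Rightarrow> real) \<Rightarrow> nat set \<Rightarrow> bool" where
  "hubinv N M h \<phi> H D \<longleftrightarrow>
     (\<forall>x<N. \<forall>y<N. H x y \<le> M x y - \<phi> x + \<phi> y \<and> h y + \<phi> y \<le> h x + \<phi> x + H x y \<and>
        (0 \<le> M x y \<longrightarrow> 0 \<le> H x y)) \<and> (\<forall>x<N. H x x = 0) \<and>
     (\<forall>r\<in>D. r < N \<and> (\<forall>x<N. 0 \<le> H x r \<and> 0 \<le> H r x \<and> H x r + \<phi> x - \<phi> r \<le> T N M x r \<and>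
        H r x + \<phi> r - \<phi> x \<le> T N M r x))"

text \<open>As \<open>V\<close> is the distance to \<open>r\<close>, the edges to \<open>r\<close>
  become 0. An edge from \<open>r\<close> gets the weight \<open>R2 y + V y\<close> of a closed walk
  through \<open>r\<close>, which is nonnegative because \<open>h\<close> is a potential. The other
  nonnegative edges remain so since \<open>V\<close> is closed under them, which also preserves what
  earlier hubs have achieved.\<close>

lemma hub_step:
  assumes inv: "hubinv N M h \<phi> H D" and r: "r < N"
    and d1: "dij N (\<lambda>p w. H w p) (\<lambda>p w. H w p) True (\<lambda>x. H x r) f1 R1"
    and d2: "dij N (\<lambda>p w. H w p) (\<lambda>p w. H w p) True R1 V R3"
    and d3: "dij N H H True (H r) f2 R2"
    and H1: "\<And>x y. H1 x y = (if x = r then R2 y else if y = r then V x else H x y)"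
    and \<phi>': "\<And>x. x < N \<Longrightarrow> \<phi>' x = \<phi> x + V x"
    and H': "\<And>x y. x < N \<Longrightarrow> y < N \<Longrightarrow> H' x y = H1 x y - V x + V y"
  shows "hubinv N M h \<phi>' H' (insert r D)"
proof -
  have HM: "H x y \<le> M x y - \<phi> x + \<phi> y" and feas: "h y + \<phi> y \<le> h x + \<phi> x + H x y"
    and HF: "0 \<le> M x y \<Longrightarrow> 0 \<le> H x y" if "x < N" "y < N" for x y
    using inv that unfolding hubinv_def by auto
  have diag: "H x x = 0" if "x < N" for x using inv that unfolding hubinv_def by auto
  have N0: "0 < N" using r by simp
  have R1ge: "(h r + \<phi> r) - (h x + \<phi> x) \<le> R1 x" if "x < N" for x
  proof (rule dij_R_ge[OF d1 _ _ that, where c = "\<lambda>x. (h r + \<phi> r) - (h x + \<phi> x)"])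
    show "(h r + \<phi> r) - (h y + \<phi> y) \<le> H y r" if "y < N" for y using feas[OF that r] by simp
    show "(h r + \<phi> r) - (h y + \<phi> y) \<le> (h r + \<phi> r) - (h x + \<phi> x) + H y x" if "x < N" "y < N" for x y
      using feas[OF that(2,1)] by simp
  qed
  have Vge: "(h r + \<phi> r) - (h x + \<phi> x) \<le> V x" if "x < N" for x
  proof (rule dijD(5)[OF d2 _ _ that, where c = "\<lambda>x. (h r + \<phi> r) - (h x + \<phi> x)"])
    show "(h r + \<phi> r) - (h y + \<phi> y) \<le> R1 y" if "y < N" for y using R1ge[OF that] .
    show "(h r + \<phi> r) - (h y + \<phi> y) \<le> (h r + \<phi> r) - (h x + \<phi> x) + H y x" if "x < N" "y < N" for x y
      using feas[OF that(2,1)] by simp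
  qed
  have R2ge: "(h x + \<phi> x) - (h r + \<phi> r) \<le> R2 x" if "x < N" for x
  proof (rule dij_R_ge[OF d3 _ _ that, where c = "\<lambda>x. (h x + \<phi> x) - (h r + \<phi> r)"])
    show "(h y + \<phi> y) - (h r + \<phi> r) \<le> H r y" if "y < N" for y using feas[OF r that] by simp
    show "(h y + \<phi> y) - (h r + \<phi> r) \<le> (h x + \<phi> x) - (h r + \<phi> r) + H x y" if "x < N" "y < N" for x y
      using feas[OF that] by simp
  qed
  have VH: "V x \<le> H x r" if "x < N" for x
    using dijD(1)[OF d2 that] dijD(2)[OF d1 that] by simp
  have Vr: "V r = 0" using VH[OF r] Vge[OF r] diag[OF r] by simp
  have R2H: "R2 x \<le> H r x" if "x < N" for x using dijD(2)[OF d3 that] by simp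
  have R2r: "R2 r = 0" using R2H[OF r] R2ge[OF r] diag[OF r] by simp
  have VT: "V x + \<phi> x - \<phi> r \<le> T N M x r" if x: "x < N" for x
  proof (rule T_ge[OF N0])
    fix p assume p: "p < N"
    \<comment> \<open>\<open>c u\<close> is the price at \<open>u\<close> below which continuing
      with \<open>f1 u\<close> to the hub would beat \<open>V x\<close>, with the reweighting
      undone. It is closed because \<open>f1\<close> obeys the triangle inequality for nonnegative
      edges, so it is a lower bound for the closure in \<open>T\<close>.\<close>
    define c where "c = (\<lambda>u. V x - f1 u + \<phi> x - \<phi> u)"
    have "c p \<le> Kc N M (M x) p"
    proof (rule Kc_greatest[OF _ _ p])
      show "closed_under N M c"
        unfolding closed_under_def
      proof (intro allI impI)
        fix u v assume uv: "u < N" "v < N" "0 \<le> M u v"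
        have "f1 u \<le> f1 v + H u v" using dijD(4)[OF d1, of v u] HF uv by simp
        then show "c v \<le> c u + M u v" using HM[OF uv(1,2)] by (simp add: c_def)
      qed
    next
      fix u assume u: "u < N"
      have "V x \<le> R1 x" using dijD(1)[OF d2 x] .
      also have "\<dots> \<le> f1 u + H x u" using dijD(3)[OF d1, of u x] u x by simp
      finally show "c u \<le> M x u" using HM[OF x u] by (simp add: c_def)
    qed
    moreover have "f1 p \<le> H p r" using dijD(1)[OF d1 p] .
    ultimately show "V x + \<phi> x - \<phi> r \<le> Kc N M (M x) p + M p r"
      using HM[OF p r] by (simp add: c_def)
  qed
  have R2T: "R2 y + \<phi> r - \<phi> y \<le> T N M r y" if y: "y < N" for y
  proof (rule T_ge[OF N0])
    fix p assume p: "p < N"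
    define c where "c = (\<lambda>u. f2 u + \<phi> r - \<phi> u)"
    have "c p \<le> Kc N M (M r) p"
    proof (rule Kc_greatest[OF _ _ p])
      show "closed_under N M c"
        unfolding closed_under_def
      proof (intro allI impI)
        fix u v assume uv: "u < N" "v < N" "0 \<le> M u v"
        have "f2 v \<le> f2 u + H u v" using dijD(4)[OF d3, of u v] HF uv by simp
        then show "c v \<le> c u + M u v" using HM[OF uv(1,2)] by (simp add: c_def)
      qed
    next
      fix u assume u: "u < N"
      show "c u \<le> M r u" using HM[OF r u] dijD(1)[OF d3 u] by (simp add: c_def)
    qed
    moreover have "R2 y \<le> f2 p + H p y" using dijD(3)[OF d3, of p y] p y by simp
    ultimately show "R2 y + \<phi> r - \<phi> y \<le> Kc N M (M r) p + M p y"
      using HM[OF p y] by (simp add: c_def)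
  qed
  have pos: "0 \<le> H' x y" if "x < N" "y < N" "0 \<le> H x y \<or> x = r \<or> y = r" for x y
  proof (cases "x = r \<or> y = r")
    case True
    then show ?thesis using H'[OF that(1,2)] R2ge[OF that(2)] Vge[OF that(2)] Vr R2r by (auto simp: H1)
  next
    case False
    then have "V x \<le> V y + H x y" using dijD(4)[OF d2, of y x] that by simp
    then show ?thesis using H'[OF that(1,2)] False by (simp add: H1)
  qed
  show ?thesis
    unfolding hubinv_def
  proof (intro conjI allI impI ballI)
    fix x y assume xy: "x < N" "y < N"
    show "H' x y \<le> M x y - \<phi>' x + \<phi>' y"
      using HM[OF xy] VH[OF xy(1)] R2H[OF xy(2)] \<phi>'[OF xy(1)] \<phi>'[OF xy(2)] H'[OF xy] by (auto simp: H1)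
    show "h y + \<phi>' y \<le> h x + \<phi>' x + H' x y"
      using feas[OF xy] Vge[OF xy(1)] R2ge[OF xy(2)] \<phi>'[OF xy(1)] \<phi>'[OF xy(2)] H'[OF xy] by (auto simp: H1)
    show "0 \<le> H' x y" if "0 \<le> M x y" using pos xy HF that by simp
  next
    fix x assume "x < N"
    then show "H' x x = 0" using H' diag R2r by (simp add: H1)
  next
    fix r' assume r': "r' \<in> insert r D"
    then show r'N: "r' < N" using inv r unfolding hubinv_def by auto
    fix x assume x: "x < N"
    have old: "r' \<noteq> r \<Longrightarrow> 0 \<le> H x r' \<and> 0 \<le> H r' x \<and> H x r' + \<phi> x - \<phi> r' \<le> T N M x r' \<and> H r' x + \<phi> r' - \<phi> x \<le> T N M r' x"
      using inv r' x unfolding hubinv_def by auto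
    show "0 \<le> H' x r'" "0 \<le> H' r' x" using pos[OF x r'N] pos[OF r'N x] old by auto
    show "H' x r' + \<phi>' x - \<phi>' r' \<le> T N M x r'"
      using old VT[OF x] R2T[OF r'N] \<phi>'[OF x] \<phi>'[OF r'N] H'[OF x r'N] R2r Vr R2T[OF r]
      by (auto simp: H1)
    show "H' r' x + \<phi>' r' - \<phi>' x \<le> T N M r' x"
      using old VT[OF r'N] R2T[OF x] \<phi>'[OF x] \<phi>'[OF r'N] H'[OF r'N x] Vr by (auto simp: H1)
  qed
qed

text \<open>The nodes of rank at most \<open>m\<close> when all nodes are ordered by the length of
  the walk from \<open>x\<close> to \<open>y\<close> through them. Each of them is a good hub for
  the pair.\<close>

definition hit :: "nat \<Rightarrow> nat \<Rightarrow> (nat \<Rightarrow> nat \<Rightarrow> real) \<Rightarrow> nat \<Rightarrow> nat \<Rightarrow> nat set" where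
  "hit N m M x y = {r. r < N \<and> card {z. z < N \<and> T N M x z + T N M z y < T N M x r + T N M r y} \<le> m}"

text \<open>A bound on the betweenness of all pairs: the inequality says that the walk from
  \<open>x\<close> over \<open>z\<close> to \<open>y\<close> is negative after the reweighting by
  \<open>\<phi>\<close>, where the contribution of \<open>z\<close> cancels.\<close>

definition btw :: "nat \<Rightarrow> nat \<Rightarrow> (nat \<Rightarrow> nat \<Rightarrow> real) \<Rightarrow> (nat \<Rightarrow> real) \<Rightarrow> bool" where
  "btw N m M \<phi> \<longleftrightarrow> (\<forall>x<N. \<forall>y<N. card {z. z < N \<and> T N M x z + T N M z y < \<phi> x - \<phi> y} \<le> m)"

text \<open>After the reweighting, the walk through a hub \<open>r\<close> is nonnegative. So every
  node on a negative walk ranks strictly before \<open>r\<close>, and \<open>r\<close> has rank at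
  most \<open>m\<close>.\<close>

lemma hubs_btw:
  assumes inv: "hubinv N M h \<phi> H D" and hit: "\<And>x y. x < N \<Longrightarrow> y < N \<Longrightarrow> D \<inter> hit N m M x y \<noteq> {}"
  shows "btw N m M \<phi>"
  unfolding btw_def
proof (intro allI impI)
  fix x y assume xy: "x < N" "y < N"
  obtain r where r: "r \<in> D" "r \<in> hit N m M x y" using hit[OF xy] by auto
  have rN: "r < N" using r(2) by (simp add: hit_def)
  have "\<phi> x - \<phi> r \<le> T N M x r" "\<phi> r - \<phi> y \<le> T N M r y"
  proof -
    have "0 \<le> H x r \<and> H x r + \<phi> x - \<phi> r \<le> T N M x r" "0 \<le> H r y \<and> H r y + \<phi> r - \<phi> y \<le> T N M r y"
      using inv r(1) xy unfolding hubinv_def by blast+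
    then show "\<phi> x - \<phi> r \<le> T N M x r" "\<phi> r - \<phi> y \<le> T N M r y" by simp_all
  qed
  then have "card {z. z < N \<and> T N M x z + T N M z y < \<phi> x - \<phi> y} \<le>
      card {z. z < N \<and> T N M x z + T N M z y < T N M x r + T N M r y}"
    by (intro card_mono) auto
  also have "\<dots> \<le> m" using r(2) by (simp add: hit_def)
  finally show "card {z. z < N \<and> T N M x z + T N M z y < \<phi> x - \<phi> y} \<le> m" .
qed

text \<open>All elements strictly smaller than a minimal element outside of the set belong to the
  set. So if the set had at most \<open>m\<close> elements, that element would have rank at most
  \<open>m\<close> and belong to the set itself.\<close>

lemma card_low_rank:
  fixes \<tau> :: "nat \<Rightarrow> real"
  shows "min N (Suc m) \<le> card {r. r < N \<and> card {z. z < N \<and> \<tau> z < \<tau> r} \<le> m}"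
proof (rule ccontr)
  let ?G = "{r. r < N \<and> card {z. z < N \<and> \<tau> z < \<tau> r} \<le> m}"
  assume "\<not> ?thesis"
  then have small: "card ?G \<le> m" "card ?G < N" by auto
  have "{..<N} - ?G \<noteq> {}"
  proof
    assume "{..<N} - ?G = {}"
    then have "card {..<N} \<le> card ?G" by (intro card_mono) auto
    then show False using small by simp
  qed
  then obtain r where r: "r \<in> {..<N} - ?G" "\<And>u. u \<in> {..<N} - ?G \<Longrightarrow> \<tau> r \<le> \<tau> u"
    using arg_min_if_finite[of "{..<N} - ?G" \<tau>] by (metis (no_types, lifting) finite_Diff finite_lessThan linorder_not_le)
  have "{z. z < N \<and> \<tau> z < \<tau> r} \<subseteq> ?G" using r(2) by force
  then have "card {z. z < N \<and> \<tau> z < \<tau> r} \<le> card ?G" by (intro card_mono) auto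
  then show False using r(1) small by auto
qed

lemma card_hit: "min N (Suc m) \<le> card (hit N m M x y)"
  unfolding hit_def using card_low_rank[of N m "\<lambda>z. T N M x z + T N M z y"] by simp

section \<open>Halving the number of negative steps\<close>

inductive reach :: "nat \<Rightarrow> (nat \<Rightarrow> nat \<Rightarrow> bool) \<Rightarrow> (nat \<Rightarrow> nat \<Rightarrow> bool) \<Rightarrow> nat \<Rightarrow> nat \<Rightarrow> bool"
  for s E F where
  reach_start: "reach s E F 0 s"
| reach_step: "reach s E F k p \<Longrightarrow> E p q \<Longrightarrow> reach s E F (Suc k) q"
| reach_free: "reach s E F k p \<Longrightarrow> F p q \<Longrightarrow> reach s E F k q"

text \<open>For a feasible \<open>h\<close> this is an equality. As an inequality it passes on to
  every matrix with smaller entries.\<close>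

definition tight :: "nat \<Rightarrow> (nat \<Rightarrow> nat \<Rightarrow> real) \<Rightarrow> (nat \<Rightarrow> real) \<Rightarrow> nat \<Rightarrow> nat \<Rightarrow> bool" where
  "tight n A h p q \<longleftrightarrow> p < n \<and> q < n \<and> A p q \<le> h q - h p"

text \<open>
  A token covers a pair by a tight walk of two steps and of nonnegative weight. In the matrix of a
  round there is in addition such a walk over nonnegative edges, which Dijkstra's algorithm follows
  for free.
\<close>

definition tokA :: "nat \<Rightarrow> (nat \<Rightarrow> nat \<Rightarrow> real) \<Rightarrow> (nat \<Rightarrow> real) \<Rightarrow> nat \<Rightarrow> nat \<Rightarrow> bool" where
  "tokA n A h p q \<longleftrightarrow> p < n \<and> q < n \<and> h p \<le> h q \<and> (\<exists>w<n. A p w + A w q \<le> h q - h p)"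

definition tokM :: "nat \<Rightarrow> nat \<Rightarrow> (nat \<Rightarrow> nat \<Rightarrow> real) \<Rightarrow> (nat \<Rightarrow> nat \<Rightarrow> real) \<Rightarrow> (nat \<Rightarrow> real) \<Rightarrow> nat \<Rightarrow> nat \<Rightarrow> bool" where
  "tokM n N M W h p q \<longleftrightarrow> p < n \<and> q < n \<and> (\<exists>w<n. W p w + W w q \<le> h q - h p) \<and>
     (\<exists>g<N. 0 \<le> M p g \<and> 0 \<le> M g q \<and> W p g + W g q \<le> h q - h p)"

lemma reach_mono:
  assumes "reach s E F k y" "\<And>p q. E p q \<Longrightarrow> E' p q" "\<And>p q. F p q \<Longrightarrow> F' p q"
  shows "reach s E' F' k y"
  using assms(1) by induction (auto intro: reach.intros assms)

lemma reach_less: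
  assumes "reach s E F k y" "s < n" "\<And>p q. E p q \<Longrightarrow> q < n" "\<And>p q. F p q \<Longrightarrow> q < n"
  shows "y < n"
  using assms(1) by induction (auto intro: assms)

text \<open>Two consecutive tight edges from \<open>b\<close> over \<open>p\<close> to
  \<open>q\<close> cost at most one edge of \<open>A\<close>. The weight of a tight walk is the
  difference of \<open>h\<close> at its ends. If \<open>p\<close> and \<open>q\<close> both lie
  below \<open>b\<close>, then all prefixes are negative and the exploration from \<open>b\<close>
  finds \<open>q\<close>; otherwise some part of the walk has nonnegative weight and is a token,
  which is free.\<close>

lemma halving:
  assumes nN: "n \<le> N" and sn: "s < n"
    and feas: "\<And>x y. x < N \<Longrightarrow> y < N \<Longrightarrow> h y \<le> h x + W x y"
    and diag: "\<And>x. x < N \<Longrightarrow> W x x = 0"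
    and nonneg: "\<And>x y. x < N \<Longrightarrow> y < N \<Longrightarrow> 0 \<le> M x y \<Longrightarrow> 0 \<le> W x y"
    and dij: "\<And>b. b < n \<Longrightarrow> dij N M W False (W b) (f b) (R b)"
    and A: "\<And>b w. b < n \<Longrightarrow> w < n \<Longrightarrow> A b w = R b w"
    and reach: "reach s (tight n W h) (tokM n N M W h) k y"
  shows "reach s (tight n A h) (tokA n A h) ((k + 1) div 2) y"
proof -
  let ?R = "reach s (tight n A h) (tokA n A h)"
  \<comment> \<open>The exploration from \<open>b\<close> has reached \<open>y\<close> with a
    negative prefix of optimal weight, but no edge of \<open>A\<close> has been counted for it
    yet.\<close>
  define pend where "pend = (\<lambda>b y. b < n \<and> y < n \<and> f b y \<le> h y - h b \<and> h y < h b)"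
  have AW: "A b w \<le> W b w" if "b < n" "w < n" for b w
    using dijD(2)[OF dij[OF that(1)], of w] A[OF that] that nN by simp
  have feas': "h y \<le> h x + W x y" if "x < n" "y < n" for x y using feas nN that by simp
  have tok_edge: "tokA n A h p q" if "p < n" "q < n" "W p q \<le> h q - h p" "h p \<le> h q" for p q
    unfolding tokA_def using that AW[of p p] AW[of p q] diag[of p] nN by (auto intro!: exI[of _ p])
  have pend_edge: "pend p q" if "p < n" "q < n" "W p q \<le> h q - h p" "h q < h p" for p q
    unfolding pend_def using that dijD(1)[OF dij[OF that(1)], of q] nN by auto
  have pend_A: "A b y \<le> h y - h b" if "pend b y" for b y
  proof -
    have b: "b < n" "y < n" "f b y \<le> h y - h b" "h y < h b" using that by (auto simp: pend_def)
    then have "R b y \<le> f b y + W y y"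
      using dijD(3)[OF dij[OF b(1)], of y y] nN diag[of y] by simp
    then show ?thesis using b nN diag[of y] A[OF b(1,2)] by simp
  qed
  have tight_self: "tight n A h p p" if "p < n" for p
    unfolding tight_def using that AW[of p p] diag[of p] nN by auto
  have suc: "?R (Suc j) y" if "?R j y" for j y
  proof -
    have "y < n" by (rule reach_less[OF that sn]) (auto simp: tight_def tokA_def)
    then show ?thesis using reach_step[OF that tight_self] by blast
  qed
  have relax: "A b w \<le> h w - h b" if "pend b p" "w < n" "W p w \<le> h w - h p" "h w < h b" for b p w
  proof -
    have b: "b < n" "p < n" and fp: "f b p \<le> h p - h b" "h p < h b" using that(1) by (auto simp: pend_def)
    have "R b w \<le> f b p + W p w"
      by (rule dijD(3)[OF dij[OF b(1)]]) (use that b fp nN in auto)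
    then show ?thesis using A[OF b(1) that(2)] fp that(3) by simp
  qed
  \<comment> \<open>The invariant of the pairing: after an odd number of edges, one edge is not yet
    accounted for. Either it was free, or it belongs to a pending exploration.\<close>
  have "if even k then ?R (k div 2) y else ?R (k div 2) y \<or> (\<exists>b. ?R (k div 2) b \<and> pend b y)"
    using reach
  proof induction
    case reach_start
    then show ?case by (simp add: reach.reach_start)
  next
    case (reach_step k p q)
    have pq: "p < n" "q < n" "W p q \<le> h q - h p" using reach_step.hyps(2) by (auto simp: tight_def)
    show ?case
    proof (cases "even k")
      case True
      then have k: "\<not> even (Suc k)" "Suc k div 2 = k div 2" and r: "?R (k div 2) p" using reach_step.IH by auto
      show ?thesis
      proof (cases "h p \<le> h q")
        case True
        then show ?thesis using reach_free[OF r tok_edge] pq k by simp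
      next
        case False
        then show ?thesis using r pend_edge pq k by auto
      qed
    next
      case False
      then have k: "even (Suc k)" "Suc k div 2 = Suc (k div 2)" by auto
      consider "?R (k div 2) p" | b where "?R (k div 2) b" "pend b p" using reach_step.IH False by auto
      then have "?R (Suc (k div 2)) q"
      proof cases
        case 1
        then show ?thesis using pq AW[of p q] by (intro reach.reach_step[OF 1]) (auto simp: tight_def)
      next
        case 2
        have b: "b < n" using 2 by (simp add: pend_def)
        show ?thesis
        proof (cases "h q < h b")
          case True
          have "tight n A h b q" using relax[OF 2(2) pq(2,3) True] b pq by (simp add: tight_def)
          then show ?thesis by (rule reach.reach_step[OF 2(1)])
        next
          \<comment> \<open>\<open>q\<close> is not below \<open>b\<close>, so the walk over
            \<open>p\<close> is nonnegative as a whole. It is a token, and the counted edge is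
            filled up by a step that stays at \<open>q\<close>.\<close>
          case False
          have "tokA n A h b q"
            unfolding tokA_def using b pq False pend_A[OF 2(2)] AW[of p q] by (auto intro!: exI[of _ p])
          then show ?thesis using reach_free[OF 2(1)] suc by blast
        qed
      qed
      then show ?thesis using k by simp
    qed
  next
    case (reach_free k p q)
    obtain w g where pq: "p < n" "q < n" and w: "w < n" "W p w + W w q \<le> h q - h p"
      and g: "g < N" "0 \<le> M p g" "0 \<le> M g q" "W p g + W g q \<le> h q - h p"
      using reach_free.hyps(2) by (auto simp: tokM_def)
    have gp: "0 \<le> W p g" "0 \<le> W g q" using nonneg g pq nN by auto
    have hpq: "h p \<le> h q" using g(4) gp by simp
    have tw: "W p w \<le> h w - h p" "W w q \<le> h q - h w"
      using w feas'[of p w] feas'[of w q] pq by auto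
    have tg: "W p g \<le> h g - h p" "W g q \<le> h q - h g"
      using g feas[of p g] feas[of g q] pq nN by auto
    have tokpq: "tokA n A h p q"
      unfolding tokA_def using pq w hpq AW[of p w] AW[of w q] by (auto intro!: exI[of _ w])
    show ?case
    proof (cases "?R (k div 2) p")
      case True
      then show ?thesis using reach.reach_free[OF True tokpq] by simp
    next
      case False
      then obtain b where k: "odd k" and b: "?R (k div 2) b" "pend b p"
        using reach_free.IH by (auto split: if_splits)
      have bn: "b < n" and fp: "f b p \<le> h p - h b" "h p < h b" using b(2) by (auto simp: pend_def)
      have "?R (k div 2) q \<or> (\<exists>b. ?R (k div 2) b \<and> pend b q)"
      proof (cases "h q < h b")
        \<comment> \<open>The potentials at \<open>p\<close>, \<open>g\<close> and \<open>q\<close>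
          do not decrease. So \<open>h q < h b\<close> makes all prefixes negative, and the
          exploration relaxes both edges of the token.\<close>
        case True
        have fg: "f b g \<le> f b p + W p g"
          by (rule dijD(4)[OF dij[OF bn]]) (use pq nN g gp fp True tg in auto)
        have "f b q \<le> f b g + W g q"
          by (rule dijD(4)[OF dij[OF bn]]) (use pq nN g gp fp fg True tg in auto)
        then have "pend b q" unfolding pend_def using fg tg fp bn pq True by auto
        then show ?thesis using b(1) by blast
      next
        \<comment> \<open>The exploration cannot follow the token over \<open>g\<close> to
          \<open>q\<close>, where the prefix is no longer negative. So the walk over
          \<open>w\<close> is used. If \<open>w\<close> lies below \<open>b\<close>, the exploration
          finds the edge to \<open>w\<close>, and with the edge to \<open>q\<close> it forms a token
          from \<open>b\<close>. Otherwise \<open>b\<close> to \<open>w\<close> over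
          \<open>p\<close> is a token, and the edge from \<open>w\<close> to \<open>q\<close> is
          either free or starts a new exploration at \<open>w\<close>.\<close>
        case False
        show ?thesis
        proof (cases "h w < h b")
          case True
          have "tokA n A h b q"
            unfolding tokA_def
            using bn pq False w(1) relax[OF b(2) w(1) tw(1) True] AW[of w q] tw(2) by (auto intro!: exI[of _ w])
          then show ?thesis using reach.reach_free[OF b(1)] by blast
        next
          case w': False
          have "tokA n A h b w"
            unfolding tokA_def using bn pq w' w(1) pend_A[OF b(2)] AW[of p w] tw(1) by (auto intro!: exI[of _ p])
          then have rw: "?R (k div 2) w" using reach.reach_free[OF b(1)] by blast
          show ?thesis
          proof (cases "h w \<le> h q")
            case True
            then show ?thesis using reach.reach_free[OF rw tok_edge] w tw pq by blast
          next
            case False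
            then show ?thesis using rw pend_edge[of w q] w tw pq by auto
          qed
        qed
      qed
      then show ?thesis using k by simp
    qed
  qed
  then show ?thesis
  proof (cases "even k")
    case True
    then show ?thesis using \<open>if even k then _ else _\<close> by simp
  next
    case False
    then have k: "(k + 1) div 2 = Suc (k div 2)" by simp
    consider "?R (k div 2) y" | b where "?R (k div 2) b" "pend b y" using \<open>if even k then _ else _\<close> False by auto
    then show ?thesis
    proof cases
      case 2
      have "tight n A h b y" using pend_A[OF 2(2)] 2(2) by (auto simp: tight_def pend_def)
      then show ?thesis using reach_step[OF 2(1)] k by simp
    qed (use suc k in simp)
  qed
qed

text \<open>The first run settles the vertices that tokens alone reach, since a token is a walk over
  nonnegative edges in \<open>M\<close>. Its \<open>R\<close> takes the single counted edge, and the
  second run follows the tokens behind it.\<close>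

lemma one_step_dist:
  assumes nN: "n \<le> N" and sn: "s < n"
    and feas: "\<And>x y. x < N \<Longrightarrow> y < N \<Longrightarrow> h y \<le> h x + M x y"
    and diag: "\<And>x. x < N \<Longrightarrow> M x x = 0"
    and d1: "dij N M M True (M s) f R" and d2: "dij N M M True R K R'"
    and reach: "reach s (tight n M h) (tokM n N M M h) k y" and k: "k \<le> 1" and y: "y < n"
  shows "K y = h y - h s"
proof -
  have Rge: "h x - h s \<le> R x" if "x < N" for x
  proof (rule dij_R_ge[OF d1 _ _ that, where c = "\<lambda>x. h x - h s"])
    show "h y - h s \<le> M s y" if "y < N" for y using feas[of s y] that sn nN by simp
    show "h y - h s \<le> h x - h s + M x y" if "x < N" "y < N" for x y using feas[OF that] by simp
  qed
  have Kge: "h x - h s \<le> K x" if "x < N" for x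
  proof (rule dijD(5)[OF d2 _ _ that, where c = "\<lambda>x. h x - h s"])
    show "h y - h s \<le> R y" if "y < N" for y using Rge[OF that] .
    show "h y - h s \<le> h x - h s + M x y" if "x < N" "y < N" for x y using feas[OF that] by simp
  qed
  have step: "F q \<le> F p + (h q - h p)" if d: "dij N M M True a F b" and t: "tokM n N M M h p q" for F a b p q
  proof -
    obtain g where g: "p < n" "q < n" "g < N" "0 \<le> M p g" "0 \<le> M g q" "M p g + M g q \<le> h q - h p"
      using t by (auto simp: tokM_def)
    have "F g \<le> F p + M p g" "F q \<le> F g + M g q"
      using dijD(4)[OF d, of p g] dijD(4)[OF d, of g q] g nN by auto
    then show ?thesis using g by simp
  qed
  have "(k = 0 \<longrightarrow> f y \<le> h y - h s) \<and> (k \<le> 1 \<longrightarrow> K y \<le> h y - h s)"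
    using reach
  proof induction
    case reach_start
    have "f s \<le> 0" using dijD(1)[OF d1, of s] diag[of s] sn nN by simp
    moreover have "K s \<le> R s" "R s \<le> f s + M s s" using dijD(1)[OF d2, of s] dijD(3)[OF d1, of s s] sn nN by auto
    ultimately show ?case using diag[of s] sn nN by simp
  next
    case (reach_step k p q)
    then have "p < N" "q < N" "M p q \<le> h q - h p" using nN by (auto simp: tight_def)
    then show ?case using dijD(1)[OF d2, of q] dijD(3)[OF d1, of p q] reach_step.IH by auto
  next
    case (reach_free k p q)
    then show ?case using step[OF d1, of p q] step[OF d2, of p q] by auto
  qed
  then show ?thesis using Kge[of y] k y nN by simp
qed

section \<open>The priority queue\<close>

text \<open>With deleted elements at infinity this is a strict weak order; \<open>bt_split\<close>
  is its negative transitivity.\<close>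

definition bt :: "(nat \<Rightarrow> real) \<Rightarrow> (nat \<Rightarrow> nat) \<Rightarrow> nat \<Rightarrow> nat \<Rightarrow> bool" where
  "bt K d a b \<longleftrightarrow> d a = 0 \<and> (d b = 0 \<longrightarrow> K a < K b)"

lemma bt_trans: "bt K d a b \<Longrightarrow> bt K d b c \<Longrightarrow> bt K d a c"
  by (auto simp: bt_def)
lemma bt_split: "bt K d a c \<Longrightarrow> bt K d a b \<or> bt K d b c"
  by (auto simp: bt_def)
lemma bt_irrefl: "\<not> bt K d a a"
  by (auto simp: bt_def)

lemma bval_BETTER [simp]:
  "bval M \<sigma> (BETTER a b) = bt (rarr \<sigma> ''K'') (warr \<sigma> ''d'') (wvar \<sigma> a) (wvar \<sigma> b)"
  by (auto simp: BETTER_def bt_def)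

context sizes
begin

lemma MM1: "Suc 0 < MM"
proof -
  have "1 * 1 \<le> N * N" using N1 by (intro mult_mono) auto
  then show ?thesis using NN_less unfolding N_def nb_def by linarith
qed

lemma one_mod [simp]: "Suc 0 mod MM = Suc 0" "1 mod MM = 1"
  using MM1 by auto

lemma MM_ne [simp]: "MM \<noteq> Suc 0" "MM \<noteq> 0"
  using MM1 by auto

lemma pair_less: "x < N \<Longrightarrow> y < N \<Longrightarrow> x * N + y < N * N"
proof -
  assume "x < N" "y < N"
  then have "x * N + y < Suc x * N" by simp
  also have "\<dots> \<le> N * N" using \<open>x < N\<close> by (intro mult_le_mono1) simp
  finally show ?thesis .
qed

lemma pair_less_MM: "x < N \<Longrightarrow> y < N \<Longrightarrow> x * N + y < MM"
  using pair_less NN_less by (fastforce simp: N_def nb_def)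

lemma wval_ix [simp]:
  assumes "wvar \<sigma> ''N'' = N" "wvar \<sigma> a < N" "wvar \<sigma> b < N"
  shows "wval MM \<sigma> (ix a b) = wvar \<sigma> a * N + wvar \<sigma> b"
  using pair_less_MM[OF assms(2,3)] assms by (simp add: ix_def)

lemma pair_inj: "y < N \<Longrightarrow> y' < N \<Longrightarrow> x * N + y = x' * N + y' \<longleftrightarrow> x = x' \<and> y = y'"
  for x y x' y' :: nat
  by (metis N1 add.commute div_mult_self1 div_less mod_less mod_mult_self1 not_one_le_zero add.right_neutral add_0)

text \<open>An exhausted block satisfies this with any of its deleted elements as leader, so no
  special case for it arises.\<close>

definition okj :: "(nat \<Rightarrow> real) \<Rightarrow> (nat \<Rightarrow> nat) \<Rightarrow> nat \<Rightarrow> nat \<Rightarrow> bool" where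
  "okj K d j e \<longleftrightarrow> j * q \<le> e \<and> e < j * q + q \<and> (\<forall>i. j * q \<le> i \<and> i < j * q + q \<longrightarrow> \<not> bt K d i e)"

definition qok :: "(nat \<Rightarrow> real) \<Rightarrow> (nat \<Rightarrow> nat) \<Rightarrow> (nat \<Rightarrow> nat) \<Rightarrow> bool" where
  "qok K d b \<longleftrightarrow> (\<forall>j<nb. okj K d j (b j))"

lemma block_less: "j < nb \<Longrightarrow> e < j * q + q \<Longrightarrow> e < N"
proof -
  assume "j < nb" "e < j * q + q"
  moreover have "Suc j * q \<le> nb * q" using \<open>j < nb\<close> by (intro mult_le_mono1) simp
  ultimately show ?thesis by (simp add: N_def mult.commute)
qed

lemma block_of: "w < N \<Longrightarrow> w div q < nb" "(w div q) * q \<le> w" "w < (w div q) * q + q"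
  using q1 by (simp_all add: N_def less_mult_imp_div_less mult.commute) 
     (metis add.commute dividend_less_div_times less_eq_Suc_le One_nat_def mult.commute)

lemma block_unique: "i * q \<le> w \<Longrightarrow> w < i * q + q \<Longrightarrow> w div q = i"
  by (metis add.commute div_nat_eqI mult.commute mult_Suc)

lemma wlp_BLK:
  assumes ok: "ok \<sigma>" and j: "wvar \<sigma> ''j'' = j" "j < nb"
  shows "wlp MM BLK (\<lambda>\<sigma>'. okj (rarr \<sigma> ''K'') (warr \<sigma> ''d'') j (warr \<sigma>' ''b'' j) \<and>
    (\<forall>i. i \<noteq> j \<longrightarrow> warr \<sigma>' ''b'' i = warr \<sigma> ''b'' i)) \<sigma>"
proof -
  let ?K = "rarr \<sigma> ''K''" and ?d = "warr \<sigma> ''d''"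
  have q: "wvar \<sigma> ''q'' = q" using ok by (simp add: ok_def)
  have "j * q < MM" using block_less[OF j(2), of "j * q"] q1 N_less by simp
  then have o: "j * q mod MM = j * q" by simp
  have e: "(j * q + k) mod MM = j * q + k" if "k < q" for k
    using block_less[OF j(2), of "j * q + k"] that N_less by simp
  show ?thesis
    unfolding BLK_def
    apply (simp add: q j o)
    apply (rule wlp_FOR[where I = "\<lambda>k \<tau>. j * q \<le> wvar \<tau> ''o'' \<and> wvar \<tau> ''o'' < j * q + q \<and>
        (\<forall>i. j * q \<le> i \<and> i < j * q + k \<longrightarrow> \<not> bt ?K ?d i (wvar \<tau> ''o''))"])
    subgoal using q_less q by simp
    subgoal by simp
    subgoal by simp
    subgoal by simp
    subgoal using q1 by auto
    subgoal premises p for k \<tau>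
    proof -
      have w: "wvar \<tau> ''j'' = j" "wvar \<tau> ''q'' = q" "warr \<tau> ''d'' = ?d" "rarr \<tau> ''K'' = ?K"
        using p(3) q j by (auto simp: fr_def)
      have k: "k < q" using p(1) q by simp
      have ub: "\<not> bt ?K ?d i (j * q + k)" if "bt ?K ?d (j * q + k) (wvar \<tau> ''o'')" "j * q \<le> i" "i < j * q + Suc k" for i
        using p(2) that bt_trans[of ?K ?d i "j * q + k" "wvar \<tau> ''o''"] bt_irrefl[of ?K ?d i]
        by (cases "i = j * q + k") auto
      have lb: "\<not> bt ?K ?d i (wvar \<tau> ''o'')" if "\<not> bt ?K ?d (j * q + k) (wvar \<tau> ''o'')" "j * q \<le> i" "i < j * q + Suc k" for i
        using p(2) that by (cases "i = j * q + k") auto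
      show ?thesis using w p(2,4) k ub lb by (auto simp: o e)
    qed
    subgoal for \<tau> using j q by (auto simp: okj_def fr_def)
    done
qed

text \<open>An element that beats the best leader would, by \<open>bt_split\<close>, beat the leader
  of its own block or else show that this leader beats the best one. After the deletion all other
  blocks are intact, as the deleted element is not in them.\<close>

lemma wlp_EXTRACT:
  assumes ok: "ok \<sigma>" and qok: "qok (rarr \<sigma> ''K'') (warr \<sigma> ''d'') (warr \<sigma> ''b'')"
    and alive: "a < N" "warr \<sigma> ''d'' a = 0"
  shows "wlp MM EXTRACT (\<lambda>\<sigma>'. \<exists>p<N. wvar \<sigma>' ''p'' = p \<and> warr \<sigma> ''d'' p = 0 \<and>
    (\<forall>w<N. warr \<sigma> ''d'' w = 0 \<longrightarrow> rarr \<sigma> ''K'' p \<le> rarr \<sigma> ''K'' w) \<and>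
    warr \<sigma>' ''d'' = (warr \<sigma> ''d'')(p := 1) \<and> qok (rarr \<sigma> ''K'') ((warr \<sigma> ''d'')(p := 1)) (warr \<sigma>' ''b'')) \<sigma>"
proof -
  let ?K = "rarr \<sigma> ''K''" and ?d = "warr \<sigma> ''d''" and ?b = "warr \<sigma> ''b''"
  have c: "wvar \<sigma> ''q'' = q" "wvar \<sigma> ''B'' = nb" using ok by (simp_all add: ok_def)
  have nb0: "0 < nb" using q1 l2 by (simp add: nb_def)
  have bN: "?b j < N" if "j < nb" for j
    using qok that block_less unfolding qok_def okj_def by blast
  have best: "\<not> bt ?K ?d w p" if w: "w < N" and p: "\<And>j. j < nb \<Longrightarrow> \<not> bt ?K ?d (?b j) p" for w p
  proof
    assume "bt ?K ?d w p"
    moreover have "\<not> bt ?K ?d w (?b (w div q))"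
      using qok block_of[of w] w unfolding qok_def okj_def by blast
    ultimately have "bt ?K ?d (?b (w div q)) p" using bt_split by blast
    then show False using p block_of(1)[OF w] by blast
  qed
  show ?thesis
    unfolding EXTRACT_def
    apply (simp add: c)
    apply (rule wlp_FOR[where I = "\<lambda>k \<tau>. (\<exists>j<nb. wvar \<tau> ''p'' = ?b j) \<and>
        (\<forall>j<k. \<not> bt ?K ?d (?b j) (wvar \<tau> ''p''))"])
    subgoal using nb_less c by simp
    subgoal by simp
    subgoal by simp
    subgoal by simp
    subgoal using nb0 by auto
    subgoal premises p for k \<tau>
    proof -
      have w: "warr \<tau> ''b'' = ?b" "warr \<tau> ''d'' = ?d" "rarr \<tau> ''K'' = ?K"
        using p(3) by (auto simp: fr_def)
      have k: "k < nb" using p(1) c by simp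
      have ub: "\<not> bt ?K ?d (?b i) (?b k)" if "bt ?K ?d (?b k) (wvar \<tau> ''p'')" "i < Suc k" for i
        using p(2) that bt_trans[of ?K ?d "?b i" "?b k" "wvar \<tau> ''p''"] bt_irrefl[of ?K ?d "?b i"]
        by (cases "i = k") auto
      have lb: "\<not> bt ?K ?d (?b i) (wvar \<tau> ''p'')" if "\<not> bt ?K ?d (?b k) (wvar \<tau> ''p'')" "i < Suc k" for i
        using p(2) that by (cases "i = k") auto
      show ?thesis using w p(2,4) k ub lb by auto
    qed
    subgoal premises p for \<tau>
    proof -
      have w: "warr \<tau> ''b'' = ?b" "warr \<tau> ''d'' = ?d" "rarr \<tau> ''K'' = ?K" "wvar \<tau> ''q'' = q"
        using p(2) c by (auto simp: fr_def)
      obtain j where j: "j < nb" "wvar \<tau> ''p'' = ?b j" using p(1) by blast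
      define e where "e = ?b j"
      have e: "e < N" using bN j e_def by simp
      have nbt: "\<not> bt ?K ?d w e" if "w < N" for w
        using best[OF that] p(1) c j(2) by (auto simp: e_def)
      have d0: "?d e = 0" using nbt[OF alive(1)] alive(2) by (auto simp: bt_def)
      have min: "\<forall>w<N. ?d w = 0 \<longrightarrow> ?K e \<le> ?K w"
      proof (intro allI impI)
        fix w assume "w < N" "?d w = 0"
        then show "?K e \<le> ?K w" using nbt[of w] d0 by (simp add: bt_def)
      qed
      let ?\<tau> = "\<tau>\<lparr>warr := (warr \<tau>)(''d'' := ?d(e := Suc 0)), wvar := (wvar \<tau>)(''j'' := e div q)\<rparr>"
      have ok': "ok ?\<tau>"
        by (rule ok_fr[OF _ ok, of EXTRACT]) (use p(2) in \<open>auto simp: fr_def cns_def\<close>)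
      have b: "wlp MM BLK (\<lambda>\<sigma>'. okj ?K (?d(e := Suc 0)) (e div q) (warr \<sigma>' ''b'' (e div q)) \<and>
        (\<forall>i. i \<noteq> e div q \<longrightarrow> warr \<sigma>' ''b'' i = ?b i)) ?\<tau>"
        using wlp_BLK[OF ok', of "e div q"] block_of(1)[OF e] w by simp
      have "wlp MM BLK (\<lambda>\<sigma>'. \<exists>p<N. wvar \<sigma>' ''p'' = p \<and> ?d p = 0 \<and> (\<forall>w<N. ?d w = 0 \<longrightarrow> ?K p \<le> ?K w) \<and>
         warr \<sigma>' ''d'' = ?d(p := Suc 0) \<and> qok ?K (?d(p := Suc 0)) (warr \<sigma>' ''b'')) ?\<tau>"
      proof (rule wlp_conseq[OF b], intro exI[of _ e] conjI)
        fix \<sigma>' assume s: "okj ?K (?d(e := Suc 0)) (e div q) (warr \<sigma>' ''b'' (e div q)) \<and>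
           (\<forall>i. i \<noteq> e div q \<longrightarrow> warr \<sigma>' ''b'' i = ?b i)" and f: "fr BLK ?\<tau> \<sigma>'"
        show "wvar \<sigma>' ''p'' = e" "warr \<sigma>' ''d'' = ?d(e := Suc 0)" using f j w by (auto simp: fr_def e_def)
        show "qok ?K (?d(e := Suc 0)) (warr \<sigma>' ''b'')"
          unfolding qok_def
        proof (intro allI impI)
          fix i assume i: "i < nb"
          show "okj ?K (?d(e := Suc 0)) i (warr \<sigma>' ''b'' i)"
          proof (cases "i = e div q")
            case False
            have ne: "e \<noteq> x" if "i * q \<le> x" "x < i * q + q" for x using block_unique[OF that] False by auto
            have "okj ?K ?d i (?b i)" using qok i by (simp add: qok_def)
            then have "okj ?K (?d(e := Suc 0)) i (?b i)"
              using ne unfolding okj_def bt_def by (metis fun_upd_apply)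
            then show ?thesis using s False by simp
          qed (use s in simp)
        qed
      qed (use e d0 min in auto)
      then show ?thesis using w j by (simp add: e_def)
    qed
    done
qed

lemma wlp_INITQ:
  assumes ok: "ok \<sigma>" and X: "wvar \<sigma> X = m'" "X \<notin> {''x'', ''j'', ''y'', ''e'', ''o''}"
  shows "wlp MM (INITQ X) (\<lambda>\<sigma>'. (\<forall>x<N. warr \<sigma>' ''d'' x = (if x < m' then 0 else 1)) \<and>
     qok (rarr \<sigma>' ''K'') (warr \<sigma>' ''d'') (warr \<sigma>' ''b'')) \<sigma>"
proof -
  have c: "wvar \<sigma> ''N'' = N" "wvar \<sigma> ''B'' = nb" using ok by (simp_all add: ok_def)
  show ?thesis
    unfolding INITQ_def wlp_Seq
    apply (rule wlp_FOR[where I = "\<lambda>k \<tau>. \<forall>x<k. warr \<tau> ''d'' x = (if x < m' then 0 else 1)"])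
    subgoal using N_less c by simp
    subgoal by simp
    subgoal by simp
    subgoal by simp
    subgoal by simp
    subgoal for k \<tau> using X by (auto simp: fr_def less_Suc_eq)
    subgoal premises p for \<tau>
      apply (rule wlp_FOR[where I = "\<lambda>k \<tau>'. warr \<tau>' ''d'' = warr \<tau> ''d'' \<and>
         (\<forall>j<k. okj (rarr \<tau> ''K'') (warr \<tau> ''d'') j (warr \<tau>' ''b'' j))"])
      subgoal using p(2) c nb_less by (simp add: fr_def)
      subgoal by simp
      subgoal by simp
      subgoal by simp
      subgoal by simp
      subgoal premises r for k \<tau>'
      proof -
        have ok': "ok \<tau>'"
          by (rule ok_fr[OF _ ok, of "INITQ X"]) (use p(2) r(3) in \<open>auto simp: fr_def cns_def\<close>)
        have k: "k < nb" using r(1) p(2) c by (simp add: fr_def)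
        have K: "rarr \<tau>' ''K'' = rarr \<tau> ''K''" using r(3) by (simp add: fr_def)
        show ?thesis
          by (rule wlp_conseq[OF wlp_BLK[OF ok' r(4) k]]) (use r(2) K in \<open>auto simp: fr_def less_Suc_eq\<close>)
      qed
      subgoal for \<tau>' using p c by (auto simp: fr_def qok_def)
      done
    done
qed

text \<open>Only \<open>w\<close> can have improved, so comparing it with the leader of its block is
  enough: an element that beats the new leader would have beaten the old one before.\<close>

lemma wlp_DECR:
  assumes ok: "ok \<sigma>" and w: "wvar \<sigma> ''w'' = w" "w < N"
    and qok: "qok K (warr \<sigma> ''d'') (warr \<sigma> ''b'')" and x: "x < K w" "rarr \<sigma> ''K'' = K(w := x)"
  shows "wlp MM DECR (\<lambda>\<sigma>'. qok (K(w := x)) (warr \<sigma> ''d'') (warr \<sigma>' ''b'')) \<sigma>"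
proof -
  let ?d = "warr \<sigma> ''d''" and ?b = "warr \<sigma> ''b''" and ?K = "K(w := x)"
  define j where "j = w div q"
  have c: "wvar \<sigma> ''q'' = q" using ok by (simp_all add: ok_def)
  have other: "okj ?K ?d i (?b i)" if "i < nb" "i \<noteq> j" for i
  proof -
    have ne: "w \<noteq> e" if "i * q \<le> e" "e < i * q + q" for e
      using block_unique[OF that] \<open>i \<noteq> j\<close> by (auto simp: j_def)
    have "okj K ?d i (?b i)" using qok that by (simp add: qok_def)
    then show ?thesis using ne unfolding okj_def bt_def by (metis fun_upd_apply)
  qed
  have old: "okj K ?d j (?b j)" using qok block_of(1)[OF w(2)] by (simp add: qok_def j_def)
  have wj: "j * q \<le> w" "w < j * q + q" using block_of(2,3)[of w] by (auto simp: j_def)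
  have new: "okj ?K ?d j w" if "bt ?K ?d w (?b j)"
    unfolding okj_def
  proof (intro conjI allI impI wj notI)
    fix e assume e: "j * q \<le> e \<and> e < j * q + q" "bt ?K ?d e w"
    have "e \<noteq> w" using e(2) bt_irrefl by blast
    have b: "bt ?K ?d e (?b j)" using bt_trans[OF e(2) that] .
    have "?b j \<noteq> w" using that bt_irrefl by metis
    then have "bt K ?d e (?b j)" using b \<open>e \<noteq> w\<close> by (simp add: bt_def)
    then show False using old e by (simp add: okj_def)
  qed
  have same: "okj ?K ?d j (?b j)" if "\<not> bt ?K ?d w (?b j)"
    unfolding okj_def
  proof (intro conjI allI impI notI)
    show "j * q \<le> ?b j" "?b j < j * q + q" using old by (auto simp: okj_def)
    fix e assume e: "j * q \<le> e \<and> e < j * q + q" "bt ?K ?d e (?b j)"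
    then have "e \<noteq> w" using that by blast
    then have "bt K ?d e (?b j)" using e(2) x(1) by (auto simp: bt_def split: if_splits)
    then show False using old e by (simp add: okj_def)
  qed
  have all: "qok ?K ?d b'" if "okj ?K ?d j (b' j)" "\<And>i. i \<noteq> j \<Longrightarrow> b' i = ?b i" for b'
    unfolding qok_def using that other by metis
  show ?thesis
    unfolding DECR_def by (auto simp add: c w(1) x(2) j_def[symmetric] intro!: all intro: new same)
qed

section \<open>Dijkstra's algorithm\<close>

definition act :: "bool \<Rightarrow> real \<Rightarrow> real \<Rightarrow> bool" where
  "act full v x \<longleftrightarrow> full \<or> v < 0 \<and> v + x < 0"

text \<open>\<open>S\<close> is the set of extracted nodes. The fourth clause, a lower bound by
  every closed function below \<open>a\<close>, takes the place of the usual statement on lengths of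
  walks; it does not depend on which edges are active.\<close>

definition dinv :: "(nat \<Rightarrow> nat \<Rightarrow> real) \<Rightarrow> (nat \<Rightarrow> nat \<Rightarrow> real) \<Rightarrow> bool \<Rightarrow> (nat \<Rightarrow> real) \<Rightarrow> nat set \<Rightarrow>
    (nat \<Rightarrow> real) \<Rightarrow> (nat \<Rightarrow> real) \<Rightarrow> bool" where
  "dinv G X full a S K R \<longleftrightarrow> (\<forall>y<N. K y \<le> a y \<and> R y \<le> a y) \<and> (\<forall>p\<in>S. \<forall>w<N. w \<notin> S \<longrightarrow> K p \<le> K w) \<and>
     (\<forall>p\<in>S. \<forall>w<N. act full (K p) (X p w) \<longrightarrow>
        R w \<le> K p + X p w \<and> (0 \<le> G p w \<longrightarrow> K w \<le> K p + X p w)) \<and>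
     (\<forall>c. (\<forall>y<N. c y \<le> a y) \<and> (\<forall>x<N. \<forall>y<N. 0 \<le> G x y \<longrightarrow> c y \<le> c x + X x y) \<longrightarrow> (\<forall>y<N. c y \<le> K y)) \<and>
     (\<forall>y<N. R y = a y \<or> (\<exists>p\<in>S. R y = K p + X p y))"

lemma dinv_init: "dinv G X full a {} a a"
  by (simp add: dinv_def)

lemma dinv_cong:
  assumes "\<And>y. y < N \<Longrightarrow> K y = K' y" "\<And>y. y < N \<Longrightarrow> R y = R' y" "S \<subseteq> {..<N}" "dinv G X full a S K R"
  shows "dinv G X full a S K' R'"
proof -
  have S: "p < N" if "p \<in> S" for p using assms(3) that by auto
  show ?thesis using assms(4) unfolding dinv_def
    by (simp add: assms(1,2)[symmetric] S cong: conj_cong bex_cong ball_cong)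
qed

lemma dinv_final: "dinv G X full a {..<N} K R \<Longrightarrow> dij N G X full a K R"
  unfolding dinv_def dij_def act_def by (simp add: Bex_def Ball_def)

lemma dinv_lower:
  assumes "dinv G X full a S K R" "\<And>y. y < N \<Longrightarrow> c y \<le> a y"
    "\<And>x y. x < N \<Longrightarrow> y < N \<Longrightarrow> 0 \<le> G x y \<Longrightarrow> c y \<le> c x + X x y" "y < N"
  shows "c y \<le> K y"
  using assms unfolding dinv_def by simp

text \<open>The keys of extracted nodes are final: they are at most \<open>K p\<close>, and only
  edges with nonnegative weight in \<open>X\<close> change keys, by \<open>GX\<close>. So what has
  been relaxed stays relaxed with respect to the current keys.\<close>

lemma dinv_step:
  assumes inv: "dinv G X full a S K R" and S: "S \<subseteq> {..<N}" and p: "p < N" "p \<notin> S"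
    and min: "\<And>w. w < N \<Longrightarrow> w \<notin> S \<Longrightarrow> K p \<le> K w"
    and GX: "\<And>x y. x < N \<Longrightarrow> y < N \<Longrightarrow> 0 \<le> G x y \<Longrightarrow> 0 \<le> X x y"
    and K': "\<And>w. w < N \<Longrightarrow> K' w = (if act full (K p) (X p w) \<and> 0 \<le> G p w then min (K w) (K p + X p w) else K w)"
    and R': "\<And>w. w < N \<Longrightarrow> R' w = (if act full (K p) (X p w) then min (R w) (K p + X p w) else R w)"
  shows "dinv G X full a (insert p S) K' R'" and "\<And>w. w \<in> insert p S \<Longrightarrow> K' w = K w"
proof -
  have mono: "K u \<le> K w" if "u \<in> S" "w < N" "w \<notin> S" for u w using inv that unfolding dinv_def by blast
  show same: "K' w = K w" if "w \<in> insert p S" for w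
  proof -
    have w: "w < N" "K w \<le> K p" using that S p mono by auto
    then show ?thesis using K'[OF w(1)] GX[OF p(1) w(1)] by auto
  qed
  have le: "K' w \<le> K w" "R' w \<le> R w" if "w < N" for w using K'[OF that] R'[OF that] by auto
  have old: "K y \<le> a y" "R y \<le> a y" if "y < N" for y using inv that unfolding dinv_def by auto
  have oldact: "R w \<le> K u + X u w" "0 \<le> G u w \<Longrightarrow> K w \<le> K u + X u w"
    if "u \<in> S" "w < N" "act full (K u) (X u w)" for u w using inv that unfolding dinv_def by auto
  have oldR: "R y = a y \<or> (\<exists>p\<in>S. R y = K p + X p y)" if "y < N" for y using inv that unfolding dinv_def by auto
  show "dinv G X full a (insert p S) K' R'"
    unfolding dinv_def
  proof (intro conjI allI impI ballI)
    fix y assume y: "y < N"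
    show "K' y \<le> a y" "R' y \<le> a y" using le[OF y] old[OF y] by auto
    show "R' y = a y \<or> (\<exists>p\<in>insert p S. R' y = K' p + X p y)"
    proof (cases "R' y = R y")
      case True
      then show ?thesis using oldR[OF y] same by auto
    next
      case False
      then have "R' y = K p + X p y" using R'[OF y] by (auto split: if_splits simp: min_def)
      then show ?thesis using same by auto
    qed
  next
    fix u w assume u: "u \<in> insert p S" and w: "w < N" "w \<notin> insert p S"
    have uw: "K u \<le> K p" "K u \<le> K w" using u w mono p min by auto
    then show "K' u \<le> K' w" using same[OF u] K'[OF w(1)] GX[OF p(1) w(1)] by auto
  next
    fix u w assume u: "u \<in> insert p S" and w: "w < N" and a: "act full (K' u) (X u w)"
    have a': "act full (K u) (X u w)" using a same[OF u] by simp
    show "R' w \<le> K' u + X u w"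
      using same[OF u] R'[OF w] oldact(1)[OF _ w a'] le[OF w] a' u by auto
    show "K' w \<le> K' u + X u w" if "0 \<le> G u w"
      using same[OF u] K'[OF w] oldact(2)[OF _ w a' that] le[OF w] a' u that by auto
  next
    fix c y assume c: "(\<forall>y<N. c y \<le> a y) \<and> (\<forall>x<N. \<forall>y<N. 0 \<le> G x y \<longrightarrow> c y \<le> c x + X x y)" and y: "y < N"
    have cK: "c z \<le> K z" if "z < N" for z using dinv_lower[OF inv, of c z] c that by blast
    have "0 \<le> G p y \<Longrightarrow> c y \<le> c p + X p y" using c p y by blast
    then show "c y \<le> K' y" using K'[OF y] cK[OF y] cK[OF p(1)] by (auto simp: min_def)
  qed
qed

lemma wlp_RELAX:
  assumes ok: "ok \<sigma>" and w: "wvar \<sigma> ''w'' = w" "w < N" and e: "wval MM \<sigma> e = i"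
    and e': "\<And>\<tau>. wvar \<tau> = wvar \<sigma> \<Longrightarrow> warr \<tau> = warr \<sigma> \<Longrightarrow> wval MM \<tau> e = i"
    and GX: "G \<notin> {''K'', ''R''}" "X \<notin> {''K'', ''R''}"
    and qok: "qok (rarr \<sigma> ''K'') (warr \<sigma> ''d'') (warr \<sigma> ''b'')"
    and x: "x = rvar \<sigma> ''v'' + rarr \<sigma> X i"
  shows "wlp MM (RELAX G X e) (\<lambda>\<sigma>'. rarr \<sigma>' ''K'' = (if 0 \<le> rarr \<sigma> G i then (rarr \<sigma> ''K'')(w := min (rarr \<sigma> ''K'' w) x) else rarr \<sigma> ''K'') \<and>
     rarr \<sigma>' ''R'' = (rarr \<sigma> ''R'')(w := min (rarr \<sigma> ''R'' w) x) \<and>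
     qok (rarr \<sigma>' ''K'') (warr \<sigma>' ''d'') (warr \<sigma>' ''b'')) \<sigma>"
proof -
  let ?K = "rarr \<sigma> ''K''"
  define \<sigma>1 where "\<sigma>1 = \<sigma>\<lparr>rvar := (rvar \<sigma>)(''x'' := x), rarr := (rarr \<sigma>)(''R'' := (rarr \<sigma> ''R'')(w := min (rarr \<sigma> ''R'' w) x))\<rparr>"
  have s1: "wvar \<sigma>1 = wvar \<sigma>" "warr \<sigma>1 = warr \<sigma>" "rvar \<sigma>1 ''x'' = x" "rarr \<sigma>1 G = rarr \<sigma> G" "rarr \<sigma>1 ''K'' = ?K"
    "rarr \<sigma>1 ''R'' = (rarr \<sigma> ''R'')(w := min (rarr \<sigma> ''R'' w) x)" "wval MM \<sigma>1 e = i"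
    using GX by (auto simp: \<sigma>1_def intro!: e')
  let ?Q = "\<lambda>\<sigma>'. rarr \<sigma>' ''K'' = (if 0 \<le> rarr \<sigma> G i then ?K(w := min (?K w) x) else ?K) \<and>
     rarr \<sigma>' ''R'' = (rarr \<sigma> ''R'')(w := min (rarr \<sigma> ''R'' w) x) \<and>
     qok (rarr \<sigma>' ''K'') (warr \<sigma>' ''d'') (warr \<sigma>' ''b'')"
  let ?C = "Cond (BAnd (BNot (RLess (RArr G e) RZero)) (RLess (RVar ''x'') (RArr ''K'' (WVar ''w''))))
        (Seq (RStore ''K'' (WVar ''w'') (RVar ''x'')) DECR) Skip"
  have C: "wlp MM ?C ?Q \<sigma>1"
  proof (cases "0 \<le> rarr \<sigma> G i \<and> x < ?K w")
    case True
    let ?\<tau> = "\<sigma>1\<lparr>rarr := (rarr \<sigma>1)(''K'' := ?K(w := x))\<rparr>"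
    have ok': "ok ?\<tau>" using ok s1 by (simp add: ok_def)
    have "wlp MM DECR (\<lambda>\<sigma>'. qok (?K(w := x)) (warr ?\<tau> ''d'') (warr \<sigma>' ''b'')) ?\<tau>"
      by (rule wlp_DECR[OF ok']) (use s1 w qok True in auto)
    then have "wlp MM DECR ?Q ?\<tau>"
      by (rule wlp_conseq) (use s1 True in \<open>auto simp: fr_def min_def\<close>)
    then show ?thesis using True s1 w by auto
  next
    case False
    then have "min (?K w) x = ?K w" if "0 \<le> rarr \<sigma> G i" using that by auto
    then have "(if 0 \<le> rarr \<sigma> G i then ?K(w := min (?K w) x) else ?K) = ?K" by auto
    then show ?thesis using False s1 w qok by auto
  qed
  have eq: "\<sigma>1 = (if x < rarr \<sigma> ''R'' w then \<sigma>\<lparr>rvar := (rvar \<sigma>)(''x'' := x), rarr := (rarr \<sigma>)(''R'' := (rarr \<sigma> ''R'')(w := x))\<rparr>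
       else \<sigma>\<lparr>rvar := (rvar \<sigma>)(''x'' := x)\<rparr>)"
    by (auto simp: \<sigma>1_def min_def)
  show ?thesis
    unfolding RELAX_def using C w x e eq by (auto split: if_splits)
qed

end

section \<open>Composition of frame conditions\<close>

definition wsub :: "com \<Rightarrow> com \<Rightarrow> bool" where
  "wsub c d \<longleftrightarrow> ww c \<subseteq> ww d \<and> wa c \<subseteq> wa d \<and> rv c \<subseteq> rv d \<and> ra c \<subseteq> ra d"

lemma fr_trans:
  assumes "fr c1 \<sigma> \<tau>" "fr c2 \<tau> \<upsilon>" "wsub c1 c" "wsub c2 c"
  shows "fr c \<sigma> \<upsilon>"
  unfolding fr_def
proof (intro conjI allI impI)
  fix x
  show "wvar \<upsilon> x = wvar \<sigma> x" if "x \<notin> ww c" using that assms(3,4) frw[OF assms(1)] frw[OF assms(2)] unfolding wsub_def by (metis subsetD)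
  show "warr \<upsilon> x = warr \<sigma> x" if "x \<notin> wa c" using that assms(3,4) frwa[OF assms(1)] frwa[OF assms(2)] unfolding wsub_def by (metis subsetD)
  show "rvar \<upsilon> x = rvar \<sigma> x" if "x \<notin> rv c" using that assms(3,4) frr[OF assms(1)] frr[OF assms(2)] unfolding wsub_def by (metis subsetD)
  show "rarr \<upsilon> x = rarr \<sigma> x" if "x \<notin> ra c" using that assms(3,4) frra[OF assms(1)] frra[OF assms(2)] unfolding wsub_def by (metis subsetD)
qed

context sizes
begin

lemma wlp_FULL:
  assumes ok: "ok \<sigma>" and G: "G \<notin> {''K'', ''R''}" and v: "rvar \<sigma> ''v'' = v"
    and e: "\<And>\<tau> w. ok \<tau> \<Longrightarrow> fr (FULL G e) \<sigma> \<tau> \<Longrightarrow> wvar \<tau> ''w'' = w \<Longrightarrow> w < N \<Longrightarrow> wval MM \<tau> e = i w"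
    and qok: "qok (rarr \<sigma> ''K'') (warr \<sigma> ''d'') (warr \<sigma> ''b'')"
  shows "wlp MM (FULL G e) (\<lambda>\<sigma>'.
     (\<forall>w<N. rarr \<sigma>' ''K'' w = (if 0 \<le> rarr \<sigma> G (i w) then min (rarr \<sigma> ''K'' w) (v + rarr \<sigma> G (i w)) else rarr \<sigma> ''K'' w) \<and>
        rarr \<sigma>' ''R'' w = min (rarr \<sigma> ''R'' w) (v + rarr \<sigma> G (i w))) \<and>
     qok (rarr \<sigma>' ''K'') (warr \<sigma>' ''d'') (warr \<sigma>' ''b'')) \<sigma>"
proof -
  let ?K = "rarr \<sigma> ''K''" and ?R = "rarr \<sigma> ''R''" and ?G = "rarr \<sigma> G"
  let ?n = "\<lambda>w. if 0 \<le> ?G (i w) then min (?K w) (v + ?G (i w)) else ?K w"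
  have c: "wvar \<sigma> ''N'' = N" using ok by (simp add: ok_def)
  show ?thesis
    unfolding FULL_def
    apply (rule wlp_FOR[where I = "\<lambda>k \<tau>.
      (\<forall>w<N. rarr \<tau> ''K'' w = (if w < k then ?n w else ?K w) \<and>
         rarr \<tau> ''R'' w = (if w < k then min (?R w) (v + ?G (i w)) else ?R w)) \<and>
      qok (rarr \<tau> ''K'') (warr \<tau> ''d'') (warr \<tau> ''b'')"])
    subgoal using N_less c by simp
    subgoal by simp
    subgoal by simp
    subgoal by simp
    subgoal using qok by simp
    subgoal premises p for k \<tau>
    proof -
      have ok': "ok \<tau>" by (rule ok_fr[OF p(3) ok]) (auto simp: cns_def)
      have fr: "fr (FULL G e) \<sigma> \<tau>" using p(3) by (simp add: fr_def FULL_def)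
      have k: "k < N" using p(1) c by simp
      have w: "rvar \<tau> ''v'' = v" "rarr \<tau> G = ?G" using p(3) v G by (auto simp: fr_def)
      have ee: "wval MM \<tau>' e = i k" if "wvar \<tau>' = wvar \<tau>" "warr \<tau>' = warr \<tau>" for \<tau>'
      proof -
        have "wval MM \<tau>' e = wval MM \<tau> e" by (induction e) (auto simp: that)
        then show ?thesis using e[OF ok' fr p(4) k] by simp
      qed
      have Kk: "rarr \<tau> ''K'' k = ?K k" "rarr \<tau> ''R'' k = ?R k" using p(2) k by auto
      have R: "wlp MM (RELAX G G e) (\<lambda>\<sigma>'. rarr \<sigma>' ''K'' = (if 0 \<le> rarr \<tau> G (i k) then (rarr \<tau> ''K'')(k := min (rarr \<tau> ''K'' k) (v + ?G (i k))) else rarr \<tau> ''K'') \<and>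
        rarr \<sigma>' ''R'' = (rarr \<tau> ''R'')(k := min (rarr \<tau> ''R'' k) (v + ?G (i k))) \<and>
        qok (rarr \<sigma>' ''K'') (warr \<sigma>' ''d'') (warr \<sigma>' ''b'')) \<tau>"
        by (rule wlp_RELAX[OF ok' p(4) k ee ee G G]) (use p(2) w in simp_all)
      show ?thesis
        by (rule wlp_conseq[OF R]) (use p(2) w Kk in \<open>auto simp: less_Suc_eq\<close>)
    qed
    subgoal for \<tau> using c by simp
    done
qed

lemma wlp_ROWK:
  assumes ok: "ok \<sigma>" and X: "X \<noteq> ''K''"
    and e: "\<And>\<tau> x. ok \<tau> \<Longrightarrow> fr (ROWK X e) \<sigma> \<tau> \<Longrightarrow> wvar \<tau> ''x'' = x \<Longrightarrow> x < N \<Longrightarrow> wval MM \<tau> e = i x"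
  shows "wlp MM (ROWK X e) (\<lambda>\<sigma>'. \<forall>x<N. rarr \<sigma>' ''K'' x = rarr \<sigma> X (i x)) \<sigma>"
proof -
  have c: "wvar \<sigma> ''N'' = N" using ok by (simp add: ok_def)
  show ?thesis
    unfolding ROWK_def
    apply (rule wlp_FOR[where I = "\<lambda>k \<tau>. \<forall>x<k. rarr \<tau> ''K'' x = rarr \<sigma> X (i x)"])
    subgoal using N_less c by simp
    subgoal by simp
    subgoal by simp
    subgoal by simp
    subgoal by simp
    subgoal premises p for k \<tau>
    proof -
      have ok': "ok \<tau>" by (rule ok_fr[OF p(3) ok]) (auto simp: cns_def)
      have fr: "fr (ROWK X e) \<sigma> \<tau>" using p(3) by (simp add: fr_def ROWK_def)
      have "wval MM \<tau> e = i k" using e[OF ok' fr p(4)] p(1) c by simp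
      moreover have "rarr \<tau> X = rarr \<sigma> X" using p(3) X by (auto simp: fr_def)
      ultimately show ?thesis using p(2,4) by (auto simp: less_Suc_eq)
    qed
    subgoal for \<tau> using c by simp
    done
qed

text \<open>\<open>Fu S K f\<close> is a balance of the fuel \<open>f\<close> after the nodes of
  \<open>S\<close> have been processed. By \<open>Fu_cong\<close> it depends on the keys of
  \<open>S\<close> only. Since these are final, the balance at the end can be evaluated with the
  final keys.\<close>

lemma wlp_DIJ:
  assumes ok: "ok \<sigma>" and a: "\<And>x. x < N \<Longrightarrow> rarr \<sigma> ''K'' x = a x"
    and GX: "\<And>x y. x < N \<Longrightarrow> y < N \<Longrightarrow> 0 \<le> G x y \<Longrightarrow> 0 \<le> X x y"
    and c: "ww c \<inter> cns = {}" "''c'' \<notin> ww c" "wa c \<subseteq> {''b''}"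
    and Fu0: "Fu {} a (wvar \<sigma> ''f'')"
    and Fu_cong: "\<And>S K K' f. S \<subseteq> {..<N} \<Longrightarrow> (\<And>w. w \<in> S \<Longrightarrow> K' w = K w) \<Longrightarrow> Fu S K f \<Longrightarrow> Fu S K' f"
    and inner: "\<And>\<tau> S K R p. ok \<tau> \<Longrightarrow> fr (DIJ c) \<sigma> \<tau> \<Longrightarrow> dinv G X full a S K R \<Longrightarrow> S \<subseteq> {..<N} \<Longrightarrow> p < N \<Longrightarrow> p \<notin> S \<Longrightarrow>
       Fu S K (wvar \<tau> ''f'') \<Longrightarrow> rarr \<tau> ''K'' = K \<Longrightarrow> rarr \<tau> ''R'' = R \<Longrightarrow> wvar \<tau> ''p'' = p \<Longrightarrow>
       rvar \<tau> ''v'' = K p \<Longrightarrow> qok K (warr \<tau> ''d'') (warr \<tau> ''b'') \<Longrightarrow>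
       wlp MM c (\<lambda>\<tau>'. (\<forall>w<N. rarr \<tau>' ''K'' w = (if act full (K p) (X p w) \<and> 0 \<le> G p w then min (K w) (K p + X p w) else K w) \<and>
            rarr \<tau>' ''R'' w = (if act full (K p) (X p w) then min (R w) (K p + X p w) else R w)) \<and>
          qok (rarr \<tau>' ''K'') (warr \<tau>' ''d'') (warr \<tau>' ''b'') \<and> Fu (insert p S) K (wvar \<tau>' ''f'')) \<tau>"
  shows "wlp MM (DIJ c) (\<lambda>\<sigma>'. dij N G X full a (rarr \<sigma>' ''K'') (rarr \<sigma>' ''R'') \<and> Fu {..<N} (rarr \<sigma>' ''K'') (wvar \<sigma>' ''f'')) \<sigma>"
proof -
  have cN: "wvar \<sigma> ''N'' = N" using ok by (simp add: ok_def)
  have Nc: "''N'' \<notin> ww c" using c(1) by (auto simp: cns_def)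
  have dd: "''d'' \<notin> wa c" using c(3) by auto
  show ?thesis
    unfolding DIJ_def wlp_Seq
    apply (rule wlp_FOR[where I = "\<lambda>k \<tau>. \<forall>x<k. rarr \<tau> ''R'' x = rarr \<sigma> ''K'' x"])
    subgoal using N_less cN by simp
    subgoal by simp
    subgoal by simp
    subgoal by simp
    subgoal by simp
    subgoal for k \<tau> by (auto simp: less_Suc_eq fr_def)
    subgoal premises p for \<tau>
    proof -
      have ok1: "ok \<tau>" by (rule ok_fr[OF p(2) ok]) (auto simp: cns_def)
      have cN1: "wvar \<tau> ''N'' = N" using ok1 by (simp add: ok_def)
      show ?thesis
      proof (rule wlp_conseq[OF wlp_INITQ[OF ok1, of "''N''" N]])
        show "wvar \<tau> ''N'' = N" "''N'' \<notin> {''x'', ''j'', ''y'', ''e'', ''o''}" using cN1 by auto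
        fix \<tau>1 assume q1: "(\<forall>x<N. warr \<tau>1 ''d'' x = (if x < N then 0 else 1)) \<and>
           qok (rarr \<tau>1 ''K'') (warr \<tau>1 ''d'') (warr \<tau>1 ''b'')" and f1: "fr (INITQ ''N'') \<tau> \<tau>1"
        have ok2: "ok \<tau>1" by (rule ok_fr[OF f1 ok1]) (auto simp: cns_def)
        have cN2: "wvar \<tau>1 ''N'' = N" using ok2 by (simp add: ok_def)
        have KR: "rarr \<tau>1 ''K'' x = a x" "rarr \<tau>1 ''R'' x = a x" if "x < N" for x
          using f1 p that a cN by (auto simp: fr_def)
        have f2: "wvar \<tau>1 ''f'' = wvar \<sigma> ''f''" using f1 p by (auto simp: fr_def)
        let ?I = "\<lambda>k \<tau>. \<exists>S\<subseteq>{..<N}. card S = k \<and> (\<forall>w<N. warr \<tau> ''d'' w = (if w \<in> S then 1 else 0)) \<and>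
           dinv G X full a S (rarr \<tau> ''K'') (rarr \<tau> ''R'') \<and> qok (rarr \<tau> ''K'') (warr \<tau> ''d'') (warr \<tau> ''b'') \<and>
           Fu S (rarr \<tau> ''K'') (wvar \<tau> ''f'')"
        show "wlp MM (FOR ''c'' ''N'' (Seq EXTRACT (Seq (RAssign ''v'' (RArr ''K'' (WVar ''p''))) c)))
          (\<lambda>\<sigma>'. dij N G X full a (rarr \<sigma>' ''K'') (rarr \<sigma>' ''R'') \<and> Fu {..<N} (rarr \<sigma>' ''K'') (wvar \<sigma>' ''f'')) \<tau>1"
        proof (rule wlp_FOR[where I = ?I])
          show "wvar \<tau>1 ''N'' < MM" using cN2 N_less by simp
          show "''c'' \<notin> ww (Seq EXTRACT (Seq (RAssign ''v'' (RArr ''K'' (WVar ''p''))) c))"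
            "''N'' \<notin> ww (Seq EXTRACT (Seq (RAssign ''v'' (RArr ''K'' (WVar ''p''))) c))" "''c'' \<noteq> ''N''"
            using c Nc by auto
          have "dinv G X full a {} (rarr \<tau>1 ''K'') (rarr \<tau>1 ''R'')"
            by (rule dinv_cong[OF _ _ _ dinv_init]) (use KR in auto)
          then show "?I 0 (wset ''c'' 0 \<tau>1)"
            using q1 f2 Fu0 Fu_cong[of "{}" "rarr \<tau>1 ''K''" a] by (intro exI[of _ "{}"]) auto
        next
          fix k \<tau>2 assume k: "k < wvar \<tau>1 ''N''" and I: "?I k \<tau>2"
            and fr: "fr (FOR ''c'' ''N'' (Seq EXTRACT (Seq (RAssign ''v'' (RArr ''K'' (WVar ''p''))) c))) \<tau>1 \<tau>2"
            and kc: "wvar \<tau>2 ''c'' = k"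
          obtain S where S: "S \<subseteq> {..<N}" "card S = k" "\<forall>w<N. warr \<tau>2 ''d'' w = (if w \<in> S then 1 else 0)"
             "dinv G X full a S (rarr \<tau>2 ''K'') (rarr \<tau>2 ''R'')" "qok (rarr \<tau>2 ''K'') (warr \<tau>2 ''d'') (warr \<tau>2 ''b'')"
             "Fu S (rarr \<tau>2 ''K'') (wvar \<tau>2 ''f'')" using I by blast
          have "S \<noteq> {..<N}" using S(2) k cN2 by auto
          then obtain al where al: "al < N" "al \<notin> S" using S(1) by auto
          have ok3: "ok \<tau>2" by (rule ok_fr[OF fr ok2]) (use c in \<open>auto simp: cns_def\<close>)
          have "fr (DIJ c) \<sigma> \<tau>1" by (rule fr_trans[OF p(2) f1]) (auto simp: wsub_def)
          then have fr2: "fr (DIJ c) \<sigma> \<tau>2" by (rule fr_trans[OF _ fr]) (auto simp: wsub_def)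
          show "wlp MM (Seq EXTRACT (Seq (RAssign ''v'' (RArr ''K'' (WVar ''p''))) c))
             (\<lambda>\<tau>'. ?I (Suc k) (wset ''c'' (Suc k) \<tau>')) \<tau>2"
            unfolding wlp_Seq
          proof (rule wlp_conseq[OF wlp_EXTRACT[OF ok3 S(5) al(1)]])
            show "warr \<tau>2 ''d'' al = 0" using S(3) al by simp
            fix \<tau>3 assume "\<exists>p<N. wvar \<tau>3 ''p'' = p \<and> warr \<tau>2 ''d'' p = 0 \<and>
                (\<forall>w<N. warr \<tau>2 ''d'' w = 0 \<longrightarrow> rarr \<tau>2 ''K'' p \<le> rarr \<tau>2 ''K'' w) \<and>
                warr \<tau>3 ''d'' = (warr \<tau>2 ''d'')(p := 1) \<and>
                qok (rarr \<tau>2 ''K'') ((warr \<tau>2 ''d'')(p := 1)) (warr \<tau>3 ''b'')"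
              and fr3: "fr EXTRACT \<tau>2 \<tau>3"
            then obtain p where p: "p < N" "wvar \<tau>3 ''p'' = p" "warr \<tau>2 ''d'' p = 0"
                "\<And>w. w < N \<Longrightarrow> warr \<tau>2 ''d'' w = 0 \<Longrightarrow> rarr \<tau>2 ''K'' p \<le> rarr \<tau>2 ''K'' w"
                "warr \<tau>3 ''d'' = (warr \<tau>2 ''d'')(p := 1)"
                "qok (rarr \<tau>2 ''K'') (warr \<tau>3 ''d'') (warr \<tau>3 ''b'')" by auto
            have pS: "p \<notin> S" using p(1,3) S(3) by (auto split: if_splits)
            let ?\<tau> = "\<tau>3\<lparr>rvar := (rvar \<tau>3)(''v'' := rarr \<tau>3 ''K'' p)\<rparr>"
            have "ok \<tau>3" by (rule ok_fr[OF fr3 ok3]) (auto simp: cns_def)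
            then have ok4: "ok ?\<tau>" by (simp add: ok_def)
            have same: "rarr \<tau>3 ''K'' = rarr \<tau>2 ''K''" "rarr \<tau>3 ''R'' = rarr \<tau>2 ''R''" "wvar \<tau>3 ''f'' = wvar \<tau>2 ''f''"
              using fr3 by (auto simp: fr_def)
            have "fr (DIJ c) \<sigma> \<tau>3" by (rule fr_trans[OF fr2 fr3]) (auto simp: wsub_def)
            then have fr4: "fr (DIJ c) \<sigma> ?\<tau>" by (rule fr_trans[of _ _ _ "RAssign ''v'' RZero"]) (auto simp: wsub_def fr_def)
            have *: "wlp MM c (\<lambda>\<tau>'. (\<forall>w<N. rarr \<tau>' ''K'' w = (if act full (rarr \<tau>2 ''K'' p) (X p w) \<and> 0 \<le> G p w then min (rarr \<tau>2 ''K'' w) (rarr \<tau>2 ''K'' p + X p w) else rarr \<tau>2 ''K'' w) \<and>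
                rarr \<tau>' ''R'' w = (if act full (rarr \<tau>2 ''K'' p) (X p w) then min (rarr \<tau>2 ''R'' w) (rarr \<tau>2 ''K'' p + X p w) else rarr \<tau>2 ''R'' w)) \<and>
              qok (rarr \<tau>' ''K'') (warr \<tau>' ''d'') (warr \<tau>' ''b'') \<and> Fu (insert p S) (rarr \<tau>2 ''K'') (wvar \<tau>' ''f'')) ?\<tau>"
              by (rule inner[OF ok4 fr4 S(4) S(1) p(1) pS]) (use S(6) same p in auto)
            show "wlp MM (RAssign ''v'' (RArr ''K'' (WVar ''p''))) (wlp MM c (\<lambda>\<tau>'. ?I (Suc k) (wset ''c'' (Suc k) \<tau>'))) \<tau>3"
              unfolding wlp_RAssign rval.simps wval.simps p(2)
            proof (rule wlp_conseq[OF *])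
              fix \<tau>4 assume r: "(\<forall>w<N. rarr \<tau>4 ''K'' w = (if act full (rarr \<tau>2 ''K'' p) (X p w) \<and> 0 \<le> G p w then min (rarr \<tau>2 ''K'' w) (rarr \<tau>2 ''K'' p + X p w) else rarr \<tau>2 ''K'' w) \<and>
                rarr \<tau>4 ''R'' w = (if act full (rarr \<tau>2 ''K'' p) (X p w) then min (rarr \<tau>2 ''R'' w) (rarr \<tau>2 ''K'' p + X p w) else rarr \<tau>2 ''R'' w)) \<and>
              qok (rarr \<tau>4 ''K'') (warr \<tau>4 ''d'') (warr \<tau>4 ''b'') \<and> Fu (insert p S) (rarr \<tau>2 ''K'') (wvar \<tau>4 ''f'')"
                and fr5: "fr c ?\<tau> \<tau>4"
              have d4: "warr \<tau>4 ''d'' = (warr \<tau>2 ''d'')(p := 1)" using frwa[OF fr5 dd] p(5) by simp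
              have min: "rarr \<tau>2 ''K'' p \<le> rarr \<tau>2 ''K'' w" if "w < N" "w \<notin> S" for w using p(4) S(3) that by simp
              have K4: "rarr \<tau>4 ''K'' w = (if act full (rarr \<tau>2 ''K'' p) (X p w) \<and> 0 \<le> G p w then min (rarr \<tau>2 ''K'' w) (rarr \<tau>2 ''K'' p + X p w) else rarr \<tau>2 ''K'' w)"
                and R4: "rarr \<tau>4 ''R'' w = (if act full (rarr \<tau>2 ''K'' p) (X p w) then min (rarr \<tau>2 ''R'' w) (rarr \<tau>2 ''K'' p + X p w) else rarr \<tau>2 ''R'' w)"
                if "w < N" for w using r that by blast+
              note dv = dinv_step(1)[OF S(4) S(1) p(1) pS min GX K4 R4]
                and sm = dinv_step(2)[OF S(4) S(1) p(1) pS min GX K4 R4]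
              have "Fu (insert p S) (rarr \<tau>4 ''K'') (wvar \<tau>4 ''f'')"
                by (rule Fu_cong[OF _ sm conjunct2[OF conjunct2[OF r]]]) (use S(1) p(1) in auto)
              moreover have "card (insert p S) = Suc k"
                using pS S(2) finite_subset[OF S(1)] by simp
              moreover have "\<forall>w<N. warr \<tau>4 ''d'' w = (if w \<in> insert p S then 1 else 0)" using d4 S(3) by auto
              ultimately show "?I (Suc k) (wset ''c'' (Suc k) \<tau>4)"
                using dv S(1) p(1) conjunct1[OF conjunct2[OF r]] by (intro exI[of _ "insert p S"]) simp
            qed
          qed
        next
          fix \<tau>2 assume "?I (wvar \<tau>1 ''N'') \<tau>2"
          then obtain S where S: "S \<subseteq> {..<N}" "card S = N" "dinv G X full a S (rarr \<tau>2 ''K'') (rarr \<tau>2 ''R'')"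
             "Fu S (rarr \<tau>2 ''K'') (wvar \<tau>2 ''f'')" using cN2 by auto
          have "S = {..<N}" using S(1,2) card_subset_eq[of "{..<N}" S] by simp
          then show "dij N G X full a (rarr \<tau>2 ''K'') (rarr \<tau>2 ''R'') \<and> Fu {..<N} (rarr \<tau>2 ''K'') (wvar \<tau>2 ''f'')"
            using S dinv_final by simp
        qed
      qed
    qed
    done
qed

lemma wlp_DIJ_FULL:
  assumes ok: "ok \<sigma>" and a: "\<And>x. x < N \<Longrightarrow> rarr \<sigma> ''K'' x = a x" and H: "H \<notin> {''K'', ''R''}"
    and e: "\<And>\<tau> p w. ok \<tau> \<Longrightarrow> wvar \<tau> ''p'' = p \<Longrightarrow> wvar \<tau> ''w'' = w \<Longrightarrow> p < N \<Longrightarrow> w < N \<Longrightarrow> wval MM \<tau> e = i p w"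
  shows "wlp MM (DIJ (FULL H e)) (\<lambda>\<sigma>'. dij N (\<lambda>p w. rarr \<sigma> H (i p w)) (\<lambda>p w. rarr \<sigma> H (i p w)) True a
     (rarr \<sigma>' ''K'') (rarr \<sigma>' ''R'')) \<sigma>"
proof -
  \<comment> \<open>The full relaxation uses no fuel. The trivial balance is written as an
    application to match the rule.\<close>
  have "wlp MM (DIJ (FULL H e)) (\<lambda>\<sigma>'. dij N (\<lambda>p w. rarr \<sigma> H (i p w)) (\<lambda>p w. rarr \<sigma> H (i p w)) True a
     (rarr \<sigma>' ''K'') (rarr \<sigma>' ''R'') \<and> (\<lambda>S K f. True) {..<N} (rarr \<sigma>' ''K'') (wvar \<sigma>' ''f'')) \<sigma>"
  proof (rule wlp_DIJ[OF ok a])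
    fix \<tau> S K R p
    assume A: "ok \<tau>" "fr (DIJ (FULL H e)) \<sigma> \<tau>" "p < N" "rarr \<tau> ''K'' = K" "rarr \<tau> ''R'' = R"
      "wvar \<tau> ''p'' = p" "rvar \<tau> ''v'' = K p" "qok K (warr \<tau> ''d'') (warr \<tau> ''b'')"
    have H': "rarr \<tau> H = rarr \<sigma> H" using A(2) H by (auto simp: fr_def)
    have F: "wlp MM (FULL H e) (\<lambda>\<sigma>'. (\<forall>w<N. rarr \<sigma>' ''K'' w = (if 0 \<le> rarr \<tau> H (i p w) then min (rarr \<tau> ''K'' w) (K p + rarr \<tau> H (i p w)) else rarr \<tau> ''K'' w) \<and>
        rarr \<sigma>' ''R'' w = min (rarr \<tau> ''R'' w) (K p + rarr \<tau> H (i p w))) \<and>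
        qok (rarr \<sigma>' ''K'') (warr \<sigma>' ''d'') (warr \<sigma>' ''b'')) \<tau>"
    proof (rule wlp_FULL[OF A(1) H A(7)])
      fix \<tau>' w assume B: "ok \<tau>'" "fr (FULL H e) \<tau> \<tau>'" "wvar \<tau>' ''w'' = w" "w < N"
      have "wvar \<tau>' ''p'' = p" using B(2) A(6) by (auto simp: fr_def)
      then show "wval MM \<tau>' e = i p w" using e[OF B(1)] B A by simp
    qed (use A in simp)
    show "wlp MM (FULL H e) (\<lambda>\<tau>'. (\<forall>w<N. rarr \<tau>' ''K'' w = (if act True (K p) (rarr \<sigma> H (i p w)) \<and> 0 \<le> rarr \<sigma> H (i p w) then min (K w) (K p + rarr \<sigma> H (i p w)) else K w) \<and>
            rarr \<tau>' ''R'' w = (if act True (K p) (rarr \<sigma> H (i p w)) then min (R w) (K p + rarr \<sigma> H (i p w)) else R w)) \<and>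
          qok (rarr \<tau>' ''K'') (warr \<tau>' ''d'') (warr \<tau>' ''b'') \<and> True) \<tau>"
      by (rule wlp_conseq[OF F]) (use A H' in \<open>auto simp: act_def\<close>)
  qed (auto simp: cns_def)
  then show ?thesis by simp
qed

definition srt :: "(nat \<Rightarrow> nat) \<Rightarrow> (nat \<Rightarrow> nat \<Rightarrow> real) \<Rightarrow> nat \<Rightarrow> nat \<Rightarrow> bool" where
  "srt a X k r \<longleftrightarrow> bij_betw (\<lambda>i. a (r * N + i)) {..<k} {..<k} \<and>
     (\<forall>i j. i \<le> j \<and> j < k \<longrightarrow> X r (a (r * N + i)) \<le> X r (a (r * N + j)))"

text \<open>The active edges are a prefix of the sorted row. The assumption \<open>fuel\<close>
  ensures that the loop does not end within it, so the consumed fuel is exactly the number of active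
  edges.\<close>

lemma wlp_SCAN:
  assumes ok: "ok \<sigma>" and p: "wvar \<sigma> ''p'' = p" "p < N" and v: "rvar \<sigma> ''v'' = v"
    and X: "\<And>w. w < N \<Longrightarrow> rarr \<sigma> ''W'' (p * N + w) = X p w" and G: "\<And>w. w < N \<Longrightarrow> rarr \<sigma> ''M'' (p * N + w) = G p w"
    and srt: "srt (warr \<sigma> ''S'') X N p" and qok: "qok (rarr \<sigma> ''K'') (warr \<sigma> ''d'') (warr \<sigma> ''b'')"
    and fuel: "card {w. w < N \<and> act False v (X p w)} \<le> wvar \<sigma> ''f''"
  shows "wlp MM SCAN (\<lambda>\<sigma>'. (\<forall>w<N. rarr \<sigma>' ''K'' w = (if act False v (X p w) \<and> 0 \<le> G p w then min (rarr \<sigma> ''K'' w) (v + X p w) else rarr \<sigma> ''K'' w) \<and>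
      rarr \<sigma>' ''R'' w = (if act False v (X p w) then min (rarr \<sigma> ''R'' w) (v + X p w) else rarr \<sigma> ''R'' w)) \<and>
    qok (rarr \<sigma>' ''K'') (warr \<sigma>' ''d'') (warr \<sigma>' ''b'') \<and>
    wvar \<sigma>' ''f'' = wvar \<sigma> ''f'' - card {w. w < N \<and> act False v (X p w)}) \<sigma>"
proof -
  let ?K = "rarr \<sigma> ''K''" and ?R = "rarr \<sigma> ''R''" and ?f = "wvar \<sigma> ''f''"
  define so where "so = (\<lambda>i. warr \<sigma> ''S'' (p * N + i))"
  define Z where "Z = {w. w < N \<and> act False v (X p w)}"
  have bij: "bij_betw so {..<N} {..<N}" and mono: "\<And>i j. i \<le> j \<Longrightarrow> j < N \<Longrightarrow> X p (so i) \<le> X p (so j)"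
    using srt unfolding srt_def so_def by auto
  have soN: "so i < N" if "i < N" for i using bij that by (auto simp: bij_betw_def)
  have inj: "so i = so j \<longleftrightarrow> i = j" if "i < N" "j < N" for i j
    using bij that by (auto simp: bij_betw_def inj_on_def)
  have cN: "wvar \<sigma> ''N'' = N" using ok by (simp add: ok_def)
  define I :: "machine_state \<Rightarrow> bool" where "I = (\<lambda>\<tau>. \<exists>i\<le>N. wvar \<tau> ''i'' = i \<and> so ` {..<i} \<subseteq> Z \<and>
     (\<forall>w<N. rarr \<tau> ''K'' w = (if w \<in> so ` {..<i} \<and> 0 \<le> G p w then min (?K w) (v + X p w) else ?K w) \<and>
        rarr \<tau> ''R'' w = (if w \<in> so ` {..<i} then min (?R w) (v + X p w) else ?R w)) \<and>
     qok (rarr \<tau> ''K'') (warr \<tau> ''d'') (warr \<tau> ''b'') \<and> wvar \<tau> ''f'' + i = ?f)"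
  have cardi: "card (so ` {..<i}) = i" if "i \<le> N" for i
    using that inj by (subst card_image) (auto simp: inj_on_def)
  have finZ: "finite Z" unfolding Z_def by simp
  have i_le: "i \<le> card Z" if "i \<le> N" "so ` {..<i} \<subseteq> Z" for i
    using card_mono[OF finZ that(2)] cardi[OF that(1)] by simp
  show ?thesis
    unfolding SCAN_def WHILEF_def wlp_Seq wlp_WAssign
  proof (rule wlp_Loop[where I = I])
    show "I (wset ''i'' (wval MM \<sigma> (WConst 0)) \<sigma>)"
      unfolding I_def using qok by (intro exI[of _ 0]) auto
  next
    fix \<tau>
    assume I: "I \<tau>" and fr: "fr (Seq (WAssign ''f'' (WSub (WVar ''f'') (WConst 1)))
           (Seq (WAssign ''w'' (WArr ''S'' (ix ''p'' ''i'')))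
             (Seq (RELAX ''M'' ''W'' (ix ''p'' ''w'')) (WAssign ''i'' (WAdd (WVar ''i'') (WConst 1))))))
          (wset ''i'' (wval MM \<sigma> (WConst 0)) \<sigma>) \<tau>"
      and b: "bval MM \<tau> (BAnd (WLess (WConst 0) (WVar ''f'')) (BAnd (WLess (WVar ''i'') (WVar ''N''))
          (BAnd (RLess (RVar ''v'') RZero) (RLess (RAdd (RVar ''v'') (RArr ''W'' (WAdd (WMult (WVar ''p'') (WVar ''N'')) (WArr ''S'' (ix ''p'' ''i''))))) RZero))))"
    obtain i where i: "i \<le> N" "wvar \<tau> ''i'' = i" "so ` {..<i} \<subseteq> Z"
      "\<And>w. w < N \<Longrightarrow> rarr \<tau> ''K'' w = (if w \<in> so ` {..<i} \<and> 0 \<le> G p w then min (?K w) (v + X p w) else ?K w)"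
      "\<And>w. w < N \<Longrightarrow> rarr \<tau> ''R'' w = (if w \<in> so ` {..<i} then min (?R w) (v + X p w) else ?R w)"
      "qok (rarr \<tau> ''K'') (warr \<tau> ''d'') (warr \<tau> ''b'')" "wvar \<tau> ''f'' + i = ?f" using I unfolding I_def by auto
    have w: "wvar \<tau> ''p'' = p" "wvar \<tau> ''N'' = N" "warr \<tau> ''S'' = warr \<sigma> ''S''" "rvar \<tau> ''v'' = v"
      "rarr \<tau> ''W'' = rarr \<sigma> ''W''" "rarr \<tau> ''M'' = rarr \<sigma> ''M''"
      using fr p v cN by (auto simp: fr_def)
    have iN: "i < N" using b i w by simp
    have ok\<tau>: "ok \<tau>" by (rule ok_fr[OF fr]) (use ok in \<open>auto simp: cns_def ok_def\<close>)
    have S: "wval MM \<tau> (ix ''p'' ''i'') = p * N + i" using w i iN p(2) by simp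
    have so: "warr \<sigma> ''S'' (p * N + i) = so i" by (simp add: so_def)
    have mod: "p * N + so i < MM" "p * N < MM" using pair_less_MM[OF p(2) soN[OF iN]] pair_less_MM[OF p(2), of 0] N1 by auto
    have f0: "0 < wvar \<tau> ''f''" and v0: "v < 0" "v + X p (so i) < 0"
      using b w S so mod X[OF soN[OF iN]] by auto
    have Zi: "so i \<in> Z" unfolding Z_def using v0 soN[OF iN] by (simp add: act_def)
    have nin: "so i \<notin> so ` {..<i}" using inj iN i(1) by auto
    let ?\<tau> = "\<tau>\<lparr>wvar := (wvar \<tau>)(''f'' := wvar \<tau> ''f'' - 1, ''w'' := so i)\<rparr>"
    have ok': "ok ?\<tau>" using ok\<tau> by (simp add: ok_def)
    have e: "wval MM \<tau>' (ix ''p'' ''w'') = p * N + so i" if "wvar \<tau>' = wvar ?\<tau>" for \<tau>'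
      using w that p(2) soN[OF iN] by simp
    have R: "wlp MM (RELAX ''M'' ''W'' (ix ''p'' ''w'')) (\<lambda>\<sigma>'. rarr \<sigma>' ''K'' = (if 0 \<le> rarr ?\<tau> ''M'' (p * N + so i) then (rarr ?\<tau> ''K'')(so i := min (rarr ?\<tau> ''K'' (so i)) (v + X p (so i))) else rarr ?\<tau> ''K'') \<and>
       rarr \<sigma>' ''R'' = (rarr ?\<tau> ''R'')(so i := min (rarr ?\<tau> ''R'' (so i)) (v + X p (so i))) \<and>
       qok (rarr \<sigma>' ''K'') (warr \<sigma>' ''d'') (warr \<sigma>' ''b'')) ?\<tau>"
      by (rule wlp_RELAX[OF ok' _ soN[OF iN]]) (use e i(6) w X[OF soN[OF iN]] in simp_all)
    have g: "rarr \<tau> ''M'' (p * N + so i) = G p (so i)" using w G[OF soN[OF iN]] by simp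
    have Suc: "so ` {..<Suc i} = insert (so i) (so ` {..<i})" by (auto simp: less_Suc_eq)
    have R': "wlp MM (RELAX ''M'' ''W'' (ix ''p'' ''w'')) (wlp MM (WAssign ''i'' (WAdd (WVar ''i'') (WConst 1))) I) ?\<tau>"
    proof (rule wlp_conseq[OF R])
      fix \<tau>' assume a: "rarr \<tau>' ''K'' = (if 0 \<le> rarr ?\<tau> ''M'' (p * N + so i) then (rarr ?\<tau> ''K'')(so i := min (rarr ?\<tau> ''K'' (so i)) (v + X p (so i))) else rarr ?\<tau> ''K'') \<and>
         rarr \<tau>' ''R'' = (rarr ?\<tau> ''R'')(so i := min (rarr ?\<tau> ''R'' (so i)) (v + X p (so i))) \<and>
         qok (rarr \<tau>' ''K'') (warr \<tau>' ''d'') (warr \<tau>' ''b'')" and fr': "fr (RELAX ''M'' ''W'' (ix ''p'' ''w'')) ?\<tau> \<tau>'"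
      have w': "wvar \<tau>' ''i'' = i" "wvar \<tau>' ''f'' = wvar \<tau> ''f'' - 1" using fr' i by (auto simp: fr_def)
      have im: "(i + 1) mod MM = Suc i" using iN N_less by simp
      show "wlp MM (WAssign ''i'' (WAdd (WVar ''i'') (WConst 1))) I \<tau>'"
        unfolding wlp_WAssign wval.simps w' one_mod im I_def
      proof (intro exI[of _ "Suc i"] conjI allI impI)
        show "so ` {..<Suc i} \<subseteq> Z" using i(3) Zi Suc by simp
        fix x assume x: "x < N"
        show "rarr (wset ''i'' (Suc i) \<tau>') ''K'' x = (if x \<in> so ` {..<Suc i} \<and> 0 \<le> G p x then min (?K x) (v + X p x) else ?K x)"
          using a i(4)[OF x] i(4)[OF soN[OF iN]] nin g unfolding Suc by auto
        show "rarr (wset ''i'' (Suc i) \<tau>') ''R'' x = (if x \<in> so ` {..<Suc i} then min (?R x) (v + X p x) else ?R x)"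
          using a i(5)[OF x] i(5)[OF soN[OF iN]] nin unfolding Suc by auto
      qed (use iN a f0 i(7) w' in auto)
    qed
    show "wlp MM (Seq (WAssign ''f'' (WSub (WVar ''f'') (WConst 1)))
           (Seq (WAssign ''w'' (WArr ''S'' (ix ''p'' ''i'')))
             (Seq (RELAX ''M'' ''W'' (ix ''p'' ''w'')) (WAssign ''i'' (WAdd (WVar ''i'') (WConst 1)))))) I \<tau>"
      using R' w i iN p(2) so by simp
  next
    fix \<tau>
    assume I: "I \<tau>" and fr: "fr (Seq (WAssign ''f'' (WSub (WVar ''f'') (WConst 1)))
           (Seq (WAssign ''w'' (WArr ''S'' (ix ''p'' ''i'')))
             (Seq (RELAX ''M'' ''W'' (ix ''p'' ''w'')) (WAssign ''i'' (WAdd (WVar ''i'') (WConst 1))))))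
          (wset ''i'' (wval MM \<sigma> (WConst 0)) \<sigma>) \<tau>"
      and b: "\<not> bval MM \<tau> (BAnd (WLess (WConst 0) (WVar ''f'')) (BAnd (WLess (WVar ''i'') (WVar ''N''))
          (BAnd (RLess (RVar ''v'') RZero) (RLess (RAdd (RVar ''v'') (RArr ''W'' (WAdd (WMult (WVar ''p'') (WVar ''N'')) (WArr ''S'' (ix ''p'' ''i''))))) RZero))))"
    obtain i where i: "i \<le> N" "wvar \<tau> ''i'' = i" "so ` {..<i} \<subseteq> Z"
      "\<And>w. w < N \<Longrightarrow> rarr \<tau> ''K'' w = (if w \<in> so ` {..<i} \<and> 0 \<le> G p w then min (?K w) (v + X p w) else ?K w)"
      "\<And>w. w < N \<Longrightarrow> rarr \<tau> ''R'' w = (if w \<in> so ` {..<i} then min (?R w) (v + X p w) else ?R w)"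
      "qok (rarr \<tau> ''K'') (warr \<tau> ''d'') (warr \<tau> ''b'')" "wvar \<tau> ''f'' + i = ?f" using I unfolding I_def by auto
    have w: "wvar \<tau> ''p'' = p" "wvar \<tau> ''N'' = N" "warr \<tau> ''S'' = warr \<sigma> ''S''" "rvar \<tau> ''v'' = v"
      "rarr \<tau> ''W'' = rarr \<sigma> ''W''"
      using fr p v cN by (auto simp: fr_def)
    have Z: "so ` {..<i} = Z"
    proof (cases "wvar \<tau> ''f'' = 0")
      \<comment> \<open>If the fuel is used up, then by \<open>fuel\<close> at least as many edges
        have been relaxed as there are active ones, so these are all.\<close>
      case True
      then have "card Z \<le> i" using fuel i(7) by (simp add: Z_def)
      then show ?thesis using card_seteq[OF finZ i(3)] cardi[OF i(1)] by simp
    next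
      case False
      show ?thesis
      proof (cases "i = N")
        case True
        then have "so ` {..<i} = {..<N}" using bij by (auto simp: bij_betw_def)
        then show ?thesis using i(3) by (auto simp: Z_def)
      next
        case iN: False
        then have iN: "i < N" using i(1) by simp
        have S: "wval MM \<tau> (ix ''p'' ''i'') = p * N + i" using w i iN p(2) by simp
        have so: "warr \<sigma> ''S'' (p * N + i) = so i" by (simp add: so_def)
        have mod: "p * N + so i < MM" "p * N < MM" using pair_less_MM[OF p(2) soN[OF iN]] pair_less_MM[OF p(2), of 0] N1 by auto
        have nb: "\<not> (v < 0 \<and> v + X p (so i) < 0)" using b False w S so mod iN i X[OF soN[OF iN]] by auto
        have "Z \<subseteq> so ` {..<i}"
        proof
          fix z assume z: "z \<in> Z"
          then have "z \<in> so ` {..<N}" using bij by (auto simp: Z_def bij_betw_def)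
          then obtain j where j: "j < N" "z = so j" by auto
          have "j < i"
          proof (rule ccontr)
            assume "\<not> j < i"
            then have "X p (so i) \<le> X p (so j)" using mono j by simp
            then show False using z j nb by (auto simp: Z_def act_def)
          qed
          then show "z \<in> so ` {..<i}" using j by auto
        qed
        then show ?thesis using i(3) by blast
      qed
    qed
    have "wvar \<tau> ''f'' = ?f - card Z" using i(7) cardi[OF i(1)] Z by simp
    moreover have "w \<in> so ` {..<i} \<longleftrightarrow> act False v (X p w)" if "w < N" for w using Z that by (auto simp: Z_def)
    ultimately show "(\<forall>w<N. rarr \<tau> ''K'' w = (if act False v (X p w) \<and> 0 \<le> G p w then min (?K w) (v + X p w) else ?K w) \<and>
      rarr \<tau> ''R'' w = (if act False v (X p w) then min (?R w) (v + X p w) else ?R w)) \<and>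
      qok (rarr \<tau> ''K'') (warr \<tau> ''d'') (warr \<tau> ''b'') \<and> wvar \<tau> ''f'' = ?f - card {w. w < N \<and> act False v (X p w)}"
      using i(4,5,6) unfolding Z_def by simp
  qed
qed

end

section \<open>Sorting and reweighting\<close>

text \<open>The invariant sees the real-valued memory only, hence the updates of the two counters
  preserve it; the position is passed as the arguments \<open>a\<close> and \<open>x\<close>
  instead.\<close>

lemma wlp_FOR2:
  assumes X: "wvar \<sigma> X = ca" "ca < M" and Y: "wvar \<sigma> Y = cb" "cb < M"
    and n: "i \<notin> ww c" "j \<notin> ww c" "X \<notin> ww c" "Y \<notin> ww c" "i \<noteq> X" "i \<noteq> Y" "j \<noteq> X" "j \<noteq> Y" "i \<noteq> j"
    and I0: "I 0 0 (rarr \<sigma>) (rvar \<sigma>)"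
    and step: "\<And>a x \<tau>. a < ca \<Longrightarrow> x < cb \<Longrightarrow> I a x (rarr \<tau>) (rvar \<tau>) \<Longrightarrow> fr (FOR i X (FOR j Y c)) \<sigma> \<tau> \<Longrightarrow>
       wvar \<tau> i = a \<Longrightarrow> wvar \<tau> j = x \<Longrightarrow> wlp M c (\<lambda>\<tau>'. I a (Suc x) (rarr \<tau>') (rvar \<tau>')) \<tau>"
    and row: "\<And>a r v. a < ca \<Longrightarrow> I a cb r v \<Longrightarrow> I (Suc a) 0 r v"
    and exit: "\<And>\<tau>. I ca 0 (rarr \<tau>) (rvar \<tau>) \<Longrightarrow> fr (FOR i X (FOR j Y c)) \<sigma> \<tau> \<Longrightarrow> Q \<tau>"
  shows "wlp M (FOR i X (FOR j Y c)) Q \<sigma>"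
proof (rule wlp_FOR[where I = "\<lambda>k \<tau>. I k 0 (rarr \<tau>) (rvar \<tau>)"])
  show "wvar \<sigma> X < M" "i \<notin> ww (FOR j Y c)" "X \<notin> ww (FOR j Y c)" "i \<noteq> X" using X n by auto
  show "I 0 0 (rarr (wset i 0 \<sigma>)) (rvar (wset i 0 \<sigma>))" using I0 by simp
  show "Q \<tau>" if "I (wvar \<sigma> X) 0 (rarr \<tau>) (rvar \<tau>)" "fr (FOR i X (FOR j Y c)) \<sigma> \<tau>" for \<tau>
    using exit that X by simp
  fix k \<tau>
  assume k: "k < wvar \<sigma> X" and I: "I k 0 (rarr \<tau>) (rvar \<tau>)" and fr1: "fr (FOR i X (FOR j Y c)) \<sigma> \<tau>" and ik: "wvar \<tau> i = k"
  have Y': "wvar \<tau> Y = cb" using frw[OF fr1, of Y] n Y by simp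
  show "wlp M (FOR j Y c) (\<lambda>\<tau>'. I (Suc k) 0 (rarr (wset i (Suc k) \<tau>')) (rvar (wset i (Suc k) \<tau>'))) \<tau>"
  proof (rule wlp_FOR[where I = "\<lambda>x \<tau>. I k x (rarr \<tau>) (rvar \<tau>)"])
    show "wvar \<tau> Y < M" "j \<notin> ww c" "Y \<notin> ww c" "j \<noteq> Y" using Y Y' n by auto
    show "I k 0 (rarr (wset j 0 \<tau>)) (rvar (wset j 0 \<tau>))" using I by simp
    show "I (Suc k) 0 (rarr (wset i (Suc k) \<tau>')) (rvar (wset i (Suc k) \<tau>'))" if "I k (wvar \<tau> Y) (rarr \<tau>') (rvar \<tau>')" for \<tau>'
      using row[of k] k X that Y' by simp
    fix x \<tau>' assume x: "x < wvar \<tau> Y" and I': "I k x (rarr \<tau>') (rvar \<tau>')" and fr2: "fr (FOR j Y c) \<tau> \<tau>'" and jx: "wvar \<tau>' j = x"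
    have fr3: "fr (FOR i X (FOR j Y c)) \<sigma> \<tau>'" by (rule fr_trans[OF fr1 fr2]) (auto simp: wsub_def)
    have ik': "wvar \<tau>' i = k" using frw[OF fr2, of i] n ik by simp
    show "wlp M c (\<lambda>\<tau>'. I k (Suc x) (rarr (wset j (Suc x) \<tau>')) (rvar (wset j (Suc x) \<tau>'))) \<tau>'"
      using step[OF _ _ I' fr3 ik' jx] k x X Y' by simp
  qed
qed

context sizes
begin

abbreviation mt :: "machine_state \<Rightarrow> string \<Rightarrow> nat \<Rightarrow> nat \<Rightarrow> real" where
  "mt \<sigma> a x y \<equiv> rarr \<sigma> a (x * N + y)"

lemma wlp_SORT:
  assumes ok: "ok \<sigma>" and e: "wvar \<sigma> e = k'" "k' \<le> N" "e \<in> {''n'', ''N''}" and X: "X \<noteq> ''K''"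
  shows "wlp MM (SORT X e) (\<lambda>\<sigma>'. \<forall>r<k'. srt (warr \<sigma>' ''S'') (\<lambda>r x. mt \<sigma> X r x) k' r) \<sigma>"
proof -
  let ?X = "\<lambda>r x. mt \<sigma> X r x"
  have cN: "wvar \<sigma> ''N'' = N" using ok by (simp add: ok_def)
  have srt_cong: "srt a ?X k' r" if "srt b ?X k' r" "\<And>i. i < k' \<Longrightarrow> a (r * N + i) = b (r * N + i)" for a b r
    using that(1) bij_betw_cong[of "{..<k'}" "\<lambda>i. a (r * N + i)" "\<lambda>i. b (r * N + i)" "{..<k'}"] that(2)
    unfolding srt_def by simp
  show ?thesis
    unfolding SORT_def
  proof (rule wlp_FOR[where I = "\<lambda>k \<tau>. \<forall>r<k. srt (warr \<tau> ''S'') ?X k' r"])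
    show "wvar \<sigma> e < MM" using e N_less by simp
    show "''r'' \<noteq> e" using e by auto
    show "\<forall>r<k'. srt (warr \<tau> ''S'') ?X k' r" if "\<forall>r<wvar \<sigma> e. srt (warr \<tau> ''S'') ?X k' r" for \<tau> using that e by simp
    fix r \<tau>
    assume r: "r < wvar \<sigma> e" and I: "\<forall>r'<r. srt (warr \<tau> ''S'') ?X k' r'"
      and fr1: "fr (FOR ''r'' e (Seq (ROWK X (ix ''r'' ''x'')) (Seq (INITQ e) (FOR ''c'' e (Seq EXTRACT (WStore ''S'' (ix ''r'' ''c'') (WVar ''p''))))))) \<sigma> \<tau>"
      and rr: "wvar \<tau> ''r'' = r"
    have rk: "r < k'" "r < N" using r e by auto
    have ok1: "ok \<tau>" by (rule ok_fr[OF fr1 ok]) (auto simp: cns_def)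
    have X1: "rarr \<tau> X = rarr \<sigma> X" using frra[OF fr1, of X] X by simp
    have R: "wlp MM (ROWK X (ix ''r'' ''x'')) (\<lambda>\<sigma>'. \<forall>x<N. rarr \<sigma>' ''K'' x = rarr \<tau> X (r * N + x)) \<tau>"
    proof (rule wlp_ROWK[OF ok1 X])
      fix \<tau>' x assume "ok \<tau>'" "fr (ROWK X (ix ''r'' ''x'')) \<tau> \<tau>'" "wvar \<tau>' ''x'' = x" "x < N"
      then show "wval MM \<tau>' (ix ''r'' ''x'') = r * N + x" using rr rk frw[of _ \<tau> \<tau>' "''r''"] by (simp add: ok_def)
    qed
    show "wlp MM (Seq (ROWK X (ix ''r'' ''x'')) (Seq (INITQ e) (FOR ''c'' e (Seq EXTRACT (WStore ''S'' (ix ''r'' ''c'') (WVar ''p''))))))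
      (\<lambda>\<tau>'. \<forall>r'<Suc r. srt (warr (wset ''r'' (Suc r) \<tau>') ''S'') ?X k' r') \<tau>"
      unfolding wlp_Seq
    proof (rule wlp_conseq[OF R])
      fix \<tau>1 assume K1: "\<forall>x<N. rarr \<tau>1 ''K'' x = rarr \<tau> X (r * N + x)" and fr2: "fr (ROWK X (ix ''r'' ''x'')) \<tau> \<tau>1"
      have ok2: "ok \<tau>1" by (rule ok_fr[OF fr2 ok1]) (auto simp: cns_def)
      have ek: "wvar \<tau>1 e = k'" using ok2 ok e by (auto simp: ok_def)
      show "wlp MM (INITQ e) (wlp MM (FOR ''c'' e (Seq EXTRACT (WStore ''S'' (ix ''r'' ''c'') (WVar ''p''))))
         (\<lambda>\<tau>'. \<forall>r'<Suc r. srt (warr (wset ''r'' (Suc r) \<tau>') ''S'') ?X k' r')) \<tau>1"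
      proof (rule wlp_conseq[OF wlp_INITQ[OF ok2 ek]])
        show "e \<notin> {''x'', ''j'', ''y'', ''e'', ''o''}" using e by auto
        fix \<tau>2 assume q2: "(\<forall>x<N. warr \<tau>2 ''d'' x = (if x < k' then 0 else 1)) \<and> qok (rarr \<tau>2 ''K'') (warr \<tau>2 ''d'') (warr \<tau>2 ''b'')"
          and fr3: "fr (INITQ e) \<tau>1 \<tau>2"
        have ok3: "ok \<tau>2" by (rule ok_fr[OF fr3 ok2]) (auto simp: cns_def)
        have ek2: "wvar \<tau>2 e = k'" using ok3 ok e by (auto simp: ok_def)
        have r2: "wvar \<tau>2 ''r'' = r" using frw[OF fr3, of "''r''"] frw[OF fr2, of "''r''"] rr by simp
        have S2: "warr \<tau>2 ''S'' = warr \<tau> ''S''" using frwa[OF fr3, of "''S''"] frwa[OF fr2, of "''S''"] by simp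
        have K2: "rarr \<tau>2 ''K'' x = ?X r x" if "x < N" for x using frra[OF fr3, of "''K''"] K1 X1 that by simp
        define K where "K = rarr \<tau>2 ''K''"
        \<comment> \<open>Selection sort: the positions below \<open>c\<close> hold distinct
          elements in the order of their keys, no remaining element has a smaller key, and the queue
          holds exactly the remaining ones. The last clause protects the rows that are already
          sorted.\<close>
        define J :: "nat \<Rightarrow> machine_state \<Rightarrow> bool" where "J = (\<lambda>c \<tau>'. let so = (\<lambda>i. warr \<tau>' ''S'' (r * N + i)) in
          inj_on so {..<c} \<and> so ` {..<c} \<subseteq> {..<k'} \<and> (\<forall>i j. i \<le> j \<and> j < c \<longrightarrow> K (so i) \<le> K (so j)) \<and>
          (\<forall>w<N. warr \<tau>' ''d'' w = 0 \<longleftrightarrow> w < k' \<and> w \<notin> so ` {..<c}) \<and>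
          (\<forall>i<c. \<forall>w<k'. w \<notin> so ` {..<c} \<longrightarrow> K (so i) \<le> K w) \<and>
          qok K (warr \<tau>' ''d'') (warr \<tau>' ''b'') \<and> (\<forall>r'<r. \<forall>i<k'. warr \<tau>' ''S'' (r' * N + i) = warr \<tau> ''S'' (r' * N + i)))"
        show "wlp MM (FOR ''c'' e (Seq EXTRACT (WStore ''S'' (ix ''r'' ''c'') (WVar ''p''))))
           (\<lambda>\<tau>'. \<forall>r'<Suc r. srt (warr (wset ''r'' (Suc r) \<tau>') ''S'') ?X k' r') \<tau>2"
        proof (rule wlp_FOR[where I = J])
          show "wvar \<tau>2 e < MM" using ek2 e N_less by simp
          show "J 0 (wset ''c'' 0 \<tau>2)" unfolding J_def using q2 S2 by (simp add: K_def)
          fix c \<tau>3 assume c: "c < wvar \<tau>2 e" and J: "J c \<tau>3"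
            and fr4: "fr (FOR ''c'' e (Seq EXTRACT (WStore ''S'' (ix ''r'' ''c'') (WVar ''p'')))) \<tau>2 \<tau>3" and cc: "wvar \<tau>3 ''c'' = c"
          define so where "so = (\<lambda>i. warr \<tau>3 ''S'' (r * N + i))"
          have J': "inj_on so {..<c}" "so ` {..<c} \<subseteq> {..<k'}" "\<And>i j. i \<le> j \<Longrightarrow> j < c \<Longrightarrow> K (so i) \<le> K (so j)"
            "\<And>w. w < N \<Longrightarrow> warr \<tau>3 ''d'' w = 0 \<longleftrightarrow> w < k' \<and> w \<notin> so ` {..<c}"
            "\<And>i w. i < c \<Longrightarrow> w < k' \<Longrightarrow> w \<notin> so ` {..<c} \<Longrightarrow> K (so i) \<le> K w"
            "qok K (warr \<tau>3 ''d'') (warr \<tau>3 ''b'')"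
            "\<And>r' i. r' < r \<Longrightarrow> i < k' \<Longrightarrow> warr \<tau>3 ''S'' (r' * N + i) = warr \<tau> ''S'' (r' * N + i)"
            using J unfolding J_def Let_def so_def by blast+
          have ck: "c < k'" using c ek2 by simp
          have K3: "rarr \<tau>3 ''K'' = K" using frra[OF fr4, of "''K''"] by (simp add: K_def)
          have ok4: "ok \<tau>3" by (rule ok_fr[OF fr4 ok3]) (auto simp: cns_def)
          have r3: "wvar \<tau>3 ''r'' = r" using frw[OF fr4, of "''r''"] r2 by simp
          have "so ` {..<c} \<noteq> {..<k'}"
          proof
            assume "so ` {..<c} = {..<k'}"
            then have "card {..<k'} = card {..<c}" using card_image[OF J'(1)] by simp
            then show False using ck by simp
          qed
          then obtain al where al: "al < k'" "al \<notin> so ` {..<c}" using J'(2) by auto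
          have alN: "al < N" "warr \<tau>3 ''d'' al = 0" using al e J'(4)[of al] by auto
          show "wlp MM (Seq EXTRACT (WStore ''S'' (ix ''r'' ''c'') (WVar ''p''))) (\<lambda>\<tau>'. J (Suc c) (wset ''c'' (Suc c) \<tau>')) \<tau>3"
            unfolding wlp_Seq
          proof (rule wlp_conseq[OF wlp_EXTRACT[OF ok4 _ alN]])
            show "qok (rarr \<tau>3 ''K'') (warr \<tau>3 ''d'') (warr \<tau>3 ''b'')" using J'(6) K3 by simp
            fix \<tau>4 assume "\<exists>p<N. wvar \<tau>4 ''p'' = p \<and> warr \<tau>3 ''d'' p = 0 \<and>
               (\<forall>w<N. warr \<tau>3 ''d'' w = 0 \<longrightarrow> rarr \<tau>3 ''K'' p \<le> rarr \<tau>3 ''K'' w) \<and>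
               warr \<tau>4 ''d'' = (warr \<tau>3 ''d'')(p := 1) \<and> qok (rarr \<tau>3 ''K'') ((warr \<tau>3 ''d'')(p := 1)) (warr \<tau>4 ''b'')"
              and fr5: "fr EXTRACT \<tau>3 \<tau>4"
            then obtain p where p: "p < N" "wvar \<tau>4 ''p'' = p" "warr \<tau>3 ''d'' p = 0"
              "\<And>w. w < N \<Longrightarrow> warr \<tau>3 ''d'' w = 0 \<Longrightarrow> K p \<le> K w" "warr \<tau>4 ''d'' = (warr \<tau>3 ''d'')(p := 1)"
              "qok K (warr \<tau>4 ''d'') (warr \<tau>4 ''b'')" using K3 by auto
            have w4: "wvar \<tau>4 ''r'' = r" "wvar \<tau>4 ''c'' = c" "wvar \<tau>4 ''N'' = N" "warr \<tau>4 ''S'' = warr \<tau>3 ''S''"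
              using frw[OF fr5, of "''r''"] frw[OF fr5, of "''c''"] frw[OF fr5, of "''N''"] frwa[OF fr5, of "''S''"] r3 cc ok4
              by (auto simp: ok_def)
            have ixv: "wval MM \<tau>4 (ix ''r'' ''c'') = r * N + c" using w4 rk ck e by simp
            have pk: "p < k'" "p \<notin> so ` {..<c}" using J'(4)[OF p(1)] p(3) by auto
            define S' where "S' = (warr \<tau>3 ''S'')(r * N + c := p)"
            define so' where "so' = (\<lambda>i. S' (r * N + i))"
            have so': "so' i = (if i = c then p else so i)" for i by (simp add: so'_def S'_def so_def)
            have im: "so' ` {..<Suc c} = insert p (so ` {..<c})" by (auto simp: so' less_Suc_eq)
            have inj': "inj_on so' {..<Suc c}"
              using J'(1) pk(2) unfolding inj_on_def by (auto simp: so' less_Suc_eq)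
            have mono': "K (so' i) \<le> K (so' j)" if "i \<le> j" "j < Suc c" for i j
              using that J'(3)[of i j] J'(5)[of i p] pk by (auto simp: so' less_Suc_eq)
            have d': "warr \<tau>4 ''d'' w = 0 \<longleftrightarrow> w < k' \<and> w \<notin> so' ` {..<Suc c}" if "w < N" for w
              using J'(4)[OF that] p(5) unfolding im by auto
            have rest: "K (so' i) \<le> K w" if "i < Suc c" "w < k'" "w \<notin> so' ` {..<Suc c}" for i w
            proof -
              have w: "w \<notin> so ` {..<c}" "w < N" using that e unfolding im by auto
              then have "warr \<tau>3 ''d'' w = 0" using J'(4)[of w] that by blast
              then show ?thesis using p(4)[OF w(2)] J'(5)[OF _ that(2) w(1), of i] that(1) by (auto simp: so' less_Suc_eq)
            qed
            have old: "S' (r' * N + i) = warr \<tau> ''S'' (r' * N + i)" if "r' < r" "i < k'" for r' i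
              using J'(7)[OF that] that ck e pair_inj[of i c r' r] by (auto simp: S'_def)
            show "wlp MM (WStore ''S'' (ix ''r'' ''c'') (WVar ''p'')) (\<lambda>\<tau>'. J (Suc c) (wset ''c'' (Suc c) \<tau>')) \<tau>4"
              unfolding wlp_WStore ixv wval.simps p(2) w4(4) S'_def[symmetric] J_def Let_def
              using inj' mono' d' rest old p(6) im pk J'(2) unfolding so'_def by simp
          qed
        next
          fix \<tau>3 assume J: "J (wvar \<tau>2 e) \<tau>3"
          define so where "so = (\<lambda>i. warr \<tau>3 ''S'' (r * N + i))"
          have J': "inj_on so {..<k'}" "so ` {..<k'} \<subseteq> {..<k'}" "\<And>i j. i \<le> j \<Longrightarrow> j < k' \<Longrightarrow> K (so i) \<le> K (so j)"
            "\<And>r' i. r' < r \<Longrightarrow> i < k' \<Longrightarrow> warr \<tau>3 ''S'' (r' * N + i) = warr \<tau> ''S'' (r' * N + i)"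
            using J ek2 unfolding J_def Let_def so_def by blast+
          have im: "so ` {..<k'} = {..<k'}" using J'(1,2) card_subset_eq[of "{..<k'}"] card_image[OF J'(1)] by simp
          have KX: "K (so i) = ?X r (so i)" if "i < k'" for i
          proof -
            have "so i < N" using im that e by (metis imageI lessThan_iff order_less_le_trans)
            then show ?thesis using K2 by (simp add: K_def)
          qed
          have "srt (warr \<tau>3 ''S'') ?X k' r"
            unfolding srt_def
          proof (intro conjI allI impI)
            show "bij_betw (\<lambda>i. warr \<tau>3 ''S'' (r * N + i)) {..<k'} {..<k'}" using J'(1) im by (simp add: bij_betw_def so_def)
            fix i j assume "i \<le> j \<and> j < k'"
            then show "mt \<sigma> X r (warr \<tau>3 ''S'' (r * N + i)) \<le> mt \<sigma> X r (warr \<tau>3 ''S'' (r * N + j))"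
              using J'(3)[of i j] KX[of i] KX[of j] by (simp add: so_def)
          qed
          moreover have "srt (warr \<tau>3 ''S'') ?X k' r'" if "r' < r" for r'
            using srt_cong[OF I[rule_format, OF that]] J'(4)[OF that] by blast
          ultimately show "\<forall>r'<Suc r. srt (warr (wset ''r'' (Suc r) \<tau>3) ''S'') ?X k' r'" by (simp add: less_Suc_eq)
        qed (use e in auto)
      qed
    qed
  qed (use e in auto)
qed

lemma wlp_COPY:
  assumes ok: "ok \<sigma>"
  shows "wlp MM COPY (\<lambda>\<sigma>'. \<forall>x<N. \<forall>y<N. mt \<sigma>' ''H'' x y = mt \<sigma> ''M'' x y \<and> mt \<sigma>' ''W'' x y = mt \<sigma> ''M'' x y) \<sigma>"
proof -
  have cN: "wvar \<sigma> ''N'' = N" using ok by (simp add: ok_def)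
  let ?P = "\<lambda>a x u w. u < a \<or> u = a \<and> w < (x::nat)"
  show ?thesis
    unfolding COPY_def
  proof (rule wlp_FOR2[where ca = N and cb = N and I = "\<lambda>a x r v. \<forall>u<N. \<forall>w<N. u < a \<or> u = a \<and> w < x \<longrightarrow>
      r ''H'' (u * N + w) = mt \<sigma> ''M'' u w \<and> r ''W'' (u * N + w) = mt \<sigma> ''M'' u w"])
    fix a x \<tau>
    assume ax: "a < N" "x < N" and I: "\<forall>u<N. \<forall>w<N. u < a \<or> u = a \<and> w < x \<longrightarrow>
      mt \<tau> ''H'' u w = mt \<sigma> ''M'' u w \<and> mt \<tau> ''W'' u w = mt \<sigma> ''M'' u w"
      and fr: "fr (FOR ''r'' ''N'' (FOR ''x'' ''N'' (Seq (RStore ''H'' (ix ''r'' ''x'') (RArr ''M'' (ix ''r'' ''x'')))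
          (RStore ''W'' (ix ''r'' ''x'') (RArr ''M'' (ix ''r'' ''x'')))))) \<sigma> \<tau>"
      and v: "wvar \<tau> ''r'' = a" "wvar \<tau> ''x'' = x"
    have w: "wvar \<tau> ''N'' = N" "rarr \<tau> ''M'' = rarr \<sigma> ''M''" using frw[OF fr, of "''N''"] frra[OF fr, of "''M''"] cN by auto
    show "wlp MM (Seq (RStore ''H'' (ix ''r'' ''x'') (RArr ''M'' (ix ''r'' ''x'')))
          (RStore ''W'' (ix ''r'' ''x'') (RArr ''M'' (ix ''r'' ''x''))))
       (\<lambda>\<tau>'. \<forall>u<N. \<forall>w<N. u < a \<or> u = a \<and> w < Suc x \<longrightarrow> mt \<tau>' ''H'' u w = mt \<sigma> ''M'' u w \<and> mt \<tau>' ''W'' u w = mt \<sigma> ''M'' u w) \<tau>"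
      using I w v ax by (auto simp: less_Suc_eq)
  qed (use cN N_less in \<open>auto simp: less_Suc_eq\<close>)
qed

lemma wlp_REWEIGHT:
  assumes ok: "ok \<sigma>" and r: "wvar \<sigma> ''r'' = r" "r < N"
    and H1: "\<And>x y. H1 x y = (if x = r then rarr \<sigma> ''R'' y else if y = r then rarr \<sigma> ''V'' x else mt \<sigma> ''H'' x y)"
  shows "wlp MM REWEIGHT (\<lambda>\<sigma>'. (\<forall>x<N. \<forall>y<N. mt \<sigma>' ''H'' x y = H1 x y - rarr \<sigma> ''V'' x + rarr \<sigma> ''V'' y \<and>
       mt \<sigma>' ''W'' x y = mt \<sigma> ''W'' x y - rarr \<sigma> ''V'' x + rarr \<sigma> ''V'' y) \<and>
     (\<forall>x<n. rarr \<sigma>' ''P'' x = rarr \<sigma> ''P'' x + rarr \<sigma> ''V'' x)) \<sigma>"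
proof -
  let ?V = "rarr \<sigma> ''V''"
  have cN: "wvar \<sigma> ''N'' = N" "wvar \<sigma> ''n'' = n" using ok by (auto simp: ok_def)
  show ?thesis
    unfolding REWEIGHT_def wlp_Seq
  proof (rule wlp_FOR[where I = "\<lambda>k \<tau>. \<forall>x<N. \<forall>y<N. mt \<tau> ''H'' x y = (if y = r \<and> x < k then ?V x else mt \<sigma> ''H'' x y)"])
    fix k \<tau> assume k: "k < wvar \<sigma> ''N''" and I: "\<forall>x<N. \<forall>y<N. mt \<tau> ''H'' x y = (if y = r \<and> x < k then ?V x else mt \<sigma> ''H'' x y)"
      and fr: "fr (FOR ''x'' ''N'' (RStore ''H'' (ix ''x'' ''r'') (RArr ''V'' (WVar ''x'')))) \<sigma> \<tau>" and x: "wvar \<tau> ''x'' = k"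
    have w: "wvar \<tau> ''N'' = N" "rarr \<tau> ''V'' = ?V" "wvar \<tau> ''r'' = r"
      using frw[OF fr, of "''N''"] frw[OF fr, of "''r''"] frra[OF fr, of "''V''"] cN r by auto
    show "wlp MM (RStore ''H'' (ix ''x'' ''r'') (RArr ''V'' (WVar ''x'')))
       (\<lambda>\<tau>'. \<forall>xa<N. \<forall>y<N. mt (wset ''x'' (Suc k) \<tau>') ''H'' xa y = (if y = r \<and> xa < Suc k then ?V xa else mt \<sigma> ''H'' xa y)) \<tau>"
      using I w x k cN r pair_inj by (auto simp: less_Suc_eq)
  next
    fix \<tau>1 assume I1: "\<forall>x<N. \<forall>y<N. mt \<tau>1 ''H'' x y = (if y = r \<and> x < wvar \<sigma> ''N'' then ?V x else mt \<sigma> ''H'' x y)"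
      and fr1: "fr (FOR ''x'' ''N'' (RStore ''H'' (ix ''x'' ''r'') (RArr ''V'' (WVar ''x'')))) \<sigma> \<tau>1"
    have w1: "wvar \<tau>1 ''N'' = N" "wvar \<tau>1 ''n'' = n" "rarr \<tau>1 ''V'' = ?V" "rarr \<tau>1 ''R'' = rarr \<sigma> ''R''" "rarr \<tau>1 ''W'' = rarr \<sigma> ''W''"
      "rarr \<tau>1 ''P'' = rarr \<sigma> ''P''" "wvar \<tau>1 ''r'' = r"
      by (simp_all add: frw[OF fr1] frra[OF fr1] cN r)
    show "wlp MM (FOR ''x'' ''N'' (RStore ''H'' (ix ''r'' ''x'') (RArr ''R'' (WVar ''x''))))
       (wlp MM (FOR ''a'' ''N'' (FOR ''x'' ''N'' (Seq (SHIFT ''H'') (SHIFT ''W''))))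
         (wlp MM (FOR ''x'' ''n'' (RStore ''P'' (WVar ''x'') (RAdd (RArr ''P'' (WVar ''x'')) (RArr ''V'' (WVar ''x'')))))
           (\<lambda>\<sigma>'. (\<forall>x<N. \<forall>y<N. mt \<sigma>' ''H'' x y = H1 x y - ?V x + ?V y \<and> mt \<sigma>' ''W'' x y = mt \<sigma> ''W'' x y - ?V x + ?V y) \<and>
             (\<forall>x<n. rarr \<sigma>' ''P'' x = rarr \<sigma> ''P'' x + ?V x)))) \<tau>1"
    proof (rule wlp_FOR[where I = "\<lambda>k \<tau>. \<forall>x<N. \<forall>y<N. mt \<tau> ''H'' x y = (if x = r \<and> y < k then rarr \<sigma> ''R'' y else mt \<tau>1 ''H'' x y)"])
      fix k \<tau> assume k: "k < wvar \<tau>1 ''N''" and I: "\<forall>x<N. \<forall>y<N. mt \<tau> ''H'' x y = (if x = r \<and> y < k then rarr \<sigma> ''R'' y else mt \<tau>1 ''H'' x y)"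
        and fr: "fr (FOR ''x'' ''N'' (RStore ''H'' (ix ''r'' ''x'') (RArr ''R'' (WVar ''x'')))) \<tau>1 \<tau>" and x: "wvar \<tau> ''x'' = k"
      have w: "wvar \<tau> ''N'' = N" "rarr \<tau> ''R'' = rarr \<sigma> ''R''" "wvar \<tau> ''r'' = r"
        by (simp_all add: frw[OF fr] frra[OF fr] w1)
      show "wlp MM (RStore ''H'' (ix ''r'' ''x'') (RArr ''R'' (WVar ''x'')))
       (\<lambda>\<tau>'. \<forall>xa<N. \<forall>y<N. mt (wset ''x'' (Suc k) \<tau>') ''H'' xa y = (if xa = r \<and> y < Suc k then rarr \<sigma> ''R'' y else mt \<tau>1 ''H'' xa y)) \<tau>"
        using I w x k w1 r pair_inj by (auto simp: less_Suc_eq)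
    next
      fix \<tau>2 assume I2: "\<forall>x<N. \<forall>y<N. mt \<tau>2 ''H'' x y = (if x = r \<and> y < wvar \<tau>1 ''N'' then rarr \<sigma> ''R'' y else mt \<tau>1 ''H'' x y)"
        and fr2: "fr (FOR ''x'' ''N'' (RStore ''H'' (ix ''r'' ''x'') (RArr ''R'' (WVar ''x'')))) \<tau>1 \<tau>2"
      have w2: "wvar \<tau>2 ''N'' = N" "wvar \<tau>2 ''n'' = n" "rarr \<tau>2 ''V'' = ?V" "rarr \<tau>2 ''W'' = rarr \<sigma> ''W''" "rarr \<tau>2 ''P'' = rarr \<sigma> ''P''"
        by (simp_all add: frw[OF fr2] frra[OF fr2] w1)
      have H2: "mt \<tau>2 ''H'' x y = H1 x y" if "x < N" "y < N" for x y
        using I1 I2 that cN w1 by (auto simp: H1)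
      show "wlp MM (FOR ''a'' ''N'' (FOR ''x'' ''N'' (Seq (SHIFT ''H'') (SHIFT ''W''))))
         (wlp MM (FOR ''x'' ''n'' (RStore ''P'' (WVar ''x'') (RAdd (RArr ''P'' (WVar ''x'')) (RArr ''V'' (WVar ''x'')))))
           (\<lambda>\<sigma>'. (\<forall>x<N. \<forall>y<N. mt \<sigma>' ''H'' x y = H1 x y - ?V x + ?V y \<and> mt \<sigma>' ''W'' x y = mt \<sigma> ''W'' x y - ?V x + ?V y) \<and>
             (\<forall>x<n. rarr \<sigma>' ''P'' x = rarr \<sigma> ''P'' x + ?V x))) \<tau>2"
      proof (rule wlp_FOR2[where ca = N and cb = N and I = "\<lambda>a x rr v. \<forall>u<N. \<forall>w<N.
          rr ''H'' (u * N + w) = H1 u w + (if u < a \<or> u = a \<and> w < x then ?V w - ?V u else 0) \<and>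
          rr ''W'' (u * N + w) = mt \<sigma> ''W'' u w + (if u < a \<or> u = a \<and> w < x then ?V w - ?V u else 0)"])
        fix a x \<tau>
        assume ax: "a < N" "x < N" and I: "\<forall>u<N. \<forall>w<N.
          mt \<tau> ''H'' u w = H1 u w + (if u < a \<or> u = a \<and> w < x then ?V w - ?V u else 0) \<and>
          mt \<tau> ''W'' u w = mt \<sigma> ''W'' u w + (if u < a \<or> u = a \<and> w < x then ?V w - ?V u else 0)"
          and fr: "fr (FOR ''a'' ''N'' (FOR ''x'' ''N'' (Seq (SHIFT ''H'') (SHIFT ''W'')))) \<tau>2 \<tau>"
          and v: "wvar \<tau> ''a'' = a" "wvar \<tau> ''x'' = x"
        have w: "wvar \<tau> ''N'' = N" "rarr \<tau> ''V'' = ?V"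
          using frw[OF fr, of "''N''"] frra[OF fr, of "''V''"] w2 by (auto simp: SHIFT_def)
        have old: "mt \<tau> ''H'' a x = H1 a x" "mt \<tau> ''W'' a x = mt \<sigma> ''W'' a x" using I ax by auto
        show "wlp MM (Seq (SHIFT ''H'') (SHIFT ''W'')) (\<lambda>\<tau>'. \<forall>u<N. \<forall>w<N.
          mt \<tau>' ''H'' u w = H1 u w + (if u < a \<or> u = a \<and> w < Suc x then ?V w - ?V u else 0) \<and>
          mt \<tau>' ''W'' u w = mt \<sigma> ''W'' u w + (if u < a \<or> u = a \<and> w < Suc x then ?V w - ?V u else 0)) \<tau>"
          unfolding SHIFT_def using I old w v ax pair_inj by (auto simp: less_Suc_eq)
      next
        fix \<tau>3 assume I3: "\<forall>u<N. \<forall>w<N. mt \<tau>3 ''H'' u w = H1 u w + (if u < N \<or> u = N \<and> w < 0 then ?V w - ?V u else 0) \<and>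
          mt \<tau>3 ''W'' u w = mt \<sigma> ''W'' u w + (if u < N \<or> u = N \<and> w < 0 then ?V w - ?V u else 0)"
          and fr3: "fr (FOR ''a'' ''N'' (FOR ''x'' ''N'' (Seq (SHIFT ''H'') (SHIFT ''W'')))) \<tau>2 \<tau>3"
        have w3: "wvar \<tau>3 ''n'' = n" "rarr \<tau>3 ''V'' = ?V" "rarr \<tau>3 ''P'' = rarr \<sigma> ''P''"
          using frw[OF fr3, of "''n''"] frra[OF fr3, of "''V''"] frra[OF fr3, of "''P''"] w2 by (auto simp: SHIFT_def)
        show "wlp MM (FOR ''x'' ''n'' (RStore ''P'' (WVar ''x'') (RAdd (RArr ''P'' (WVar ''x'')) (RArr ''V'' (WVar ''x'')))))
           (\<lambda>\<sigma>'. (\<forall>x<N. \<forall>y<N. mt \<sigma>' ''H'' x y = H1 x y - ?V x + ?V y \<and> mt \<sigma>' ''W'' x y = mt \<sigma> ''W'' x y - ?V x + ?V y) \<and>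
             (\<forall>x<n. rarr \<sigma>' ''P'' x = rarr \<sigma> ''P'' x + ?V x)) \<tau>3"
        proof (rule wlp_FOR[where I = "\<lambda>k \<tau>. \<forall>x. rarr \<tau> ''P'' x = rarr \<sigma> ''P'' x + (if x < k then ?V x else 0)"])
          fix k \<tau> assume "\<forall>x. rarr \<tau> ''P'' x = rarr \<sigma> ''P'' x + (if x < k then ?V x else 0)" "wvar \<tau> ''x'' = k"
            and fr: "fr (FOR ''x'' ''n'' (RStore ''P'' (WVar ''x'') (RAdd (RArr ''P'' (WVar ''x'')) (RArr ''V'' (WVar ''x''))))) \<tau>3 \<tau>"
          moreover have "rarr \<tau> ''V'' = ?V" using frra[OF fr, of "''V''"] w3 by simp
          ultimately show "wlp MM (RStore ''P'' (WVar ''x'') (RAdd (RArr ''P'' (WVar ''x'')) (RArr ''V'' (WVar ''x''))))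
             (\<lambda>\<tau>'. \<forall>x. rarr (wset ''x'' (Suc k) \<tau>') ''P'' x = rarr \<sigma> ''P'' x + (if x < Suc k then ?V x else 0)) \<tau>"
            by (auto simp: less_Suc_eq)
        next
          fix \<tau>4 assume P: "\<forall>x. rarr \<tau>4 ''P'' x = rarr \<sigma> ''P'' x + (if x < wvar \<tau>3 ''n'' then ?V x else 0)"
            and fr: "fr (FOR ''x'' ''n'' (RStore ''P'' (WVar ''x'') (RAdd (RArr ''P'' (WVar ''x'')) (RArr ''V'' (WVar ''x''))))) \<tau>3 \<tau>4"
          have "rarr \<tau>4 ''H'' = rarr \<tau>3 ''H''" "rarr \<tau>4 ''W'' = rarr \<tau>3 ''W''"
            using frra[OF fr, of "''H''"] frra[OF fr, of "''W''"] by auto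
          then show "(\<forall>x<N. \<forall>y<N. mt \<tau>4 ''H'' x y = H1 x y - ?V x + ?V y \<and> mt \<tau>4 ''W'' x y = mt \<sigma> ''W'' x y - ?V x + ?V y) \<and>
             (\<forall>x<n. rarr \<tau>4 ''P'' x = rarr \<sigma> ''P'' x + ?V x)"
            using P I3 w3 by simp
        qed (use w3 n_less in auto)
      qed (use w2 N_less H2 in \<open>auto simp: SHIFT_def less_Suc_eq\<close>)
    qed (use w1 N_less in auto)
  qed (use cN N_less in auto)
qed

section \<open>Processing the hubs and exploring\<close>

lemma wlp_HUB:
  assumes ok: "ok \<sigma>" and r: "warr \<sigma> ''h'' (wvar \<sigma> ''h'') = r" "r < N"
    and inv: "hubinv N M h \<phi> (mt \<sigma> ''H'') D"
  shows "wlp MM HUB (\<lambda>\<sigma>'. \<exists>V. hubinv N M h (\<lambda>x. \<phi> x + V x) (mt \<sigma>' ''H'') (insert r D) \<and>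
     (\<forall>x<N. \<forall>y<N. mt \<sigma>' ''W'' x y = mt \<sigma> ''W'' x y - V x + V y) \<and>
     (\<forall>x<n. rarr \<sigma>' ''P'' x = rarr \<sigma> ''P'' x + V x)) \<sigma>"
proof -
  let ?H = "mt \<sigma> ''H''"
  define B where "B = (\<lambda>\<tau>. ok \<tau> \<and> wvar \<tau> ''r'' = r \<and> rarr \<tau> ''H'' = rarr \<sigma> ''H'' \<and> rarr \<tau> ''W'' = rarr \<sigma> ''W'' \<and> rarr \<tau> ''P'' = rarr \<sigma> ''P'')"
  have Bfr: "B \<tau>'" if "fr c \<tau> \<tau>'" "B \<tau>" "ww c \<inter> cns = {}" "''r'' \<notin> ww c" "''H'' \<notin> ra c" "''W'' \<notin> ra c" "''P'' \<notin> ra c" for c \<tau> \<tau>'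
    using that ok_fr[OF that(1)] by (simp add: B_def frw[OF that(1)] frra[OF that(1)])
  have rev: "wlp MM (DIJ (FULL ''H'' (ix ''w'' ''p''))) (\<lambda>\<sigma>'. dij N (\<lambda>p w. ?H w p) (\<lambda>p w. ?H w p) True a (rarr \<sigma>' ''K'') (rarr \<sigma>' ''R'') \<and> B \<sigma>') \<tau>"
    if "B \<tau>" "\<And>x. x < N \<Longrightarrow> rarr \<tau> ''K'' x = a x" for \<tau> a
  proof -
    have "wlp MM (DIJ (FULL ''H'' (ix ''w'' ''p''))) (\<lambda>\<sigma>'. dij N (\<lambda>p w. rarr \<tau> ''H'' (w * N + p)) (\<lambda>p w. rarr \<tau> ''H'' (w * N + p)) True a (rarr \<sigma>' ''K'') (rarr \<sigma>' ''R'')) \<tau>"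
      by (rule wlp_DIJ_FULL) (use that in \<open>auto simp: B_def ok_def\<close>)
    moreover have "rarr \<tau> ''H'' = rarr \<sigma> ''H''" using that(1) by (simp add: B_def)
    ultimately show ?thesis
      by (elim wlp_conseq) (use that(1) Bfr[of "DIJ (FULL ''H'' (ix ''w'' ''p''))" \<tau>] in \<open>simp add: cns_def\<close>)
  qed
  have fwd: "wlp MM (DIJ (FULL ''H'' (ix ''p'' ''w''))) (\<lambda>\<sigma>'. dij N ?H ?H True a (rarr \<sigma>' ''K'') (rarr \<sigma>' ''R'') \<and> B \<sigma>') \<tau>"
    if "B \<tau>" "\<And>x. x < N \<Longrightarrow> rarr \<tau> ''K'' x = a x" for \<tau> a
  proof -
    have "wlp MM (DIJ (FULL ''H'' (ix ''p'' ''w''))) (\<lambda>\<sigma>'. dij N (\<lambda>p w. rarr \<tau> ''H'' (p * N + w)) (\<lambda>p w. rarr \<tau> ''H'' (p * N + w)) True a (rarr \<sigma>' ''K'') (rarr \<sigma>' ''R'')) \<tau>"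
      by (rule wlp_DIJ_FULL) (use that in \<open>auto simp: B_def ok_def\<close>)
    moreover have "rarr \<tau> ''H'' = rarr \<sigma> ''H''" using that(1) by (simp add: B_def)
    ultimately show ?thesis
      by (elim wlp_conseq) (use that(1) Bfr[of "DIJ (FULL ''H'' (ix ''p'' ''w''))" \<tau>] in \<open>simp add: cns_def\<close>)
  qed
  have row: "wlp MM (ROWK X e) (\<lambda>\<sigma>'. (\<forall>x<N. rarr \<sigma>' ''K'' x = rarr \<tau> X (i x)) \<and> B \<sigma>') \<tau>"
    if B: "B \<tau>" and X: "X \<noteq> ''K''"
      and e: "\<And>\<tau>' x. ok \<tau>' \<Longrightarrow> wvar \<tau>' ''r'' = r \<Longrightarrow> wvar \<tau>' ''x'' = x \<Longrightarrow> x < N \<Longrightarrow> wval MM \<tau>' e = i x" for \<tau> X e i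
  proof -
    have "wlp MM (ROWK X e) (\<lambda>\<sigma>'. \<forall>x<N. rarr \<sigma>' ''K'' x = rarr \<tau> X (i x)) \<tau>"
    proof (rule wlp_ROWK[OF _ X])
      show "ok \<tau>" using B by (simp add: B_def)
      fix \<tau>' x assume "ok \<tau>'" "fr (ROWK X e) \<tau> \<tau>'" "wvar \<tau>' ''x'' = x" "x < N"
      then show "wval MM \<tau>' e = i x" using e B frw[of "ROWK X e" \<tau> \<tau>' "''r''"] by (simp add: B_def)
    qed
    then show ?thesis by (rule wlp_conseq) (use B Bfr[of "ROWK X e" \<tau>] in \<open>simp add: cns_def\<close>)
  qed
  have B0: "B (wset ''r'' r \<sigma>)" using ok by (simp add: B_def ok_def)
  show ?thesis
    unfolding HUB_def wlp_Seq wlp_WAssign wval.simps r(1)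
  proof (rule wlp_conseq[OF row[OF B0, of "''H''" "ix ''x'' ''r''" "\<lambda>x. x * N + r"]])
    fix \<tau>1 assume 1: "(\<forall>x<N. rarr \<tau>1 ''K'' x = rarr (wset ''r'' r \<sigma>) ''H'' (x * N + r)) \<and> B \<tau>1"
    show "wlp MM (DIJ (FULL ''H'' (ix ''w'' ''p''))) (wlp MM (ROWK ''R'' (WVar ''x'')) (wlp MM (DIJ (FULL ''H'' (ix ''w'' ''p'')))
       (wlp MM (FOR ''x'' ''N'' (RStore ''V'' (WVar ''x'') (RArr ''K'' (WVar ''x'')))) (wlp MM (ROWK ''H'' (ix ''r'' ''x''))
       (wlp MM (DIJ (FULL ''H'' (ix ''p'' ''w''))) (wlp MM REWEIGHT (\<lambda>\<sigma>'. \<exists>V. hubinv N M h (\<lambda>x. \<phi> x + V x) (mt \<sigma>' ''H'') (insert r D) \<and>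
        (\<forall>x<N. \<forall>y<N. mt \<sigma>' ''W'' x y = mt \<sigma> ''W'' x y - V x + V y) \<and> (\<forall>x<n. rarr \<sigma>' ''P'' x = rarr \<sigma> ''P'' x + V x)))))))) \<tau>1"
    proof (rule wlp_conseq[OF rev[of \<tau>1 "\<lambda>x. ?H x r"]])
      show "B \<tau>1" "\<And>x. x < N \<Longrightarrow> rarr \<tau>1 ''K'' x = mt \<sigma> ''H'' x r" using 1 by auto
      fix \<tau>2 assume 2: "dij N (\<lambda>p w. ?H w p) (\<lambda>p w. ?H w p) True (\<lambda>x. ?H x r) (rarr \<tau>2 ''K'') (rarr \<tau>2 ''R'') \<and> B \<tau>2"
      show "wlp MM (ROWK ''R'' (WVar ''x'')) (wlp MM (DIJ (FULL ''H'' (ix ''w'' ''p'')))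
       (wlp MM (FOR ''x'' ''N'' (RStore ''V'' (WVar ''x'') (RArr ''K'' (WVar ''x'')))) (wlp MM (ROWK ''H'' (ix ''r'' ''x''))
       (wlp MM (DIJ (FULL ''H'' (ix ''p'' ''w''))) (wlp MM REWEIGHT (\<lambda>\<sigma>'. \<exists>V. hubinv N M h (\<lambda>x. \<phi> x + V x) (mt \<sigma>' ''H'') (insert r D) \<and>
        (\<forall>x<N. \<forall>y<N. mt \<sigma>' ''W'' x y = mt \<sigma> ''W'' x y - V x + V y) \<and> (\<forall>x<n. rarr \<sigma>' ''P'' x = rarr \<sigma> ''P'' x + V x))))))) \<tau>2"
      proof (rule wlp_conseq[OF row[of \<tau>2 "''R''" "WVar ''x''" "\<lambda>x. x"]])
        show "B \<tau>2" using 2 by simp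
        fix \<tau>3 assume 3: "(\<forall>x<N. rarr \<tau>3 ''K'' x = rarr \<tau>2 ''R'' x) \<and> B \<tau>3"
        show "wlp MM (DIJ (FULL ''H'' (ix ''w'' ''p'')))
         (wlp MM (FOR ''x'' ''N'' (RStore ''V'' (WVar ''x'') (RArr ''K'' (WVar ''x'')))) (wlp MM (ROWK ''H'' (ix ''r'' ''x''))
         (wlp MM (DIJ (FULL ''H'' (ix ''p'' ''w''))) (wlp MM REWEIGHT (\<lambda>\<sigma>'. \<exists>V. hubinv N M h (\<lambda>x. \<phi> x + V x) (mt \<sigma>' ''H'') (insert r D) \<and>
          (\<forall>x<N. \<forall>y<N. mt \<sigma>' ''W'' x y = mt \<sigma> ''W'' x y - V x + V y) \<and> (\<forall>x<n. rarr \<sigma>' ''P'' x = rarr \<sigma> ''P'' x + V x)))))) \<tau>3"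
        proof (rule wlp_conseq[OF rev[of \<tau>3 "rarr \<tau>2 ''R''"]])
          show "B \<tau>3" "\<And>x. x < N \<Longrightarrow> rarr \<tau>3 ''K'' x = rarr \<tau>2 ''R'' x" using 3 by auto
          fix \<tau>4 assume 4: "dij N (\<lambda>p w. ?H w p) (\<lambda>p w. ?H w p) True (rarr \<tau>2 ''R'') (rarr \<tau>4 ''K'') (rarr \<tau>4 ''R'') \<and> B \<tau>4"
          have N4: "wvar \<tau>4 ''N'' = N" using 4 by (simp add: B_def ok_def)
          show "wlp MM (FOR ''x'' ''N'' (RStore ''V'' (WVar ''x'') (RArr ''K'' (WVar ''x'')))) (wlp MM (ROWK ''H'' (ix ''r'' ''x''))
           (wlp MM (DIJ (FULL ''H'' (ix ''p'' ''w''))) (wlp MM REWEIGHT (\<lambda>\<sigma>'. \<exists>V. hubinv N M h (\<lambda>x. \<phi> x + V x) (mt \<sigma>' ''H'') (insert r D) \<and>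
            (\<forall>x<N. \<forall>y<N. mt \<sigma>' ''W'' x y = mt \<sigma> ''W'' x y - V x + V y) \<and> (\<forall>x<n. rarr \<sigma>' ''P'' x = rarr \<sigma> ''P'' x + V x))))) \<tau>4"
          proof (rule wlp_FOR[where I = "\<lambda>k \<tau>. \<forall>x<k. rarr \<tau> ''V'' x = rarr \<tau>4 ''K'' x"])
            fix k \<tau> assume "\<forall>x<k. rarr \<tau> ''V'' x = rarr \<tau>4 ''K'' x" "wvar \<tau> ''x'' = k"
              and fr: "fr (FOR ''x'' ''N'' (RStore ''V'' (WVar ''x'') (RArr ''K'' (WVar ''x'')))) \<tau>4 \<tau>"
            then show "wlp MM (RStore ''V'' (WVar ''x'') (RArr ''K'' (WVar ''x''))) (\<lambda>\<tau>'. \<forall>x<Suc k. rarr (wset ''x'' (Suc k) \<tau>') ''V'' x = rarr \<tau>4 ''K'' x) \<tau>"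
              using frra[OF fr, of "''K''"] by (simp add: less_Suc_eq)
          next
            fix \<tau>5 assume V: "\<forall>x<wvar \<tau>4 ''N''. rarr \<tau>5 ''V'' x = rarr \<tau>4 ''K'' x"
              and fr: "fr (FOR ''x'' ''N'' (RStore ''V'' (WVar ''x'') (RArr ''K'' (WVar ''x'')))) \<tau>4 \<tau>5"
            have B5: "B \<tau>5" by (rule Bfr[OF fr]) (use 4 in \<open>auto simp: cns_def\<close>)
            show "wlp MM (ROWK ''H'' (ix ''r'' ''x'')) (wlp MM (DIJ (FULL ''H'' (ix ''p'' ''w''))) (wlp MM REWEIGHT (\<lambda>\<sigma>'. \<exists>V. hubinv N M h (\<lambda>x. \<phi> x + V x) (mt \<sigma>' ''H'') (insert r D) \<and>
              (\<forall>x<N. \<forall>y<N. mt \<sigma>' ''W'' x y = mt \<sigma> ''W'' x y - V x + V y) \<and> (\<forall>x<n. rarr \<sigma>' ''P'' x = rarr \<sigma> ''P'' x + V x)))) \<tau>5"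
            proof (rule wlp_conseq[OF row[OF B5, of "''H''" "ix ''r'' ''x''" "\<lambda>x. r * N + x"]])
              fix \<tau>6 assume 6: "(\<forall>x<N. rarr \<tau>6 ''K'' x = rarr \<tau>5 ''H'' (r * N + x)) \<and> B \<tau>6" and fr6: "fr (ROWK ''H'' (ix ''r'' ''x'')) \<tau>5 \<tau>6"
              show "wlp MM (DIJ (FULL ''H'' (ix ''p'' ''w''))) (wlp MM REWEIGHT (\<lambda>\<sigma>'. \<exists>V. hubinv N M h (\<lambda>x. \<phi> x + V x) (mt \<sigma>' ''H'') (insert r D) \<and>
                (\<forall>x<N. \<forall>y<N. mt \<sigma>' ''W'' x y = mt \<sigma> ''W'' x y - V x + V y) \<and> (\<forall>x<n. rarr \<sigma>' ''P'' x = rarr \<sigma> ''P'' x + V x))) \<tau>6"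
              proof (rule wlp_conseq[OF fwd[of \<tau>6 "?H r"]])
                show "B \<tau>6" "\<And>x. x < N \<Longrightarrow> rarr \<tau>6 ''K'' x = mt \<sigma> ''H'' r x" using 6 B5 by (auto simp: B_def)
                fix \<tau>7 assume 7: "dij N ?H ?H True (?H r) (rarr \<tau>7 ''K'') (rarr \<tau>7 ''R'') \<and> B \<tau>7"
                  and fr7: "fr (DIJ (FULL ''H'' (ix ''p'' ''w''))) \<tau>6 \<tau>7"
                have V7: "rarr \<tau>7 ''V'' = rarr \<tau>5 ''V''" by (simp add: frra[OF fr7] frra[OF fr6])
                define V where "V = rarr \<tau>7 ''V''"
                have VK: "V x = rarr \<tau>4 ''K'' x" if "x < N" for x using V V7 N4 that by (simp add: V_def)
                define H1 where "H1 = (\<lambda>x y. if x = r then rarr \<tau>7 ''R'' y else if y = r then V x else ?H x y)"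
                have B7: "ok \<tau>7" "wvar \<tau>7 ''r'' = r" "rarr \<tau>7 ''H'' = rarr \<sigma> ''H''" "rarr \<tau>7 ''W'' = rarr \<sigma> ''W''" "rarr \<tau>7 ''P'' = rarr \<sigma> ''P''"
                  using 7 by (auto simp: B_def)
                \<comment> \<open>\<open>dij\<close> looks at the keys below \<open>N\<close> only,
                  where the stored \<open>V\<close> agrees with the keys of the second run.\<close>
                have d2: "dij N (\<lambda>p w. ?H w p) (\<lambda>p w. ?H w p) True (rarr \<tau>2 ''R'') V (rarr \<tau>4 ''R'')"
                  using conjunct1[OF 4] unfolding dij_def by (simp add: VK cong: conj_cong)
                have H1eq: "H1 x y = (if x = r then rarr \<tau>7 ''R'' y else if y = r then rarr \<tau>7 ''V'' x else mt \<tau>7 ''H'' x y)" for x y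
                  using B7 by (simp add: H1_def V_def)
                show "wlp MM REWEIGHT (\<lambda>\<sigma>'. \<exists>V. hubinv N M h (\<lambda>x. \<phi> x + V x) (mt \<sigma>' ''H'') (insert r D) \<and>
                  (\<forall>x<N. \<forall>y<N. mt \<sigma>' ''W'' x y = mt \<sigma> ''W'' x y - V x + V y) \<and> (\<forall>x<n. rarr \<sigma>' ''P'' x = rarr \<sigma> ''P'' x + V x)) \<tau>7"
                proof (rule wlp_conseq[OF wlp_REWEIGHT[OF B7(1,2) r(2) H1eq]])
                  fix \<tau>8 assume 8: "(\<forall>x<N. \<forall>y<N. mt \<tau>8 ''H'' x y = H1 x y - rarr \<tau>7 ''V'' x + rarr \<tau>7 ''V'' y \<and>
                       mt \<tau>8 ''W'' x y = mt \<tau>7 ''W'' x y - rarr \<tau>7 ''V'' x + rarr \<tau>7 ''V'' y) \<and>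
                      (\<forall>x<n. rarr \<tau>8 ''P'' x = rarr \<tau>7 ''P'' x + rarr \<tau>7 ''V'' x)"
                  have "hubinv N M h (\<lambda>x. \<phi> x + V x) (mt \<tau>8 ''H'') (insert r D)"
                    by (rule hub_step[OF inv r(2) conjunct1[OF 2] d2 conjunct1[OF 7], of H1])
                       (use 8 in \<open>simp_all add: H1_def V_def\<close>)
                  then show "\<exists>V. hubinv N M h (\<lambda>x. \<phi> x + V x) (mt \<tau>8 ''H'') (insert r D) \<and>
                    (\<forall>x<N. \<forall>y<N. mt \<tau>8 ''W'' x y = mt \<sigma> ''W'' x y - V x + V y) \<and> (\<forall>x<n. rarr \<tau>8 ''P'' x = rarr \<sigma> ''P'' x + V x)"
                    using 8 B7 by (intro exI[of _ V]) (simp add: V_def)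
                qed
              qed
            qed (use r in \<open>auto simp: ok_def\<close>)
          qed (use N4 N_less in auto)
        qed
      qed (auto simp: ok_def)
    qed
  qed (use r in \<open>auto simp: ok_def\<close>)
qed

lemma wlp_HUBS:
  assumes ok: "ok \<sigma>" and hubs: "\<And>i. i < q \<Longrightarrow> warr \<sigma> ''h'' i < N"
    and HM: "\<And>x y. x < N \<Longrightarrow> y < N \<Longrightarrow> mt \<sigma> ''H'' x y = M x y" and WM: "\<And>x y. x < N \<Longrightarrow> y < N \<Longrightarrow> mt \<sigma> ''W'' x y = M x y"
    and feas: "\<And>x y. x < N \<Longrightarrow> y < N \<Longrightarrow> h y \<le> h x + M x y" and diag: "\<And>x. x < N \<Longrightarrow> M x x = 0"
  shows "wlp MM (FOR ''h'' ''q'' HUB) (\<lambda>\<sigma>'. \<exists>\<phi>. hubinv N M h \<phi> (mt \<sigma>' ''H'') (warr \<sigma> ''h'' ` {..<q}) \<and>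
     (\<forall>x<N. \<forall>y<N. mt \<sigma>' ''W'' x y = M x y - \<phi> x + \<phi> y) \<and> (\<forall>x<n. rarr \<sigma>' ''P'' x = rarr \<sigma> ''P'' x + \<phi> x)) \<sigma>"
proof -
  have cq: "wvar \<sigma> ''q'' = q" using ok by (simp add: ok_def)
  let ?I = "\<lambda>k \<sigma>'. \<exists>\<phi>. hubinv N M h \<phi> (mt \<sigma>' ''H'') (warr \<sigma> ''h'' ` {..<k}) \<and>
     (\<forall>x<N. \<forall>y<N. mt \<sigma>' ''W'' x y = M x y - \<phi> x + \<phi> y) \<and> (\<forall>x<n. rarr \<sigma>' ''P'' x = rarr \<sigma> ''P'' x + \<phi> x)"
  show ?thesis
  proof (rule wlp_FOR[where I = ?I])
    show "?I 0 (wset ''h'' 0 \<sigma>)"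
      using HM WM feas diag by (intro exI[of _ "\<lambda>_. 0"]) (simp add: hubinv_def)
    fix k \<tau> assume k: "k < wvar \<sigma> ''q''" and I: "?I k \<tau>" and fr: "fr (FOR ''h'' ''q'' HUB) \<sigma> \<tau>" and hk: "wvar \<tau> ''h'' = k"
    obtain \<phi> where \<phi>: "hubinv N M h \<phi> (mt \<tau> ''H'') (warr \<sigma> ''h'' ` {..<k})"
      "\<forall>x<N. \<forall>y<N. mt \<tau> ''W'' x y = M x y - \<phi> x + \<phi> y" "\<forall>x<n. rarr \<tau> ''P'' x = rarr \<sigma> ''P'' x + \<phi> x" using I by blast
    have ok1: "ok \<tau>" by (rule ok_fr[OF fr ok]) (auto simp: cns_def)
    have h: "warr \<tau> ''h'' (wvar \<tau> ''h'') = warr \<sigma> ''h'' k" using frwa[OF fr, of "''h''"] hk by simp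
    have hN: "warr \<sigma> ''h'' k < N" using hubs k cq by simp
    have im: "warr \<sigma> ''h'' ` {..<Suc k} = insert (warr \<sigma> ''h'' k) (warr \<sigma> ''h'' ` {..<k})" by (auto simp: less_Suc_eq)
    show "wlp MM HUB (\<lambda>\<tau>'. ?I (Suc k) (wset ''h'' (Suc k) \<tau>')) \<tau>"
    proof (rule wlp_conseq[OF wlp_HUB[OF ok1 h hN \<phi>(1)]])
      fix \<tau>' assume "\<exists>V. hubinv N M h (\<lambda>x. \<phi> x + V x) (mt \<tau>' ''H'') (insert (warr \<sigma> ''h'' k) (warr \<sigma> ''h'' ` {..<k})) \<and>
         (\<forall>x<N. \<forall>y<N. mt \<tau>' ''W'' x y = mt \<tau> ''W'' x y - V x + V y) \<and> (\<forall>x<n. rarr \<tau>' ''P'' x = rarr \<tau> ''P'' x + V x)"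
      then obtain V where "hubinv N M h (\<lambda>x. \<phi> x + V x) (mt \<tau>' ''H'') (insert (warr \<sigma> ''h'' k) (warr \<sigma> ''h'' ` {..<k}))"
         "\<forall>x<N. \<forall>y<N. mt \<tau>' ''W'' x y = mt \<tau> ''W'' x y - V x + V y" "\<forall>x<n. rarr \<tau>' ''P'' x = rarr \<tau> ''P'' x + V x" by blast
      then show "?I (Suc k) (wset ''h'' (Suc k) \<tau>')"
        using \<phi>(2,3) unfolding im by (intro exI[of _ "\<lambda>x. \<phi> x + V x"]) simp
    qed
  qed (use cq q_less in auto)
qed

definition cnt :: "(nat \<Rightarrow> nat \<Rightarrow> real) \<Rightarrow> nat \<Rightarrow> real \<Rightarrow> nat" where
  "cnt X p v = card {w. w < N \<and> act False v (X p w)}"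

text \<open>A smaller key leaves more edges in the negative range. So lower bounds for the keys
  become upper bounds for the work.\<close>

lemma cnt_mono: "v \<le> v' \<Longrightarrow> cnt X p v' \<le> cnt X p v"
  unfolding cnt_def by (rule card_mono) (auto simp: act_def)

text \<open>The fuel has to suffice for whatever keys occur. \<open>low b\<close> is closed and
  below the initial keys, hence below all keys at any time, so the scan of \<open>p\<close> relaxes
  at most \<open>cnt X p (low b p)\<close> edges. The sum over \<open>p\<close> is at most
  \<open>N * m\<close> for each of the \<open>n\<close> sources.\<close>

lemma wlp_EXPLORE:
  assumes ok: "ok \<sigma>" and G: "G = mt \<sigma> ''M''" and X: "X = mt \<sigma> ''W''"
    and GX: "\<And>x y. x < N \<Longrightarrow> y < N \<Longrightarrow> 0 \<le> G x y \<Longrightarrow> 0 \<le> X x y"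
    and srt: "\<And>r. r < N \<Longrightarrow> srt (warr \<sigma> ''S'') X N r"
    and low: "\<And>b y. b < n \<Longrightarrow> y < N \<Longrightarrow> low b y \<le> X b y"
      "\<And>b x y. b < n \<Longrightarrow> x < N \<Longrightarrow> y < N \<Longrightarrow> 0 \<le> G x y \<Longrightarrow> low b y \<le> low b x + X x y"
    and few: "\<And>b. b < n \<Longrightarrow> (\<Sum>p<N. cnt X p (low b p)) \<le> N * m"
    and fuel: "n * (N * m) \<le> wvar \<sigma> ''f''"
  shows "wlp MM EXPLORE (\<lambda>\<sigma>'. \<exists>f R. \<forall>b<n. dij N G X False (X b) (f b) (R b) \<and> (\<forall>w<n. mt \<sigma>' ''A'' b w = R b w)) \<sigma>"
proof -
  have cn: "wvar \<sigma> ''n'' = n" "wvar \<sigma> ''N'' = N" using ok by (auto simp: ok_def)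
  let ?I = "\<lambda>k \<tau>. (\<exists>f R. \<forall>b<k. dij N G X False (X b) (f b) (R b) \<and> (\<forall>w<n. mt \<tau> ''A'' b w = R b w)) \<and> (n - k) * (N * m) \<le> wvar \<tau> ''f''"
  show ?thesis
    unfolding EXPLORE_def
  proof (rule wlp_FOR[where I = ?I])
    show "?I 0 (wset ''u'' 0 \<sigma>)" using fuel by simp
    show "\<exists>f R. \<forall>b<n. dij N G X False (X b) (f b) (R b) \<and> (\<forall>w<n. mt \<tau> ''A'' b w = R b w)" if "?I (wvar \<sigma> ''n'') \<tau>" for \<tau>
      using that cn by auto
    fix b \<tau> assume b: "b < wvar \<sigma> ''n''" and I: "?I b \<tau>"
      and fr1: "fr (FOR ''u'' ''n'' (Seq (ROWK ''W'' (ix ''u'' ''x'')) (Seq (DIJ SCAN)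
        (FOR ''x'' ''n'' (RStore ''A'' (ix ''u'' ''x'') (RArr ''R'' (WVar ''x''))))))) \<sigma> \<tau>" and u: "wvar \<tau> ''u'' = b"
    have bn: "b < n" "b < N" using b cn n_le_N by auto
    obtain f R where fR: "\<And>b'. b' < b \<Longrightarrow> dij N G X False (X b') (f b') (R b')" "\<And>b' w. b' < b \<Longrightarrow> w < n \<Longrightarrow> mt \<tau> ''A'' b' w = R b' w"
      and fu: "(n - b) * (N * m) \<le> wvar \<tau> ''f''" using I by blast
    have ok1: "ok \<tau>" by (rule ok_fr[OF fr1 ok]) (auto simp: cns_def)
    have a1: "rarr \<tau> ''W'' = rarr \<sigma> ''W''" "rarr \<tau> ''M'' = rarr \<sigma> ''M''" "warr \<tau> ''S'' = warr \<sigma> ''S''"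
      by (simp_all add: frra[OF fr1] frwa[OF fr1])
    have R1: "wlp MM (ROWK ''W'' (ix ''u'' ''x'')) (\<lambda>\<sigma>'. \<forall>x<N. rarr \<sigma>' ''K'' x = rarr \<tau> ''W'' (b * N + x)) \<tau>"
    proof (rule wlp_ROWK[OF ok1])
      fix \<tau>' x assume "ok \<tau>'" "fr (ROWK ''W'' (ix ''u'' ''x'')) \<tau> \<tau>'" "wvar \<tau>' ''x'' = x" "x < N"
      then show "wval MM \<tau>' (ix ''u'' ''x'') = b * N + x" using u bn frw[of _ \<tau> \<tau>' "''u''"] by (simp add: ok_def)
    qed simp
    show "wlp MM (Seq (ROWK ''W'' (ix ''u'' ''x'')) (Seq (DIJ SCAN)
        (FOR ''x'' ''n'' (RStore ''A'' (ix ''u'' ''x'') (RArr ''R'' (WVar ''x'')))))) (\<lambda>\<tau>'. ?I (Suc b) (wset ''u'' (Suc b) \<tau>')) \<tau>"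
      unfolding wlp_Seq
    proof (rule wlp_conseq[OF R1])
      fix \<tau>1 assume K1: "\<forall>x<N. rarr \<tau>1 ''K'' x = rarr \<tau> ''W'' (b * N + x)" and fr2: "fr (ROWK ''W'' (ix ''u'' ''x'')) \<tau> \<tau>1"
      have ok2: "ok \<tau>1" by (rule ok_fr[OF fr2 ok1]) (auto simp: cns_def)
      have a2: "rarr \<tau>1 ''W'' = rarr \<sigma> ''W''" "rarr \<tau>1 ''M'' = rarr \<sigma> ''M''" "warr \<tau>1 ''S'' = warr \<sigma> ''S''" "rarr \<tau>1 ''A'' = rarr \<tau> ''A''"
        "wvar \<tau>1 ''u'' = b" "wvar \<tau>1 ''f'' = wvar \<tau> ''f''"
        by (simp_all add: frra[OF fr2] frwa[OF fr2] frw[OF fr2] a1 u)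
      define F0 where "F0 = wvar \<tau> ''f''"
      \<comment> \<open>The fuel that is left and the edges relaxed at the extracted nodes add up to
        the fuel at the start of this source.\<close>
      define Fu where "Fu = (\<lambda>S K fl. fl + (\<Sum>p\<in>S. cnt X p (K p :: real)) = F0)"
      have F0: "N * m \<le> F0"
      proof -
        have "1 * (N * m) \<le> (n - b) * (N * m)" using bn by (intro mult_le_mono1) simp
        then show ?thesis using fu unfolding F0_def by linarith
      qed
      have D: "wlp MM (DIJ SCAN) (\<lambda>\<sigma>'. dij N G X False (X b) (rarr \<sigma>' ''K'') (rarr \<sigma>' ''R'') \<and> Fu {..<N} (rarr \<sigma>' ''K'') (wvar \<sigma>' ''f'')) \<tau>1"
      proof (rule wlp_DIJ[OF ok2])
        show "rarr \<tau>1 ''K'' x = X b x" if "x < N" for x using K1 that a1 by (simp add: X)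
        show "0 \<le> X x y" if "x < N" "y < N" "0 \<le> G x y" for x y using GX that by blast
        show "ww SCAN \<inter> cns = {}" "''c'' \<notin> ww SCAN" "wa SCAN \<subseteq> {''b''}" by (auto simp: cns_def)
        show "Fu {} (X b) (wvar \<tau>1 ''f'')" using a2 by (simp add: Fu_def F0_def)
        show "Fu S K' fl" if "S \<subseteq> {..<N}" "\<And>w. w \<in> S \<Longrightarrow> K' w = K w" "Fu S K fl" for S K K' fl
          using that by (simp add: Fu_def)
        fix \<tau>2 S K R p
        assume A: "ok \<tau>2" "fr (DIJ SCAN) \<tau>1 \<tau>2" "dinv G X False (X b) S K R" "S \<subseteq> {..<N}" "p < N" "p \<notin> S"
          "Fu S K (wvar \<tau>2 ''f'')" "rarr \<tau>2 ''K'' = K" "rarr \<tau>2 ''R'' = R" "wvar \<tau>2 ''p'' = p"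
          "rvar \<tau>2 ''v'' = K p" "qok K (warr \<tau>2 ''d'') (warr \<tau>2 ''b'')"
        have a3: "rarr \<tau>2 ''W'' = rarr \<sigma> ''W''" "rarr \<tau>2 ''M'' = rarr \<sigma> ''M''" "warr \<tau>2 ''S'' = warr \<sigma> ''S''"
          by (simp_all add: frra[OF A(2)] frwa[OF A(2)] a2)
        have lowK: "low b z \<le> K z" if "z < N" for z
          by (rule dinv_lower[OF A(3) _ _ that]) (use low bn in auto)
        have "(\<Sum>z\<in>insert p S. cnt X z (K z)) \<le> (\<Sum>z\<in>insert p S. cnt X z (low b z))"
          by (rule sum_mono) (use lowK A(4,5) in \<open>auto intro!: cnt_mono\<close>)
        also have "\<dots> \<le> (\<Sum>z<N. cnt X z (low b z))" by (rule sum_mono2) (use A(4,5) in auto)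
        also have "\<dots> \<le> F0" using few[OF bn(1)] F0 by simp
        finally have le: "cnt X p (K p) + (\<Sum>z\<in>S. cnt X z (K z)) \<le> F0"
          using A(6) finite_subset[OF A(4)] by simp
        have S: "wlp MM SCAN (\<lambda>\<sigma>'. (\<forall>w<N. rarr \<sigma>' ''K'' w = (if act False (K p) (X p w) \<and> 0 \<le> G p w then min (rarr \<tau>2 ''K'' w) (K p + X p w) else rarr \<tau>2 ''K'' w) \<and>
           rarr \<sigma>' ''R'' w = (if act False (K p) (X p w) then min (rarr \<tau>2 ''R'' w) (K p + X p w) else rarr \<tau>2 ''R'' w)) \<and>
           qok (rarr \<sigma>' ''K'') (warr \<sigma>' ''d'') (warr \<sigma>' ''b'') \<and>
           wvar \<sigma>' ''f'' = wvar \<tau>2 ''f'' - card {w. w < N \<and> act False (K p) (X p w)}) \<tau>2"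
          by (rule wlp_SCAN[OF A(1,10,5,11)]) (use a3 A srt le in \<open>simp_all add: X G Fu_def cnt_def\<close>)
        show "wlp MM SCAN (\<lambda>\<tau>'. (\<forall>w<N. rarr \<tau>' ''K'' w = (if act False (K p) (X p w) \<and> 0 \<le> G p w then min (K w) (K p + X p w) else K w) \<and>
            rarr \<tau>' ''R'' w = (if act False (K p) (X p w) then min (R w) (K p + X p w) else R w)) \<and>
          qok (rarr \<tau>' ''K'') (warr \<tau>' ''d'') (warr \<tau>' ''b'') \<and> Fu (insert p S) K (wvar \<tau>' ''f'')) \<tau>2"
        proof (rule wlp_conseq[OF S])
          fix \<tau>3 assume s: "(\<forall>w<N. rarr \<tau>3 ''K'' w = (if act False (K p) (X p w) \<and> 0 \<le> G p w then min (rarr \<tau>2 ''K'' w) (K p + X p w) else rarr \<tau>2 ''K'' w) \<and>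
           rarr \<tau>3 ''R'' w = (if act False (K p) (X p w) then min (rarr \<tau>2 ''R'' w) (K p + X p w) else rarr \<tau>2 ''R'' w)) \<and>
           qok (rarr \<tau>3 ''K'') (warr \<tau>3 ''d'') (warr \<tau>3 ''b'') \<and>
           wvar \<tau>3 ''f'' = wvar \<tau>2 ''f'' - card {w. w < N \<and> act False (K p) (X p w)}"
          have "Fu (insert p S) K (wvar \<tau>3 ''f'')"
            using s A(6,7) le finite_subset[OF A(4)] by (simp add: Fu_def cnt_def)
          then show "(\<forall>w<N. rarr \<tau>3 ''K'' w = (if act False (K p) (X p w) \<and> 0 \<le> G p w then min (K w) (K p + X p w) else K w) \<and>
            rarr \<tau>3 ''R'' w = (if act False (K p) (X p w) then min (R w) (K p + X p w) else R w)) \<and>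
            qok (rarr \<tau>3 ''K'') (warr \<tau>3 ''d'') (warr \<tau>3 ''b'') \<and> Fu (insert p S) K (wvar \<tau>3 ''f'')"
            using s unfolding A(8,9) by blast
        qed
      qed
      show "wlp MM (DIJ SCAN) (wlp MM (FOR ''x'' ''n'' (RStore ''A'' (ix ''u'' ''x'') (RArr ''R'' (WVar ''x''))))
          (\<lambda>\<tau>'. ?I (Suc b) (wset ''u'' (Suc b) \<tau>'))) \<tau>1"
      proof (rule wlp_conseq[OF D])
        fix \<tau>2 assume d: "dij N G X False (X b) (rarr \<tau>2 ''K'') (rarr \<tau>2 ''R'') \<and> Fu {..<N} (rarr \<tau>2 ''K'') (wvar \<tau>2 ''f'')"
          and fr3: "fr (DIJ SCAN) \<tau>1 \<tau>2"
        have ok3: "ok \<tau>2" by (rule ok_fr[OF fr3 ok2]) (auto simp: cns_def)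
        have c3: "wvar \<tau>2 ''n'' = n" "wvar \<tau>2 ''N'' = N" using ok3 by (auto simp: ok_def)
        have a3: "rarr \<tau>2 ''A'' = rarr \<tau> ''A''" "wvar \<tau>2 ''u'' = b" by (simp_all add: frra[OF fr3] frw[OF fr3] a2)
        have "(\<Sum>z<N. cnt X z (rarr \<tau>2 ''K'' z)) \<le> (\<Sum>z<N. cnt X z (low b z))"
          by (rule sum_mono, rule cnt_mono, rule dijD(5)[OF conjunct1[OF d]]) (use low bn in auto)
        also have "\<dots> \<le> N * m" using few[OF bn(1)] .
        finally have used: "F0 \<le> wvar \<tau>2 ''f'' + N * m" using d by (simp add: Fu_def)
        have left: "(n - Suc b) * (N * m) \<le> wvar \<tau>2 ''f''"
        proof -
          have "n - b = Suc (n - Suc b)" using bn by simp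
          then have "(n - b) * (N * m) = N * m + (n - Suc b) * (N * m)" by simp
          then show ?thesis using used fu by (simp add: F0_def)
        qed
        show "wlp MM (FOR ''x'' ''n'' (RStore ''A'' (ix ''u'' ''x'') (RArr ''R'' (WVar ''x''))))
          (\<lambda>\<tau>'. ?I (Suc b) (wset ''u'' (Suc b) \<tau>')) \<tau>2"
        proof (rule wlp_FOR[where I = "\<lambda>k \<tau>'. (\<forall>w<k. mt \<tau>' ''A'' b w = rarr \<tau>2 ''R'' w) \<and> (\<forall>b'<b. \<forall>w<n. mt \<tau>' ''A'' b' w = mt \<tau> ''A'' b' w)"])
          fix k \<tau>' assume k: "k < wvar \<tau>2 ''n''" and J: "(\<forall>w<k. mt \<tau>' ''A'' b w = rarr \<tau>2 ''R'' w) \<and> (\<forall>b'<b. \<forall>w<n. mt \<tau>' ''A'' b' w = mt \<tau> ''A'' b' w)"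
            and fr4: "fr (FOR ''x'' ''n'' (RStore ''A'' (ix ''u'' ''x'') (RArr ''R'' (WVar ''x'')))) \<tau>2 \<tau>'" and x: "wvar \<tau>' ''x'' = k"
          have w: "wvar \<tau>' ''N'' = N" "wvar \<tau>' ''u'' = b" "rarr \<tau>' ''R'' = rarr \<tau>2 ''R''"
            by (simp_all add: frra[OF fr4] frw[OF fr4] a3 c3)
          have kN: "k < N" using k c3 n_le_N by simp
          have "b' * N + w \<noteq> b * N + k" if "b' < b" "w < n" for b' w using pair_inj[of w k b' b] that n_le_N kN by auto
          then show "wlp MM (RStore ''A'' (ix ''u'' ''x'') (RArr ''R'' (WVar ''x''))) (\<lambda>\<tau>'. (\<forall>w<Suc k. mt (wset ''x'' (Suc k) \<tau>') ''A'' b w = rarr \<tau>2 ''R'' w) \<and>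
             (\<forall>b'<b. \<forall>w<n. mt (wset ''x'' (Suc k) \<tau>') ''A'' b' w = mt \<tau> ''A'' b' w)) \<tau>'"
            using J w x bn kN by (simp add: less_Suc_eq)
        next
          fix \<tau>3 assume J: "(\<forall>w<wvar \<tau>2 ''n''. mt \<tau>3 ''A'' b w = rarr \<tau>2 ''R'' w) \<and> (\<forall>b'<b. \<forall>w<n. mt \<tau>3 ''A'' b' w = mt \<tau> ''A'' b' w)"
            and fr4: "fr (FOR ''x'' ''n'' (RStore ''A'' (ix ''u'' ''x'') (RArr ''R'' (WVar ''x'')))) \<tau>2 \<tau>3"
          have "wvar \<tau>3 ''f'' = wvar \<tau>2 ''f''" by (simp add: frw[OF fr4])
          moreover have "\<exists>f R. \<forall>b'<Suc b. dij N G X False (X b') (f b') (R b') \<and> (\<forall>w<n. mt \<tau>3 ''A'' b' w = R b' w)"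
            by (intro exI[of _ "f(b := rarr \<tau>2 ''K'')"] exI[of _ "R(b := rarr \<tau>2 ''R'')"])
               (use J c3 d fR in \<open>auto simp: less_Suc_eq\<close>)
          ultimately show "?I (Suc b) (wset ''u'' (Suc b) \<tau>3)" using left by simp
        qed (use c3 n_less a3 in auto)
      qed
    qed
  qed (use cn n_less in auto)
qed

lemma wlp_BASE:
  assumes ok: "ok \<sigma>"
  shows "wlp MM BASE (\<lambda>\<sigma>'. \<exists>g. (\<forall>u<n. \<forall>w<n. \<bar>mt \<sigma> ''A'' u w\<bar> \<le> g) \<and> 0 \<le> g \<and>
     (\<forall>u<N. \<forall>w<N. mt \<sigma>' ''M'' u w = (if u = w then 0 else if u < n \<and> w < n then mt \<sigma> ''A'' u w else 3 * g))) \<sigma>"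
proof -
  have c: "wvar \<sigma> ''n'' = n" "wvar \<sigma> ''N'' = N" using ok by (auto simp: ok_def)
  let ?A = "mt \<sigma> ''A''"
  let ?c1 = "Seq (Cond (RLess (RVar ''g'') (RArr ''A'' (ix ''u'' ''w''))) (RAssign ''g'' (RArr ''A'' (ix ''u'' ''w''))) Skip)
        (Cond (RLess (RVar ''g'') (RSub RZero (RArr ''A'' (ix ''u'' ''w''))))
           (RAssign ''g'' (RSub RZero (RArr ''A'' (ix ''u'' ''w'')))) Skip)"
  let ?c2 = "Cond (WEq (WVar ''u'') (WVar ''w'')) (RStore ''M'' (ix ''u'' ''w'') RZero)
         (Cond (BAnd (WLess (WVar ''u'') (WVar ''n'')) (WLess (WVar ''w'') (WVar ''n'')))
            (RStore ''M'' (ix ''u'' ''w'') (RArr ''A'' (ix ''u'' ''w''))) (RStore ''M'' (ix ''u'' ''w'') (RVar ''g'')))"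
  let ?\<sigma> = "\<sigma>\<lparr>rvar := (rvar \<sigma>)(''g'' := 0)\<rparr>"
  show ?thesis
    unfolding BASE_def wlp_Seq wlp_RAssign rval.simps
  proof (rule wlp_FOR2[where ca = n and cb = n and I = "\<lambda>a x r v. 0 \<le> v ''g'' \<and> (\<forall>u<n. \<forall>w<n. u < a \<or> u = a \<and> w < x \<longrightarrow> \<bar>?A u w\<bar> \<le> v ''g'')"])
    fix a x \<tau> assume ax: "a < n" "x < n" and I: "0 \<le> rvar \<tau> ''g'' \<and> (\<forall>u<n. \<forall>w<n. u < a \<or> u = a \<and> w < x \<longrightarrow> \<bar>?A u w\<bar> \<le> rvar \<tau> ''g'')"
      and fr: "fr (FOR ''u'' ''n'' (FOR ''w'' ''n'' ?c1)) ?\<sigma> \<tau>" and v: "wvar \<tau> ''u'' = a" "wvar \<tau> ''w'' = x"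
    have w: "wvar \<tau> ''N'' = N" "rarr \<tau> ''A'' = rarr \<sigma> ''A''" by (simp_all add: frra[OF fr] frw[OF fr] c)
    have axN: "a < N" "x < N" using ax n_le_N by auto
    show "wlp MM ?c1 (\<lambda>\<tau>'. 0 \<le> rvar \<tau>' ''g'' \<and> (\<forall>u<n. \<forall>w<n. u < a \<or> u = a \<and> w < Suc x \<longrightarrow> \<bar>?A u w\<bar> \<le> rvar \<tau>' ''g'')) \<tau>"
      using I w v axN by (force simp: less_Suc_eq)
  next
    fix \<tau>1 assume I1: "0 \<le> rvar \<tau>1 ''g'' \<and> (\<forall>u<n. \<forall>w<n. u < n \<or> u = n \<and> w < 0 \<longrightarrow> \<bar>?A u w\<bar> \<le> rvar \<tau>1 ''g'')"
      and fr1: "fr (FOR ''u'' ''n'' (FOR ''w'' ''n'' ?c1)) ?\<sigma> \<tau>1"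
    define g where "g = rvar \<tau>1 ''g''"
    let ?\<tau> = "\<tau>1\<lparr>rvar := (rvar \<tau>1)(''g'' := rvar \<tau>1 ''g'' + (rvar \<tau>1 ''g'' + rvar \<tau>1 ''g''))\<rparr>"
    have w1: "wvar \<tau>1 ''N'' = N" "wvar \<tau>1 ''n'' = n" "rarr \<tau>1 ''A'' = rarr \<sigma> ''A''" by (simp_all add: frra[OF fr1] frw[OF fr1] c)
    let ?new = "\<lambda>u w. if u = w then 0 else if u < n \<and> w < n then ?A u w else 3 * g"
    show "wlp MM (FOR ''u'' ''N'' (FOR ''w'' ''N'' ?c2)) (\<lambda>\<sigma>'. \<exists>g. (\<forall>u<n. \<forall>w<n. \<bar>?A u w\<bar> \<le> g) \<and> 0 \<le> g \<and>
     (\<forall>u<N. \<forall>w<N. mt \<sigma>' ''M'' u w = (if u = w then 0 else if u < n \<and> w < n then ?A u w else 3 * g))) ?\<tau>"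
    proof (rule wlp_FOR2[where ca = N and cb = N and I = "\<lambda>a x r v. \<forall>u<N. \<forall>w<N. u < a \<or> u = a \<and> w < x \<longrightarrow> r ''M'' (u * N + w) = ?new u w"])
      fix a x \<tau> assume ax: "a < N" "x < N" and I: "\<forall>u<N. \<forall>w<N. u < a \<or> u = a \<and> w < x \<longrightarrow> mt \<tau> ''M'' u w = ?new u w"
        and fr: "fr (FOR ''u'' ''N'' (FOR ''w'' ''N'' ?c2)) ?\<tau> \<tau>" and v: "wvar \<tau> ''u'' = a" "wvar \<tau> ''w'' = x"
      have w: "wvar \<tau> ''N'' = N" "wvar \<tau> ''n'' = n" "rarr \<tau> ''A'' = rarr \<sigma> ''A''" "rvar \<tau> ''g'' = 3 * g"
        by (simp_all add: frra[OF fr] frw[OF fr] frr[OF fr] w1 g_def)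
      have new: "wlp MM ?c2 (\<lambda>\<tau>'. rarr \<tau>' ''M'' = (rarr \<tau> ''M'')(a * N + x := ?new a x)) \<tau>"
        using w v ax by simp
      show "wlp MM ?c2 (\<lambda>\<tau>'. \<forall>u<N. \<forall>w<N. u < a \<or> u = a \<and> w < Suc x \<longrightarrow> mt \<tau>' ''M'' u w = ?new u w) \<tau>"
      proof (rule wlp_conseq[OF new], intro allI impI)
        fix \<tau>' :: machine_state and u w assume "rarr \<tau>' ''M'' = (rarr \<tau> ''M'')(a * N + x := ?new a x)" "u < N" "w < N" "u < a \<or> u = a \<and> w < Suc x"
        then show "mt \<tau>' ''M'' u w = ?new u w" using I pair_inj[of w x u a] ax by (cases "u = a \<and> w = x") (auto simp: less_Suc_eq)
      qed
    next
      fix \<tau>2 assume "\<forall>u<N. \<forall>w<N. u < N \<or> u = N \<and> w < 0 \<longrightarrow> mt \<tau>2 ''M'' u w = ?new u w"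
      then show "\<exists>g. (\<forall>u<n. \<forall>w<n. \<bar>?A u w\<bar> \<le> g) \<and> 0 \<le> g \<and>
        (\<forall>u<N. \<forall>w<N. mt \<tau>2 ''M'' u w = (if u = w then 0 else if u < n \<and> w < n then ?A u w else 3 * g))"
        using I1 by (intro exI[of _ g]) (simp add: g_def)
    qed (use w1 N_less in \<open>auto simp: less_Suc_eq\<close>)
  qed (use c n_less in \<open>auto simp: less_Suc_eq\<close>)
qed

end

section \<open>Auxiliary nodes\<close>

text \<open>The positions 0, 1, 3, 7 and so on, capped at the last position. That the next pivot is
  at most at twice the position plus one, \<open>jj_Suc_le\<close>, limits the explicit pairs to
  twice the number of negative ones.\<close>

primrec jj :: "nat \<Rightarrow> nat \<Rightarrow> nat" where
  "jj n 0 = 0"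
| "jj n (Suc k) = (if 2 * jj n k + 1 < n then 2 * jj n k + 1 else n - 1)"

lemma jj_less: "1 \<le> n \<Longrightarrow> jj n k < n"
  by (induction k) auto

lemma jj_ge: "min (2 ^ k) n \<le> Suc (jj n k)"
  by (induction k) auto

lemma jj_Suc_le: "1 \<le> n \<Longrightarrow> jj n (Suc k) \<le> 2 * jj n k + 1"
  by auto

section \<open>Filling the matrix of the next round\<close>

context sizes
begin

lemma jj_last: "jj n (lv - 1) = n - 1"
proof -
  have "n \<le> 2 ^ (lv - 1)" using n_pow by (simp add: lv_def numeral_2_eq_2)
  then show ?thesis using jj_ge[of "lv - 1" n] jj_less[OF n1, of "lv - 1"] by simp
qed

lemma lv1: "1 \<le> lv" using l2 by (simp add: lv_def)

definition nd :: "nat \<Rightarrow> nat \<Rightarrow> nat" where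
  "nd w k = (k + 1) * n + w"

lemma nd_ge: "n \<le> nd w k"
  by (simp add: nd_def)

lemma nd_less: "w < n \<Longrightarrow> k < lv \<Longrightarrow> nd w k < N"
proof -
  assume "w < n" "k < lv"
  then have "nd w k < (k + 2) * n" by (simp add: nd_def)
  also have "\<dots> \<le> l * (q * q)" using \<open>k < lv\<close> n_le by (intro mult_le_mono) (auto simp: lv_def)
  also have "\<dots> = N" by (simp add: N_def nb_def)
  finally show ?thesis .
qed

lemma nd_inj: "w < n \<Longrightarrow> w' < n \<Longrightarrow> nd w k = nd w' k' \<longleftrightarrow> w = w' \<and> k = k'"
proof
  assume a: "w < n" "w' < n" "nd w k = nd w' k'"
  have md: "nd w k mod n = w" "nd w k div n = k + 1" if "w < n" for w k
    unfolding nd_def add.commute[of _ w] using that n1 by (simp_all only: mod_mult_self1 div_mult_self1 mod_less div_less)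
  show "w = w' \<and> k = k'" using md[OF a(1), of k] md[OF a(2), of k'] a(3) by simp
qed auto

definition zz :: "(nat \<Rightarrow> nat \<Rightarrow> real) \<Rightarrow> (nat \<Rightarrow> nat \<Rightarrow> nat) \<Rightarrow> nat \<Rightarrow> nat \<Rightarrow> real" where
  "zz A so w k = A w (so w (jj n k))"

text \<open>The first clause restricts every entry to an initial value, an explicit pair or an edge
  from or to an auxiliary node; feasibility of the new potentials follows from it alone. The other
  clauses record what has been entered so far: \<open>Dt\<close> marks the edges from auxiliary
  nodes and \<open>Du\<close> those to them, or the explicit pairs in their place, that are
  done.\<close>

definition fi :: "(nat \<Rightarrow> nat \<Rightarrow> real) \<Rightarrow> (nat \<Rightarrow> nat \<Rightarrow> nat) \<Rightarrow> (nat \<Rightarrow> nat \<Rightarrow> real) \<Rightarrow>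
    (nat \<Rightarrow> nat \<Rightarrow> nat \<Rightarrow> bool) \<Rightarrow> (nat \<Rightarrow> nat \<Rightarrow> nat \<Rightarrow> bool) \<Rightarrow> (nat \<Rightarrow> real) \<Rightarrow> bool" where
  "fi A so M0 Dt Du Mx \<longleftrightarrow>
     (\<forall>u<N. \<forall>v<N. Mx (u * N + v) = M0 u v \<or>
        (u < n \<and> v < n \<and> (\<exists>w<n. Mx (u * N + v) = A u w + A w v) \<and> Mx (u * N + v) \<le> M0 u v) \<or>
        (\<exists>k<lv. \<exists>w<n. u = nd w k \<and> v < n \<and> Mx (u * N + v) = A w v - zz A so w k) \<or>
        (\<exists>k<lv. \<exists>w<n. v = nd w k \<and> u < n \<and> Mx (u * N + v) = A u w + zz A so w k)) \<and>
     (\<forall>w<n. \<forall>k<lv. \<forall>t<n. Dt w k t \<longrightarrow> zz A so w k \<le> A w t \<longrightarrow> Mx (nd w k * N + t) = A w t - zz A so w k) \<and>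
     (\<forall>w<n. \<forall>k<lv. \<forall>u<n. Du w k u \<longrightarrow> (0 \<le> A u w + zz A so w k \<longrightarrow> Mx (u * N + nd w k) = A u w + zz A so w k) \<and>
        (A u w + zz A so w k < 0 \<longrightarrow> (\<forall>i<jj n (Suc k). Mx (u * N + so w i) \<le> A u w + A w (so w i))))"

lemma fi_mono:
  assumes "fi A so M0 Dt Du Mx" "\<And>w k t. w < n \<Longrightarrow> k < lv \<Longrightarrow> t < n \<Longrightarrow> Dt' w k t \<Longrightarrow> Dt w k t"
    "\<And>w k t. w < n \<Longrightarrow> k < lv \<Longrightarrow> t < n \<Longrightarrow> Du' w k t \<Longrightarrow> Du w k t"
  shows "fi A so M0 Dt' Du' Mx"
  unfolding fi_def
proof (intro conjI)
  note f = assms(1)[unfolded fi_def]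
  show "\<forall>w<n. \<forall>k<lv. \<forall>t<n. Dt' w k t \<longrightarrow> zz A so w k \<le> A w t \<longrightarrow> Mx (nd w k * N + t) = A w t - zz A so w k"
    using conjunct1[OF conjunct2[OF f]] assms(2) by blast
  show "\<forall>w<n. \<forall>k<lv. \<forall>u<n. Du' w k u \<longrightarrow> (0 \<le> A u w + zz A so w k \<longrightarrow> Mx (u * N + nd w k) = A u w + zz A so w k) \<and>
        (A u w + zz A so w k < 0 \<longrightarrow> (\<forall>i<jj n (Suc k). Mx (u * N + so w i) \<le> A u w + A w (so w i)))"
    using conjunct2[OF conjunct2[OF f]] assms(3) by blast
qed (rule conjunct1[OF assms(1)[unfolded fi_def]])

lemma fi_D:
  assumes "fi A so M0 Dt Du Mx"
  shows "u < N \<Longrightarrow> v < N \<Longrightarrow> Mx (u * N + v) = M0 u v \<or>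
        (u < n \<and> v < n \<and> (\<exists>w<n. Mx (u * N + v) = A u w + A w v) \<and> Mx (u * N + v) \<le> M0 u v) \<or>
        (\<exists>k<lv. \<exists>w<n. u = nd w k \<and> v < n \<and> Mx (u * N + v) = A w v - zz A so w k) \<or>
        (\<exists>k<lv. \<exists>w<n. v = nd w k \<and> u < n \<and> Mx (u * N + v) = A u w + zz A so w k)"
    "w < n \<Longrightarrow> k < lv \<Longrightarrow> t < n \<Longrightarrow> Dt w k t \<Longrightarrow> zz A so w k \<le> A w t \<Longrightarrow> Mx (nd w k * N + t) = A w t - zz A so w k"
    "w < n \<Longrightarrow> k < lv \<Longrightarrow> u < n \<Longrightarrow> Du w k u \<Longrightarrow> 0 \<le> A u w + zz A so w k \<Longrightarrow> Mx (u * N + nd w k) = A u w + zz A so w k"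
    "w < n \<Longrightarrow> k < lv \<Longrightarrow> u < n \<Longrightarrow> Du w k u \<Longrightarrow> A u w + zz A so w k < 0 \<Longrightarrow> i < jj n (Suc k) \<Longrightarrow> Mx (u * N + so w i) \<le> A u w + A w (so w i)"
  using assms unfolding fi_def by blast+

lemma fi_old_le:
  assumes "fi A so M0 Dt Du Mx" "u < n" "v < n"
  shows "Mx (u * N + v) \<le> M0 u v"
proof -
  have "u \<noteq> nd w k" "v \<noteq> nd w k" for w k using nd_ge[of w k] assms by auto
  then show ?thesis using fi_D(1)[OF assms(1), of u v] assms n_le_N by auto
qed

lemma upd_ne:
  fixes Mx :: "nat \<Rightarrow> real"
  assumes "b < N" "d < N" "a \<noteq> c \<or> b \<noteq> d"
  shows "(Mx(a * N + b := x)) (c * N + d) = Mx (c * N + d)"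
  using assms pair_inj[of b d a c] by auto

text \<open>Only entries between two vertices can be written with different values, and these have
  to decrease so that explicit pairs survive. For an edge of an auxiliary node the new value is
  unique, as \<open>nd\<close> determines the vertex and the level.\<close>

lemma fi_step:
  assumes fi: "fi A so M0 Dt Du Mx" and so: "\<And>w i. w < n \<Longrightarrow> i < n \<Longrightarrow> so w i < n" and ab: "a < N" "b < N"
    and legit: "(a < n \<and> b < n \<and> (\<exists>w<n. x = A a w + A w b) \<and> x \<le> M0 a b) \<or>
        (\<exists>k<lv. \<exists>w<n. a = nd w k \<and> b < n \<and> x = A w b - zz A so w k) \<or>
        (\<exists>k<lv. \<exists>w<n. b = nd w k \<and> a < n \<and> x = A a w + zz A so w k)"
    and down: "a < n \<Longrightarrow> b < n \<Longrightarrow> x \<le> Mx (a * N + b)"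
  shows "fi A so M0 Dt Du (Mx(a * N + b := x))"
proof -
  let ?M = "Mx(a * N + b := x)"
  show ?thesis
    unfolding fi_def
  proof (intro conjI allI impI)
    fix u v assume uv: "u < N" "v < N"
    show "?M (u * N + v) = M0 u v \<or>
        (u < n \<and> v < n \<and> (\<exists>w<n. ?M (u * N + v) = A u w + A w v) \<and> ?M (u * N + v) \<le> M0 u v) \<or>
        (\<exists>k<lv. \<exists>w<n. u = nd w k \<and> v < n \<and> ?M (u * N + v) = A w v - zz A so w k) \<or>
        (\<exists>k<lv. \<exists>w<n. v = nd w k \<and> u < n \<and> ?M (u * N + v) = A u w + zz A so w k)"
    proof (cases "u = a \<and> v = b")
      case True
      then show ?thesis using legit by simp
    next
      case False
      then have "?M (u * N + v) = Mx (u * N + v)" using upd_ne[of b v a u] ab uv by auto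
      then show ?thesis using fi_D(1)[OF fi uv] by simp
    qed
  next
    fix w k t assume a: "w < n" "k < lv" "t < n" "Dt w k t" "zz A so w k \<le> A w t"
    show "?M (nd w k * N + t) = A w t - zz A so w k"
    proof (cases "a = nd w k \<and> b = t")
      case True
      then have an: "\<not> a < n" "\<not> (\<exists>k. \<exists>w<n. b = nd w k)" using nd_ge a by (auto simp: not_less) (metis nd_ge not_less)
      then obtain k' w' where "k' < lv" "w' < n" "a = nd w' k'" "x = A w' b - zz A so w' k'" using legit by blast
      then show ?thesis using True nd_inj[of w w' k k'] a by auto
    next
      case False
      then have "?M (nd w k * N + t) = Mx (nd w k * N + t)" using upd_ne[of b t a "nd w k"] ab a n_le_N by auto
      then show ?thesis using fi_D(2)[OF fi a] by simp
    qed
  next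
    fix w k u assume a: "w < n" "k < lv" "u < n" "Du w k u" "0 \<le> A u w + zz A so w k"
    show "?M (u * N + nd w k) = A u w + zz A so w k"
    proof (cases "a = u \<and> b = nd w k")
      case True
      then have an: "\<not> b < n" using nd_ge by (auto simp: not_less)
      then obtain k' w' where "k' < lv" "w' < n" "b = nd w' k'" "x = A a w' + zz A so w' k'" using legit by blast
      then show ?thesis using True nd_inj[of w w' k k'] a by auto
    next
      case False
      then have "?M (u * N + nd w k) = Mx (u * N + nd w k)" using upd_ne[of b "nd w k" a u] ab a nd_less by auto
      then show ?thesis using fi_D(3)[OF fi a] by simp
    qed
  next
    fix w k u i assume a: "w < n" "k < lv" "u < n" "Du w k u" "A u w + zz A so w k < 0" "i < jj n (Suc k)"
    have soi: "so w i < n" using so a jj_less[OF n1, of "Suc k"] by simp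
    have "?M (u * N + so w i) \<le> Mx (u * N + so w i)"
    proof (cases "a = u \<and> b = so w i")
      case True
      then show ?thesis using down a soi by simp
    next
      case False
      then show ?thesis using upd_ne[of b "so w i" a u] ab soi n_le_N by auto
    qed
    then show "?M (u * N + so w i) \<le> A u w + A w (so w i)" using fi_D(4)[OF fi a] by simp
  qed
qed

lemma wlp_EXPL:
  assumes ok: "ok \<sigma>" and w: "wvar \<sigma> ''w'' = w" "w < n" and u: "wvar \<sigma> ''u'' = u" "u < n"
    and e: "wvar \<sigma> ''o'' = e" "e \<le> n" and A: "A = mt \<sigma> ''A''" and so: "so = (\<lambda>w i. warr \<sigma> ''S'' (w * N + i))"
    and soN: "\<And>w i. w < n \<Longrightarrow> i < n \<Longrightarrow> so w i < n"
    and fi: "fi A so M0 Dt Du (rarr \<sigma> ''M'')" and fuel: "e \<le> wvar \<sigma> ''f''"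
  shows "wlp MM EXPL (\<lambda>\<sigma>'. fi A so M0 Dt Du (rarr \<sigma>' ''M'') \<and>
      (\<forall>i<e. rarr \<sigma>' ''M'' (u * N + so w i) \<le> A u w + A w (so w i)) \<and> wvar \<sigma>' ''f'' = wvar \<sigma> ''f'' - e) \<sigma>"
proof -
  let ?c = "Seq (WAssign ''t'' (WArr ''S'' (ix ''w'' ''i'')))
     (Seq (RAssign ''x'' (RAdd (RArr ''A'' (ix ''u'' ''w'')) (RArr ''A'' (ix ''w'' ''t''))))
     (Seq (Cond (RLess (RVar ''x'') (RArr ''M'' (ix ''u'' ''t''))) (RStore ''M'' (ix ''u'' ''t'') (RVar ''x'')) Skip)
       (WAssign ''i'' (WAdd (WVar ''i'') (WConst 1)))))"
  have cN: "wvar \<sigma> ''N'' = N" using ok by (simp add: ok_def)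
  define I :: "machine_state \<Rightarrow> bool" where "I = (\<lambda>\<tau>. fi A so M0 Dt Du (rarr \<tau> ''M'') \<and> wvar \<tau> ''i'' \<le> e \<and>
     (\<forall>i<wvar \<tau> ''i''. rarr \<tau> ''M'' (u * N + so w i) \<le> A u w + A w (so w i)) \<and> wvar \<tau> ''f'' + wvar \<tau> ''i'' = wvar \<sigma> ''f'')"
  show ?thesis
    unfolding EXPL_def WHILEF_def wlp_Seq wlp_WAssign
  proof (rule wlp_Loop[where I = I])
    show "I (wset ''i'' (wval MM \<sigma> (WConst 0)) \<sigma>)" unfolding I_def using fi by simp
    fix \<tau> assume I: "I \<tau>" and fr: "fr (Seq (WAssign ''f'' (WSub (WVar ''f'') (WConst 1))) ?c) (wset ''i'' (wval MM \<sigma> (WConst 0)) \<sigma>) \<tau>"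
    have v: "wvar \<tau> ''w'' = w" "wvar \<tau> ''u'' = u" "wvar \<tau> ''o'' = e" "wvar \<tau> ''N'' = N" "rarr \<tau> ''A'' = rarr \<sigma> ''A''" "warr \<tau> ''S'' = warr \<sigma> ''S''"
      by (simp_all add: frw[OF fr] frwa[OF fr] frra[OF fr] w u e cN)
    define i where "i = wvar \<tau> ''i''"
    { assume b: "bval MM \<tau> (BAnd (WLess (WConst 0) (WVar ''f'')) (WLess (WVar ''i'') (WVar ''o'')))"
      have i: "i < e" "i < n" "i < N" "0 < wvar \<tau> ''f''" using b v e n_le_N by (auto simp: i_def)
      define t where "t = so w i"
      have t: "t < n" "t < N" "w < N" "u < N" using soN[OF w(2) i(2)] n_le_N w u by (auto simp: t_def)
      define x where "x = A u w + A w t"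
      define Mx where "Mx = rarr \<tau> ''M''"
      have im: "(i + 1) mod MM = Suc i" using i N_less by simp
      have S: "warr \<sigma> ''S'' (w * N + i) = t" by (simp add: t_def so)
      have fi\<tau>: "fi A so M0 Dt Du Mx" using I by (simp add: I_def Mx_def)
      have fi': "fi A so M0 Dt Du (Mx(u * N + t := x))" if "x < Mx (u * N + t)"
        by (rule fi_step[OF fi\<tau> soN]) (use that t w u fi_old_le[OF fi\<tau>, of u t] in \<open>auto simp: x_def\<close>)
      have less: "(if x < Mx (u * N + t) then Mx(u * N + t := x) else Mx) (u * N + so w j) \<le> A u w + A w (so w j)" if "j < Suc i" for j
      proof (cases "j = i")
        case True
        then show ?thesis by (auto simp: x_def t_def)
      next
        case False
        then have "Mx (u * N + so w j) \<le> A u w + A w (so w j)" using that I by (simp add: I_def Mx_def i_def)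
        then show ?thesis by (cases "u * N + so w j = u * N + t") (auto simp: x_def t_def)
      qed
      have fl: "wvar \<tau> ''f'' - Suc 0 + Suc i = wvar \<sigma> ''f''" using I i by (simp add: I_def i_def)
      have "wlp MM (Seq (WAssign ''f'' (WSub (WVar ''f'') (WConst 1))) ?c) (\<lambda>\<tau>'. rarr \<tau>' ''M'' = (if x < Mx (u * N + t) then Mx(u * N + t := x) else Mx) \<and>
          wvar \<tau>' ''i'' = Suc i \<and> wvar \<tau>' ''f'' = wvar \<tau> ''f'' - Suc 0) \<tau>"
        using v i t S im by (simp add: i_def[symmetric] Mx_def x_def A)
      then show "wlp MM (Seq (WAssign ''f'' (WSub (WVar ''f'') (WConst 1))) ?c) I \<tau>"
        by (rule wlp_conseq) (use fi' fi\<tau> less fl i in \<open>simp add: I_def\<close>)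
    }
    { assume b: "\<not> bval MM \<tau> (BAnd (WLess (WConst 0) (WVar ''f'')) (WLess (WVar ''i'') (WVar ''o'')))"
      have "wvar \<tau> ''i'' = e" using b I v fuel by (auto simp: I_def)
      then show "fi A so M0 Dt Du (rarr \<tau> ''M'') \<and> (\<forall>i<e. rarr \<tau> ''M'' (u * N + so w i) \<le> A u w + A w (so w i)) \<and>
          wvar \<tau> ''f'' = wvar \<sigma> ''f'' - e" using I by (auto simp: I_def)
    }
  qed
qed

definition dn :: "nat \<Rightarrow> nat \<Rightarrow> nat \<Rightarrow> nat \<Rightarrow> bool" where
  "dn w k w' k' \<longleftrightarrow> w' < w \<or> w' = w \<and> k' < k"

text \<open>The number of explicit pairs for \<open>u\<close> at this level, which is also the fuel
  that they take.\<close>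

definition cc :: "(nat \<Rightarrow> nat \<Rightarrow> real) \<Rightarrow> (nat \<Rightarrow> nat \<Rightarrow> nat) \<Rightarrow> nat \<Rightarrow> nat \<Rightarrow> nat \<Rightarrow> nat" where
  "cc A so w k u = (if A u w + zz A so w k < 0 then jj n (Suc k) else 0)"

lemma wlp_LEVEL:
  assumes ok: "ok \<sigma>" and w: "wvar \<sigma> ''w'' = w" "w < n" and k: "wvar \<sigma> ''k'' = k" "k < lv"
    and j: "wvar \<sigma> ''j'' = jj n k" and A: "A = mt \<sigma> ''A''" and so: "so = (\<lambda>w i. warr \<sigma> ''S'' (w * N + i))"
    and soN: "\<And>w i. w < n \<Longrightarrow> i < n \<Longrightarrow> so w i < n"
    and fi: "fi A so M0 (\<lambda>w' k' t. dn w k w' k') (\<lambda>w' k' t. dn w k w' k') (rarr \<sigma> ''M'')"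
    and fuel: "(\<Sum>u<n. cc A so w k u) \<le> wvar \<sigma> ''f''"
  shows "wlp MM LEVEL (\<lambda>\<sigma>'. fi A so M0 (\<lambda>w' k' t. dn w (Suc k) w' k') (\<lambda>w' k' t. dn w (Suc k) w' k') (rarr \<sigma>' ''M'') \<and>
      wvar \<sigma>' ''j'' = jj n (Suc k) \<and> wvar \<sigma>' ''f'' = wvar \<sigma> ''f'' - (\<Sum>u<n. cc A so w k u)) \<sigma>"
proof -
  define a where "a = nd w k"
  define z where "z = zz A so w k"
  define e where "e = jj n (Suc k)"
  have cN: "wvar \<sigma> ''N'' = N" "wvar \<sigma> ''n'' = n" using ok by (auto simp: ok_def)
  have aN: "a < N" "n \<le> a" using nd_less[OF w(2) k(2)] nd_ge[of w k] by (auto simp: a_def)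
  have jn: "jj n k < n" "e < n" using jj_less[OF n1, of k] jj_less[OF n1, of "Suc k"] by (simp_all add: e_def del: jj.simps)
  have wN: "w < N" using w n_le_N by simp
  have mods: "(((k + 1) mod MM) * n mod MM + w) mod MM = a"
  proof -
    have "k + 1 \<le> lv" using k by simp
    then have "k + 1 < MM" using lv_less by simp
    moreover have "(k + 1) * n < MM" using aN(1) N_less by (simp add: a_def nd_def)
    moreover have "(k + 1) * n + w < MM" using aN(1) N_less by (simp add: a_def nd_def)
    ultimately show ?thesis by (simp add: a_def nd_def)
  qed
  have zidx: "(w * N mod MM + warr \<sigma> ''S'' (w * N + jj n k)) mod MM = w * N + so w (jj n k)"
    using pair_less_MM[OF wN, of "so w (jj n k)"] soN[OF w(2) jn(1)] n_le_N pair_less_MM[OF wN, of 0] N1 by (simp add: so)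
  have zv: "rarr \<sigma> ''A'' (w * N + so w (jj n k)) = z" by (simp add: z_def zz_def A)
  have jm: "((jj n k + jj n k) mod MM + 1) mod MM = 2 * jj n k + 1"
  proof -
    have "n * 2 \<le> N"
    proof -
      have "n * 2 \<le> (q * q) * l" using n_le l2 by (intro mult_le_mono)
      then show ?thesis by (simp add: N_def nb_def ac_simps)
    qed
    then have "2 * jj n k + 1 < MM" using jn(1) N_less by linarith
    then show ?thesis by (simp add: mult_2)
  qed
  define \<sigma>1 where "\<sigma>1 = \<sigma>\<lparr>rvar := (rvar \<sigma>)(''z'' := z), wvar := (wvar \<sigma>)(''a'' := a, ''o'' := e)\<rparr>"
  let ?t = "FOR ''t'' ''n'' (Cond (RLess (RArr ''A'' (ix ''w'' ''t'')) (RVar ''z'')) Skip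
        (RStore ''M'' (ix ''a'' ''t'') (RSub (RArr ''A'' (ix ''w'' ''t'')) (RVar ''z''))))"
  let ?ub = "Seq (RAssign ''x'' (RAdd (RArr ''A'' (ix ''u'' ''w'')) (RVar ''z'')))
        (Cond (RLess (RVar ''x'') RZero) EXPL (RStore ''M'' (ix ''u'' ''a'') (RVar ''x'')))"
  let ?u = "FOR ''u'' ''n'' ?ub"
  let ?post = "\<lambda>\<sigma>'. fi A so M0 (\<lambda>w' k' t. dn w (Suc k) w' k') (\<lambda>w' k' t. dn w (Suc k) w' k') (rarr \<sigma>' ''M'') \<and>
      wvar \<sigma>' ''j'' = jj n (Suc k) \<and> wvar \<sigma>' ''f'' = wvar \<sigma> ''f'' - (\<Sum>u<n. cc A so w k u)"
  let ?Dt = "\<lambda>t w' k' t'. dn w k w' k' \<or> w' = w \<and> k' = k \<and> t' < (t::nat)"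
  have pre: "wlp MM LEVEL ?post \<sigma> = wlp MM ?t (wlp MM ?u (wlp MM (WAssign ''j'' (WVar ''o'')) ?post)) \<sigma>1"
  proof -
    have 1: "wval MM (\<sigma>\<lparr>wvar := (wvar \<sigma>)(''a'' := a), rvar := (rvar \<sigma>)(''z'' := z)\<rparr>) (WAdd (WAdd (WVar ''j'') (WVar ''j'')) (WConst 1)) = 2 * jj n k + 1"
      using jm j by simp
    have 2: "\<sigma>1 = \<sigma>\<lparr>rvar := (rvar \<sigma>)(''z'' := z), wvar := (wvar \<sigma>)(''a'' := a, ''o'' := 2 * jj n k + 1)\<rparr>" if "2 * jj n k + 1 < n"
      using that by (simp add: \<sigma>1_def e_def)
    have 3: "\<sigma>1 = \<sigma>\<lparr>rvar := (rvar \<sigma>)(''z'' := z), wvar := (wvar \<sigma>)(''a'' := a, ''o'' := n - 1)\<rparr>" if "\<not> 2 * jj n k + 1 < n"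
      using that by (simp add: \<sigma>1_def e_def)
    have A0: "wval MM \<sigma> (WAdd (WMult (WAdd (WVar ''k'') (WConst 1)) (WVar ''n'')) (WVar ''w'')) = a"
      using mods w k cN by simp
    have Z0: "rval MM (wset ''a'' a \<sigma>) (RArr ''A'' (WAdd (WMult (WVar ''w'') (WVar ''N'')) (WArr ''S'' (ix ''w'' ''j'')))) = z"
      using zidx zv w j cN wN jn n_le_N by simp
    show ?thesis
      unfolding LEVEL_def wlp_Seq[of _ "WAssign ''a'' _"] wlp_Seq[of _ "RAssign ''z'' _"] wlp_Seq[of _ "WAssign ''o'' _"] wlp_Seq[of _ "Cond _ Skip _"]
        wlp_Seq[of _ "FOR ''t'' _ _"] wlp_Seq[of _ "FOR ''u'' _ _"] wlp_WAssign[of _ "''a''"] A0 wlp_RAssign[of _ "''z''"] Z0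
      using 1 2 3 cN by (cases "2 * jj n k + 1 < n") (simp_all add: n1)
  qed
  have c1: "wvar \<sigma>1 ''n'' = n" "wvar \<sigma>1 ''N'' = N" "wvar \<sigma>1 ''w'' = w" "wvar \<sigma>1 ''a'' = a" "wvar \<sigma>1 ''o'' = e" "rvar \<sigma>1 ''z'' = z"
    "rarr \<sigma>1 = rarr \<sigma>" "warr \<sigma>1 = warr \<sigma>" "wvar \<sigma>1 ''f'' = wvar \<sigma> ''f''"
    using w by (auto simp: \<sigma>1_def cN)
  have ok1: "ok \<sigma>1" using ok by (simp add: ok_def \<sigma>1_def)
  show ?thesis
    unfolding pre
  proof (rule wlp_FOR[where I = "\<lambda>t \<tau>. fi A so M0 (?Dt t) (\<lambda>w' k' t. dn w k w' k') (rarr \<tau> ''M'')"])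
    show "fi A so M0 (?Dt 0) (\<lambda>w' k' t. dn w k w' k') (rarr (wset ''t'' 0 \<sigma>1) ''M'')" using fi c1 by simp
    fix t \<tau> assume t: "t < wvar \<sigma>1 ''n''" and I: "fi A so M0 (?Dt t) (\<lambda>w' k' t. dn w k w' k') (rarr \<tau> ''M'')"
      and fr: "fr ?t \<sigma>1 \<tau>" and tt: "wvar \<tau> ''t'' = t"
    have v: "wvar \<tau> ''N'' = N" "wvar \<tau> ''w'' = w" "wvar \<tau> ''a'' = a" "rvar \<tau> ''z'' = z" "rarr \<tau> ''A'' = rarr \<sigma> ''A''"
      by (simp_all add: frw[OF fr] frr[OF fr] frra[OF fr] c1)
    have tn: "t < n" "t < N" using t c1 n_le_N by auto
    let ?Mx = "rarr \<tau> ''M''"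
    let ?M' = "if A w t < z then ?Mx else ?Mx(a * N + t := A w t - z)"
    have "fi A so M0 (?Dt t) (\<lambda>w' k' t. dn w k w' k') ?M'"
    proof (cases "A w t < z")
      case False
      have "fi A so M0 (?Dt t) (\<lambda>w' k' t. dn w k w' k') (?Mx(a * N + t := A w t - z))"
        by (rule fi_step[OF I soN aN(1) tn(2)]) (use aN tn w k in \<open>auto simp: a_def z_def\<close>)
      then show ?thesis using False by simp
    qed (use I in simp)
    then have "fi A so M0 (?Dt (Suc t)) (\<lambda>w' k' t. dn w k w' k') ?M'"
      unfolding fi_def[of _ _ _ "?Dt (Suc t)"]
    proof (intro conjI)
      assume f: "fi A so M0 (?Dt t) (\<lambda>w' k' t. dn w k w' k') ?M'"
      show "\<forall>w'<n. \<forall>k'<lv. \<forall>t'<n. ?Dt (Suc t) w' k' t' \<longrightarrow> zz A so w' k' \<le> A w' t' \<longrightarrow> ?M' (nd w' k' * N + t') = A w' t' - zz A so w' k'"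
      proof (intro allI impI)
        fix w' k' t' assume x: "w' < n" "k' < lv" "t' < n" "?Dt (Suc t) w' k' t'" "zz A so w' k' \<le> A w' t'"
        show "?M' (nd w' k' * N + t') = A w' t' - zz A so w' k'"
        proof (cases "?Dt t w' k' t'")
          case True
          then show ?thesis using fi_D(2)[OF f x(1,2,3) _ x(5)] by blast
        next
          case False
          then have "w' = w" "k' = k" "t' = t" using x(4) by (auto simp: less_Suc_eq)
          then show ?thesis using x by (simp add: a_def z_def)
        qed
      qed
    qed (auto simp only: fi_def)
    then show "wlp MM (Cond (RLess (RArr ''A'' (ix ''w'' ''t'')) (RVar ''z'')) Skip
        (RStore ''M'' (ix ''a'' ''t'') (RSub (RArr ''A'' (ix ''w'' ''t'')) (RVar ''z''))))
        (\<lambda>\<tau>'. fi A so M0 (?Dt (Suc t)) (\<lambda>w' k' t. dn w k w' k') (rarr (wset ''t'' (Suc t) \<tau>') ''M'')) \<tau>"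
      using v tt tn wN aN by (simp add: A split: if_splits)
  next
    fix \<tau> assume "fi A so M0 (?Dt (wvar \<sigma>1 ''n'')) (\<lambda>w' k' t. dn w k w' k') (rarr \<tau> ''M'')" and fr: "fr ?t \<sigma>1 \<tau>"
    then have fi2: "fi A so M0 (\<lambda>w' k' t. dn w (Suc k) w' k') (\<lambda>w' k' t. dn w k w' k') (rarr \<tau> ''M'')"
      by (elim fi_mono) (auto simp: c1 dn_def less_Suc_eq)
    have v: "wvar \<tau> ''n'' = n" "wvar \<tau> ''N'' = N" "wvar \<tau> ''w'' = w" "wvar \<tau> ''a'' = a" "wvar \<tau> ''o'' = e" "rvar \<tau> ''z'' = z" "rarr \<tau> ''A'' = rarr \<sigma> ''A''"
       "warr \<tau> ''S'' = warr \<sigma> ''S''" "wvar \<tau> ''f'' = wvar \<sigma> ''f''"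
      by (simp_all add: frw[OF fr] frr[OF fr] frra[OF fr] frwa[OF fr] c1)
    have ok2: "ok \<tau>" by (rule ok_fr[OF fr ok1]) (auto simp: cns_def)
    let ?D = "\<lambda>w' k' t. dn w (Suc k) w' k'"
    let ?I = "\<lambda>u \<tau>'. fi A so M0 ?D (?Dt u) (rarr \<tau>' ''M'') \<and> wvar \<tau>' ''f'' + (\<Sum>u'<u. cc A so w k u') = wvar \<sigma> ''f''"
    show "wlp MM ?u (wlp MM (WAssign ''j'' (WVar ''o'')) ?post) \<tau>"
    proof (rule wlp_FOR[where I = ?I])
      show "?I 0 (wset ''u'' 0 \<tau>)" using fi2 v by simp
      fix u \<tau>1 assume u: "u < wvar \<tau> ''n''" and I: "?I u \<tau>1" and fr1: "fr ?u \<tau> \<tau>1" and uu: "wvar \<tau>1 ''u'' = u"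
      have un: "u < n" "u < N" using u v n_le_N by auto
      have v1: "wvar \<tau>1 ''N'' = N" "wvar \<tau>1 ''w'' = w" "wvar \<tau>1 ''a'' = a" "wvar \<tau>1 ''o'' = e" "rvar \<tau>1 ''z'' = z" "rarr \<tau>1 ''A'' = rarr \<sigma> ''A''"
         "warr \<tau>1 ''S'' = warr \<sigma> ''S''"
        by (simp_all add: frw[OF fr1] frr[OF fr1] frra[OF fr1] frwa[OF fr1] v)
      have ok3: "ok \<tau>1" by (rule ok_fr[OF fr1 ok2]) (auto simp: cns_def)
      have "(\<Sum>u'<Suc u. cc A so w k u') \<le> (\<Sum>u'<n. cc A so w k u')" using un by (intro sum_mono2) auto
      then have fu: "cc A so w k u \<le> wvar \<tau>1 ''f''" using I fuel by simp
      let ?\<tau> = "\<tau>1\<lparr>rvar := (rvar \<tau>1)(''x'' := A u w + z)\<rparr>"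
      have ok4: "ok ?\<tau>" using ok3 by (simp add: ok_def)
      have close: "fi A so M0 ?D (?Dt (Suc u)) Mx'" if f: "fi A so M0 ?D (?Dt u) Mx'"
        and "0 \<le> A u w + z \<Longrightarrow> Mx' (u * N + a) = A u w + z" "A u w + z < 0 \<Longrightarrow> (\<forall>i<e. Mx' (u * N + so w i) \<le> A u w + A w (so w i))" for Mx'
        unfolding fi_def[of _ _ _ _ "?Dt (Suc u)"]
      proof (intro conjI)
        show "\<forall>w'<n. \<forall>k'<lv. \<forall>u'<n. ?Dt (Suc u) w' k' u' \<longrightarrow> (0 \<le> A u' w' + zz A so w' k' \<longrightarrow> Mx' (u' * N + nd w' k') = A u' w' + zz A so w' k') \<and>
          (A u' w' + zz A so w' k' < 0 \<longrightarrow> (\<forall>i<jj n (Suc k'). Mx' (u' * N + so w' i) \<le> A u' w' + A w' (so w' i)))"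
        proof (intro allI impI)
          fix w' k' u' assume x: "w' < n" "k' < lv" "u' < n" "?Dt (Suc u) w' k' u'"
          show "(0 \<le> A u' w' + zz A so w' k' \<longrightarrow> Mx' (u' * N + nd w' k') = A u' w' + zz A so w' k') \<and>
            (A u' w' + zz A so w' k' < 0 \<longrightarrow> (\<forall>i<jj n (Suc k'). Mx' (u' * N + so w' i) \<le> A u' w' + A w' (so w' i)))"
          proof (cases "?Dt u w' k' u'")
            case True
            then show ?thesis using fi_D(3,4)[OF f x(1,2,3)] by blast
          next
            case False
            then have eq: "w' = w" "k' = k" "u' = u" using x(4) by (auto simp: less_Suc_eq)
            show ?thesis unfolding eq using that(2,3) unfolding a_def z_def e_def by blast
          qed
        qed
      qed (use f in \<open>auto simp only: fi_def\<close>)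
      have "wlp MM (Cond (RLess (RVar ''x'') RZero) EXPL (RStore ''M'' (ix ''u'' ''a'') (RVar ''x''))) (\<lambda>\<tau>'. ?I (Suc u) (wset ''u'' (Suc u) \<tau>')) ?\<tau>"
      proof (cases "A u w + z < 0")
        case True
        have c: "cc A so w k u = e" using True by (simp add: cc_def z_def e_def)
        have E: "wlp MM EXPL (\<lambda>\<sigma>'. fi A so M0 ?D (?Dt u) (rarr \<sigma>' ''M'') \<and>
             (\<forall>i<e. rarr \<sigma>' ''M'' (u * N + so w i) \<le> A u w + A w (so w i)) \<and> wvar \<sigma>' ''f'' = wvar ?\<tau> ''f'' - e) ?\<tau>"
          by (rule wlp_EXPL[OF ok4 _ w(2) _ un(1)]) (use v1 uu jn soN I fu c in \<open>simp_all add: A so\<close>)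
        have "wlp MM EXPL (\<lambda>\<tau>'. ?I (Suc u) (wset ''u'' (Suc u) \<tau>')) ?\<tau>"
          by (rule wlp_conseq[OF E]) (use close True I fu c in auto)
        then show ?thesis using True by simp
      next
        case False
        have c: "cc A so w k u = 0" using False by (simp add: cc_def z_def)
        have "fi A so M0 ?D (?Dt u) ((rarr \<tau>1 ''M'')(u * N + a := A u w + z))"
          by (rule fi_step[OF conjunct1[OF I] soN un(2) aN(1)]) (use aN un w k in \<open>auto simp: a_def z_def\<close>)
        then have "fi A so M0 ?D (?Dt (Suc u)) ((rarr \<tau>1 ''M'')(u * N + a := A u w + z))"
          by (rule close) (use False in auto)
        then show ?thesis using False I c v1 uu un aN by simp
      qed
      then show "wlp MM ?ub (\<lambda>\<tau>'. ?I (Suc u) (wset ''u'' (Suc u) \<tau>')) \<tau>1"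
        using v1 uu un wN by (simp add: A)
    next
      fix \<tau>1 assume I: "?I (wvar \<tau> ''n'') \<tau>1" and fr1: "fr ?u \<tau> \<tau>1"
      have "wvar \<tau>1 ''o'' = e" by (simp add: frw[OF fr1] v)
      moreover have "fi A so M0 ?D ?D (rarr \<tau>1 ''M'')"
        by (rule fi_mono[OF conjunct1[OF I]]) (auto simp: v dn_def less_Suc_eq)
      ultimately show "wlp MM (WAssign ''j'' (WVar ''o'')) ?post \<tau>1" using I v by (auto simp: e_def)
    qed (use v n_less in auto)
  qed (use c1 n_less in auto)
qed

lemma wlp_FILL:
  assumes ok: "ok \<sigma>" and A: "A = mt \<sigma> ''A''" and so: "so = (\<lambda>w i. warr \<sigma> ''S'' (w * N + i))"
    and soN: "\<And>w i. w < n \<Longrightarrow> i < n \<Longrightarrow> so w i < n" and M0: "M0 = mt \<sigma> ''M''"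
    and fuel: "(\<Sum>w<n. \<Sum>k<lv. \<Sum>u<n. cc A so w k u) \<le> wvar \<sigma> ''f''"
  shows "wlp MM FILL (\<lambda>\<sigma>'. fi A so M0 (\<lambda>w k t. True) (\<lambda>w k t. True) (rarr \<sigma>' ''M'')) \<sigma>"
proof -
  have c: "wvar \<sigma> ''n'' = n" "wvar \<sigma> ''E'' = lv" using ok by (auto simp: ok_def)
  define used where "used = (\<lambda>w k. (\<Sum>w'<w. \<Sum>k<lv. \<Sum>u<n. cc A so w' k u) + (\<Sum>k'<k. \<Sum>u<n. cc A so w k' u))"
  have used_le: "used w k \<le> wvar \<sigma> ''f''" if "w < n" "k \<le> lv" for w k
  proof -
    have "(\<Sum>k'<k. \<Sum>u<n. cc A so w k' u) \<le> (\<Sum>k'<lv. \<Sum>u<n. cc A so w k' u)" using that by (intro sum_mono2) auto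
    then have "used w k \<le> (\<Sum>w'<Suc w. \<Sum>k<lv. \<Sum>u<n. cc A so w' k u)" by (simp add: used_def)
    also have "\<dots> \<le> (\<Sum>w'<n. \<Sum>k<lv. \<Sum>u<n. cc A so w' k u)" using that by (intro sum_mono2) auto
    finally show ?thesis using fuel by simp
  qed
  let ?D = "\<lambda>w k w' k' t. dn w k w' k'"
  let ?I = "\<lambda>w k \<tau>. fi A so M0 (?D w k) (?D w k) (rarr \<tau> ''M'') \<and> wvar \<tau> ''f'' + used w k = wvar \<sigma> ''f''"
  show ?thesis
    unfolding FILL_def
  proof (rule wlp_FOR[where I = "\<lambda>w \<tau>. ?I w 0 \<tau>"])
    show "?I 0 0 (wset ''w'' 0 \<sigma>)" by (simp add: fi_def M0 dn_def used_def)
    fix w \<tau> assume w: "w < wvar \<sigma> ''n''" and I: "?I w 0 \<tau>" and fr: "fr (FOR ''w'' ''n'' (Seq (WAssign ''j'' (WConst 0)) (FOR ''k'' ''E'' LEVEL))) \<sigma> \<tau>"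
      and ww: "wvar \<tau> ''w'' = w"
    have wn: "w < n" using w c by simp
    have ok1: "ok \<tau>" by (rule ok_fr[OF fr ok]) (auto simp: cns_def)
    have v: "rarr \<tau> ''A'' = rarr \<sigma> ''A''" "warr \<tau> ''S'' = warr \<sigma> ''S''" by (simp_all add: frra[OF fr] frwa[OF fr])
    let ?\<tau> = "wset ''j'' 0 \<tau>"
    have ok2: "ok ?\<tau>" using ok1 by (simp add: ok_def)
    have "wlp MM (FOR ''k'' ''E'' LEVEL) (\<lambda>\<tau>'. ?I (Suc w) 0 (wset ''w'' (Suc w) \<tau>')) ?\<tau>"
    proof (rule wlp_FOR[where I = "\<lambda>k \<tau>'. ?I w k \<tau>' \<and> wvar \<tau>' ''j'' = jj n k"])
      show "wvar ?\<tau> ''E'' < MM" using ok2 lv_less by (simp add: ok_def)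
      show "?I w 0 (wset ''k'' 0 ?\<tau>) \<and> wvar (wset ''k'' 0 ?\<tau>) ''j'' = jj n 0" using I by simp
      fix k \<tau>1 assume k: "k < wvar ?\<tau> ''E''" and J: "?I w k \<tau>1 \<and> wvar \<tau>1 ''j'' = jj n k" and fr1: "fr (FOR ''k'' ''E'' LEVEL) ?\<tau> \<tau>1"
        and kk: "wvar \<tau>1 ''k'' = k"
      have kl: "k < lv" using k ok2 by (simp add: ok_def)
      have ok3: "ok \<tau>1" by (rule ok_fr[OF fr1 ok2]) (auto simp: cns_def)
      have v1: "rarr \<tau>1 ''A'' = rarr \<sigma> ''A''" "warr \<tau>1 ''S'' = warr \<sigma> ''S''" "wvar \<tau>1 ''w'' = w"
        by (simp_all add: frra[OF fr1] frwa[OF fr1] frw[OF fr1] v ww)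
      have us: "used w (Suc k) = used w k + (\<Sum>u<n. cc A so w k u)" by (simp add: used_def)
      have "used w (Suc k) \<le> wvar \<sigma> ''f''" using used_le[OF wn, of "Suc k"] kl by simp
      then have fu: "(\<Sum>u<n. cc A so w k u) \<le> wvar \<tau>1 ''f''" using J us by simp
      have L: "wlp MM LEVEL (\<lambda>\<sigma>'. fi A so M0 (\<lambda>w' k' t. dn w (Suc k) w' k') (\<lambda>w' k' t. dn w (Suc k) w' k') (rarr \<sigma>' ''M'') \<and>
         wvar \<sigma>' ''j'' = jj n (Suc k) \<and> wvar \<sigma>' ''f'' = wvar \<tau>1 ''f'' - (\<Sum>u<n. cc A so w k u)) \<tau>1"
        by (rule wlp_LEVEL[OF ok3 v1(3) wn kk kl]) (use J v1 fu soN in \<open>simp_all add: A so\<close>)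
      show "wlp MM LEVEL (\<lambda>\<tau>'. ?I w (Suc k) (wset ''k'' (Suc k) \<tau>') \<and> wvar (wset ''k'' (Suc k) \<tau>') ''j'' = jj n (Suc k)) \<tau>1"
        by (rule wlp_conseq[OF L]) (use J us fu in simp)
    next
      fix \<tau>1 :: machine_state assume "?I w (wvar ?\<tau> ''E'') \<tau>1 \<and> wvar \<tau>1 ''j'' = jj n (wvar ?\<tau> ''E'')"
      then have J: "?I w lv \<tau>1" using ok2 by (simp add: ok_def)
      have "fi A so M0 (?D (Suc w) 0) (?D (Suc w) 0) (rarr \<tau>1 ''M'')"
        by (rule fi_mono[OF conjunct1[OF J]]) (auto simp: dn_def less_Suc_eq)
      moreover have "used (Suc w) 0 = used w lv" by (simp add: used_def)
      ultimately show "?I (Suc w) 0 (wset ''w'' (Suc w) \<tau>1)" using J by simp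
    qed auto
    then show "wlp MM (Seq (WAssign ''j'' (WConst 0)) (FOR ''k'' ''E'' LEVEL)) (\<lambda>\<tau>'. ?I (Suc w) 0 (wset ''w'' (Suc w) \<tau>')) \<tau>" by simp
  next
    fix \<tau> :: machine_state assume I: "?I (wvar \<sigma> ''n'') 0 \<tau>"
    show "fi A so M0 (\<lambda>w k t. True) (\<lambda>w k t. True) (rarr \<tau> ''M'')"
      by (rule fi_mono[OF conjunct1[OF I]]) (auto simp: c dn_def)
  qed (use c n_less in auto)
qed

end

section \<open>The effect of a round\<close>

lemma sum_card_swap:
  "(\<Sum>p<a. card {w. w < b \<and> P p w}) = (\<Sum>w<b. card {p. p < a \<and> P p w})" for a b :: nat
proof -
  have c: "card {w. w < b \<and> Q w} = (\<Sum>w<b. if Q w then 1 else 0)" for b :: nat and Q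
  proof -
    have "{w. w < b \<and> Q w} = {w \<in> {..<b}. Q w}" by auto
    then show ?thesis by (simp only: card_eq_sum sum.inter_filter[OF finite_lessThan])
  qed
  show ?thesis unfolding c by (rule sum.swap)
qed

context sizes
begin

text \<open>An auxiliary node gets the potential \<open>h w + zz A so w k\<close>, for which its
  edges inherit feasibility from \<open>A\<close>; entries between vertices only decrease, so tight
  edges stay tight. A token over \<open>w\<close> is served at the least level whose pivot makes the
  first edge nonnegative. If the second edge is negative there, then the target lies before this
  pivot, and the previous level, where the first edge was negative, has entered the pair
  explicitly.\<close>

lemma fill_ok:
  assumes feasA: "\<And>x y. x < n \<Longrightarrow> y < n \<Longrightarrow> h y \<le> h x + A x y"
    and g: "\<And>u w. u < n \<Longrightarrow> w < n \<Longrightarrow> \<bar>A u w\<bar> \<le> g" "0 \<le> g"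
    and M0: "\<And>u w. u < N \<Longrightarrow> w < N \<Longrightarrow> M0 u w = (if u = w then 0 else if u < n \<and> w < n then A u w else 3 * g)"
    and so: "\<And>w. w < n \<Longrightarrow> bij_betw (so w) {..<n} {..<n}"
      "\<And>w i j. w < n \<Longrightarrow> i \<le> j \<Longrightarrow> j < n \<Longrightarrow> A w (so w i) \<le> A w (so w j)"
    and fi: "fi A so M0 (\<lambda>w k t. True) (\<lambda>w k t. True) Mx" and M: "M = (\<lambda>u v. Mx (u * N + v))"
  obtains h' where "\<And>x. x < n \<Longrightarrow> h' x = h x" "\<And>x y. x < N \<Longrightarrow> y < N \<Longrightarrow> h' y \<le> h' x + M x y"
    "\<And>x. x < N \<Longrightarrow> M x x = 0" "\<And>p r. tight n A h p r \<Longrightarrow> tight n M h' p r"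
    "\<And>p r. tokA n A h p r \<Longrightarrow> tokM n N M M h' p r"
proof -
  have soN: "so w i < n" if "w < n" "i < n" for w i using so(1)[OF that(1)] that by (auto simp: bij_betw_def)
  let ?z = "zz A so"
  define h' where "h' = (\<lambda>x. if x < n then h x else if \<exists>w k. w < n \<and> k < lv \<and> x = nd w k
     then (THE y. \<exists>w k. w < n \<and> k < lv \<and> x = nd w k \<and> y = h w + ?z w k) else h 0)"
  have h'n: "h' x = h x" if "x < n" for x using that by (simp add: h'_def)
  have h'nd: "h' (nd w k) = h w + ?z w k" if "w < n" "k < lv" for w k
  proof -
    have "(THE y. \<exists>w' k'. w' < n \<and> k' < lv \<and> nd w k = nd w' k' \<and> y = h w' + ?z w' k') = h w + ?z w k"
      by (rule the_equality) (use that nd_inj in auto)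
    then show ?thesis using that nd_ge[of w k] by (auto simp: h'_def)
  qed
  have zg: "\<bar>?z w k\<bar> \<le> g" if "w < n" for w k
    unfolding zz_def using g soN[OF that] jj_less[OF n1] that by blast
  have hg: "\<bar>h x - h y\<bar> \<le> g" if "x < n" "y < n" for x y
    using feasA[OF that] feasA[OF that(2,1)] g(1)[OF that] g(1)[OF that(2,1)] by linarith
  have cases: "\<exists>w e. w < n \<and> h' x = h w + e \<and> \<bar>e\<bar> \<le> g" for x
  proof -
    consider "x < n" | w k where "w < n" "k < lv" "x = nd w k" | "\<not> x < n" "\<not> (\<exists>w k. w < n \<and> k < lv \<and> x = nd w k)" by blast
    then show ?thesis
    proof cases
      case 1
      then show ?thesis using h'n g(2) by (intro exI[of _ x] exI[of _ 0]) simp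
    next
      case 2
      then show ?thesis using h'nd zg by (intro exI[of _ w] exI[of _ "?z w k"]) simp
    next
      case 3
      then show ?thesis using g(2) n1 by (intro exI[of _ 0] exI[of _ 0]) (auto simp: h'_def)
    qed
  qed
  \<comment> \<open>Vertices differ by at most \<open>g\<close>, and every node is within
    \<open>g\<close> of the potential of some vertex. This is the origin of the factor 3 in
    \<open>BASE\<close>.\<close>
  have h3: "h' y - h' x \<le> 3 * g" for x y
  proof -
    obtain w e where 1: "w < n" "h' x = h w + e" "\<bar>e\<bar> \<le> g" using cases by blast
    obtain w' e' where 2: "w' < n" "h' y = h w' + e'" "\<bar>e'\<bar> \<le> g" using cases by blast
    show ?thesis using 1 2 hg[OF 1(1) 2(1)] by linarith
  qed
  have feas: "h' y \<le> h' x + M x y" if xy: "x < N" "y < N" for x y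
    using fi_D(1)[OF fi xy]
  proof (elim disjE exE conjE)
    assume "Mx (x * N + y) = M0 x y"
    then show ?thesis using M0[OF xy] h3[of y x] feasA[of x y] h'n[of x] h'n[of y] by (auto simp: M split: if_splits)
  next
    fix w assume "x < n" "y < n" "w < n" "Mx (x * N + y) = A x w + A w y"
    then show ?thesis using feasA[of x w] feasA[of w y] h'n[of x] h'n[of y] by (simp add: M)
  next
    fix k w assume "k < lv" "w < n" "x = nd w k" "y < n" "Mx (x * N + y) = A w y - ?z w k"
    then show ?thesis using feasA[of w y] h'nd[of w k] h'n[of y] by (simp add: M)
  next
    fix k w assume "k < lv" "w < n" "y = nd w k" "x < n" "Mx (x * N + y) = A x w + ?z w k"
    then show ?thesis using feasA[of x w] h'nd[of w k] h'n[of x] by (simp add: M)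
  qed
  have diag: "M x x = 0" if x: "x < N" for x
    using fi_D(1)[OF fi x x]
  proof (elim disjE exE conjE)
    assume "Mx (x * N + x) = M0 x x"
    then show ?thesis using M0[OF x x] by (simp add: M)
  next
    fix w assume "x < n" "w < n" "Mx (x * N + x) = A x w + A w x" "Mx (x * N + x) \<le> M0 x x"
    then show ?thesis using feasA[of x w] feasA[of w x] M0[OF x x] by (simp add: M)
  next
    fix k w assume "x = nd w k" "x < n"
    then show ?thesis using nd_ge[of w k] by simp
  next
    fix k w assume "x = nd w k" "x < n"
    then show ?thesis using nd_ge[of w k] by simp
  qed
  have MA: "M u v \<le> A u v" if "u < n" "v < n" for u v
    using fi_old_le[OF fi that] M0[of u v] feasA[of u v] that n_le_N by (auto simp: M split: if_splits)
  have ti: "tight n M h' p r" if "tight n A h p r" for p r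
    using that MA[of p r] h'n[of p] h'n[of r] by (auto simp: tight_def)
  have tok: "tokM n N M M h' p r" if tok: "tokA n A h p r" for p r
  proof -
    obtain w where pr: "p < n" "r < n" "h p \<le> h r" and w: "w < n" "A p w + A w r \<le> h r - h p"
      using tok by (auto simp: tokA_def)
    have eq: "A p w + A w r = h r - h p" using w feasA[of p w] feasA[of w r] pr by linarith
    have N: "p < N" "r < N" "w < N" using pr w n_le_N by auto
    have "r \<in> so w ` {..<n}" using so(1)[OF w(1)] pr by (auto simp: bij_betw_def)
    then obtain i where i: "i < n" "so w i = r" by auto
    let ?P = "\<lambda>k. 0 \<le> A p w + ?z w k"
    \<comment> \<open>The last pivot is the largest entry of the row, so a level with a nonnegative
      first edge exists.\<close>
    have "A w r \<le> ?z w (lv - 1)" unfolding zz_def jj_last using so(2)[OF w(1), of i "n - 1"] i n1 by simp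
    then have last: "?P (lv - 1)" using eq pr by linarith
    define k where "k = (LEAST k. ?P k)"
    have Pk: "?P k" unfolding k_def by (rule LeastI[of ?P, OF last])
    have "k \<le> lv - 1" unfolding k_def by (rule Least_le[of ?P, OF last])
    then have kl: "k < lv" using lv1 by simp
    have "\<exists>g<N. 0 \<le> M p g \<and> 0 \<le> M g r \<and> M p g + M g r \<le> h' r - h' p"
    proof (cases "?z w k \<le> A w r")
      case True
      have "M p (nd w k) = A p w + ?z w k" "M (nd w k) r = A w r - ?z w k"
        using fi_D(3)[OF fi w(1) kl pr(1) _ Pk] fi_D(2)[OF fi w(1) kl pr(2) _ True] by (auto simp: M)
      then show ?thesis using nd_less[OF w(1) kl] Pk True eq h'n pr by (intro exI[of _ "nd w k"]) auto
    next
      case False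
      have ij: "i < jj n k"
      proof (rule ccontr)
        assume "\<not> i < jj n k"
        then have "?z w k \<le> A w r" unfolding zz_def using so(2)[OF w(1), of "jj n k" i] i by simp
        then show False using False by simp
      qed
      then obtain k' where k': "k = Suc k'" by (cases k) auto
      have "\<not> ?P k'" using not_less_Least[of k' ?P] k' unfolding k_def by simp
      then have "Mx (p * N + so w i) \<le> A p w + A w (so w i)"
        using fi_D(4)[OF fi w(1) _ pr(1), of k' i] ij k' kl by (simp add: not_le)
      then have "M p r \<le> h r - h p" using i eq by (simp add: M)
      then have "M p r = h r - h p" using feas[OF N(1,2)] h'n pr by simp
      \<comment> \<open>The explicit edge leads to \<open>r\<close> already; the entry 0 on the
        diagonal at \<open>r\<close> serves as the second edge.\<close>
      then show ?thesis using N pr diag[OF N(2)] h'n by (intro exI[of _ r]) simp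
    qed
    moreover have "M p w + M w r \<le> h' r - h' p" using MA[of p w] MA[of w r] w pr h'n by simp
    ultimately show ?thesis using pr w(1) unfolding tokM_def by blast
  qed
  show thesis by (rule that[of h']) (use h'n feas diag ti tok in auto)
qed

text \<open>If the pivot at the position \<open>jj n k\<close> forms a negative pair with
  \<open>A u w\<close>, then so do all \<open>jj n k + 1\<close> entries up to it. The explicit
  pairs of this level, at most twice as many, are charged to these. Exchanging the sums then counts,
  for fixed \<open>u\<close> and \<open>t\<close>, the vertices \<open>w\<close> in between, of
  which there are at most \<open>m\<close>; the factor \<open>lv\<close> accounts for the
  levels.\<close>

lemma fill_count:
  assumes so: "\<And>w. w < n \<Longrightarrow> bij_betw (so w) {..<n} {..<n}"
      "\<And>w i j. w < n \<Longrightarrow> i \<le> j \<Longrightarrow> j < n \<Longrightarrow> A w (so w i) \<le> A w (so w j)"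
    and few: "\<And>u t. u < n \<Longrightarrow> t < n \<Longrightarrow> card {w. w < n \<and> A u w + A w t < 0} \<le> m"
  shows "(\<Sum>w<n. \<Sum>k<lv. \<Sum>u<n. cc A so w k u) \<le> cf"
proof -
  have one: "cc A so w k u \<le> 2 * card {t. t < n \<and> A u w + A w t < 0}" if w: "w < n" for w k u
  proof (cases "A u w + zz A so w k < 0")
    case True
    have "so w ` {..jj n k} \<subseteq> {t. t < n \<and> A u w + A w t < 0}"
    proof
      fix t assume "t \<in> so w ` {..jj n k}"
      then obtain i where i: "i \<le> jj n k" "t = so w i" by auto
      have jn: "jj n k < n" using jj_less[OF n1] .
      have "t < n" using so(1)[OF w] i jn by (auto simp: bij_betw_def)
      moreover have "A w t \<le> zz A so w k" unfolding zz_def using so(2)[OF w i(1) jn] i by simp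
      ultimately show "t \<in> {t. t < n \<and> A u w + A w t < 0}" using True by auto
    qed
    then have "card (so w ` {..jj n k}) \<le> card {t. t < n \<and> A u w + A w t < 0}" by (intro card_mono) auto
    moreover have "inj_on (so w) {..jj n k}"
      using so(1)[OF w] jj_less[OF n1, of k] by (auto simp: bij_betw_def elim!: inj_on_subset)
    ultimately have "Suc (jj n k) \<le> card {t. t < n \<and> A u w + A w t < 0}" by (simp add: card_image)
    then show ?thesis using True jj_Suc_le[OF n1, of k] unfolding cc_def by (simp del: jj.simps)
  qed (simp add: cc_def)
  have "(\<Sum>w<n. \<Sum>k<lv. \<Sum>u<n. cc A so w k u) \<le> (\<Sum>w<n. \<Sum>k<lv. \<Sum>u<n. 2 * card {t. t < n \<and> A u w + A w t < 0})"
    by (intro sum_mono one) auto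
  also have "\<dots> = (\<Sum>w<n. lv * (\<Sum>u<n. 2 * card {t. t < n \<and> A u w + A w t < 0}))" by simp
  also have "\<dots> = lv * (\<Sum>w<n. \<Sum>u<n. 2 * card {t. t < n \<and> A u w + A w t < 0})" by (simp add: sum_distrib_left)
  also have "(\<Sum>w<n. \<Sum>u<n. 2 * card {t. t < n \<and> A u w + A w t < 0}) = (\<Sum>u<n. \<Sum>w<n. 2 * card {t. t < n \<and> A u w + A w t < 0})"
    by (rule sum.swap)
  also have "\<dots> = (\<Sum>u<n. 2 * (\<Sum>t<n. card {w. w < n \<and> A u w + A w t < 0}))"
  proof (intro sum.cong refl)
    fix u
    have "(\<Sum>w<n. card {t. t < n \<and> A u w + A w t < 0}) = (\<Sum>t<n. card {w. w < n \<and> A u w + A w t < 0})"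
      by (rule sum_card_swap)
    then show "(\<Sum>w<n. 2 * card {t. t < n \<and> A u w + A w t < 0}) = 2 * (\<Sum>t<n. card {w. w < n \<and> A u w + A w t < 0})"
      by (simp only: sum_distrib_left[symmetric])
  qed
  also have "lv * \<dots> \<le> lv * (\<Sum>u<n. 2 * (\<Sum>t<n. m))"
    by (intro mult_le_mono2 sum_mono) (use few in auto)
  also have "\<dots> = cf" by (simp add: cf_def)
  finally show ?thesis .
qed

text \<open>
  The matrix of a round and the potentials \<open>h\<close> that certify it: \<open>h\<close> is the sought distance \<open>h0\<close>
  up to the accumulated reweighting, and every vertex is reached from the source by tight edges
  of which at most \<open>k\<close> are not covered by tokens.
\<close>

definition IM :: "(nat \<Rightarrow> real) \<Rightarrow> nat \<Rightarrow> machine_state \<Rightarrow> bool" where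
  "IM h0 k \<sigma> \<longleftrightarrow> (\<exists>h. (\<forall>x<n. h x = h0 x + rarr \<sigma> ''P'' x) \<and> (\<forall>x<N. mt \<sigma> ''M'' x x = 0) \<and>
     (\<forall>x<N. \<forall>y<N. h y \<le> h x + mt \<sigma> ''M'' x y) \<and>
     (\<forall>y<n. \<exists>j\<le>k. reach s (tight n (mt \<sigma> ''M'') h) (tokM n N (mt \<sigma> ''M'') (mt \<sigma> ''M'') h) j y))"

text \<open>The same bound on betweenness is used twice: for the edges that the explorations relax
  and for the pairs of shortcuts with negative weight. Both are sums of two values that
  \<open>T\<close> bounds from below.\<close>

lemma wlp_ROUND:
  assumes ok: "ok \<sigma>" and IM: "IM h0 k \<sigma>" and hubs: "\<And>i. i < q \<Longrightarrow> warr \<sigma> ''h'' i < N"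
    and hit: "\<And>x y. x < N \<Longrightarrow> y < N \<Longrightarrow> warr \<sigma> ''h'' ` {..<q} \<inter> hit N m (mt \<sigma> ''M'') x y \<noteq> {}"
  shows "wlp MM ROUND (IM h0 ((k + 1) div 2)) \<sigma>"
proof -
  let ?M = "mt \<sigma> ''M''"
  obtain h where hP: "\<And>x. x < n \<Longrightarrow> h x = h0 x + rarr \<sigma> ''P'' x" and diag: "\<And>x. x < N \<Longrightarrow> ?M x x = 0"
    and feas: "\<And>x y. x < N \<Longrightarrow> y < N \<Longrightarrow> h y \<le> h x + ?M x y"
    and reach: "\<And>y. y < n \<Longrightarrow> \<exists>j\<le>k. reach s (tight n ?M h) (tokM n N ?M ?M h) j y" using IM unfolding IM_def by blast
  show ?thesis
    unfolding ROUND_def wlp_Seq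
  proof (rule wlp_conseq[OF wlp_COPY[OF ok]])
    fix \<tau>1 assume 1: "\<forall>x<N. \<forall>y<N. mt \<tau>1 ''H'' x y = ?M x y \<and> mt \<tau>1 ''W'' x y = ?M x y" and fr1: "fr COPY \<sigma> \<tau>1"
    have ok1: "ok \<tau>1" by (rule ok_fr[OF fr1 ok]) (auto simp: cns_def)
    have v1: "warr \<tau>1 ''h'' = warr \<sigma> ''h''" "rarr \<tau>1 ''P'' = rarr \<sigma> ''P''" "rarr \<tau>1 ''M'' = rarr \<sigma> ''M''"
      by (simp_all add: frwa[OF fr1] frra[OF fr1])
    show "wlp MM (FOR ''h'' ''q'' HUB) (wlp MM (SORT ''W'' ''N'') (wlp MM (FUEL ''ce'') (wlp MM EXPLORE
       (wlp MM (SORT ''A'' ''n'') (wlp MM BASE (wlp MM (FUEL ''cf'') (wlp MM FILL (IM h0 ((k + 1) div 2))))))))) \<tau>1"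
    proof (rule wlp_conseq[OF wlp_HUBS[OF ok1, of ?M h]])
      fix \<tau>2 assume "\<exists>\<phi>. hubinv N ?M h \<phi> (mt \<tau>2 ''H'') (warr \<tau>1 ''h'' ` {..<q}) \<and>
        (\<forall>x<N. \<forall>y<N. mt \<tau>2 ''W'' x y = ?M x y - \<phi> x + \<phi> y) \<and> (\<forall>x<n. rarr \<tau>2 ''P'' x = rarr \<tau>1 ''P'' x + \<phi> x)"
        and fr2: "fr (FOR ''h'' ''q'' HUB) \<tau>1 \<tau>2"
      then obtain \<phi> where inv: "hubinv N ?M h \<phi> (mt \<tau>2 ''H'') (warr \<sigma> ''h'' ` {..<q})"
        and W: "\<And>x y. x < N \<Longrightarrow> y < N \<Longrightarrow> mt \<tau>2 ''W'' x y = ?M x y - \<phi> x + \<phi> y"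
        and P: "\<And>x. x < n \<Longrightarrow> rarr \<tau>2 ''P'' x = rarr \<sigma> ''P'' x + \<phi> x" using v1 by auto
      have btw: "btw N m ?M \<phi>" by (rule hubs_btw[OF inv hit])
      have ok2: "ok \<tau>2" by (rule ok_fr[OF fr2 ok1]) (auto simp: cns_def)
      have M2: "rarr \<tau>2 ''M'' = rarr \<sigma> ''M''" by (simp add: frra[OF fr2] v1)
      define X where "X = mt \<tau>2 ''W''"
      define h1 where "h1 = (\<lambda>x. h x + \<phi> x)"
      have feas1: "h1 y \<le> h1 x + X x y" if "x < N" "y < N" for x y
        using feas[OF that] W[OF that] by (simp add: X_def h1_def)
      have XF: "0 \<le> X x y" if "x < N" "y < N" "0 \<le> ?M x y" for x y
      proof -
        have "0 \<le> mt \<tau>2 ''H'' x y" "mt \<tau>2 ''H'' x y \<le> ?M x y - \<phi> x + \<phi> y" using inv that unfolding hubinv_def by auto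
        then show ?thesis using W[OF that(1,2)] by (simp add: X_def)
      qed
      have diagX: "X x x = 0" if "x < N" for x using W[OF that that] diag[OF that] by (simp add: X_def)
      have reach1: "\<exists>j\<le>k. reach s (tight n X h1) (tokM n N ?M X h1) j y" if y: "y < n" for y
      proof -
        obtain j where j: "j \<le> k" "reach s (tight n ?M h) (tokM n N ?M ?M h) j y" using reach[OF y] by blast
        have "reach s (tight n X h1) (tokM n N ?M X h1) j y"
        proof (rule reach_mono[OF j(2)])
          fix p r assume "tight n ?M h p r"
          then show "tight n X h1 p r" using W[of p r] n_le_N by (auto simp: tight_def X_def h1_def)
        next
          fix p r assume "tokM n N ?M ?M h p r"
          then obtain w g where a: "p < n" "r < n" "w < n" "?M p w + ?M w r \<le> h r - h p" "g < N" "0 \<le> ?M p g" "0 \<le> ?M g r"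
            "?M p g + ?M g r \<le> h r - h p" by (auto simp: tokM_def)
          have N: "p < N" "r < N" "w < N" using a n_le_N by auto
          have "X p w + X w r \<le> h1 r - h1 p" "X p g + X g r \<le> h1 r - h1 p"
            using a(4,8) W[OF N(1,3)] W[OF N(3,2)] W[OF N(1) a(5)] W[OF a(5) N(2)] by (auto simp: X_def h1_def)
          then show "tokM n N ?M X h1 p r" using a unfolding tokM_def by blast
        qed
        then show ?thesis using j by blast
      qed
      have c2: "wvar \<tau>2 ''N'' = N" "wvar \<tau>2 ''n'' = n" using ok2 by (auto simp: ok_def)
      show "wlp MM (SORT ''W'' ''N'') (wlp MM (FUEL ''ce'') (wlp MM EXPLORE
       (wlp MM (SORT ''A'' ''n'') (wlp MM BASE (wlp MM (FUEL ''cf'') (wlp MM FILL (IM h0 ((k + 1) div 2)))))))) \<tau>2"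
      proof (rule wlp_conseq[OF wlp_SORT[OF ok2 c2(1)]])
        fix \<tau>3 assume 3: "\<forall>r<N. srt (warr \<tau>3 ''S'') (mt \<tau>2 ''W'') N r" and fr3: "fr (SORT ''W'' ''N'') \<tau>2 \<tau>3"
        have ok3: "ok \<tau>3" by (rule ok_fr[OF fr3 ok2]) (auto simp: cns_def)
        define \<tau>4 where "\<tau>4 = wset ''f'' ce \<tau>3"
        have ok4: "ok \<tau>4" using ok3 by (simp add: ok_def \<tau>4_def)
        have v4: "rarr \<tau>4 ''M'' = rarr \<sigma> ''M''" "rarr \<tau>4 ''W'' = rarr \<tau>2 ''W''" "warr \<tau>4 ''S'' = warr \<tau>3 ''S''" "wvar \<tau>4 ''f'' = ce"
          "rarr \<tau>4 ''P'' = rarr \<tau>2 ''P''"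
          by (simp_all add: \<tau>4_def frra[OF fr3] M2)
        have fu: "wlp MM (FUEL ''ce'') Q \<tau>3 = Q \<tau>4" for Q
          using ok3 by (simp add: FUEL_def \<tau>4_def ok_def)
        \<comment> \<open>The closure of row \<open>b\<close> in the matrix of the round,
          reweighted. If adding the edge from \<open>p\<close> to \<open>w\<close> gives a negative
          value, then \<open>p\<close> counts as lying between \<open>b\<close> and
          \<open>w\<close>: the closure dominates \<open>T\<close> to \<open>p\<close>, and the edge
          dominates \<open>T\<close> from \<open>p\<close>.\<close>
        define low where "low = (\<lambda>b y. Kc N ?M (?M b) y - \<phi> b + \<phi> y)"
        have TX: "T N ?M b p + T N ?M p w < \<phi> b - \<phi> w" if "b < N" "p < N" "w < N" "low b p + X p w < 0" for b p w
          using T_le_Kc[OF that(2), of ?M b] T_le_edge[OF that(2,3), of ?M] diag[OF that(2)] W[OF that(2,3)] that(4)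
          by (simp add: low_def X_def)
        have low1: "low b y \<le> X b y" if "b < n" "y < N" for b y
          using Kc_le[OF that(2), of ?M "?M b"] W[of b y] that n_le_N by (simp add: low_def X_def)
        have low2: "low b y \<le> low b x + X x y" if "x < N" "y < N" "0 \<le> ?M x y" for b x y
          using Kc_step[of x N y ?M "?M b"] that W[OF that(1,2)] by (simp add: low_def X_def)
        have few: "(\<Sum>p<N. cnt X p (low b p)) \<le> N * m" if b: "b < n" for b
        proof -
          have "(\<Sum>p<N. cnt X p (low b p)) = (\<Sum>w<N. card {p. p < N \<and> act False (low b p) (X p w)})"
            unfolding cnt_def by (rule sum_card_swap)
          also have "\<dots> \<le> (\<Sum>w<N. m)"
          proof (rule sum_mono)
            fix w assume w: "w \<in> {..<N}"
            have "card {p. p < N \<and> act False (low b p) (X p w)} \<le> card {z. z < N \<and> T N ?M b z + T N ?M z w < \<phi> b - \<phi> w}"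
              by (rule card_mono) (use TX[of b _ w] b w n_le_N in \<open>auto simp: act_def\<close>)
            also have "\<dots> \<le> m" using btw b w n_le_N unfolding btw_def by auto
            finally show "card {p. p < N \<and> act False (low b p) (X p w)} \<le> m" .
          qed
          finally show ?thesis by simp
        qed
        have E: "wlp MM EXPLORE (\<lambda>\<sigma>'. \<exists>f R. \<forall>b<n. dij N ?M X False (X b) (f b) (R b) \<and> (\<forall>w<n. mt \<sigma>' ''A'' b w = R b w)) \<tau>4"
          by (rule wlp_EXPLORE[OF ok4, where low = low])
             (use XF 3 low1 low2 few in \<open>auto simp: v4 X_def ce_def\<close>)
        show "wlp MM (FUEL ''ce'') (wlp MM EXPLORE (wlp MM (SORT ''A'' ''n'') (wlp MM BASE (wlp MM (FUEL ''cf'') (wlp MM FILL (IM h0 ((k + 1) div 2))))))) \<tau>3"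
          unfolding fu
        proof (rule wlp_conseq[OF E])
          fix \<tau>5 assume "\<exists>f R. \<forall>b<n. dij N ?M X False (X b) (f b) (R b) \<and> (\<forall>w<n. mt \<tau>5 ''A'' b w = R b w)" and fr5: "fr EXPLORE \<tau>4 \<tau>5"
          then obtain f R where d: "\<And>b. b < n \<Longrightarrow> dij N ?M X False (X b) (f b) (R b)" and AR: "\<And>b w. b < n \<Longrightarrow> w < n \<Longrightarrow> mt \<tau>5 ''A'' b w = R b w" by blast
          define A where "A = mt \<tau>5 ''A''"
          have ok5: "ok \<tau>5" by (rule ok_fr[OF fr5 ok4]) (auto simp: cns_def)
          have c5: "wvar \<tau>5 ''n'' = n" using ok5 by (simp add: ok_def)
          have P5: "rarr \<tau>5 ''P'' = rarr \<tau>2 ''P''" by (simp add: frra[OF fr5] v4)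
          have reachA: "\<exists>j\<le>(k + 1) div 2. reach s (tight n A h1) (tokA n A h1) j y" if y: "y < n" for y
          proof -
            obtain j where j: "j \<le> k" "reach s (tight n X h1) (tokM n N ?M X h1) j y" using reach1[OF y] by blast
            have "reach s (tight n A h1) (tokA n A h1) ((j + 1) div 2) y"
              by (rule halving[OF n_le_N s_less feas1 diagX XF d _ j(2)]) (use AR in \<open>auto simp: A_def\<close>)
            moreover have "(j + 1) div 2 \<le> (k + 1) div 2" using j(1) by (intro div_le_mono) simp
            ultimately show ?thesis by blast
          qed
          have feasA: "h1 y \<le> h1 x + A x y" if "x < n" "y < n" for x y
          proof -
            have xN: "x < N" "y < N" using that n_le_N by auto
            have "h1 y - h1 x \<le> R x y"
            proof (rule dij_R_ge[OF d[OF that(1)] _ _ xN(2), where c = "\<lambda>y. h1 y - h1 x"])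
              show "h1 z - h1 x \<le> X x z" if "z < N" for z using feas1[OF xN(1) that] by simp
              show "h1 z - h1 x \<le> h1 y - h1 x + X y z" if "y < N" "z < N" for y z using feas1[OF that] by simp
            qed
            then show ?thesis using AR[OF that] by (simp add: A_def)
          qed
          \<comment> \<open>A shortcut is an edge, or an edge followed by nonnegative edges and one
            last edge. \<open>T\<close> minimises over both, so the betweenness bound applies to
            pairs of shortcuts, too.\<close>
          have AT: "T N ?M u w - \<phi> u + \<phi> w \<le> A u w" if uw: "u < n" "w < n" for u w
          proof -
            have N: "u < N" "w < N" using uw n_le_N by auto
            have "R u w = X u w \<or> (\<exists>p<N. R u w = f u p + X p w)" using dijD(6)[OF d[OF uw(1)] N(2)] .
            then show ?thesis
            proof (elim disjE exE conjE)
              assume "R u w = X u w"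
              then show ?thesis using T_le_edge[OF N, of ?M] diag[OF N(1)] W[OF N] AR[OF uw] by (simp add: A_def X_def)
            next
              fix p assume p: "p < N" "R u w = f u p + X p w"
              have "low u p \<le> f u p"
                by (rule dijD(5)[OF d[OF uw(1)]]) (use low1[OF uw(1)] low2 p in auto)
              then show ?thesis using T_le[OF p(1), of ?M u w] W[OF p(1) N(2)] AR[OF uw] p(2) by (simp add: A_def X_def low_def)
            qed
          qed
          have fewA: "card {w. w < n \<and> A u w + A w t < 0} \<le> m" if ut: "u < n" "t < n" for u t
          proof -
            have "{w. w < n \<and> A u w + A w t < 0} \<subseteq> {z. z < N \<and> T N ?M u z + T N ?M z t < \<phi> u - \<phi> t}"
            proof (intro subsetI CollectI conjI; elim CollectE conjE)
              fix w assume w: "w < n" "A u w + A w t < 0"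
              show "w < N" using w n_le_N by simp
              show "T N ?M u w + T N ?M w t < \<phi> u - \<phi> t" using AT[OF ut(1) w(1)] AT[OF w(1) ut(2)] w(2) by simp
            qed
            then have "card {w. w < n \<and> A u w + A w t < 0} \<le> card {z. z < N \<and> T N ?M u z + T N ?M z t < \<phi> u - \<phi> t}"
              by (intro card_mono) auto
            also have "\<dots> \<le> m" using btw ut n_le_N unfolding btw_def by auto
            finally show ?thesis .
          qed
          show "wlp MM (SORT ''A'' ''n'') (wlp MM BASE (wlp MM (FUEL ''cf'') (wlp MM FILL (IM h0 ((k + 1) div 2))))) \<tau>5"
          proof (rule wlp_conseq[OF wlp_SORT[OF ok5 c5]])
            fix \<tau>6 assume 6: "\<forall>r<n. srt (warr \<tau>6 ''S'') (mt \<tau>5 ''A'') n r" and fr6: "fr (SORT ''A'' ''n'') \<tau>5 \<tau>6"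
            have ok6: "ok \<tau>6" by (rule ok_fr[OF fr6 ok5]) (auto simp: cns_def)
            have v6: "rarr \<tau>6 ''A'' = rarr \<tau>5 ''A''" "rarr \<tau>6 ''P'' = rarr \<tau>2 ''P''" by (simp_all add: frra[OF fr6] P5)
            define so where "so = (\<lambda>w i. warr \<tau>6 ''S'' (w * N + i))"
            have so1: "bij_betw (so w) {..<n} {..<n}" if "w < n" for w
              using 6 that unfolding srt_def so_def by blast
            have so2: "A w (so w i) \<le> A w (so w j)" if "w < n" "i \<le> j" "j < n" for w i j
              using 6 that unfolding srt_def so_def A_def by blast
            show "wlp MM BASE (wlp MM (FUEL ''cf'') (wlp MM FILL (IM h0 ((k + 1) div 2)))) \<tau>6"
            proof (rule wlp_conseq[OF wlp_BASE[OF ok6]])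
              fix \<tau>7 assume "\<exists>g. (\<forall>u<n. \<forall>w<n. \<bar>mt \<tau>6 ''A'' u w\<bar> \<le> g) \<and> 0 \<le> g \<and>
                 (\<forall>u<N. \<forall>w<N. mt \<tau>7 ''M'' u w = (if u = w then 0 else if u < n \<and> w < n then mt \<tau>6 ''A'' u w else 3 * g))"
                and fr7: "fr BASE \<tau>6 \<tau>7"
              then obtain g where g: "\<And>u w. u < n \<Longrightarrow> w < n \<Longrightarrow> \<bar>A u w\<bar> \<le> g" "0 \<le> g"
                 "\<And>u w. u < N \<Longrightarrow> w < N \<Longrightarrow> mt \<tau>7 ''M'' u w = (if u = w then 0 else if u < n \<and> w < n then A u w else 3 * g)"
                unfolding v6 A_def by blast
              have ok7: "ok \<tau>7" by (rule ok_fr[OF fr7 ok6]) (auto simp: cns_def)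
              define \<tau>8 where "\<tau>8 = wset ''f'' cf \<tau>7"
              have ok8: "ok \<tau>8" using ok7 by (simp add: ok_def \<tau>8_def)
              have v8: "rarr \<tau>8 ''A'' = rarr \<tau>5 ''A''" "rarr \<tau>8 ''P'' = rarr \<tau>2 ''P''" "warr \<tau>8 ''S'' = warr \<tau>6 ''S''" "rarr \<tau>8 ''M'' = rarr \<tau>7 ''M''" "wvar \<tau>8 ''f'' = cf"
                by (simp_all add: \<tau>8_def frra[OF fr7] frwa[OF fr7] v6)
              have fu8: "wlp MM (FUEL ''cf'') Q \<tau>7 = Q \<tau>8" for Q
                using ok7 by (simp add: FUEL_def \<tau>8_def ok_def)
              have soN: "so w i < n" if "w < n" "i < n" for w i using so1[OF that(1)] that by (auto simp: bij_betw_def)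
              have F: "wlp MM FILL (\<lambda>\<sigma>'. fi A so (mt \<tau>7 ''M'') (\<lambda>w k t. True) (\<lambda>w k t. True) (rarr \<sigma>' ''M'')) \<tau>8"
                by (rule wlp_FILL[OF ok8]) (use soN fill_count[OF so1 so2 fewA] in \<open>simp_all add: v8 A_def so_def\<close>)
              show "wlp MM (FUEL ''cf'') (wlp MM FILL (IM h0 ((k + 1) div 2))) \<tau>7"
                unfolding fu8
              proof (rule wlp_conseq[OF F])
                fix \<tau>9 assume fi: "fi A so (mt \<tau>7 ''M'') (\<lambda>w k t. True) (\<lambda>w k t. True) (rarr \<tau>9 ''M'')" and fr9: "fr FILL \<tau>8 \<tau>9"
                have P9: "rarr \<tau>9 ''P'' = rarr \<tau>2 ''P''" by (simp add: frra[OF fr9] v8)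
                obtain h' where h': "\<And>x. x < n \<Longrightarrow> h' x = h1 x" "\<And>x y. x < N \<Longrightarrow> y < N \<Longrightarrow> h' y \<le> h' x + mt \<tau>9 ''M'' x y"
                  "\<And>x. x < N \<Longrightarrow> mt \<tau>9 ''M'' x x = 0" "\<And>p r. tight n A h1 p r \<Longrightarrow> tight n (mt \<tau>9 ''M'') h' p r"
                  "\<And>p r. tokA n A h1 p r \<Longrightarrow> tokM n N (mt \<tau>9 ''M'') (mt \<tau>9 ''M'') h' p r"
                  using fill_ok[OF feasA g(1,2,3) so1 so2 fi refl] by blast
                have "\<exists>j\<le>(k + 1) div 2. reach s (tight n (mt \<tau>9 ''M'') h') (tokM n N (mt \<tau>9 ''M'') (mt \<tau>9 ''M'') h') j y" if y: "y < n" for y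
                proof -
                  obtain j where j: "j \<le> (k + 1) div 2" "reach s (tight n A h1) (tokA n A h1) j y" using reachA[OF y] by blast
                  have "reach s (tight n (mt \<tau>9 ''M'') h') (tokM n N (mt \<tau>9 ''M'') (mt \<tau>9 ''M'') h') j y"
                    by (rule reach_mono[OF j(2)]) (use h'(4,5) in auto)
                  then show ?thesis using j(1) by blast
                qed
                then show "IM h0 ((k + 1) div 2) \<tau>9"
                  unfolding IM_def using h'(1,2,3) hP P P9 by (intro exI[of _ h']) (simp add: h1_def)
              qed
            qed
          qed (use n_le_N in auto)
        qed
      qed auto
    qed (use 1 feas diag hubs v1 in auto)
  qed
qed

end

section \<open>Shortest paths and potentials\<close>

text \<open>A closed walk that repeats a vertex splits into two shorter closed walks, and one of
  them is negative.\<close>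

lemma (in wf_digraph) neg_closed_imp_neg_cycle:
  assumes "awalk u c u" "awalk_cost f c < 0"
  shows "\<exists>p. cycle p \<and> awalk_cost f p < 0"
  using assms
proof (induction "length c" arbitrary: c u rule: less_induct)
  case less
  then obtain e c' where c: "c = e # c'" by (cases c) auto
  have e: "e \<in> arcs G" "u = tail G e" "awalk (head G e) c' u" using less.prems c by (auto simp: awalk_Cons_iff)
  show ?case
  proof (cases "distinct (awalk_verts (head G e) c')")
    case True
    then have "distinct (tl (awalk_verts u c))" by (simp add: c)
    then show ?thesis using less.prems c unfolding cycle_def by blast
  next
    case False
    obtain a r t x where d: "c' = a @ r @ t" "0 < length r" "awalk (head G e) a x" "awalk x r x" "awalk x t u"
      using awalk_not_distinct_decomp[OF e(3) False] by blast
    have "awalk u (e # a @ t) u" using e d awalk_appendI[OF d(3,5)] by (simp add: awalk_Cons_iff)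
    moreover have "awalk_cost f c = awalk_cost f r + awalk_cost f (e # a @ t)" by (simp add: c d)
    ultimately show ?thesis
      using less.hyps[of r x] less.hyps[of "e # a @ t" u] d less.prems(2) c by fastforce
  qed
qed

lemma (in pair_wf_digraph) potential_le_cost:
  assumes d: "\<And>x y. (x, y) \<in> parcs G \<Longrightarrow> d y \<le> d x + w (x, y)" and "awalk u p v"
  shows "d v \<le> d u + awalk_cost w p"
  using assms(2)
proof (induction p arbitrary: u)
  case Nil
  then show ?case by (simp add: awalk_Nil_iff)
next
  case (Cons e p)
  then have e: "e \<in> parcs G" "u = fst e" "awalk (snd e) p v" by (auto simp: awalk_Cons_iff)
  then show ?case using Cons.IH[OF e(3)] d[of "fst e" "snd e"] by simp
qed

lemma potential_no_negative_cycle: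
  assumes "pair_fin_digraph G" and "\<And>x y. (x, y) \<in> parcs G \<Longrightarrow> d y \<le> d x + w (x, y)"
  shows "\<not> has_negative_cycle G w"
proof
  interpret pair_fin_digraph G by fact
  assume "has_negative_cycle G w"
  then obtain p u where "awalk u p u" "awalk_cost w p < 0" unfolding has_negative_cycle_def cycle_def by blast
  then show False using potential_le_cost[of d w u p u] assms(2) by fastforce
qed

section \<open>Potentials of the completed graph\<close>

lemma pawalk_verts_heads: "pcas u p v \<Longrightarrow> pawalk_verts u p = u # map snd p"
  by (induction p arbitrary: u) auto

text \<open>Let \<open>W\<close> be the total absolute weight. A missing arc gets a weight of at
  least \<open>2 W\<close>, so a walk without repeated arcs that uses one costs at least
  \<open>2 W - W = W\<close>. Hence the completion creates no negative cycle, and it does not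
  shorten distances to reachable vertices, which are at most \<open>W\<close>. In return every
  vertex becomes reachable, so that all potentials are real numbers.\<close>

lemma shortest_potential:
  assumes inst: "sssp_instance n G s" and nc: "\<not> has_negative_cycle G w"
    and B: "2 * (\<Sum>e\<in>parcs G. \<bar>w e\<bar>) \<le> B"
    and A: "\<And>x y. x < n \<Longrightarrow> y < n \<Longrightarrow> A x y = (if x = y then 0 else if (x, y) \<notin> parcs G then B else w (x, y))"
  obtains h where "h s = 0" "\<And>x y. x < n \<Longrightarrow> y < n \<Longrightarrow> h y \<le> h x + A x y"
    "\<And>y. y < n \<Longrightarrow> \<exists>j\<le>n. reach s (tight n A h) (\<lambda>_ _. False) j y"
    "\<And>v p. pre_digraph.awalk (with_proj G) s p v \<Longrightarrow> ereal (h v) = sssp_dist G w s v"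
    "\<And>x y. (x, y) \<in> parcs G \<Longrightarrow> h y \<le> h x + w (x, y)"
proof -
  have G: "pair_fin_digraph G" and V: "pverts G = {..<n}" and s: "s < n" using inst by (auto simp: sssp_instance_def)
  interpret G: pair_fin_digraph G by fact
  define Gc :: "nat pair_pre_digraph" where "Gc = \<lparr>pverts = {..<n}, parcs = {(x, y). x < n \<and> y < n \<and> x \<noteq> y}\<rparr>"
  have Gc: "pverts Gc = {..<n}" "parcs Gc = {(x, y). x < n \<and> y < n \<and> x \<noteq> y}" by (auto simp: Gc_def)
  interpret C: pair_fin_digraph Gc
  proof
    have "parcs Gc \<subseteq> {..<n} \<times> {..<n}" by (auto simp: Gc)
    then show "finite (parcs Gc)" by (rule finite_subset) auto
  qed (auto simp: Gc)
  define c where "c = (\<lambda>e. A (fst e) (snd e))"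
  define W where "W = (\<Sum>e\<in>parcs G. \<bar>w e\<bar>)"
  have W0: "0 \<le> W" unfolding W_def by (rule sum_nonneg) simp
  have finG: "finite (parcs G)" using G.pair_finite_arcs .
  have arcG: "x < n \<and> y < n" if "(x, y) \<in> parcs G" for x y using G.in_arcsD1[OF that] G.in_arcsD2[OF that] V by simp
  have cw: "c e = w e" if "e \<in> parcs Gc" "e \<in> parcs G" for e using that A by (auto simp: c_def Gc)
  have cB: "c e = B" if "e \<in> parcs Gc" "e \<notin> parcs G" for e using that A by (auto simp: c_def Gc)
  have sub: "\<bar>\<Sum>e\<in>S. w e\<bar> \<le> W" if "S \<subseteq> parcs G" for S
  proof -
    have "\<bar>\<Sum>e\<in>S. w e\<bar> \<le> (\<Sum>e\<in>S. \<bar>w e\<bar>)" by (rule sum_abs)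
    also have "\<dots> \<le> W" unfolding W_def by (rule sum_mono2[OF finG that]) simp
    finally show ?thesis .
  qed
  have toG: "G.awalk u p v \<and> C.awalk_cost c p = G.awalk_cost w p" if "C.awalk u p v" "set p \<subseteq> parcs G" for u p v
  proof
    show "G.awalk u p v" using that V unfolding C.awalk_def G.awalk_def by (simp add: Gc)
    have "map c p = map w p" using that cw by (intro map_cong refl) (auto simp: C.awalk_def)
    then show "C.awalk_cost c p = G.awalk_cost w p" unfolding C.awalk_cost_def G.awalk_cost_def by (rule arg_cong)
  qed
  have big: "W \<le> C.awalk_cost c p" if p: "C.awalk u p v" "distinct p" "\<not> set p \<subseteq> parcs G" for u p v
  proof -
    have pc: "set p \<subseteq> parcs Gc" using p(1) by (auto simp: C.awalk_def)
    have "C.awalk_cost c p = (\<Sum>e\<in>set p. c e)" by (simp add: C.awalk_cost_def sum_list_distinct_conv_sum_set[OF p(2)])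
    also have "\<dots> = (\<Sum>e\<in>set p \<inter> parcs G. c e) + (\<Sum>e\<in>set p - parcs G. c e)"
      by (metis List.finite_set add.commute sum.Int_Diff)
    also have "(\<Sum>e\<in>set p \<inter> parcs G. c e) = (\<Sum>e\<in>set p \<inter> parcs G. w e)" using pc cw by (intro sum.cong) auto
    also have "(\<Sum>e\<in>set p - parcs G. c e) = (\<Sum>e\<in>set p - parcs G. B)" using pc cB by (intro sum.cong) auto
    also have "\<dots> = real (card (set p - parcs G)) * B" by simp
    finally have eq: "C.awalk_cost c p = (\<Sum>e\<in>set p \<inter> parcs G. w e) + real (card (set p - parcs G)) * B" .
    have "set p - parcs G \<noteq> {}" using p(3) by auto
    then have "1 \<le> real (card (set p - parcs G))" by (simp add: card_gt_0_iff Suc_le_eq)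
    moreover have B0: "0 \<le> B" using B W0 unfolding W_def by linarith
    ultimately have "1 * B \<le> real (card (set p - parcs G)) * B" by (intro mult_right_mono) auto
    moreover have "- W \<le> (\<Sum>e\<in>set p \<inter> parcs G. w e)" using sub[of "set p \<inter> parcs G"] by auto
    ultimately show ?thesis using eq B unfolding W_def by linarith
  qed
  have nocyc: "\<not> (C.awalk u p u \<and> C.awalk_cost c p < 0)" for u p
  proof
    assume "C.awalk u p u \<and> C.awalk_cost c p < 0"
    then obtain p' where "C.cycle p'" "C.awalk_cost c p' < 0" using C.neg_closed_imp_neg_cycle by blast
    then obtain u' where p': "C.awalk u' p' u'" "distinct (tl (pawalk_verts u' p'))" "p' \<noteq> []" "C.awalk_cost c p' < 0"
      unfolding C.cycle_def by auto
    have "pcas u' p' u'" using p'(1) by (simp add: C.awalk_def)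
    \<comment> \<open>\<open>big\<close> requires that no arc is repeated. This holds for a cycle
      because the heads of its arcs are distinct.\<close>
    then have "distinct (map snd p')" using p'(2) pawalk_verts_heads by fastforce
    then have dp: "distinct p'" by (simp add: distinct_map)
    show False
    proof (cases "set p' \<subseteq> parcs G")
      case True
      then have "G.awalk u' p' u'" "G.awalk_cost w p' < 0" using toG[OF p'(1) True] p'(4) by auto
      then have "G.cycle p'" using p'(2,3) unfolding G.cycle_def by auto
      then show False using nc \<open>G.awalk_cost w p' < 0\<close> unfolding has_negative_cycle_def by blast
    next
      case False
      then show False using big[OF p'(1) dp False] p'(4) W0 by simp
    qed
  qed
  have path: "\<exists>p. C.apath s p v \<and> C.\<mu> c s v = ereal (C.awalk_cost c p)" if "v < n" for v
  proof (rule C.no_neg_cyc_reach_imp_path)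
    show "s \<rightarrow>\<^sup>*\<^bsub>with_proj Gc\<^esub> v"
    proof (cases "s = v")
      case True
      then have "C.awalk s [] v" using s by (simp add: C.awalk_Nil_iff Gc)
      then show ?thesis using C.reachable_awalk by blast
    next
      case False
      then have "C.awalk s [(s, v)] v" using s that by (simp add: C.awalk_simps Gc)
      then show ?thesis using C.reachable_awalk by blast
    qed
    show "\<not> (\<exists>x r. C.awalk x r x \<and> x \<in> set (C.awalk_verts s p) \<and> C.awalk_cost c r < 0)" for p using nocyc by blast
  qed
  define h where "h = (\<lambda>v. real_of_ereal (C.\<mu> c s v))"
  have hp: "\<exists>p. C.apath s p v \<and> h v = C.awalk_cost c p" if "v < n" for v using path[OF that] by (auto simp: h_def)
  have hle: "h v \<le> C.awalk_cost c p" if "C.awalk s p v" for v p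
  proof -
    have "v < n" using C.awalk_last_in_verts[OF that] by (simp add: Gc)
    then obtain p' where "C.\<mu> c s v = ereal (C.awalk_cost c p')" using path by blast
    then show ?thesis using C.min_cost_le_walk_cost[OF that, of c] by (simp add: h_def)
  qed
  have feas: "h y \<le> h x + A x y" if xy: "x < n" "y < n" for x y
  proof (cases "x = y")
    case True
    then show ?thesis using A xy by simp
  next
    case False
    obtain p where p: "C.apath s p x" "h x = C.awalk_cost c p" using hp[OF xy(1)] by blast
    have "C.awalk x [(x, y)] y" using False xy by (simp add: C.awalk_simps Gc)
    then have "C.awalk s (p @ [(x, y)]) y" using p(1) C.awalk_appendI by (auto simp: C.apath_def)
    from hle[OF this] show ?thesis using p(2) by (simp add: c_def)
  qed
  have hs: "h s = 0"
  proof -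
    have "C.awalk s [] s" using s by (simp add: C.awalk_Nil_iff Gc)
    then have "h s \<le> 0" using hle by fastforce
    moreover obtain p where "C.apath s p s" "h s = C.awalk_cost c p" using hp[OF s] by blast
    then have "0 \<le> h s" using nocyc[of s p] by (auto simp: C.apath_def)
    ultimately show ?thesis by simp
  qed
  have reach: "reach s (tight n A h) (\<lambda>_ _. False) (length p) v" if "C.awalk s p v" "C.awalk_cost c p \<le> h v" for p v
    using that
  proof (induction p arbitrary: v rule: rev_induct)
    case Nil
    then show ?case using reach_start by (auto simp: C.awalk_Nil_iff)
  next
    case (snoc e p)
    obtain x where x: "C.awalk s p x" "C.awalk x [e] v" using snoc.prems(1) by auto
    then have e: "e = (x, v)" "x < n" "v < n" by (auto simp: C.awalk_simps Gc)
    have "h v \<le> h x + A x v" "h x \<le> C.awalk_cost c p" using feas e hle x(1) by auto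
    moreover have "C.awalk_cost c (p @ [e]) = C.awalk_cost c p + A x v" by (simp add: c_def e)
    ultimately have "C.awalk_cost c p \<le> h x" "tight n A h x v" using snoc.prems(2) e by (auto simp: tight_def)
    then show ?case using reach_step[OF snoc.IH[OF x(1)]] by simp
  qed
  have reachn: "\<exists>j\<le>n. reach s (tight n A h) (\<lambda>_ _. False) j y" if y: "y < n" for y
  proof -
    obtain p where p: "C.apath s p y" "h y = C.awalk_cost c p" using hp[OF y] by blast
    have "length p \<le> n" using C.length_apath_less[OF p(1)] by (simp add: Gc)
    then show ?thesis using reach[of p y] p by (auto simp: C.apath_def)
  qed
  have hG: "h y \<le> h x + w (x, y)" if "(x, y) \<in> parcs G" for x y
  proof (cases "x = y")
    case True
    \<comment> \<open>The completed graph has no loops but \<open>G\<close> may have them; each is a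
      cycle by itself and thus nonnegative.\<close>
    have "G.cycle [(x, x)]" using that True V arcG unfolding G.cycle_def by (auto simp: G.awalk_simps)
    then have "0 \<le> w (x, x)" using nc unfolding has_negative_cycle_def by (force simp: G.awalk_cost_def not_less)
    then show ?thesis using True by simp
  next
    case False
    then show ?thesis using feas[of x y] A[of x y] arcG[OF that] that by simp
  qed
  have dist: "ereal (h v) = sssp_dist G w s v" if p: "G.awalk s p v" for v p
  proof (rule antisym)
    have "h v \<le> G.awalk_cost w p'" if "G.awalk s p' v" for p'
      using G.potential_le_cost[of h w s p' v] hG that hs by simp
    then show "ereal (h v) \<le> sssp_dist G w s v"
      unfolding sssp_dist_def G.\<mu>_def by (intro INF_greatest) auto
    have vn: "v < n" using G.awalk_last_in_verts[OF p] V by simp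
    obtain p' where p': "C.apath s p' v" "h v = C.awalk_cost c p'" using hp[OF vn] by blast
    have aw: "C.awalk s p' v" using p'(1) by (simp add: C.apath_def)
    show "sssp_dist G w s v \<le> ereal (h v)"
    proof (cases "set p' \<subseteq> parcs G")
      case True
      then show ?thesis unfolding sssp_dist_def using toG[OF aw True] G.min_cost_le_walk_cost[of s p' v w] p'(2) by simp
    next
      case False
      have "distinct p'"
      proof -
        have "pcas s p' v" "distinct (pawalk_verts s p')" using p'(1) by (auto simp: C.apath_def C.awalk_def)
        then have "distinct (map snd p')" using pawalk_verts_heads by fastforce
        then show ?thesis by (simp add: distinct_map)
      qed
      then have "W \<le> h v" using big[OF aw _ False] p'(2) by simp
      obtain r where r: "G.apath s r v" using p G.apath_awalk_to_apath by blast
      have "distinct r"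
      proof -
        have "pcas s r v" "distinct (pawalk_verts s r)" using r by (auto simp: G.apath_def G.awalk_def)
        then have "distinct (map snd r)" using pawalk_verts_heads by fastforce
        then show ?thesis by (simp add: distinct_map)
      qed
      moreover have "set r \<subseteq> parcs G" using r by (auto simp: G.apath_def G.awalk_def)
      ultimately have "G.awalk_cost w r \<le> W"
        using sub[of "set r"] by (simp add: G.awalk_cost_def sum_list_distinct_conv_sum_set)
      moreover have "sssp_dist G w s v \<le> ereal (G.awalk_cost w r)"
        unfolding sssp_dist_def using r by (intro G.min_cost_le_walk_cost) (simp add: G.apath_def)
      ultimately show ?thesis using \<open>W \<le> h v\<close> by (meson ereal_less_eq(3) order_trans)
    qed
  qed
  show thesis by (rule that[OF hs feas reachn dist hG])
qed

section \<open>Input and output\<close>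

context sizes
begin

lemma nn_less: "x < n \<Longrightarrow> y < n \<Longrightarrow> x * n + y < MM"
proof -
  assume "x < n" "y < n"
  then have "x * n + y \<le> x * N + y" using n_le_N by simp
  also have "\<dots> < MM" using pair_less_MM \<open>x < n\<close> \<open>y < n\<close> n_le_N by simp
  finally show ?thesis .
qed

lemma wval_ex [simp]:
  assumes "wvar \<sigma> ''n'' = n" "wvar \<sigma> a < n" "wvar \<sigma> b < n"
  shows "wval MM \<sigma> (ex a b) = wvar \<sigma> a * n + wvar \<sigma> b"
  using nn_less[OF assms(2,3)] assms by (simp add: ex_def)

lemma wlp_LOAD:
  assumes ok: "ok \<sigma>" and z: "z = 2 * (\<Sum>x<n. \<Sum>y<n. \<bar>rarr \<sigma> ''weight'' (x * n + y)\<bar>)"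
  shows "wlp MM LOAD (\<lambda>\<sigma>'. \<forall>x<n. \<forall>y<n. mt \<sigma>' ''A'' x y = (if x = y then 0 else if warr \<sigma> ''edge'' (x * n + y) = 0 then z else rarr \<sigma> ''weight'' (x * n + y))) \<sigma>"
proof -
  let ?w = "\<lambda>x y. rarr \<sigma> ''weight'' (x * n + y)"
  have c: "wvar \<sigma> ''n'' = n" "wvar \<sigma> ''N'' = N" using ok by (auto simp: ok_def)
  let ?c1 = "Cond (RLess (RArr ''weight'' (ex ''x'' ''y'')) RZero)
       (RAssign ''z'' (RSub (RVar ''z'') (RArr ''weight'' (ex ''x'' ''y''))))
       (RAssign ''z'' (RAdd (RVar ''z'') (RArr ''weight'' (ex ''x'' ''y''))))"
  let ?c2 = "Cond (WEq (WVar ''x'') (WVar ''y'')) (RStore ''A'' (ix ''x'' ''y'') RZero)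
         (Cond (WEq (WArr ''edge'' (ex ''x'' ''y'')) (WConst 0)) (RStore ''A'' (ix ''x'' ''y'') (RVar ''z''))
            (RStore ''A'' (ix ''x'' ''y'') (RArr ''weight'' (ex ''x'' ''y''))))"
  let ?\<sigma> = "\<sigma>\<lparr>rvar := (rvar \<sigma>)(''z'' := 0)\<rparr>"
  show ?thesis
    unfolding LOAD_def wlp_Seq wlp_RAssign rval.simps
  proof (rule wlp_FOR2[where ca = n and cb = n and I = "\<lambda>a x r v. v ''z'' = (\<Sum>u<a. \<Sum>y<n. \<bar>?w u y\<bar>) + (\<Sum>y<x. \<bar>?w a y\<bar>)"])
    fix a x \<tau> assume ax: "a < n" "x < n" and I: "rvar \<tau> ''z'' = (\<Sum>u<a. \<Sum>y<n. \<bar>?w u y\<bar>) + (\<Sum>y<x. \<bar>?w a y\<bar>)"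
      and fr: "fr (FOR ''x'' ''n'' (FOR ''y'' ''n'' ?c1)) ?\<sigma> \<tau>" and v: "wvar \<tau> ''x'' = a" "wvar \<tau> ''y'' = x"
    have w: "wvar \<tau> ''n'' = n" "rarr \<tau> ''weight'' = rarr \<sigma> ''weight''" by (simp_all add: frra[OF fr] frw[OF fr] c)
    show "wlp MM ?c1 (\<lambda>\<tau>'. rvar \<tau>' ''z'' = (\<Sum>u<a. \<Sum>y<n. \<bar>?w u y\<bar>) + (\<Sum>y<Suc x. \<bar>?w a y\<bar>)) \<tau>"
      using I w v ax by simp
  next
    fix \<tau>1 assume I1: "rvar \<tau>1 ''z'' = (\<Sum>u<n. \<Sum>y<n. \<bar>?w u y\<bar>) + (\<Sum>y<0. \<bar>?w n y\<bar>)"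
      and fr1: "fr (FOR ''x'' ''n'' (FOR ''y'' ''n'' ?c1)) ?\<sigma> \<tau>1"
    let ?\<tau> = "\<tau>1\<lparr>rvar := (rvar \<tau>1)(''z'' := rvar \<tau>1 ''z'' + rvar \<tau>1 ''z'')\<rparr>"
    have w1: "wvar \<tau>1 ''N'' = N" "wvar \<tau>1 ''n'' = n" "rarr \<tau>1 ''weight'' = rarr \<sigma> ''weight''" "warr \<tau>1 ''edge'' = warr \<sigma> ''edge''"
      by (simp_all add: frra[OF fr1] frw[OF fr1] frwa[OF fr1] c)
    have z1: "rvar \<tau>1 ''z'' + rvar \<tau>1 ''z'' = z" using I1 z by simp
    let ?new = "\<lambda>x y. if x = y then 0 else if warr \<sigma> ''edge'' (x * n + y) = 0 then z else ?w x y"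
    show "wlp MM (FOR ''x'' ''n'' (FOR ''y'' ''n'' ?c2)) (\<lambda>\<sigma>'. \<forall>x<n. \<forall>y<n. mt \<sigma>' ''A'' x y = ?new x y) ?\<tau>"
    proof (rule wlp_FOR2[where ca = n and cb = n and I = "\<lambda>a x r v. \<forall>u<n. \<forall>y<n. u < a \<or> u = a \<and> y < x \<longrightarrow> r ''A'' (u * N + y) = ?new u y"])
      fix a x \<tau> assume ax: "a < n" "x < n" and I: "\<forall>u<n. \<forall>y<n. u < a \<or> u = a \<and> y < x \<longrightarrow> mt \<tau> ''A'' u y = ?new u y"
        and fr: "fr (FOR ''x'' ''n'' (FOR ''y'' ''n'' ?c2)) ?\<tau> \<tau>" and v: "wvar \<tau> ''x'' = a" "wvar \<tau> ''y'' = x"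
      have w: "wvar \<tau> ''N'' = N" "wvar \<tau> ''n'' = n" "rarr \<tau> ''weight'' = rarr \<sigma> ''weight''" "warr \<tau> ''edge'' = warr \<sigma> ''edge''" "rvar \<tau> ''z'' = z"
        by (simp_all add: frra[OF fr] frw[OF fr] frr[OF fr] frwa[OF fr] w1 z1)
      have axN: "a < N" "x < N" using ax n_le_N by auto
      have new: "wlp MM ?c2 (\<lambda>\<tau>'. rarr \<tau>' ''A'' = (rarr \<tau> ''A'')(a * N + x := ?new a x)) \<tau>"
        using w v ax axN by simp
      show "wlp MM ?c2 (\<lambda>\<tau>'. \<forall>u<n. \<forall>y<n. u < a \<or> u = a \<and> y < Suc x \<longrightarrow> mt \<tau>' ''A'' u y = ?new u y) \<tau>"
      proof (rule wlp_conseq[OF new], intro allI impI)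
        fix \<tau>' :: machine_state and u y assume "rarr \<tau>' ''A'' = (rarr \<tau> ''A'')(a * N + x := ?new a x)" "u < n" "y < n" "u < a \<or> u = a \<and> y < Suc x"
        then show "mt \<tau>' ''A'' u y = ?new u y" using I pair_inj[of y x u a] axN n_le_N by (cases "u = a \<and> y = x") (auto simp: less_Suc_eq)
      qed
    next
      fix \<tau>2 assume "\<forall>u<n. \<forall>y<n. u < n \<or> u = n \<and> y < 0 \<longrightarrow> mt \<tau>2 ''A'' u y = ?new u y"
      then show "\<forall>x<n. \<forall>y<n. mt \<tau>2 ''A'' x y = ?new x y" by simp
    qed (use w1 n_less in \<open>auto simp: less_Suc_eq\<close>)
  qed (use c n_less in auto)
qed

lemma wlp_DIST:
  assumes ok: "ok \<sigma>" and IM: "IM h0 1 \<sigma>"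
  shows "wlp MM DIST (\<lambda>\<sigma>'. \<forall>x<n. rarr \<sigma>' ''dist'' x = h0 x - h0 s) \<sigma>"
proof -
  let ?M = "mt \<sigma> ''M''"
  obtain h where hP: "\<And>x. x < n \<Longrightarrow> h x = h0 x + rarr \<sigma> ''P'' x" and diag: "\<And>x. x < N \<Longrightarrow> ?M x x = 0"
    and feas: "\<And>x y. x < N \<Longrightarrow> y < N \<Longrightarrow> h y \<le> h x + ?M x y"
    and reach: "\<And>y. y < n \<Longrightarrow> \<exists>j\<le>1. reach s (tight n ?M h) (tokM n N ?M ?M h) j y" using IM unfolding IM_def by blast
  have sN: "s < N" using s_less n_le_N by simp
  have row1: "wlp MM (ROWK ''M'' (ix ''s'' ''x'')) (\<lambda>\<sigma>'. \<forall>x<N. rarr \<sigma>' ''K'' x = rarr \<sigma> ''M'' (s * N + x)) \<sigma>"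
    by (rule wlp_ROWK[OF ok]) (use sN in \<open>auto simp: ok_def\<close>)
  show ?thesis
    unfolding DIST_def wlp_Seq
  proof (rule wlp_conseq[OF row1])
    fix \<tau>1 assume 1: "\<forall>x<N. rarr \<tau>1 ''K'' x = rarr \<sigma> ''M'' (s * N + x)" and fr1: "fr (ROWK ''M'' (ix ''s'' ''x'')) \<sigma> \<tau>1"
    have ok1: "ok \<tau>1" by (rule ok_fr[OF fr1 ok]) (auto simp: cns_def)
    have v1: "rarr \<tau>1 ''M'' = rarr \<sigma> ''M''" "rarr \<tau>1 ''P'' = rarr \<sigma> ''P''" by (simp_all add: frra[OF fr1])
    have D1: "wlp MM (DIJ (FULL ''M'' (ix ''p'' ''w''))) (\<lambda>\<sigma>'. dij N (\<lambda>p w. rarr \<tau>1 ''M'' (p * N + w)) (\<lambda>p w. rarr \<tau>1 ''M'' (p * N + w)) True (?M s) (rarr \<sigma>' ''K'') (rarr \<sigma>' ''R'')) \<tau>1"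
      by (rule wlp_DIJ_FULL[OF ok1]) (use 1 in \<open>auto simp: ok_def\<close>)
    show "wlp MM (DIJ (FULL ''M'' (ix ''p'' ''w''))) (wlp MM (ROWK ''R'' (WVar ''x'')) (wlp MM (DIJ (FULL ''M'' (ix ''p'' ''w'')))
       (wlp MM (FOR ''x'' ''n'' (RStore ''dist'' (WVar ''x'') (RAdd (RSub (RArr ''K'' (WVar ''x'')) (RArr ''P'' (WVar ''x''))) (RArr ''P'' (WVar ''s'')))))
         (\<lambda>\<sigma>'. \<forall>x<n. rarr \<sigma>' ''dist'' x = h0 x - h0 s)))) \<tau>1"
    proof (rule wlp_conseq[OF D1])
      fix \<tau>2 assume "dij N (\<lambda>p w. rarr \<tau>1 ''M'' (p * N + w)) (\<lambda>p w. rarr \<tau>1 ''M'' (p * N + w)) True (?M s) (rarr \<tau>2 ''K'') (rarr \<tau>2 ''R'')"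
        and fr2: "fr (DIJ (FULL ''M'' (ix ''p'' ''w''))) \<tau>1 \<tau>2"
      then have d2: "dij N ?M ?M True (?M s) (rarr \<tau>2 ''K'') (rarr \<tau>2 ''R'')" using v1 by simp
      have ok2: "ok \<tau>2" by (rule ok_fr[OF fr2 ok1]) (auto simp: cns_def)
      have v2: "rarr \<tau>2 ''M'' = rarr \<sigma> ''M''" "rarr \<tau>2 ''P'' = rarr \<sigma> ''P''" by (simp_all add: frra[OF fr2] v1)
      have row2: "wlp MM (ROWK ''R'' (WVar ''x'')) (\<lambda>\<sigma>'. \<forall>x<N. rarr \<sigma>' ''K'' x = rarr \<tau>2 ''R'' x) \<tau>2"
        by (rule wlp_ROWK[OF ok2]) auto
      show "wlp MM (ROWK ''R'' (WVar ''x'')) (wlp MM (DIJ (FULL ''M'' (ix ''p'' ''w'')))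
       (wlp MM (FOR ''x'' ''n'' (RStore ''dist'' (WVar ''x'') (RAdd (RSub (RArr ''K'' (WVar ''x'')) (RArr ''P'' (WVar ''x''))) (RArr ''P'' (WVar ''s'')))))
         (\<lambda>\<sigma>'. \<forall>x<n. rarr \<sigma>' ''dist'' x = h0 x - h0 s))) \<tau>2"
      proof (rule wlp_conseq[OF row2])
        fix \<tau>3 assume 3: "\<forall>x<N. rarr \<tau>3 ''K'' x = rarr \<tau>2 ''R'' x" and fr3: "fr (ROWK ''R'' (WVar ''x'')) \<tau>2 \<tau>3"
        have ok3: "ok \<tau>3" by (rule ok_fr[OF fr3 ok2]) (auto simp: cns_def)
        have v3: "rarr \<tau>3 ''M'' = rarr \<sigma> ''M''" "rarr \<tau>3 ''P'' = rarr \<sigma> ''P''" by (simp_all add: frra[OF fr3] v2)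
        have D3: "wlp MM (DIJ (FULL ''M'' (ix ''p'' ''w''))) (\<lambda>\<sigma>'. dij N (\<lambda>p w. rarr \<tau>3 ''M'' (p * N + w)) (\<lambda>p w. rarr \<tau>3 ''M'' (p * N + w)) True (rarr \<tau>2 ''R'') (rarr \<sigma>' ''K'') (rarr \<sigma>' ''R'')) \<tau>3"
          by (rule wlp_DIJ_FULL[OF ok3]) (use 3 in \<open>auto simp: ok_def\<close>)
        show "wlp MM (DIJ (FULL ''M'' (ix ''p'' ''w'')))
         (wlp MM (FOR ''x'' ''n'' (RStore ''dist'' (WVar ''x'') (RAdd (RSub (RArr ''K'' (WVar ''x'')) (RArr ''P'' (WVar ''x''))) (RArr ''P'' (WVar ''s'')))))
           (\<lambda>\<sigma>'. \<forall>x<n. rarr \<sigma>' ''dist'' x = h0 x - h0 s)) \<tau>3"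
        proof (rule wlp_conseq[OF D3])
          fix \<tau>4 assume "dij N (\<lambda>p w. rarr \<tau>3 ''M'' (p * N + w)) (\<lambda>p w. rarr \<tau>3 ''M'' (p * N + w)) True (rarr \<tau>2 ''R'') (rarr \<tau>4 ''K'') (rarr \<tau>4 ''R'')"
            and fr4: "fr (DIJ (FULL ''M'' (ix ''p'' ''w''))) \<tau>3 \<tau>4"
          then have d4: "dij N ?M ?M True (rarr \<tau>2 ''R'') (rarr \<tau>4 ''K'') (rarr \<tau>4 ''R'')" using v3 by simp
          have ok4: "ok \<tau>4" by (rule ok_fr[OF fr4 ok3]) (auto simp: cns_def)
          have c4: "wvar \<tau>4 ''n'' = n" "wvar \<tau>4 ''s'' = s" using ok4 by (auto simp: ok_def)
          have P4: "rarr \<tau>4 ''P'' = rarr \<sigma> ''P''" by (simp add: frra[OF fr4] v3)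
          have K4: "rarr \<tau>4 ''K'' y = h y - h s" if y: "y < n" for y
          proof -
            obtain j where j: "j \<le> 1" "reach s (tight n ?M h) (tokM n N ?M ?M h) j y" using reach[OF y] by blast
            show ?thesis by (rule one_step_dist[OF n_le_N s_less feas diag d2 d4 j(2,1) y])
          qed
          let ?c = "RStore ''dist'' (WVar ''x'') (RAdd (RSub (RArr ''K'' (WVar ''x'')) (RArr ''P'' (WVar ''x''))) (RArr ''P'' (WVar ''s'')))"
          show "wlp MM (FOR ''x'' ''n'' ?c) (\<lambda>\<sigma>'. \<forall>x<n. rarr \<sigma>' ''dist'' x = h0 x - h0 s) \<tau>4"
          proof (rule wlp_FOR[where I = "\<lambda>k \<tau>. \<forall>x<k. rarr \<tau> ''dist'' x = h0 x - h0 s"])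
            fix k \<tau> assume k: "k < wvar \<tau>4 ''n''" and I: "\<forall>x<k. rarr \<tau> ''dist'' x = h0 x - h0 s" and fr: "fr (FOR ''x'' ''n'' ?c) \<tau>4 \<tau>" and x: "wvar \<tau> ''x'' = k"
            have v: "rarr \<tau> ''K'' = rarr \<tau>4 ''K''" "rarr \<tau> ''P'' = rarr \<sigma> ''P''" "wvar \<tau> ''s'' = s"
              by (simp_all add: frra[OF fr] frw[OF fr] P4 c4)
            have "rarr \<tau>4 ''K'' k - rarr \<sigma> ''P'' k + rarr \<sigma> ''P'' s = h0 k - h0 s"
              using K4[of k] hP[of k] hP[OF s_less] k c4 by simp
            then show "wlp MM ?c (\<lambda>\<tau>'. \<forall>x<Suc k. rarr (wset ''x'' (Suc k) \<tau>') ''dist'' x = h0 x - h0 s) \<tau>"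
              using I v x by (simp add: less_Suc_eq)
          qed (use c4 n_less in auto)
        qed
      qed
    qed
  qed
qed

lemma wlp_VERIFY:
  assumes ok: "ok \<sigma>" and nc: "wvar \<sigma> ''negative_cycle'' = 0"
  shows "wlp MM VERIFY (\<lambda>\<sigma>'. wvar \<sigma>' ''negative_cycle'' = 0 \<longleftrightarrow> (\<forall>x<n. \<forall>y<n. warr \<sigma> ''edge'' (x * n + y) \<noteq> 0 \<longrightarrow>
      rarr \<sigma> ''dist'' y \<le> rarr \<sigma> ''dist'' x + rarr \<sigma> ''weight'' (x * n + y))) \<sigma>"
proof -
  have c: "wvar \<sigma> ''n'' = n" using ok by (auto simp: ok_def)
  let ?bad = "\<lambda>x y. warr \<sigma> ''edge'' (x * n + y) \<noteq> 0 \<longrightarrow> rarr \<sigma> ''dist'' y \<le> rarr \<sigma> ''dist'' x + rarr \<sigma> ''weight'' (x * n + y)"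
  let ?c = "Cond (BAnd (BNot (WEq (WArr ''edge'' (ex ''x'' ''y'')) (WConst 0)))
     (RLess (RAdd (RArr ''dist'' (WVar ''x'')) (RArr ''weight'' (ex ''x'' ''y''))) (RArr ''dist'' (WVar ''y''))))
     (WAssign ''negative_cycle'' (WConst 1)) Skip"
  show ?thesis
    unfolding VERIFY_def
  proof (rule wlp_FOR[where I = "\<lambda>k \<tau>. wvar \<tau> ''negative_cycle'' = 0 \<longleftrightarrow> (\<forall>x<k. \<forall>y<n. ?bad x y)"])
    fix k \<tau> assume k: "k < wvar \<sigma> ''n''" and I: "wvar \<tau> ''negative_cycle'' = 0 \<longleftrightarrow> (\<forall>x<k. \<forall>y<n. ?bad x y)"
      and fr: "fr (FOR ''x'' ''n'' (FOR ''y'' ''n'' ?c)) \<sigma> \<tau>" and xk: "wvar \<tau> ''x'' = k"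
    have v: "wvar \<tau> ''n'' = n" by (simp add: frw[OF fr] c)
    show "wlp MM (FOR ''y'' ''n'' ?c) (\<lambda>\<tau>'. wvar (wset ''x'' (Suc k) \<tau>') ''negative_cycle'' = 0 \<longleftrightarrow> (\<forall>x<Suc k. \<forall>y<n. ?bad x y)) \<tau>"
    proof (rule wlp_FOR[where I = "\<lambda>j \<tau>. wvar \<tau> ''negative_cycle'' = 0 \<longleftrightarrow> (\<forall>x<k. \<forall>y<n. ?bad x y) \<and> (\<forall>y<j. ?bad k y)"])
      fix j \<tau>1 assume j: "j < wvar \<tau> ''n''" and J: "wvar \<tau>1 ''negative_cycle'' = 0 \<longleftrightarrow> (\<forall>x<k. \<forall>y<n. ?bad x y) \<and> (\<forall>y<j. ?bad k y)"
        and fr1: "fr (FOR ''y'' ''n'' ?c) \<tau> \<tau>1" and yj: "wvar \<tau>1 ''y'' = j"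
      have v1: "wvar \<tau>1 ''n'' = n" "wvar \<tau>1 ''x'' = k" "warr \<tau>1 ''edge'' = warr \<sigma> ''edge''" "rarr \<tau>1 ''weight'' = rarr \<sigma> ''weight''" "rarr \<tau>1 ''dist'' = rarr \<sigma> ''dist''"
        by (simp_all add: frw[OF fr1] frwa[OF fr1] frra[OF fr1] frw[OF fr] frwa[OF fr] frra[OF fr] c xk)
      have kj: "k < n" "j < n" using k j c v by auto
      show "wlp MM ?c (\<lambda>\<tau>'. wvar (wset ''y'' (Suc j) \<tau>') ''negative_cycle'' = 0 \<longleftrightarrow> (\<forall>x<k. \<forall>y<n. ?bad x y) \<and> (\<forall>y<Suc j. ?bad k y)) \<tau>1"
        using J v1 yj kj by (auto simp: less_Suc_eq)
    next
      fix \<tau>1 :: machine_state assume "wvar \<tau>1 ''negative_cycle'' = 0 \<longleftrightarrow> (\<forall>x<k. \<forall>y<n. ?bad x y) \<and> (\<forall>y<wvar \<tau> ''n''. ?bad k y)"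
      then show "wvar (wset ''x'' (Suc k) \<tau>1) ''negative_cycle'' = 0 \<longleftrightarrow> (\<forall>x<Suc k. \<forall>y<n. ?bad x y)"
        using v by (auto simp: less_Suc_eq)
    qed (use v n_less I in auto)
  qed (use c n_less nc in auto)
qed

text \<open>Every iteration expands a marked vertex that has not been expanded, unless none is left.
  As there are \<open>n\<close> vertices, after \<open>n\<close> iterations the marked set is closed
  under edges.\<close>

lemma wlp_SEARCH:
  assumes ok: "ok \<sigma>" and r0: "\<And>x. warr \<sigma> ''reachable'' x = 0" and D0: "\<And>x. warr \<sigma> ''D'' x = 0"
    and E: "E = {(x, y). x < n \<and> y < n \<and> warr \<sigma> ''edge'' (x * n + y) \<noteq> 0}"
  shows "wlp MM SEARCH (\<lambda>\<sigma>'. \<forall>x<n. warr \<sigma>' ''reachable'' x \<noteq> 0 \<longleftrightarrow> (s, x) \<in> E\<^sup>*) \<sigma>"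
proof -
  have c: "wvar \<sigma> ''n'' = n" "wvar \<sigma> ''s'' = s" using ok by (auto simp: ok_def)
  define mk :: "machine_state \<Rightarrow> nat set" where "mk = (\<lambda>\<tau>. {x. x < n \<and> warr \<tau> ''reachable'' x \<noteq> 0})"
  define dd :: "machine_state \<Rightarrow> nat set" where "dd = (\<lambda>\<tau>. {x. x < n \<and> warr \<tau> ''D'' x \<noteq> 0})"
  define I where "I = (\<lambda>k \<tau>. s \<in> mk \<tau> \<and> mk \<tau> \<subseteq> {x. (s, x) \<in> E\<^sup>*} \<and> dd \<tau> \<subseteq> mk \<tau> \<and>
     (\<forall>p\<in>dd \<tau>. \<forall>x<n. (p, x) \<in> E \<longrightarrow> x \<in> mk \<tau>) \<and> (card (dd \<tau>) = k \<or> dd \<tau> = mk \<tau>))"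
  have cong: "I k (wset x v \<tau>) = I k \<tau>" for k x v \<tau> by (simp add: I_def mk_def dd_def)
  let ?find = "FOR ''x'' ''n'' (Cond (BAnd (BNot (WEq (WArr ''reachable'' (WVar ''x'')) (WConst 0)))
           (WEq (WArr ''D'' (WVar ''x'')) (WConst 0))) (WAssign ''p'' (WVar ''x'')) Skip)"
  let ?mark = "FOR ''x'' ''n'' (Cond (WEq (WArr ''edge'' (ex ''p'' ''x'')) (WConst 0)) Skip (WStore ''reachable'' (WVar ''x'') (WConst 1)))"
  let ?do = "Cond (WLess (WVar ''p'') (WVar ''n'')) (Seq (WStore ''D'' (WVar ''p'') (WConst 1)) ?mark) Skip"
  let ?body = "Seq (WAssign ''p'' (WVar ''n'')) (Seq ?find ?do)"
  let ?\<sigma> = "\<sigma>\<lparr>warr := (warr \<sigma>)(''reachable'' := (warr \<sigma> ''reachable'')(s := 1))\<rparr>"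
  have "wlp MM (FOR ''c'' ''n'' ?body) (\<lambda>\<sigma>'. \<forall>x<n. warr \<sigma>' ''reachable'' x \<noteq> 0 \<longleftrightarrow> (s, x) \<in> E\<^sup>*) ?\<sigma>"
  proof (rule wlp_FOR[where I = I])
    have "mk ?\<sigma> = {s}" "dd ?\<sigma> = {}" using s_less r0 D0 by (auto simp: mk_def dd_def)
    then show "I 0 (wset ''c'' 0 ?\<sigma>)" unfolding cong by (simp add: I_def)
    fix k \<tau> assume k: "k < wvar ?\<sigma> ''n''" and I: "I k \<tau>" and fr: "fr (FOR ''c'' ''n'' ?body) ?\<sigma> \<tau>"
    have v: "wvar \<tau> ''n'' = n" "warr \<tau> ''edge'' = warr \<sigma> ''edge''" by (simp_all add: frw[OF fr] frwa[OF fr] c)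
    let ?\<tau> = "wset ''p'' n \<tau>"
    let ?J = "\<lambda>j \<tau>'. (wvar \<tau>' ''p'' = n \<and> (\<forall>x<j. x \<in> mk \<tau> \<longrightarrow> x \<in> dd \<tau>)) \<or> wvar \<tau>' ''p'' \<in> mk \<tau> - dd \<tau>"
    have find: "wlp MM ?find (?J n) ?\<tau>"
    proof (rule wlp_FOR[where I = ?J])
      fix j \<tau>1 assume j: "j < wvar ?\<tau> ''n''" and J: "?J j \<tau>1" and fr1: "fr ?find ?\<tau> \<tau>1" and xj: "wvar \<tau>1 ''x'' = j"
      have v1: "warr \<tau>1 = warr \<tau>" using fr1 by (auto simp: fr_def fun_eq_iff)
      show "wlp MM (Cond (BAnd (BNot (WEq (WArr ''reachable'' (WVar ''x'')) (WConst 0))) (WEq (WArr ''D'' (WVar ''x'')) (WConst 0))) (WAssign ''p'' (WVar ''x'')) Skip)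
         (\<lambda>\<tau>'. ?J (Suc j) (wset ''x'' (Suc j) \<tau>')) \<tau>1"
        using J v1 xj j v by (auto simp: mk_def dd_def less_Suc_eq)
    qed (use v n_less in auto)
    have do: "wlp MM ?do (\<lambda>\<tau>'. I (Suc k) (wset ''c'' (Suc k) \<tau>')) \<tau>1" if J: "?J n \<tau>1" and fr1: "fr ?find ?\<tau> \<tau>1" for \<tau>1
    proof -
      have v1: "warr \<tau>1 = warr \<tau>" "wvar \<tau>1 ''n'' = n" using fr1 v by (auto simp: fr_def fun_eq_iff)
      have same: "mk \<tau>1 = mk \<tau>" "dd \<tau>1 = dd \<tau>" by (simp_all add: mk_def dd_def v1)
      show ?thesis
      proof (cases "wvar \<tau>1 ''p'' < n")
        case False
        then have "wvar \<tau>1 ''p'' = n" "\<forall>x<n. x \<in> mk \<tau> \<longrightarrow> x \<in> dd \<tau>" using J by (auto simp: mk_def)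
        then have "dd \<tau> = mk \<tau>" using I by (auto simp: I_def mk_def)
        then have "I (Suc k) \<tau>1" using I unfolding I_def same by auto
        then show ?thesis using False v1 cong by simp
      next
        case True
        define p where "p = wvar \<tau>1 ''p''"
        have p: "p < n" "p \<in> mk \<tau>" "p \<notin> dd \<tau>" using J True by (auto simp: p_def)
        let ?\<tau>1 = "\<tau>1\<lparr>warr := (warr \<tau>1)(''D'' := (warr \<tau>1 ''D'')(p := 1))\<rparr>"
        let ?Q = "\<lambda>j \<tau>'. \<forall>x<n. warr \<tau>' ''reachable'' x \<noteq> 0 \<longleftrightarrow> x \<in> mk \<tau> \<or> x < j \<and> (p, x) \<in> E"
        have mark: "wlp MM ?mark (?Q n) ?\<tau>1"
        proof (rule wlp_FOR[where I = ?Q])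
          show "?Q 0 (wset ''x'' 0 ?\<tau>1)" using v1 by (auto simp: mk_def)
          fix j \<tau>2 assume j: "j < wvar ?\<tau>1 ''n''" and Q: "?Q j \<tau>2" and fr2: "fr ?mark ?\<tau>1 \<tau>2" and xj: "wvar \<tau>2 ''x'' = j"
          have v2: "wvar \<tau>2 ''n'' = n" "wvar \<tau>2 ''p'' = p" "warr \<tau>2 ''edge'' = warr \<sigma> ''edge''"
            by (simp_all add: frw[OF fr2] frwa[OF fr2] v1 v p_def)
          have jn: "j < n" using j v1 by simp
          have Ej: "(p, j) \<in> E \<longleftrightarrow> warr \<sigma> ''edge'' (p * n + j) \<noteq> 0" using p jn by (simp add: E)
          show "wlp MM (Cond (WEq (WArr ''edge'' (ex ''p'' ''x'')) (WConst 0)) Skip (WStore ''reachable'' (WVar ''x'') (WConst 1)))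
             (\<lambda>\<tau>'. ?Q (Suc j) (wset ''x'' (Suc j) \<tau>')) \<tau>2"
            using Q v2 xj jn p Ej by (auto simp: less_Suc_eq)
        qed (use v1 n_less in auto)
        have "wlp MM ?mark (\<lambda>\<tau>'. I (Suc k) (wset ''c'' (Suc k) \<tau>')) ?\<tau>1"
        proof (rule wlp_conseq[OF mark])
          fix \<tau>2 assume Q: "?Q n \<tau>2" and fr2: "fr ?mark ?\<tau>1 \<tau>2"
          have D2: "warr \<tau>2 ''D'' = (warr \<tau> ''D'')(p := 1)" by (simp add: frwa[OF fr2] v1)
          have mk2: "mk \<tau>2 = mk \<tau> \<union> {x. x < n \<and> (p, x) \<in> E}" using Q by (auto simp: mk_def)
          have dd2: "dd \<tau>2 = insert p (dd \<tau>)" using D2 p(1) by (auto simp: dd_def)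
          have fin: "finite (dd \<tau>)" by (simp add: dd_def)
          have "card (dd \<tau>) = k" using I p by (auto simp: I_def)
          then have "card (dd \<tau>2) = Suc k" unfolding dd2 using p fin by simp
          moreover have "(s, x) \<in> E\<^sup>*" if "(p, x) \<in> E" for x
            using that p(2) I unfolding I_def by (auto intro: rtrancl_into_rtrancl)
          ultimately have "I (Suc k) \<tau>2"
            using I p(1,2) unfolding I_def mk2 dd2 by auto
          then show "I (Suc k) (wset ''c'' (Suc k) \<tau>2)" using cong by simp
        qed
        then show ?thesis using True v1 by (simp add: p_def)
      qed
    qed
    have "wlp MM ?find (wlp MM ?do (\<lambda>\<tau>'. I (Suc k) (wset ''c'' (Suc k) \<tau>'))) ?\<tau>"
      by (rule wlp_conseq[OF find do])
    then show "wlp MM ?body (\<lambda>\<tau>'. I (Suc k) (wset ''c'' (Suc k) \<tau>')) \<tau>" using v by simp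
  next
    fix \<tau> assume I: "I (wvar ?\<sigma> ''n'') \<tau>"
    have "dd \<tau> = mk \<tau>"
    proof (rule ccontr)
      assume ne: "dd \<tau> \<noteq> mk \<tau>"
      then have "card (dd \<tau>) = n" using I c by (auto simp: I_def)
      moreover have "dd \<tau> \<subseteq> {..<n}" "mk \<tau> \<subseteq> {..<n}" by (auto simp: dd_def mk_def)
      ultimately have "dd \<tau> = {..<n}" using card_subset_eq[of "{..<n}" "dd \<tau>"] by simp
      then show False using ne I \<open>mk \<tau> \<subseteq> {..<n}\<close> by (auto simp: I_def)
    qed
    then have closed: "x \<in> mk \<tau>" if "p \<in> mk \<tau>" "(p, x) \<in> E" for p x
      using that I by (auto simp: I_def E)
    have "x \<in> mk \<tau>" if "(s, x) \<in> E\<^sup>*" for x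
      using that by induction (use closed I in \<open>auto simp: I_def\<close>)
    then show "\<forall>x<n. warr \<tau> ''reachable'' x \<noteq> 0 \<longleftrightarrow> (s, x) \<in> E\<^sup>*" using I by (auto simp: I_def mk_def)
  qed (use c n_less in auto)
  then show ?thesis unfolding SEARCH_def using c by simp
qed

end

section \<open>Expectations\<close>

text \<open>A Hoare triple for expectations: apart from the sure postcondition and the time bound,
  \<open>g\<close> bounds the expected value of \<open>g'\<close> after the run. Chaining such
  potentials bounds the probability of failure without conditioning on the outcomes of earlier
  rounds.\<close>

definition ebound :: "nat \<Rightarrow> com \<Rightarrow> nat \<Rightarrow> (machine_state \<Rightarrow> bool) \<Rightarrow> (machine_state \<Rightarrow> bool) \<Rightarrow>
    (machine_state \<Rightarrow> ennreal) \<Rightarrow> (machine_state \<Rightarrow> ennreal) \<Rightarrow> bool" where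
  "ebound M c t P Q g g' \<longleftrightarrow> (\<forall>\<sigma>. P \<sigma> \<longrightarrow> (\<exists>p. halts M t c \<sigma> p \<and> (\<forall>\<sigma>'\<in>set_pmf p. Q \<sigma>') \<and>
     (\<integral>\<^sup>+x. g' x \<partial>measure_pmf p) \<le> g \<sigma>))"

lemma ebound_Seq:
  assumes c: "ebound M c t P Q g g'" and d: "ebound M d u Q R g' g''"
  shows "ebound M (Seq c d) (t + 1 + u) P R g g''"
  unfolding ebound_def
proof (intro allI impI)
  fix \<sigma> assume "P \<sigma>"
  then obtain p where p: "halts M t c \<sigma> p" "\<And>\<sigma>'. \<sigma>' \<in> set_pmf p \<Longrightarrow> Q \<sigma>'" "(\<integral>\<^sup>+x. g' x \<partial>measure_pmf p) \<le> g \<sigma>"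
    using c unfolding ebound_def by blast
  have "\<forall>\<sigma>'. \<exists>r. Q \<sigma>' \<longrightarrow> halts M u d \<sigma>' r \<and> (\<forall>\<sigma>''\<in>set_pmf r. R \<sigma>'') \<and> (\<integral>\<^sup>+x. g'' x \<partial>measure_pmf r) \<le> g' \<sigma>'"
    using d unfolding ebound_def by blast
  then obtain r where r: "\<And>\<sigma>'. Q \<sigma>' \<Longrightarrow> halts M u d \<sigma>' (r \<sigma>') \<and> (\<forall>\<sigma>''\<in>set_pmf (r \<sigma>'). R \<sigma>'') \<and> (\<integral>\<^sup>+x. g'' x \<partial>measure_pmf (r \<sigma>')) \<le> g' \<sigma>'"
    by metis
  have "halts M (t + 1 + u) (Seq c d) \<sigma> (bind_pmf p r)" by (rule halts_Seq[OF p(1)]) (use r p(2) in blast)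
  moreover have "\<forall>\<sigma>''\<in>set_pmf (bind_pmf p r). R \<sigma>''" using r p(2) by auto
  moreover have "(\<integral>\<^sup>+x. g'' x \<partial>measure_pmf (bind_pmf p r)) \<le> g \<sigma>"
  proof -
    have "(\<integral>\<^sup>+x. g'' x \<partial>measure_pmf (bind_pmf p r)) = (\<integral>\<^sup>+x. \<integral>\<^sup>+y. g'' y \<partial>measure_pmf (r x) \<partial>measure_pmf p)" by simp
    also have "\<dots> \<le> (\<integral>\<^sup>+x. g' x \<partial>measure_pmf p)"
      by (rule nn_integral_mono_AE) (use r p(2) in \<open>auto simp: AE_measure_pmf_iff\<close>)
    finally show ?thesis using p(3) by simp
  qed
  ultimately show "\<exists>p. halts M (t + 1 + u) (Seq c d) \<sigma> p \<and> (\<forall>\<sigma>'\<in>set_pmf p. R \<sigma>') \<and> (\<integral>\<^sup>+x. g'' x \<partial>measure_pmf p) \<le> g \<sigma>" by blast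
qed

lemma ebound_det:
  assumes "\<And>\<sigma>. P \<sigma> \<Longrightarrow> \<exists>u \<sigma>'. bs M c \<sigma> u \<sigma>' \<and> u \<le> t \<and> Q \<sigma>' \<and> g' \<sigma>' \<le> g \<sigma>"
  shows "ebound M c t P Q g g'"
  unfolding ebound_def
proof (intro allI impI)
  fix \<sigma> assume "P \<sigma>"
  then obtain u \<sigma>' where u: "bs M c \<sigma> u \<sigma>'" "u \<le> t" "Q \<sigma>'" "g' \<sigma>' \<le> g \<sigma>" using assms by blast
  have "halts M t c \<sigma> (return_pmf \<sigma>')" using halts_mono[OF bs_halts[OF u(1)] u(2)] .
  then show "\<exists>p. halts M t c \<sigma> p \<and> (\<forall>\<sigma>'\<in>set_pmf p. Q \<sigma>') \<and> (\<integral>\<^sup>+x. g' x \<partial>measure_pmf p) \<le> g \<sigma>"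
    using u by (intro exI[of _ "return_pmf \<sigma>'"]) (simp add: nn_integral_return)
qed

lemma ebound_mono:
  assumes "ebound M c t P Q g g'" "\<And>\<sigma>. P' \<sigma> \<Longrightarrow> P \<sigma> \<and> g \<sigma> \<le> h \<sigma>" "t \<le> u"
  shows "ebound M c u P' Q h g'"
  using assms halts_mono unfolding ebound_def by (meson order_trans)

lemma ebound_FOR:
  assumes body: "\<And>k. k < E \<Longrightarrow> ebound M c t (\<lambda>\<sigma>. Inv k \<sigma> \<and> wvar \<sigma> i = k)
      (\<lambda>\<sigma>'. Inv (Suc k) (wset i (Suc k) \<sigma>') \<and> wvar \<sigma>' i = k) (G k) (\<lambda>\<sigma>'. G (Suc k) (wset i (Suc k) \<sigma>'))"
    and X: "\<And>k \<sigma>. Inv k \<sigma> \<Longrightarrow> wvar \<sigma> X = E" and E: "E < M"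
  shows "ebound M (FOR i X c) (3 + E * (t + 4)) (\<lambda>\<sigma>. Inv 0 (wset i 0 \<sigma>)) (Inv E) (\<lambda>\<sigma>. G 0 (wset i 0 \<sigma>)) (G E)"
proof -
  let ?b = "Seq c (WAssign i (WAdd (WVar i) (WConst 1)))"
  let ?L = "Loop (WLess (WVar i) (WVar X)) ?b"
  have loop: "ebound M ?L ((E - k) * (t + 4) + 1) (\<lambda>\<sigma>. Inv k \<sigma> \<and> wvar \<sigma> i = k) (Inv E) (G k) (G E)" if "k \<le> E" for k
    using that
  proof (induction "E - k" arbitrary: k)
    case 0
    then have k: "k = E" by simp
    show ?case unfolding k
    proof (rule ebound_det)
      fix \<sigma> assume a: "Inv E \<sigma> \<and> wvar \<sigma> i = E"
      then have "bs M ?L \<sigma> 1 \<sigma>" using X[of E \<sigma>] by (intro bs_LoopF) simp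
      then show "\<exists>u \<sigma>'. bs M ?L \<sigma> u \<sigma>' \<and> u \<le> (E - E) * (t + 4) + 1 \<and> Inv E \<sigma>' \<and> G E \<sigma>' \<le> G E \<sigma>"
        using a by (intro exI[of _ 1] exI[of _ \<sigma>]) simp
    qed
  next
    case (Suc d)
    then have k: "k < E" "d = E - Suc k" "Suc k \<le> E" by auto
    note IH = Suc.hyps(1)[OF k(2,3)]
    have "ebound M (WAssign i (WAdd (WVar i) (WConst 1))) 1 (\<lambda>\<sigma>'. Inv (Suc k) (wset i (Suc k) \<sigma>') \<and> wvar \<sigma>' i = k)
       (\<lambda>\<sigma>. Inv (Suc k) \<sigma> \<and> wvar \<sigma> i = Suc k) (\<lambda>\<sigma>'. G (Suc k) (wset i (Suc k) \<sigma>')) (G (Suc k))"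
    proof (rule ebound_det)
      fix \<sigma> assume a: "Inv (Suc k) (wset i (Suc k) \<sigma>) \<and> wvar \<sigma> i = k"
      have "wval M \<sigma> (WAdd (WVar i) (WConst 1)) = Suc k" using a E k by (simp add: mod_simps)
      then have "bs M (WAssign i (WAdd (WVar i) (WConst 1))) \<sigma> 1 (wset i (Suc k) \<sigma>)"
        using bs_WAssign[of M i "WAdd (WVar i) (WConst 1)" \<sigma>] by simp
      then show "\<exists>u \<sigma>'. bs M (WAssign i (WAdd (WVar i) (WConst 1))) \<sigma> u \<sigma>' \<and> u \<le> 1 \<and> (Inv (Suc k) \<sigma>' \<and> wvar \<sigma>' i = Suc k) \<and>
          G (Suc k) \<sigma>' \<le> G (Suc k) (wset i (Suc k) \<sigma>)"
        using a by (intro exI[of _ 1] exI[of _ "wset i (Suc k) \<sigma>"]) simp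
    qed
    from ebound_Seq[OF ebound_Seq[OF body[OF k(1)] this] IH]
    have S: "ebound M (Seq ?b ?L) (t + 1 + 1 + 1 + ((E - Suc k) * (t + 4) + 1)) (\<lambda>\<sigma>. Inv k \<sigma> \<and> wvar \<sigma> i = k) (Inv E) (G k) (G E)" .
    have time: "(E - k) * (t + 4) + 1 = Suc (t + 1 + 1 + 1 + ((E - Suc k) * (t + 4) + 1))"
    proof -
      have "E - k = Suc (E - Suc k)" using k by simp
      then show ?thesis by simp
    qed
    show ?case
      unfolding ebound_def
    proof (intro allI impI)
      fix \<sigma> assume a: "Inv k \<sigma> \<and> wvar \<sigma> i = k"
      then obtain p where p: "halts M (t + 1 + 1 + 1 + ((E - Suc k) * (t + 4) + 1)) (Seq ?b ?L) \<sigma> p"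
        "\<forall>\<sigma>'\<in>set_pmf p. Inv E \<sigma>'" "(\<integral>\<^sup>+x. G E x \<partial>measure_pmf p) \<le> G k \<sigma>" using S unfolding ebound_def by blast
      have "bval M \<sigma> (WLess (WVar i) (WVar X))" using a X[of k \<sigma>] k by simp
      then have "halts M ((E - k) * (t + 4) + 1) ?L \<sigma> p"
        unfolding time using p(1) by (simp add: halts_def bind_return_pmf)
      then show "\<exists>p. halts M ((E - k) * (t + 4) + 1) ?L \<sigma> p \<and> (\<forall>\<sigma>'\<in>set_pmf p. Inv E \<sigma>') \<and> (\<integral>\<^sup>+x. G E x \<partial>measure_pmf p) \<le> G k \<sigma>"
        using p by blast
    qed
  qed
  have init: "ebound M (WAssign i (WConst 0)) 1 (\<lambda>\<sigma>. Inv 0 (wset i 0 \<sigma>)) (\<lambda>\<sigma>. Inv 0 \<sigma> \<and> wvar \<sigma> i = 0) (\<lambda>\<sigma>. G 0 (wset i 0 \<sigma>)) (G 0)"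
  proof (rule ebound_det)
    fix \<sigma> assume a: "Inv 0 (wset i 0 \<sigma>)"
    have "bs M (WAssign i (WConst 0)) \<sigma> 1 (wset i 0 \<sigma>)" using bs_WAssign[of M i "WConst 0" \<sigma>] by simp
    then show "\<exists>u \<sigma>'. bs M (WAssign i (WConst 0)) \<sigma> u \<sigma>' \<and> u \<le> 1 \<and> (Inv 0 \<sigma>' \<and> wvar \<sigma>' i = 0) \<and> G 0 \<sigma>' \<le> G 0 (wset i 0 \<sigma>)"
      using a by (intro exI[of _ 1] exI[of _ "wset i 0 \<sigma>"]) simp
  qed
  have e: "3 + E * (t + 4) = 1 + 1 + ((E - 0) * (t + 4) + 1)" by simp
  show ?thesis unfolding FOR_def e by (rule ebound_Seq[OF init loop]) simp
qed

section \<open>Sampling the hubs\<close>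

context sizes
begin

text \<open>The probability that a uniformly chosen node misses a fixed set of
  \<open>min N (Suc m)\<close> nodes, the size that \<open>card_hit\<close> guarantees.\<close>

definition beta :: real where
  "beta = (real N - real (min N (Suc m))) / real N"

lemma beta_bounds: "0 \<le> beta" "beta \<le> 1"
  using N1 by (auto simp: beta_def field_simps)

definition unhit :: "(nat \<Rightarrow> nat \<Rightarrow> real) \<Rightarrow> (nat \<Rightarrow> nat) \<Rightarrow> nat \<Rightarrow> (nat \<times> nat) set" where
  "unhit M a k = {(x, y). x < N \<and> y < N \<and> (\<forall>j<k. a j \<notin> hit N m M x y)}"

lemma finite_unhit: "finite (unhit M a k)"
proof -
  have "unhit M a k \<subseteq> {..<N} \<times> {..<N}" by (auto simp: unhit_def)
  then show ?thesis by (rule finite_subset) auto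
qed

text \<open>For each missed pair at least \<open>min N (Suc m)\<close> of the \<open>N\<close>
  choices of the next hub hit it. So the expected number of missed pairs shrinks by the factor
  \<open>beta\<close>.\<close>

lemma sum_unhit:
  "(\<Sum>v<N. card (unhit M (a(k := v)) (Suc k))) \<le> card (unhit M a k) * (N - min N (Suc m))"
proof -
  let ?U = "unhit M a k"
  have U: "unhit M (a(k := v)) (Suc k) = {z \<in> ?U. v \<notin> hit N m M (fst z) (snd z)}" for v
    by (auto simp: unhit_def less_Suc_eq)
  have c: "card {z \<in> ?U. v \<notin> hit N m M (fst z) (snd z)} = (\<Sum>z\<in>?U. if v \<notin> hit N m M (fst z) (snd z) then 1 else 0)" for v
    by (simp only: card_eq_sum sum.inter_filter[OF finite_unhit])
  have "(\<Sum>v<N. card (unhit M (a(k := v)) (Suc k))) = (\<Sum>v<N. \<Sum>z\<in>?U. if v \<notin> hit N m M (fst z) (snd z) then 1 else 0)"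
    unfolding U c ..
  also have "\<dots> = (\<Sum>z\<in>?U. \<Sum>v<N. if v \<notin> hit N m M (fst z) (snd z) then 1 else 0)" by (rule sum.swap)
  also have "\<dots> \<le> (\<Sum>z\<in>?U. N - min N (Suc m))"
  proof (rule sum_mono)
    fix z
    let ?h = "hit N m M (fst z) (snd z)"
    have sub: "?h \<subseteq> {..<N}" by (auto simp: hit_def)
    have "(\<Sum>v<N. if v \<notin> ?h then 1 else 0 :: nat) = card {v \<in> {..<N}. v \<notin> ?h}"
      by (simp only: card_eq_sum sum.inter_filter[OF finite_lessThan])
    also have "{v \<in> {..<N}. v \<notin> ?h} = {..<N} - ?h" by auto
    also have "card \<dots> = N - card ?h" using card_Diff_subset[OF finite_subset[OF sub] sub] by simp
    also have "\<dots> \<le> N - min N (Suc m)" using card_hit[of N m M "fst z" "snd z"] by simp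
    finally show "(\<Sum>v<N. if v \<notin> ?h then 1 else 0) \<le> N - min N (Suc m)" .
  qed
  also have "\<dots> = card ?U * (N - min N (Suc m))" by simp
  finally show ?thesis .
qed

lemma sample_expectation:
  assumes ok: "ok \<sigma>0"
  shows "\<exists>p. halts MM (3 + q * 7) SAMPLE \<sigma>0 p \<and> (\<forall>\<sigma>'\<in>set_pmf p. fr SAMPLE \<sigma>0 \<sigma>' \<and> (\<forall>j<q. warr \<sigma>' ''h'' j < N)) \<and>
     (\<integral>\<^sup>+\<sigma>'. ennreal (real (card (unhit M (warr \<sigma>' ''h'') q))) \<partial>measure_pmf p) \<le> ennreal ((real N)\<^sup>2 * beta ^ q)"
proof -
  let ?c = "Seq (Random ''x'' (WVar ''N'')) (WStore ''h'' (WVar ''h'') (WVar ''x''))"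
  define Inv where "Inv = (\<lambda>k \<tau>. fr SAMPLE \<sigma>0 \<tau> \<and> (\<forall>j<k. warr \<tau> ''h'' j < N))"
  \<comment> \<open>The number of missed pairs, discounted by \<open>beta\<close> for every hub
    still to be drawn, does not increase in expectation.\<close>
  define G :: "nat \<Rightarrow> machine_state \<Rightarrow> ennreal" where "G = (\<lambda>k \<tau>. ennreal (real (card (unhit M (warr \<tau> ''h'') k)) * beta ^ (q - k)))"
  have frI: "fr SAMPLE \<sigma>0 (\<tau>\<lparr>wvar := (wvar \<tau>)(x := v)\<rparr>)" if "fr SAMPLE \<sigma>0 \<tau>" "x \<in> {''h'', ''x''}" for \<tau> x v
    using that by (auto simp: fr_def)
  have "ebound MM (FOR ''h'' ''q'' ?c) (3 + q * (3 + 4)) (\<lambda>\<sigma>. Inv 0 (wset ''h'' 0 \<sigma>)) (Inv q) (\<lambda>\<sigma>. G 0 (wset ''h'' 0 \<sigma>)) (G q)"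
  proof (rule ebound_FOR)
    show "q < MM" using q_less .
    show "wvar \<sigma> ''q'' = q" if "Inv k \<sigma>" for k \<sigma> using that ok frw[of SAMPLE \<sigma>0 \<sigma> "''q''"] by (simp add: Inv_def ok_def)
    fix k assume k: "k < q"
    show "ebound MM ?c 3 (\<lambda>\<sigma>. Inv k \<sigma> \<and> wvar \<sigma> ''h'' = k) (\<lambda>\<sigma>'. Inv (Suc k) (wset ''h'' (Suc k) \<sigma>') \<and> wvar \<sigma>' ''h'' = k)
       (G k) (\<lambda>\<sigma>'. G (Suc k) (wset ''h'' (Suc k) \<sigma>'))"
      unfolding ebound_def
    proof (intro allI impI)
      fix \<tau> assume a: "Inv k \<tau> \<and> wvar \<tau> ''h'' = k"
      have NN: "wvar \<tau> ''N'' = N" using a ok frw[of SAMPLE \<sigma>0 \<tau> "''N''"] by (simp add: Inv_def ok_def)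
      have mx: "max 1 N = N" using N1 by simp
      let ?u = "pmf_of_set {..<N}"
      have "0 \<in> {..<N}" using N1 by simp
      then have fin: "finite {..<N}" "{..<N} \<noteq> {}" by blast+
      let ?s = "\<lambda>v. \<tau>\<lparr>wvar := (wvar \<tau>)(''x'' := v), warr := (warr \<tau>)(''h'' := (warr \<tau> ''h'')(k := v))\<rparr>"
      define p where "p = map_pmf ?s ?u"
      have "halts MM 1 (Random ''x'' (WVar ''N'')) \<tau> (map_pmf (\<lambda>v. wset ''x'' v \<tau>) ?u)"
        using NN mx by (simp add: halts_def bind_return_pmf' bind_map_pmf map_pmf_def bind_assoc_pmf bind_return_pmf)
      moreover have "halts MM 1 (WStore ''h'' (WVar ''h'') (WVar ''x'')) \<sigma>' (return_pmf (\<sigma>'\<lparr>warr := (warr \<sigma>')(''h'' := (warr \<sigma>' ''h'')(wvar \<sigma>' ''h'' := wvar \<sigma>' ''x''))\<rparr>))" for \<sigma>'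
        using bs_halts[OF bs_WStore[of MM "''h''" "WVar ''h''" "WVar ''x''" \<sigma>']] by simp
      ultimately have "halts MM (1 + 1 + 1) ?c \<tau> (bind_pmf (map_pmf (\<lambda>v. wset ''x'' v \<tau>) ?u)
          (\<lambda>\<sigma>'. return_pmf (\<sigma>'\<lparr>warr := (warr \<sigma>')(''h'' := (warr \<sigma>' ''h'')(wvar \<sigma>' ''h'' := wvar \<sigma>' ''x''))\<rparr>)))"
        by (rule halts_Seq)
      moreover have "bind_pmf (map_pmf (\<lambda>v. wset ''x'' v \<tau>) ?u)
          (\<lambda>\<sigma>'. return_pmf (\<sigma>'\<lparr>warr := (warr \<sigma>')(''h'' := (warr \<sigma>' ''h'')(wvar \<sigma>' ''h'' := wvar \<sigma>' ''x''))\<rparr>)) = p"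
        using a unfolding p_def map_pmf_def by (simp add: bind_assoc_pmf bind_return_pmf)
      ultimately have h: "halts MM 3 ?c \<tau> p" by (simp add: numeral_3_eq_3)
      have Q: "Inv (Suc k) (wset ''h'' (Suc k) \<sigma>') \<and> wvar \<sigma>' ''h'' = k" if sp: "\<sigma>' \<in> set_pmf p" for \<sigma>'
      proof -
        obtain v where v: "v < N" "\<sigma>' = ?s v"
          using sp unfolding p_def set_map_pmf set_pmf_of_set[OF fin(2,1)] by blast
        have "fr SAMPLE \<sigma>0 \<sigma>'" unfolding v(2) using a by (auto simp: Inv_def fr_def)
        then have f: "fr SAMPLE \<sigma>0 (wset ''h'' (Suc k) \<sigma>')" by (rule frI) simp
        have "warr \<sigma>' ''h'' = (warr \<tau> ''h'')(k := v)" "wvar \<sigma>' ''h'' = k" using a by (simp_all add: v(2))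
        then show ?thesis using a v(1) f by (auto simp: Inv_def less_Suc_eq)
      qed
      have "(\<integral>\<^sup>+\<sigma>'. G (Suc k) (wset ''h'' (Suc k) \<sigma>') \<partial>measure_pmf p) =
         (\<integral>\<^sup>+v. ennreal (real (card (unhit M ((warr \<tau> ''h'')(k := v)) (Suc k))) * beta ^ (q - Suc k)) \<partial>measure_pmf ?u)"
        unfolding p_def by (simp add: G_def)
      also have "\<dots> = (\<Sum>v<N. ennreal (real (card (unhit M ((warr \<tau> ''h'')(k := v)) (Suc k))) * beta ^ (q - Suc k))) / real N"
        using fin by (simp add: nn_integral_pmf_of_set ennreal_of_nat_eq_real_of_nat)
      also have "\<dots> = ennreal ((\<Sum>v<N. real (card (unhit M ((warr \<tau> ''h'')(k := v)) (Suc k))) * beta ^ (q - Suc k)) / real N)"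
        using N1 beta_bounds by (simp add: sum_ennreal divide_ennreal sum_nonneg)
      also have "\<dots> \<le> G k \<tau>"
        unfolding G_def
      proof (rule ennreal_leI)
        have "(\<Sum>v<N. real (card (unhit M ((warr \<tau> ''h'')(k := v)) (Suc k)))) = real (\<Sum>v<N. card (unhit M ((warr \<tau> ''h'')(k := v)) (Suc k)))" by simp
        also have "\<dots> \<le> real (card (unhit M (warr \<tau> ''h'') k) * (N - min N (Suc m)))" using sum_unhit of_nat_le_iff by blast
        also have "\<dots> = real (card (unhit M (warr \<tau> ''h'') k)) * (beta * real N)" using N1 by (simp add: beta_def of_nat_diff)
        finally have le: "(\<Sum>v<N. real (card (unhit M ((warr \<tau> ''h'')(k := v)) (Suc k)))) \<le> real (card (unhit M (warr \<tau> ''h'') k)) * (beta * real N)" .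
        have "(\<Sum>v<N. real (card (unhit M ((warr \<tau> ''h'')(k := v)) (Suc k))) * beta ^ (q - Suc k)) / real N
           = (\<Sum>v<N. real (card (unhit M ((warr \<tau> ''h'')(k := v)) (Suc k)))) * beta ^ (q - Suc k) / real N" by (simp add: sum_distrib_right)
        also have "\<dots> \<le> real (card (unhit M (warr \<tau> ''h'') k)) * (beta * real N) * beta ^ (q - Suc k) / real N"
          using le beta_bounds N1 by (intro divide_right_mono mult_right_mono) auto
        also have "\<dots> = real (card (unhit M (warr \<tau> ''h'') k)) * (beta * beta ^ (q - Suc k))" using N1 by simp
        also have "beta * beta ^ (q - Suc k) = beta ^ (q - k)" using k by (metis Suc_diff_Suc power_Suc)
        finally show "(\<Sum>v<N. real (card (unhit M ((warr \<tau> ''h'')(k := v)) (Suc k))) * beta ^ (q - Suc k)) / real N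
           \<le> real (card (unhit M (warr \<tau> ''h'') k)) * beta ^ (q - k)" .
      qed
      finally show "\<exists>p. halts MM 3 ?c \<tau> p \<and> (\<forall>\<sigma>'\<in>set_pmf p. Inv (Suc k) (wset ''h'' (Suc k) \<sigma>') \<and> wvar \<sigma>' ''h'' = k) \<and>
          (\<integral>\<^sup>+\<sigma>'. G (Suc k) (wset ''h'' (Suc k) \<sigma>') \<partial>measure_pmf p) \<le> G k \<tau>" using h Q by blast
    qed
  qed
  moreover have "Inv 0 (wset ''h'' 0 \<sigma>0)" unfolding Inv_def using frI[OF fr_refl] by simp
  ultimately obtain p where p: "halts MM (3 + q * 7) SAMPLE \<sigma>0 p" "\<forall>\<sigma>'\<in>set_pmf p. Inv q \<sigma>'"
    "(\<integral>\<^sup>+\<sigma>'. G q \<sigma>' \<partial>measure_pmf p) \<le> G 0 (wset ''h'' 0 \<sigma>0)" unfolding ebound_def SAMPLE_def by auto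
  have "card (unhit M (warr \<sigma>0 ''h'') 0) \<le> card ({..<N} \<times> {..<N})" by (rule card_mono) (auto simp: unhit_def)
  then have "card (unhit M (warr \<sigma>0 ''h'') 0) \<le> N * N" by simp
  then have "real (card (unhit M (warr \<sigma>0 ''h'') 0)) \<le> (real N)\<^sup>2" unfolding power2_eq_square by (metis of_nat_le_iff of_nat_mult)
  then have "G 0 (wset ''h'' 0 \<sigma>0) \<le> ennreal ((real N)\<^sup>2 * beta ^ q)"
    unfolding G_def using beta_bounds by (auto intro!: ennreal_leI mult_right_mono)
  then show ?thesis using p unfolding Inv_def G_def by (intro exI[of _ p]) auto
qed

text \<open>
  A fixed pair of nodes is missed by all hubs of a round with probability at most
  \<open>(1 - m/N)\<^sup>q \<le> exp (- m q/N)\<close>, and \<open>m q / N = C l\<close>.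
\<close>

lemma failure_bound: "real l * ((real N)\<^sup>2 * beta ^ q) \<le> 2 ^ (7 * l) * exp (- (real C * real l))"
proof -
  have bq: "beta ^ q \<le> exp (- (real C * real l))"
  proof (cases "N \<le> Suc m")
    case True
    then have "beta = 0" by (simp add: beta_def min_def)
    then show ?thesis using q1 by (simp add: power_0_left)
  next
    case False
    have N0: "0 < real N" using N1 by simp
    have "beta \<le> 1 + (- (real m / real N))" using False N0 by (simp add: beta_def min_def field_simps)
    also have "\<dots> \<le> exp (- (real m / real N))" by (rule exp_ge_add_one_self)
    finally have "beta ^ q \<le> exp (- (real m / real N)) ^ q" using beta_bounds by (intro power_mono)
    also have "\<dots> = exp (- (real q * (real m / real N)))" by (simp add: exp_of_nat_mult[symmetric])
    also have "real q * (real m / real N) = real C * real l"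
      using q1 l2 by (simp add: m_def N_def nb_def field_simps)
    finally show ?thesis .
  qed
  have ql: "q \<le> 2 ^ l"
  proof -
    have "q \<le> 2 ^ (l - 2)" using q_le n_pow by simp
    also have "\<dots> \<le> 2 ^ l" by (rule power_increasing) auto
    finally show ?thesis .
  qed
  have ll: "l \<le> 2 ^ l" using less_exp[of l] by simp
  have "l * (N * N) = l * (l * (l * (q * (q * (q * q)))))" by (simp add: N_def nb_def ac_simps)
  \<comment> \<open>Seven factors \<open>l\<close> or \<open>q\<close>, each at most
    \<open>2 ^ l\<close>. This is the origin of the 7, also in the later condition on
    \<open>C\<close>.\<close>
  also have "\<dots> \<le> 2 ^ l * (2 ^ l * (2 ^ l * (2 ^ l * (2 ^ l * (2 ^ l * 2 ^ l)))))"
    by (intro mult_le_mono ql ll)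
  also have "\<dots> = 2 ^ (7 * l)" by (simp add: power_add[symmetric])
  finally have "real (l * (N * N)) \<le> real (2 ^ (7 * l))" using of_nat_le_iff by blast
  then have lN: "real l * (real N)\<^sup>2 \<le> 2 ^ (7 * l)" by (simp add: power2_eq_square)
  have "real l * ((real N)\<^sup>2 * beta ^ q) = (real l * (real N)\<^sup>2) * beta ^ q" by simp
  also have "\<dots> \<le> 2 ^ (7 * l) * exp (- (real C * real l))"
    using lN bq beta_bounds by (intro mult_mono) auto
  finally show ?thesis .
qed

end

section \<open>The sizes\<close>

definition lf :: "nat \<Rightarrow> nat" where "lf n = (LEAST L. n \<le> 2 ^ L) + 2"
definition qf :: "nat \<Rightarrow> nat" where "qf n = (LEAST q. n \<le> q * q)"

lemma lf_props: "n \<le> 2 ^ (lf n - 2)" "lf n - 2 \<le> n" "i < lf n - 2 \<Longrightarrow> 2 ^ i < n"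
proof -
  have ex: "n \<le> 2 ^ n" using less_exp[of n] by simp
  show "n \<le> 2 ^ (lf n - 2)" unfolding lf_def by simp (rule LeastI[of "\<lambda>L. n \<le> 2 ^ L", OF ex])
  show "lf n - 2 \<le> n" unfolding lf_def by simp (rule Least_le[of "\<lambda>L. n \<le> 2 ^ L", OF ex])
  show "i < lf n - 2 \<Longrightarrow> 2 ^ i < n" unfolding lf_def using not_less_Least[of i "\<lambda>L. n \<le> 2 ^ L"] by simp
qed

lemma qf_props: "n \<le> qf n * qf n" "qf n \<le> n" "i < qf n \<Longrightarrow> i * i < n"
proof -
  have ex: "n \<le> n * n" by (cases n) auto
  show "n \<le> qf n * qf n" unfolding qf_def by (rule LeastI[of "\<lambda>q. n \<le> q * q", OF ex])
  show "qf n \<le> n" unfolding qf_def by (rule Least_le[of "\<lambda>q. n \<le> q * q", OF ex])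
  show "i < qf n \<Longrightarrow> i * i < n" unfolding qf_def using not_less_Least[of i "\<lambda>q. n \<le> q * q"] by simp
qed

text \<open>The counterpart of \<open>TM\<close> for the time before the sizes are computed, when
  only \<open>n\<close> is known to be in memory.\<close>

definition hn :: "nat \<Rightarrow> nat \<Rightarrow> nat \<Rightarrow> com \<Rightarrow> bool" where
  "hn M n A c \<longleftrightarrow> ''n'' \<notin> ww c \<and> (\<forall>\<sigma>. wvar \<sigma> ''n'' = n \<longrightarrow> (\<exists>t \<sigma>'. t \<le> A \<and> bs M c \<sigma> t \<sigma>'))"

lemma hn_Skip: "hn M n 0 Skip"
  unfolding hn_def using bs_Skip by fastforce
lemma hn_WAssign: "x \<noteq> ''n'' \<Longrightarrow> hn M n 1 (WAssign x e)"
  unfolding hn_def using bs_WAssign by fastforce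
lemma hn_Seq:
  assumes c: "hn M n A c" and d: "hn M n B d"
  shows "hn M n (A + B + 1) (Seq c d)"
  unfolding hn_def
proof (intro conjI allI impI)
  show "''n'' \<notin> ww (Seq c d)" using assms by (auto simp: hn_def)
  fix \<sigma> :: machine_state assume "wvar \<sigma> ''n'' = n"
  then obtain t \<sigma>' where t: "t \<le> A" "bs M c \<sigma> t \<sigma>'" using c unfolding hn_def by blast
  have "wvar \<sigma>' ''n'' = n" using frw[OF bs_fr[OF t(2)], of "''n''"] c \<open>wvar \<sigma> ''n'' = n\<close> by (simp add: hn_def)
  then obtain u \<sigma>'' where u: "u \<le> B" "bs M d \<sigma>' u \<sigma>''" using d unfolding hn_def by blast
  then show "\<exists>t \<sigma>'. t \<le> A + B + 1 \<and> bs M (Seq c d) \<sigma> t \<sigma>'" using bs_Seq[OF t(2) u(2)] t(1)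
    by (intro exI[of _ "t + 1 + u"] exI[of _ \<sigma>'']) simp
qed
lemma hn_Cond:
  assumes c: "hn M n A c" and d: "hn M n B d"
  shows "hn M n (A + B + 1) (Cond b c d)"
  unfolding hn_def
proof (intro conjI allI impI)
  show "''n'' \<notin> ww (Cond b c d)" using assms by (auto simp: hn_def)
  fix \<sigma> :: machine_state assume "wvar \<sigma> ''n'' = n"
  then have "\<exists>t \<sigma>'. t \<le> A + B \<and> bs M (if bval M \<sigma> b then c else d) \<sigma> t \<sigma>'"
  proof (cases "bval M \<sigma> b")
    case True
    from c \<open>wvar \<sigma> ''n'' = n\<close> obtain t \<sigma>' where "t \<le> A" "bs M c \<sigma> t \<sigma>'" unfolding hn_def by blast
    with True show ?thesis by (intro exI[of _ t] exI[of _ \<sigma>']) simp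
  next
    case False
    from d \<open>wvar \<sigma> ''n'' = n\<close> obtain t \<sigma>' where "t \<le> B" "bs M d \<sigma> t \<sigma>'" unfolding hn_def by blast
    with False show ?thesis by (intro exI[of _ t] exI[of _ \<sigma>']) simp
  qed
  then obtain t \<sigma>' where "t \<le> A + B" "bs M (if bval M \<sigma> b then c else d) \<sigma> t \<sigma>'" by blast
  then show "\<exists>t \<sigma>'. t \<le> A + B + 1 \<and> bs M (Cond b c d) \<sigma> t \<sigma>'" using bs_Cond
    by (intro exI[of _ "1 + t"] exI[of _ \<sigma>']) simp
qed
lemma hn_FOR:
  assumes c: "hn M n A c" and v: "v \<notin> ww c" "v \<noteq> ''n''" and M: "n < M"
  shows "hn M n (3 + n * (A + 4)) (FOR v ''n'' c)"
  unfolding hn_def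
proof (intro conjI allI impI)
  show "''n'' \<notin> ww (FOR v ''n'' c)" using c v by (auto simp: hn_def)
  fix \<sigma> :: machine_state assume n: "wvar \<sigma> ''n'' = n"
  let ?b = "Seq c (WAssign v (WAdd (WVar v) (WConst 1)))"
  let ?L = "Loop (WLess (WVar v) (WVar ''n'')) ?b"
  have "\<exists>t \<sigma>'. t \<le> (n - wvar \<sigma> v) * (A + 4) + 1 \<and> bs M ?L \<sigma> t \<sigma>'" if "wvar \<sigma> ''n'' = n" for \<sigma> :: machine_state
    using that
  proof (induction "n - wvar \<sigma> v" arbitrary: \<sigma>)
    case 0
    then show ?case by (intro exI[of _ 1] exI[of _ \<sigma>]) (auto intro!: bs_LoopF[unfolded One_nat_def])
  next
    case (Suc d)
    obtain t \<sigma>' where t: "t \<le> A" "bs M c \<sigma> t \<sigma>'" using c Suc.prems unfolding hn_def by blast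
    let ?\<tau> = "wset v (wval M \<sigma>' (WAdd (WVar v) (WConst 1))) \<sigma>'"
    have w: "wvar \<sigma>' v = wvar \<sigma> v" "wvar \<sigma>' ''n'' = n"
      using frw[OF bs_fr[OF t(2)]] v c Suc.prems by (auto simp: hn_def)
    have lt: "wvar \<sigma> v < n" using Suc.hyps(2) by simp
    have v': "wvar ?\<tau> v = Suc (wvar \<sigma> v)" "wvar ?\<tau> ''n'' = n" using lt M w v by (auto simp: mod_simps)
    have "d = n - wvar ?\<tau> v" using Suc.hyps(2) v' by simp
    from Suc.hyps(1)[OF this v'(2)] obtain u \<sigma>'' where u: "u \<le> (n - wvar ?\<tau> v) * (A + 4) + 1" "bs M ?L ?\<tau> u \<sigma>''" by blast
    have b: "bs M ?b \<sigma> (t + 1 + 1) ?\<tau>" by (intro bs_Seq[OF t(2)] bs_WAssign)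
    have "bs M ?L \<sigma> (t + 1 + 1 + u + 2) \<sigma>''" by (rule bs_LoopT[OF _ b u(2)]) (use lt Suc.prems in simp)
    moreover have "t + 1 + 1 + u + 2 \<le> (n - wvar \<sigma> v) * (A + 4) + 1"
    proof -
      have "n - wvar \<sigma> v = Suc (n - wvar ?\<tau> v)" using lt v' by simp
      then have "(n - wvar \<sigma> v) * (A + 4) = A + 4 + (n - wvar ?\<tau> v) * (A + 4)" by simp
      then show ?thesis using t(1) u(1) by linarith
    qed
    ultimately show ?case by blast
  qed
  from this[of "wset v (0 mod M) \<sigma>"] obtain t \<sigma>' where t: "t \<le> n * (A + 4) + 1" "bs M ?L (wset v (0 mod M) \<sigma>) t \<sigma>'"
    using n v by auto
  have "bs M (FOR v ''n'' c) \<sigma> (1 + 1 + t) \<sigma>'"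
    unfolding FOR_def using bs_Seq[OF bs_WAssign[of M v "WConst 0" \<sigma>]] t(2) by simp
  then show "\<exists>t \<sigma>'. t \<le> 3 + n * (A + 4) \<and> bs M (FOR v ''n'' c) \<sigma> t \<sigma>'" using t(1)
    by (intro exI[of _ "1 + 1 + t"] exI[of _ \<sigma>']) simp
qed

lemma hn_le: "hn M n A c \<Longrightarrow> A \<le> B \<Longrightarrow> hn M n B c"
  unfolding hn_def by (elim conjE, intro conjI allI impI) (assumption, drule spec, drule mp, assumption, elim exE conjE, intro exI conjI, rule order_trans)

lemma hn_SIZES: "n < M \<Longrightarrow> hn M n (50 + 20 * n) (SIZES C)"
  unfolding SIZES_def
  by (rule hn_le, (rule hn_Skip hn_WAssign hn_Seq hn_Cond hn_FOR | (simp; fail))+)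

definition mmf :: "nat \<Rightarrow> nat \<Rightarrow> nat" where "mmf C n = word_bound (C + 12) n"

text \<open>With \<open>x = n + 1\<close>, \<open>n\<close> and \<open>q\<close> are at most
  \<open>x\<close>, \<open>l\<close> is at most \<open>x ^ 2\<close>, and
  \<open>C \<le> 2 ^ C \<le> x ^ C\<close> absorbs the constant into the exponent. The largest
  products have the exponent \<open>C + 10\<close>, and the \<open>C + 12\<close> of the word bound
  makes the inequalities strict. The list covers all intermediate results of
  \<open>SIZES\<close>.\<close>

lemma sizes_bounds:
  assumes n: "1 \<le> n" and q: "q = qf n" and l: "l = lf n"
  shows "n * (q * (q * l) * (C * (l * (q * l)))) < mmf C n"
    "n * (2 * (l - 1) * (n * (C * (l * (q * l))))) < mmf C n"
    "(q * (q * l)) * (q * (q * l)) < mmf C n" "2 * n < mmf C n" "n * n < mmf C n" "C * (l * (q * l)) < mmf C n"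
    "q * (q * l) * (C * (l * (q * l))) < mmf C n" "2 * (l - 1) < mmf C n" "n * (C * (l * (q * l))) < mmf C n"
    "2 * (l - 1) * (n * (C * (l * (q * l)))) < mmf C n" "C < mmf C n" "l + 1 < mmf C n" "l * (q * l) < mmf C n" "q * (q * l) < mmf C n"
    "q * l < mmf C n"
proof -
  define x where "x = n + 1"
  have x2: "2 \<le> x" using n by (simp add: x_def)
  have MM: "mmf C n = x ^ (C + 12)" by (simp add: mmf_def word_bound_def x_def)
  have lt: "y < mmf C n" if "y \<le> x ^ e" "e < C + 12" for y e
  proof -
    have "x ^ e < x ^ (C + 12)" using x2 that(2) by (intro power_strict_increasing) auto
    then show ?thesis using that(1) MM by simp
  qed
  have nx: "n \<le> x ^ 1" by (simp add: x_def)
  have qx: "q \<le> x ^ 1" using qf_props(2)[of n] by (simp add: x_def q)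
  have lx: "l \<le> x ^ 2"
  proof -
    have "l \<le> n + 2" using lf_props(2)[of n] unfolding l by linarith
    also have "\<dots> = x + 1" by (simp add: x_def)
    also have "\<dots> \<le> x * 2" using x2 by simp
    also have "\<dots> \<le> x * x" using x2 by (intro mult_le_mono2)
    finally show ?thesis by (simp add: power2_eq_square)
  qed
  have l1x: "l - 1 \<le> x ^ 2" using lx by simp
  have l3x: "l + 1 \<le> x ^ 3"
  proof -
    have "1 \<le> x ^ 2" using x2 by simp
    then have "l + 1 \<le> x ^ 2 * 2" using lx by simp
    also have "\<dots> \<le> x ^ 2 * x" using x2 by (intro mult_le_mono2)
    finally show ?thesis by (simp add: power2_eq_square power3_eq_cube)
  qed
  have twox: "2 \<le> x ^ 1" using x2 by simp
  have Cx: "C \<le> x ^ C"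
  proof -
    have "C \<le> 2 ^ C" using less_exp[of C] by simp
    also have "\<dots> \<le> x ^ C" using x2 by (intro power_mono) auto
    finally show ?thesis .
  qed
  have mul: "y * z \<le> x ^ (a + b)" if "y \<le> x ^ a" "z \<le> x ^ b" for y z a b
    using mult_le_mono[OF that] by (simp add: power_add)
  note ql = mul[OF qx lx] and qql = mul[OF qx mul[OF qx lx]] and lql = mul[OF lx mul[OF qx lx]]
  note Cm = mul[OF Cx lql]
  show "n * (q * (q * l) * (C * (l * (q * l)))) < mmf C n" by (rule lt[OF mul[OF nx mul[OF qql Cm]]]) simp
  show "n * (2 * (l - 1) * (n * (C * (l * (q * l))))) < mmf C n" by (rule lt[OF mul[OF nx mul[OF mul[OF twox l1x] mul[OF nx Cm]]]]) simp
  show "(q * (q * l)) * (q * (q * l)) < mmf C n" by (rule lt[OF mul[OF qql qql]]) simp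
  show "2 * n < mmf C n" by (rule lt[OF mul[OF twox nx]]) simp
  show "n * n < mmf C n" by (rule lt[OF mul[OF nx nx]]) simp
  show "C * (l * (q * l)) < mmf C n" by (rule lt[OF Cm]) simp
  show "q * (q * l) * (C * (l * (q * l))) < mmf C n" by (rule lt[OF mul[OF qql Cm]]) simp
  show "2 * (l - 1) < mmf C n" by (rule lt[OF mul[OF twox l1x]]) simp
  show "n * (C * (l * (q * l))) < mmf C n" by (rule lt[OF mul[OF nx Cm]]) simp
  show "2 * (l - 1) * (n * (C * (l * (q * l)))) < mmf C n" by (rule lt[OF mul[OF mul[OF twox l1x] mul[OF nx Cm]]]) simp
  show "C < mmf C n" by (rule lt[OF Cx]) simp
  show "l + 1 < mmf C n" by (rule lt[OF l3x]) simp
  show "l * (q * l) < mmf C n" by (rule lt[OF lql]) simp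
  show "q * (q * l) < mmf C n" by (rule lt[OF qql]) simp
  show "q * l < mmf C n" by (rule lt[OF ql]) simp
qed

lemma sizes_inst:
  assumes "1 \<le> n" "s < n"
  shows "sizes (mmf C n) n s (qf n) (lf n) C"
  using assms qf_props[of n] lf_props[of n] sizes_bounds[OF assms(1) refl refl]
  by unfold_locales (auto simp: lf_def)

lemma wlp_SIZES:
  assumes n: "1 \<le> n" "s < n" and \<sigma>: "wvar \<sigma> ''n'' = n" "wvar \<sigma> ''s'' = s"
  shows "wlp (mmf C n) (SIZES C) (sizes.ok n s (qf n) (lf n) C) \<sigma>"
proof -
  interpret sizes "mmf C n" n s "qf n" "lf n" C using sizes_inst[OF n] .
  define q where "q = qf n"
  define L where "L = lf n - 2"
  define MM where "MM = mmf C n"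
  note b = sizes_bounds[OF n(1) refl refl, of C, folded MM_def]
  have l: "lf n = L + 2" by (simp add: L_def lf_def)
  have MM4: "3 \<le> MM" "2 * n < MM" "n < MM" using b(4) n by auto
  have Lprop: "n \<le> 2 ^ L" "L \<le> n" "\<And>i. i < L \<Longrightarrow> 2 ^ i < n" using lf_props(1,2)[of n] lf_props(3)[of _ n] by (auto simp: L_def)
  have qprop: "n \<le> q * q" "q \<le> n" "\<And>i. i < q \<Longrightarrow> i * i < n" using qf_props(1,2)[of n] qf_props(3)[of _ n] by (auto simp: q_def)
  let ?c1 = "Cond (WLess (WVar ''p'') (WVar ''n''))
        (Seq (WAssign ''p'' (WAdd (WVar ''p'') (WVar ''p''))) (WAssign ''l'' (WAdd (WVar ''l'') (WConst 1)))) Skip"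
  let ?c2 = "Cond (WLess (WMult (WVar ''q'') (WVar ''q'')) (WVar ''n'')) (WAssign ''q'' (WAdd (WVar ''q'') (WConst 1))) Skip"
  have m2: "MM \<noteq> Suc 0" "2 mod MM = 2" "Suc 0 mod MM = Suc 0" "C mod MM = C" using MM4 b(11) by auto
  let ?\<sigma>0 = "wset ''l'' (wval MM (wset ''p'' (wval MM \<sigma> (WConst 1)) \<sigma>) (WConst 2)) (wset ''p'' (wval MM \<sigma> (WConst 1)) \<sigma>)"
  let ?rest = "\<lambda>\<sigma>. sizes.ok n s (qf n) (lf n) C \<sigma>"
  let ?assigns = "\<lambda>Q. wlp MM (WAssign ''B'' (WMult (WVar ''q'') (WVar ''l''))) (wlp MM (WAssign ''N'' (WMult (WVar ''q'') (WVar ''B'')))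
      (wlp MM (WAssign ''E'' (WSub (WVar ''l'') (WConst 1))) (wlp MM (WAssign ''m'' (WMult (WConst C) (WMult (WVar ''l'') (WVar ''B''))))
      (wlp MM (WAssign ''ce'' (WMult (WVar ''n'') (WMult (WVar ''N'') (WVar ''m''))))
      (wlp MM (WAssign ''cf'' (WMult (WVar ''n'') (WMult (WMult (WConst 2) (WVar ''E'')) (WMult (WVar ''n'') (WVar ''m''))))) Q)))))"
  have "wlp MM (FOR ''x'' ''n'' ?c1) (wlp MM (WAssign ''q'' (WConst 0)) (wlp MM (FOR ''x'' ''n'' ?c2) (?assigns ?rest))) ?\<sigma>0"
  proof (rule wlp_FOR[where I = "\<lambda>k \<tau>. wvar \<tau> ''p'' = 2 ^ min k L \<and> wvar \<tau> ''l'' = min k L + 2"])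
    fix k \<tau>
    assume I: "wvar \<tau> ''p'' = 2 ^ min k L \<and> wvar \<tau> ''l'' = min k L + 2"
      and fr: "fr (FOR ''x'' ''n'' ?c1) ?\<sigma>0 \<tau>"
    have nn: "wvar \<tau> ''n'' = n" using frw[OF fr, of "''n''"] \<sigma> by simp
    show "wlp MM ?c1 (\<lambda>\<tau>'. wvar (wset ''x'' (Suc k) \<tau>') ''p'' = 2 ^ min (Suc k) L \<and> wvar (wset ''x'' (Suc k) \<tau>') ''l'' = min (Suc k) L + 2) \<tau>"
    proof (cases "k < L")
      case True
      have "2 ^ k < n" using Lprop(3)[OF True] .
      then have "2 ^ k + 2 ^ k < MM" using MM4 by simp
      moreover have "k + 3 < MM" using True b(12) l by simp
      ultimately show ?thesis using I nn True \<open>2 ^ k < n\<close> m2 by (simp add: min_def)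
    next
      case False
      then show ?thesis using I nn Lprop(1) by (simp add: min_def)
    qed
  next
    fix \<tau>1 assume I1: "wvar \<tau>1 ''p'' = 2 ^ min (wvar ?\<sigma>0 ''n'') L \<and>
        wvar \<tau>1 ''l'' = min (wvar ?\<sigma>0 ''n'') L + 2"
      and fr1: "fr (FOR ''x'' ''n'' ?c1) ?\<sigma>0 \<tau>1"
    have v1: "wvar \<tau>1 ''n'' = n" "wvar \<tau>1 ''s'' = s" "wvar \<tau>1 ''l'' = lf n"
      using I1 Lprop(2) l by (simp_all add: frw[OF fr1] \<sigma> min_def)
    let ?\<tau>1 = "wset ''q'' (wval MM \<tau>1 (WConst 0)) \<tau>1"
    have "wlp MM (FOR ''x'' ''n'' ?c2) (?assigns ?rest) ?\<tau>1"
    proof (rule wlp_FOR[where I = "\<lambda>k \<tau>. wvar \<tau> ''q'' = min k q"])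
      fix k \<tau> assume k: "k < wvar ?\<tau>1 ''n''" and I: "wvar \<tau> ''q'' = min k q" and fr: "fr (FOR ''x'' ''n'' ?c2) ?\<tau>1 \<tau>"
      have nn: "wvar \<tau> ''n'' = n" using frw[OF fr, of "''n''"] v1 by simp
      show "wlp MM ?c2 (\<lambda>\<tau>'. wvar (wset ''x'' (Suc k) \<tau>') ''q'' = min (Suc k) q) \<tau>"
      proof (cases "k < q")
        case True
        have "k * k < n" using qprop(3)[OF True] .
        then have "k * k < MM" using MM4 by simp
        moreover have "k + 1 < MM" using True qprop(2) MM4 by simp
        ultimately show ?thesis using I nn True \<open>k * k < n\<close> m2 by (simp add: min_def)
      next
        case False
        have "q * q \<le> n * n" using qprop(2) by (intro mult_le_mono)
        then have "q * q < MM" using b(5) by simp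
        then show ?thesis using I nn qprop(1) False by (simp add: min_def)
      qed
    next
      fix \<tau>2 assume I2: "wvar \<tau>2 ''q'' = min (wvar ?\<tau>1 ''n'') q" and fr2: "fr (FOR ''x'' ''n'' ?c2) ?\<tau>1 \<tau>2"
      have v2: "wvar \<tau>2 ''n'' = n" "wvar \<tau>2 ''s'' = s" "wvar \<tau>2 ''l'' = lf n" "wvar \<tau>2 ''q'' = qf n"
        using I2 v1 qprop(2) by (simp_all add: frw[OF fr2] q_def min_def)
      have e: "qf n * lf n mod MM = qf n * lf n" "qf n * (qf n * lf n) mod MM = qf n * (qf n * lf n)" "lf n * (qf n * lf n) mod MM = lf n * (qf n * lf n)"
        "C * (lf n * (qf n * lf n)) mod MM = C * (lf n * (qf n * lf n))"
        "qf n * (qf n * lf n) * (C * (lf n * (qf n * lf n))) mod MM = qf n * (qf n * lf n) * (C * (lf n * (qf n * lf n)))"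
        "n * (qf n * (qf n * lf n) * (C * (lf n * (qf n * lf n)))) mod MM = n * (qf n * (qf n * lf n) * (C * (lf n * (qf n * lf n))))"
        "2 * (lf n - Suc 0) mod MM = 2 * (lf n - Suc 0)" "n * (C * (lf n * (qf n * lf n))) mod MM = n * (C * (lf n * (qf n * lf n)))"
        "2 * (lf n - Suc 0) * (n * (C * (lf n * (qf n * lf n)))) mod MM = 2 * (lf n - Suc 0) * (n * (C * (lf n * (qf n * lf n))))"
        "n * (2 * (lf n - Suc 0) * (n * (C * (lf n * (qf n * lf n))))) mod MM = n * (2 * (lf n - Suc 0) * (n * (C * (lf n * (qf n * lf n)))))"
        using b by simp_all
      show "?assigns ?rest \<tau>2"
        unfolding wlp_WAssign
        by (simp del: mult_cancel1 mult_cancel2 add: v2 m2 e ok_def N_def nb_def lv_def m_def ce_def cf_def)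
    qed (use v1 MM4 in auto)
    then show "wlp MM (WAssign ''q'' (WConst 0)) (wlp MM (FOR ''x'' ''n'' ?c2) (?assigns ?rest)) \<tau>1"
      by (simp only: wlp_WAssign)
  qed (use \<sigma> MM4 m2 in auto)
  moreover have "wlp M (Seq c d) Q = wlp M c (wlp M d Q)" for M c d Q by (rule ext) (rule wlp_Seq)
  ultimately show ?thesis unfolding SIZES_def MM_def[symmetric] by (simp only: wlp_WAssign)
qed

section \<open>The main loop\<close>

context sizes
begin

lemma IM_mono:
  assumes "IM h0 k \<sigma>" "k \<le> k'"
  shows "IM h0 k' \<sigma>"
proof -
  have mono: "(\<exists>j\<le>k. R j) \<Longrightarrow> (\<exists>j\<le>k'. R j)" for R using assms(2) order_trans by blast
  obtain h where h: "\<forall>x<n. h x = h0 x + rarr \<sigma> ''P'' x" "\<forall>x<N. mt \<sigma> ''M'' x x = 0"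
    "\<forall>x<N. \<forall>y<N. h y \<le> h x + mt \<sigma> ''M'' x y"
    and r: "\<forall>y<n. \<exists>j\<le>k. reach s (tight n (mt \<sigma> ''M'') h) (tokM n N (mt \<sigma> ''M'') (mt \<sigma> ''M'') h) j y"
    using assms(1) unfolding IM_def by (elim exE conjE) blast
  have "\<forall>y<n. \<exists>j\<le>k'. reach s (tight n (mt \<sigma> ''M'') h) (tokM n N (mt \<sigma> ''M'') (mt \<sigma> ''M'') h) j y"
    by (intro allI impI, rule mono) (rule r[rule_format])
  with h show ?thesis unfolding IM_def by (intro exI[of _ h] conjI)
qed

lemma IM_cong: "rarr \<sigma>' ''P'' = rarr \<sigma> ''P'' \<Longrightarrow> rarr \<sigma>' ''M'' = rarr \<sigma> ''M'' \<Longrightarrow> IM h0 k \<sigma>' = IM h0 k \<sigma>"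
  unfolding IM_def by simp

lemma TM_wlp:
  assumes "TM k i j c" "ok \<sigma>" "wlp MM c Q \<sigma>"
  shows "\<exists>t \<sigma>'. bs MM c \<sigma> t \<sigma>' \<and> t \<le> k * q ^ i * l ^ j + 50 * wvar \<sigma> ''f'' \<and> Q \<sigma>' \<and> fr c \<sigma> \<sigma>'"
proof -
  obtain t \<sigma>' where t: "bs MM c \<sigma> t \<sigma>'" "t + 50 * wvar \<sigma>' ''f'' \<le> k * q ^ i * l ^ j + 50 * wvar \<sigma> ''f''"
    using assms(1,2) unfolding TM_def by blast
  have "Q \<sigma>'" using assms(3) t(1) unfolding wlp_def by blast
  then show ?thesis using t bs_fr[OF t(1)] by (intro exI[of _ t] exI[of _ \<sigma>']) simp
qed

definition loaded :: "nat pair_pre_digraph \<Rightarrow> (nat \<times> nat \<Rightarrow> real) \<Rightarrow> machine_state \<Rightarrow> bool" where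
  "loaded G w \<sigma> \<longleftrightarrow> ok \<sigma> \<and> wvar \<sigma> ''f'' = 0 \<and> wvar \<sigma> ''negative_cycle'' = 0 \<and>
     warr \<sigma> ''edge'' = warr (sssp_input n G w s) ''edge'' \<and> rarr \<sigma> ''weight'' = rarr (sssp_input n G w s) ''weight'' \<and>
     warr \<sigma> ''reachable'' = (\<lambda>_. 0) \<and> warr \<sigma> ''D'' = (\<lambda>_. 0)"

lemma loaded_fr:
  assumes fr: "fr c \<sigma> \<sigma>'" and b: "loaded G w \<sigma>" and "ww c \<inter> cns = {}" "''f'' \<notin> ww c" "''negative_cycle'' \<notin> ww c"
    "''edge'' \<notin> wa c" "''reachable'' \<notin> wa c" "''D'' \<notin> wa c" "''weight'' \<notin> ra c"
  shows "loaded G w \<sigma>'"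
  using b ok_fr[OF fr] assms(3-) by (simp add: loaded_def frw[OF fr] frwa[OF fr] frra[OF fr])

lemma input_edge: "x < n \<Longrightarrow> y < n \<Longrightarrow> warr (sssp_input n G w s) ''edge'' (x * n + y) = (if (x, y) \<in> parcs G then 1 else 0)"
  by (simp add: sssp_input_def)
lemma input_weight: "x < n \<Longrightarrow> y < n \<Longrightarrow> rarr (sssp_input n G w s) ''weight'' (x * n + y) = (if (x, y) \<in> parcs G then w (x, y) else 0)"
  by (simp add: sssp_input_def)

definition adj :: "nat pair_pre_digraph \<Rightarrow> (nat \<times> nat \<Rightarrow> real) \<Rightarrow> nat \<Rightarrow> nat \<Rightarrow> real" where
  "adj G w x y = (if x = y then 0 else if (x, y) \<notin> parcs G then 2 * (\<Sum>e\<in>parcs G. \<bar>w e\<bar>) else w (x, y))"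

definition spot :: "nat pair_pre_digraph \<Rightarrow> (nat \<times> nat \<Rightarrow> real) \<Rightarrow> (nat \<Rightarrow> real) \<Rightarrow> bool" where
  "spot G w h \<longleftrightarrow> h s = 0 \<and> (\<forall>x<n. \<forall>y<n. h y \<le> h x + adj G w x y) \<and>
     (\<forall>y<n. \<exists>j\<le>n. reach s (tight n (adj G w) h) (\<lambda>_ _. False) j y) \<and>
     (\<forall>v p. pre_digraph.awalk (with_proj G) s p v \<longrightarrow> ereal (h v) = sssp_dist G w s v) \<and>
     (\<forall>x y. (x, y) \<in> parcs G \<longrightarrow> h y \<le> h x + w (x, y))"

lemma spotD:
  assumes "spot G w h"
  shows "h s = 0" "x < n \<Longrightarrow> y < n \<Longrightarrow> h y \<le> h x + adj G w x y"
    "y < n \<Longrightarrow> \<exists>j\<le>n. reach s (tight n (adj G w) h) (\<lambda>_ _. False) j y"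
    "pre_digraph.awalk (with_proj G) s p v \<Longrightarrow> ereal (h v) = sssp_dist G w s v"
    "(x, y) \<in> parcs G \<Longrightarrow> h y \<le> h x + w (x, y)"
proof -
  note a = assms[unfolded spot_def]
  note b = a[THEN conjunct2] note c = b[THEN conjunct2] note d = c[THEN conjunct2]
  show "h s = 0" by (rule a[THEN conjunct1])
  show "x < n \<Longrightarrow> y < n \<Longrightarrow> h y \<le> h x + adj G w x y" by (rule b[THEN conjunct1, rule_format])
  show "y < n \<Longrightarrow> \<exists>j\<le>n. reach s (tight n (adj G w) h) (\<lambda>_ _. False) j y" by (rule c[THEN conjunct1, rule_format])
  show "pre_digraph.awalk (with_proj G) s p v \<Longrightarrow> ereal (h v) = sssp_dist G w s v" by (rule d[THEN conjunct1, rule_format])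
  show "(x, y) \<in> parcs G \<Longrightarrow> h y \<le> h x + w (x, y)" by (rule d[THEN conjunct2, rule_format])
qed

lemma spot_exists:
  assumes "sssp_instance n G s" "\<not> has_negative_cycle G w"
  shows "\<exists>h. spot G w h"
proof -
  obtain h where "h s = 0" "\<And>x y. x < n \<Longrightarrow> y < n \<Longrightarrow> h y \<le> h x + adj G w x y"
    "\<And>y. y < n \<Longrightarrow> \<exists>j\<le>n. reach s (tight n (adj G w) h) (\<lambda>_ _. False) j y"
    "\<And>v p. pre_digraph.awalk (with_proj G) s p v \<Longrightarrow> ereal (h v) = sssp_dist G w s v"
    "\<And>x y. (x, y) \<in> parcs G \<Longrightarrow> h y \<le> h x + w (x, y)"
    by (rule shortest_potential[OF assms order_refl, of "adj G w"]) (simp_all add: adj_def)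
  then show ?thesis unfolding spot_def by (intro exI[of _ h]) simp
qed

lemma arcs_bounded:
  assumes "sssp_instance n G s" "(x, y) \<in> parcs G"
  shows "x < n" "y < n"
proof -
  have G: "pair_fin_digraph G" and V: "pverts G = {..<n}" using assms(1) by (auto simp: sssp_instance_def)
  interpret pair_fin_digraph G by fact
  show "x < n" "y < n" using in_arcsD1[OF assms(2)] in_arcsD2[OF assms(2)] V by auto
qed

lemma sum_input_weight:
  assumes inst: "sssp_instance n G s"
  shows "(\<Sum>x<n. \<Sum>y<n. \<bar>rarr (sssp_input n G w s) ''weight'' (x * n + y)\<bar>) = (\<Sum>e\<in>parcs G. \<bar>w e\<bar>)"
proof -
  have sub: "parcs G \<subseteq> {..<n} \<times> {..<n}" using arcs_bounded[OF inst] by auto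
  have "(\<Sum>x<n. \<Sum>y<n. \<bar>rarr (sssp_input n G w s) ''weight'' (x * n + y)\<bar>) = (\<Sum>x<n. \<Sum>y<n. if (x, y) \<in> parcs G then \<bar>w (x, y)\<bar> else 0)"
    by (intro sum.cong refl) (auto simp: input_weight)
  also have "\<dots> = (\<Sum>e\<in>{..<n} \<times> {..<n}. if e \<in> parcs G then \<bar>w e\<bar> else 0)"
    unfolding sum.cartesian_product by (rule sum.cong) auto
  also have "\<dots> = (\<Sum>e\<in>({..<n} \<times> {..<n}) \<inter> parcs G. \<bar>w e\<bar>)" by (rule sum.inter_restrict[symmetric]) simp
  also have "({..<n} \<times> {..<n}) \<inter> parcs G = parcs G" using sub by blast
  finally show ?thesis .
qed

text \<open>At the start there are no tokens, and \<open>n\<close> tight edges suffice because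
  shortest paths are simple. The nodes that are not vertices get the potential of vertex 0, from
  which no potential differs by more than \<open>g\<close>.\<close>

lemma wlp_LOAD_BASE:
  assumes inst: "sssp_instance n G s" and b: "loaded G w \<sigma>" and P: "rarr \<sigma> ''P'' = (\<lambda>_. 0)" and h: "spot G w h"
  shows "wlp MM (Seq LOAD BASE) (IM h n) \<sigma>"
  unfolding wlp_Seq
proof (rule wlp_conseq[OF wlp_LOAD[OF _ refl]])
  show ok: "ok \<sigma>" using b by (simp add: loaded_def)
  fix \<tau> assume A: "\<forall>x<n. \<forall>y<n. mt \<tau> ''A'' x y = (if x = y then 0 else if warr \<sigma> ''edge'' (x * n + y) = 0
      then 2 * (\<Sum>x<n. \<Sum>y<n. \<bar>rarr \<sigma> ''weight'' (x * n + y)\<bar>) else rarr \<sigma> ''weight'' (x * n + y))"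
    and fr: "fr LOAD \<sigma> \<tau>"
  have e: "warr \<sigma> ''edge'' = warr (sssp_input n G w s) ''edge''" "rarr \<sigma> ''weight'' = rarr (sssp_input n G w s) ''weight''"
    using b by (auto simp: loaded_def)
  have z: "(\<Sum>x<n. \<Sum>y<n. \<bar>rarr \<sigma> ''weight'' (x * n + y)\<bar>) = (\<Sum>e\<in>parcs G. \<bar>w e\<bar>)"
    unfolding e by (rule sum_input_weight[OF inst])
  have A: "mt \<tau> ''A'' x y = adj G w x y" if "x < n" "y < n" for x y
    using A[unfolded z, rule_format, OF that] that by (simp add: e input_edge input_weight adj_def)
  have ok1: "ok \<tau>" by (rule ok_fr[OF fr ok]) (auto simp: cns_def)
  show "wlp MM BASE (IM h n) \<tau>"
  proof (rule wlp_conseq[OF wlp_BASE[OF ok1]])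
    fix \<tau>2 assume "\<exists>g. (\<forall>u<n. \<forall>w<n. \<bar>mt \<tau> ''A'' u w\<bar> \<le> g) \<and> 0 \<le> g \<and>
      (\<forall>u<N. \<forall>w<N. mt \<tau>2 ''M'' u w = (if u = w then 0 else if u < n \<and> w < n then mt \<tau> ''A'' u w else 3 * g))"
      and fr2: "fr BASE \<tau> \<tau>2"
    then obtain g where g: "\<And>u w. u < n \<Longrightarrow> w < n \<Longrightarrow> \<bar>mt \<tau> ''A'' u w\<bar> \<le> g" "0 \<le> g"
      and M: "\<And>u w. u < N \<Longrightarrow> w < N \<Longrightarrow> mt \<tau>2 ''M'' u w = (if u = w then 0 else if u < n \<and> w < n then mt \<tau> ''A'' u w else 3 * g)"
      by blast
    have g: "\<bar>adj G w x y\<bar> \<le> g" "0 \<le> g" if "x < n" "y < n" for x y using g A that by auto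
    have M: "mt \<tau>2 ''M'' u v = (if u = v then 0 else if u < n \<and> v < n then adj G w u v else 3 * g)" if "u < N" "v < N" for u v
      using M[OF that] A by simp
    have Mn: "mt \<tau>2 ''M'' u v = adj G w u v" if "u < n" "v < n" for u v
      using M[of u v] that n_le_N by (simp add: adj_def)
    have P2: "rarr \<tau>2 ''P'' = (\<lambda>_. 0)" using P by (simp add: frra[OF fr] frra[OF fr2])
    have feas: "h y \<le> h x + adj G w x y" if "x < n" "y < n" for x y by (rule spotD(2)[OF h that])
    have n0: "0 < n" using n1 by simp
    define h' where "h' x = (if x < n then h x else h 0)" for x
    have up: "h' y \<le> h 0 + g" for y
      using feas[OF n0, of y] g[OF n0, of y] g(2)[OF n0 n0] by (auto simp: h'_def)
    have dn: "h 0 \<le> h' x + g" for x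
      using feas[OF _ n0, of x] g(1)[OF _ n0, of x] g(2)[OF n0 n0] by (auto simp: h'_def)
    have f: "h' y \<le> h' x + mt \<tau>2 ''M'' x y" if xy: "x < N" "y < N" for x y
    proof (cases "x < n \<and> y < n")
      case True
      then show ?thesis using feas Mn by (simp add: h'_def)
    next
      case False
      show ?thesis
      proof (cases "x = y")
        case True
        then show ?thesis using M[OF xy] by simp
      next
        case ne: False
        then have "mt \<tau>2 ''M'' x y = 3 * g" using M[OF xy] False by auto
        then show ?thesis using up[of y] dn[of x] g(2)[OF n0 n0] by simp
      qed
    qed
    have r: "\<exists>j\<le>n. reach s (tight n (mt \<tau>2 ''M'') h') (tokM n N (mt \<tau>2 ''M'') (mt \<tau>2 ''M'') h') j y" if y: "y < n" for y
    proof -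
      obtain j where j: "j \<le> n" "reach s (tight n (adj G w) h) (\<lambda>_ _. False) j y"
        using spotD(3)[OF h y] by (elim exE conjE)
      have "reach s (tight n (mt \<tau>2 ''M'') h') (tokM n N (mt \<tau>2 ''M'') (mt \<tau>2 ''M'') h') j y"
        by (rule reach_mono[OF j(2)]) (simp_all add: tight_def Mn h'_def)
      with j(1) show ?thesis by (intro exI[of _ j] conjI)
    qed
    show "IM h n \<tau>2"
      unfolding IM_def
      by (intro exI[of _ h'] conjI allI impI r f) (simp_all add: h'_def P2 M)
  qed
qed

text \<open>With a negative cycle there is no potential to refer to, and every state counts as good.
  The truncated exponent reaches 0 before the last round, and further rounds keep the bound
  1.\<close>

definition Good :: "nat pair_pre_digraph \<Rightarrow> (nat \<times> nat \<Rightarrow> real) \<Rightarrow> (nat \<Rightarrow> real) \<Rightarrow> nat \<Rightarrow> machine_state \<Rightarrow> bool" where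
  "Good G w h r \<sigma> \<longleftrightarrow> (has_negative_cycle G w \<or> IM h (2 ^ (l - 2 - r)) \<sigma>)"

definition err :: real where "err = (real N)\<^sup>2 * beta ^ q"

lemma err_nonneg: "0 \<le> err"
  unfolding err_def using beta_bounds by simp

text \<open>A bound for the probability of a wrong answer, given the state before round \<open>r\<close>.\<close>

definition risk :: "nat pair_pre_digraph \<Rightarrow> (nat \<times> nat \<Rightarrow> real) \<Rightarrow> (nat \<Rightarrow> real) \<Rightarrow> nat \<Rightarrow> machine_state \<Rightarrow> ennreal" where
  "risk G w h r \<sigma> = (if Good G w h r \<sigma> then ennreal (real (l - r) * err) else 1)"

definition PASS :: com where
  "PASS = Seq SAMPLE (Seq ROUND (WAssign ''f'' (WConst 0)))"

lemma Good_cong: "rarr \<sigma>' ''P'' = rarr \<sigma> ''P'' \<Longrightarrow> rarr \<sigma>' ''M'' = rarr \<sigma> ''M'' \<Longrightarrow> Good G w h k \<sigma>' = Good G w h k \<sigma>"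
  by (simp add: Good_def IM_cong[of \<sigma>' \<sigma>])

lemma risk_le_1: "real l * err \<le> 1 \<Longrightarrow> risk G w h r \<sigma> \<le> 1"
proof -
  assume "real l * err \<le> 1"
  moreover have "real (l - r) * err \<le> real l * err" using err_nonneg by (intro mult_right_mono) auto
  ultimately have "ennreal (real (l - r) * err) \<le> ennreal 1" by (intro ennreal_leI) simp
  then show ?thesis by (simp add: risk_def)
qed

text \<open>A union bound in terms of expectations. After the sampling, the number of missed pairs
  is added to the risk of the later rounds: if it is 0, the round succeeds, and otherwise it is at
  least 1 and pays for any failure.\<close>

lemma ebound_PASS:
  assumes small: "real l * err \<le> 1" and k: "k < l"
  shows "ebound MM PASS (3 + q * 7 + 1 + ((5000 + 150 * C) * q ^ 5 * l ^ 3 + 1 + 1))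
    (\<lambda>\<sigma>. loaded G w \<sigma> \<and> wvar \<sigma> ''g'' = k) (\<lambda>\<sigma>'. loaded G w (wset ''g'' (Suc k) \<sigma>') \<and> wvar \<sigma>' ''g'' = k)
    (risk G w h k) (\<lambda>\<sigma>'. risk G w h (Suc k) (wset ''g'' (Suc k) \<sigma>'))"
  unfolding PASS_def
proof (rule ebound_Seq)
  let ?U = "\<lambda>\<sigma>. unhit (mt \<sigma> ''M'') (warr \<sigma> ''h'') q"
  let ?Q = "\<lambda>\<sigma>. loaded G w \<sigma> \<and> wvar \<sigma> ''g'' = k \<and> (\<forall>j<q. warr \<sigma> ''h'' j < N)"
  let ?g = "\<lambda>\<sigma>. if Good G w h k \<sigma> then ennreal (real (l - Suc k) * err) + ennreal (real (card (?U \<sigma>))) else 1"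
  show "ebound MM SAMPLE (3 + q * 7) (\<lambda>\<sigma>. loaded G w \<sigma> \<and> wvar \<sigma> ''g'' = k) ?Q (risk G w h k) ?g"
    unfolding ebound_def
  proof (intro allI impI)
    fix \<sigma> assume a: "loaded G w \<sigma> \<and> wvar \<sigma> ''g'' = k"
    then have "ok \<sigma>" by (simp add: loaded_def)
    from sample_expectation[OF this, of "mt \<sigma> ''M''"] obtain p where p: "halts MM (3 + q * 7) SAMPLE \<sigma> p"
      "\<And>\<sigma>'. \<sigma>' \<in> set_pmf p \<Longrightarrow> fr SAMPLE \<sigma> \<sigma>'" "\<And>\<sigma>' j. \<sigma>' \<in> set_pmf p \<Longrightarrow> j < q \<Longrightarrow> warr \<sigma>' ''h'' j < N"
      "(\<integral>\<^sup>+\<sigma>'. ennreal (real (card (unhit (mt \<sigma> ''M'') (warr \<sigma>' ''h'') q))) \<partial>measure_pmf p) \<le> ennreal err"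
      unfolding err_def by blast
    have same: "rarr \<sigma>' ''P'' = rarr \<sigma> ''P''" "rarr \<sigma>' ''M'' = rarr \<sigma> ''M''" "wvar \<sigma>' ''g'' = k" if "\<sigma>' \<in> set_pmf p" for \<sigma>'
      using a by (simp_all add: frra[OF p(2)[OF that]] frw[OF p(2)[OF that]])
    have gd: "Good G w h k \<sigma>' = Good G w h k \<sigma>" if "\<sigma>' \<in> set_pmf p" for \<sigma>'
      by (rule Good_cong) (use same[OF that] in simp_all)
    have Q: "?Q \<sigma>'" if "\<sigma>' \<in> set_pmf p" for \<sigma>'
    proof -
      have "loaded G w \<sigma>'" by (rule loaded_fr[OF p(2)[OF that]]) (use a in \<open>auto simp: cns_def\<close>)
      then show ?thesis using same(3)[OF that] p(3)[OF that] by blast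
    qed
    have "(\<integral>\<^sup>+x. ?g x \<partial>measure_pmf p) \<le> risk G w h k \<sigma>"
    proof (cases "Good G w h k \<sigma>")
      case True
      have "(\<integral>\<^sup>+x. ?g x \<partial>measure_pmf p) = (\<integral>\<^sup>+x. ennreal (real (l - Suc k) * err) + ennreal (real (card (unhit (mt \<sigma> ''M'') (warr x ''h'') q))) \<partial>measure_pmf p)"
        by (rule nn_integral_cong_AE) (use True same gd in \<open>simp add: AE_measure_pmf_iff\<close>)
      also have "\<dots> = ennreal (real (l - Suc k) * err) + (\<integral>\<^sup>+x. ennreal (real (card (unhit (mt \<sigma> ''M'') (warr x ''h'') q))) \<partial>measure_pmf p)"
        by (subst nn_integral_add) simp_all
      also have "\<dots> \<le> ennreal (real (l - Suc k) * err) + ennreal err" using p(4) by (intro add_left_mono)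
      also have "\<dots> = ennreal (real (l - Suc k) * err + err)" using err_nonneg by (intro ennreal_plus[symmetric]) auto
      also have "real (l - Suc k) * err + err = real (l - k) * err" using k by (simp add: of_nat_diff algebra_simps)
      finally show ?thesis using True by (simp add: risk_def)
    next
      case False
      have "(\<integral>\<^sup>+x. ?g x \<partial>measure_pmf p) = (\<integral>\<^sup>+x. 1 \<partial>measure_pmf p)"
        by (rule nn_integral_cong_AE) (use False same gd in \<open>simp add: AE_measure_pmf_iff\<close>)
      then show ?thesis using False by (simp add: risk_def)
    qed
    then show "\<exists>p. halts MM (3 + q * 7) SAMPLE \<sigma> p \<and> (\<forall>\<sigma>'\<in>set_pmf p. ?Q \<sigma>') \<and> (\<integral>\<^sup>+x. ?g x \<partial>measure_pmf p) \<le> risk G w h k \<sigma>"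
      using p(1) Q by blast
  qed
  show "ebound MM (Seq ROUND (WAssign ''f'' (WConst 0))) ((5000 + 150 * C) * q ^ 5 * l ^ 3 + 1 + 1) ?Q
    (\<lambda>\<sigma>'. loaded G w (wset ''g'' (Suc k) \<sigma>') \<and> wvar \<sigma>' ''g'' = k) ?g (\<lambda>\<sigma>'. risk G w h (Suc k) (wset ''g'' (Suc k) \<sigma>'))"
  proof (rule ebound_det)
    fix \<sigma> assume a: "?Q \<sigma>"
    then have ok: "ok \<sigma>" and f: "wvar \<sigma> ''f'' = 0" by (auto simp: loaded_def)
    define D where "D = (\<not> has_negative_cycle G w \<and> Good G w h k \<sigma> \<and> ?U \<sigma> = {})"
    have "wlp MM ROUND (\<lambda>\<sigma>'. D \<longrightarrow> IM h ((2 ^ (l - 2 - k) + 1) div 2) \<sigma>') \<sigma>"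
    proof (cases D)
      case True
      have im: "IM h (2 ^ (l - 2 - k)) \<sigma>" and U: "?U \<sigma> = {}" using True by (auto simp: D_def Good_def)
      have hub: "\<And>i. i < q \<Longrightarrow> warr \<sigma> ''h'' i < N" using a by blast
      have "wlp MM ROUND (IM h ((2 ^ (l - 2 - k) + 1) div 2)) \<sigma>"
      proof (rule wlp_ROUND[OF ok im hub])
        fix x y assume xy: "x < N" "y < N"
        have "(x, y) \<notin> ?U \<sigma>" unfolding U by simp
        then obtain j where "j < q" "warr \<sigma> ''h'' j \<in> hit N m (mt \<sigma> ''M'') x y" using xy unfolding unhit_def by blast
        then show "warr \<sigma> ''h'' ` {..<q} \<inter> hit N m (mt \<sigma> ''M'') x y \<noteq> {}" by blast
      qed
      then show ?thesis using True by simp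
    qed (simp add: wlp_def)
    from TM_wlp[OF TM_ROUND ok this] obtain t \<sigma>' where t: "bs MM ROUND \<sigma> t \<sigma>'" "t \<le> (5000 + 150 * C) * q ^ 5 * l ^ 3"
      and im: "D \<Longrightarrow> IM h ((2 ^ (l - 2 - k) + 1) div 2) \<sigma>'" and fr: "fr ROUND \<sigma> \<sigma>'" using f by auto
    let ?\<tau> = "wset ''f'' (wval MM \<sigma>' (WConst 0)) \<sigma>'"
    have b: "bs MM (Seq ROUND (WAssign ''f'' (WConst 0))) \<sigma> (t + 1 + 1) ?\<tau>" by (intro bs_Seq[OF t(1)] bs_WAssign)
    have ok': "ok \<sigma>'" by (rule ok_fr[OF fr ok]) (auto simp: cns_def)
    then have ok'': "ok (wset ''g'' (Suc k) ?\<tau>)" by (simp add: ok_def)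
    have L: "loaded G w (wset ''g'' (Suc k) ?\<tau>)"
      using a ok'' by (simp add: loaded_def frw[OF fr] frwa[OF fr] frra[OF fr])
    have gk: "wvar ?\<tau> ''g'' = k" using a by (simp add: frw[OF fr])
    have "risk G w h (Suc k) (wset ''g'' (Suc k) ?\<tau>) \<le> ?g \<sigma>"
    proof (cases "Good G w h k \<sigma> \<and> (has_negative_cycle G w \<or> ?U \<sigma> = {})")
      case True
      have "Good G w h (Suc k) (wset ''g'' (Suc k) ?\<tau>)"
      proof (cases "has_negative_cycle G w")
        case False
        then have "IM h ((2 ^ (l - 2 - k) + 1) div 2) \<sigma>'" using True im by (simp add: D_def)
        \<comment> \<open>A power of two is halved exactly, whereas 1 is reproduced; so the rounds
          lead to 1 and not to 0, and \<open>DIST\<close> has to handle one counted edge.\<close>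
        moreover have "(2 ^ (l - 2 - k) + 1) div 2 \<le> (2::nat) ^ (l - 2 - Suc k)"
        proof (cases "l - 2 - k")
          case (Suc j)
          then have "l - 2 - Suc k = j" by simp
          then show ?thesis using Suc by simp
        qed simp
        ultimately have "IM h (2 ^ (l - 2 - Suc k)) \<sigma>'" by (rule IM_mono)
        then have "IM h (2 ^ (l - 2 - Suc k)) (wset ''g'' (Suc k) ?\<tau>)" using IM_cong[of "wset ''g'' (Suc k) ?\<tau>" \<sigma>'] by simp
        then show ?thesis by (simp add: Good_def)
      qed (simp add: Good_def)
      then show ?thesis using True by (simp add: risk_def)
    next
      case False
      have "risk G w h (Suc k) (wset ''g'' (Suc k) ?\<tau>) \<le> 1" by (rule risk_le_1[OF small])
      also have "\<dots> \<le> ?g \<sigma>"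
      proof (cases "Good G w h k \<sigma>")
        case True
        then have "?U \<sigma> \<noteq> {}" using False by blast
        then have "0 < card (?U \<sigma>)" using finite_unhit by (simp add: card_gt_0_iff)
        then have "(1::real) \<le> real (card (?U \<sigma>))" by simp
        then have "ennreal 1 \<le> ennreal (real (card (?U \<sigma>)))" by (rule ennreal_leI)
        then have "1 \<le> ennreal (real (l - Suc k) * err) + ennreal (real (card (?U \<sigma>)))"
          using add_increasing[of "ennreal (real (l - Suc k) * err)" 1] by simp
        then show ?thesis using True by simp
      qed simp
      finally show ?thesis .
    qed
    then show "\<exists>u \<sigma>'. bs MM (Seq ROUND (WAssign ''f'' (WConst 0))) \<sigma> u \<sigma>' \<and> u \<le> (5000 + 150 * C) * q ^ 5 * l ^ 3 + 1 + 1 \<and>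
      (loaded G w (wset ''g'' (Suc k) \<sigma>') \<and> wvar \<sigma>' ''g'' = k) \<and> risk G w h (Suc k) (wset ''g'' (Suc k) \<sigma>') \<le> ?g \<sigma>"
      using b t(2) L gk by (intro exI[of _ "t + 1 + 1"] exI[of _ ?\<tau>]) simp
  qed
qed

end

section \<open>Correctness of the answer\<close>

lemma (in pair_wf_digraph) awalk_iff_rtrancl:
  assumes "u \<in> pverts G"
  shows "(\<exists>p. awalk u p v) \<longleftrightarrow> (u, v) \<in> (parcs G)\<^sup>*"
proof
  assume "(u, v) \<in> (parcs G)\<^sup>*"
  then show "\<exists>p. awalk u p v"
  proof (induction rule: rtrancl_induct)
    case base
    then show ?case using assms by (intro exI[of _ "[]"]) (simp add: awalk_Nil_iff)
  next
    case (step y z)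
    then obtain p where "awalk u p y" by blast
    moreover have "awalk y [(y, z)] z" using arc_implies_awalk[of "(y, z)"] step(2) by simp
    ultimately show ?case using awalk_appendI by blast
  qed
next
  assume "\<exists>p. awalk u p v"
  then obtain p where "awalk u p v" by blast
  then show "(u, v) \<in> (parcs G)\<^sup>*"
  proof (induction p arbitrary: u)
    case Nil
    then show ?case by (simp add: awalk_Nil_iff)
  next
    case (Cons e p)
    then have "(u, snd e) \<in> parcs G" "(snd e, v) \<in> (parcs G)\<^sup>*" by (auto simp: awalk_Cons_iff)
    then show ?case by (rule converse_rtrancl_into_rtrancl)
  qed
qed

definition SSSP :: "nat \<Rightarrow> com" where
  "SSSP C = Seq (SIZES C) (Seq (Seq LOAD BASE)
     (Seq (FOR ''g'' ''l'' (Seq SAMPLE (Seq ROUND (WAssign ''f'' (WConst 0))))) (Seq DIST (Seq SEARCH VERIFY))))"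

context sizes
begin

text \<open>With a negative cycle no function is a potential, so the check raises the flag whatever
  the rounds have computed. Without one, the computed values are feasible at all vertices, also at
  unreachable ones, as they are distances in the completed graph; so the flag stays down.\<close>

lemma correct_output:
  assumes inst: "sssp_instance n G s" and h: "\<not> has_negative_cycle G w \<Longrightarrow> spot G w h"
    and dist: "\<And>x. \<not> has_negative_cycle G w \<Longrightarrow> x < n \<Longrightarrow> rarr \<sigma> ''dist'' x = h x"
    and r: "\<And>x. x < n \<Longrightarrow> warr \<sigma> ''reachable'' x \<noteq> 0 \<longleftrightarrow> (s, x) \<in> (parcs G)\<^sup>*"
    and neg: "wvar \<sigma> ''negative_cycle'' = 0 \<longleftrightarrow> (\<forall>(x, y)\<in>parcs G. rarr \<sigma> ''dist'' y \<le> rarr \<sigma> ''dist'' x + w (x, y))"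
  shows "correct_answer G w s (sssp_output \<sigma>)"
proof -
  have G: "pair_fin_digraph G" and V: "pverts G = {..<n}" using inst by (auto simp: sssp_instance_def)
  interpret pair_fin_digraph G by fact
  show ?thesis
  proof (cases "has_negative_cycle G w")
    case True
    have "wvar \<sigma> ''negative_cycle'' \<noteq> 0"
    proof
      assume "wvar \<sigma> ''negative_cycle'' = 0"
      then have "\<not> has_negative_cycle G w"
        by (intro potential_no_negative_cycle[OF G, of "rarr \<sigma> ''dist''"]) (use neg in auto)
      then show False using True by simp
    qed
    then show ?thesis using True by (simp add: sssp_output_def)
  next
    case False
    note h = spotD[OF h[OF False]] and dist = dist[OF False]
    have "rarr \<sigma> ''dist'' y \<le> rarr \<sigma> ''dist'' x + w (x, y)" if xy: "(x, y) \<in> parcs G" for x y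
      using h(5)[OF xy] dist arcs_bounded[OF inst xy] by simp
    then have n0: "wvar \<sigma> ''negative_cycle'' = 0" unfolding neg by blast
    have sV: "s \<in> pverts G" using inst unfolding sssp_instance_def by blast
    have "(if warr \<sigma> ''reachable'' v \<noteq> 0 then ereal (rarr \<sigma> ''dist'' v) else \<infinity>) = sssp_dist G w s v" if v: "v < n" for v
    proof (cases "\<exists>p. awalk s p v")
      case True
      then obtain p where p: "awalk s p v" by blast
      have "warr \<sigma> ''reachable'' v \<noteq> 0" using True awalk_iff_rtrancl[OF sV] r[OF v] by blast
      then show ?thesis using h(4)[OF p] dist[OF v] by simp
    next
      case False
      then have z: "warr \<sigma> ''reachable'' v = 0" using awalk_iff_rtrancl[OF sV] r[OF v] by blast
      have "{p. awalk s p v} = {}" using False by blast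
      then have "sssp_dist G w s v = \<infinity>" unfolding sssp_dist_def \<mu>_def by (simp add: top_ereal_def)
      then show ?thesis using z by simp
    qed
    then show ?thesis using n0 V by (simp add: sssp_output_def)
  qed
qed

lemma wlp_answer:
  assumes inst: "sssp_instance n G s" and h: "\<not> has_negative_cycle G w \<Longrightarrow> spot G w h"
    and b: "loaded G w \<sigma>" and good: "Good G w h l \<sigma>"
  shows "wlp MM (Seq DIST (Seq SEARCH VERIFY)) (\<lambda>\<sigma>'. correct_answer G w s (sssp_output \<sigma>')) \<sigma>"
proof -
  have ok: "ok \<sigma>" using b by (simp add: loaded_def)
  have d: "wlp MM DIST (\<lambda>\<tau>. \<not> has_negative_cycle G w \<longrightarrow> (\<forall>x<n. rarr \<tau> ''dist'' x = h x)) \<sigma>"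
  proof (cases "has_negative_cycle G w")
    case False
    then have "IM h 1 \<sigma>" using good by (simp add: Good_def)
    then show ?thesis using wlp_DIST[OF ok, of h] spotD(1)[OF h[OF False]] False by simp
  qed (simp add: wlp_def)
  have E: "parcs G = {(x, y). x < n \<and> y < n \<and> warr (sssp_input n G w s) ''edge'' (x * n + y) \<noteq> 0}"
  proof (rule set_eqI, clarify)
    fix x y
    show "(x, y) \<in> parcs G \<longleftrightarrow> (x, y) \<in> {(x, y). x < n \<and> y < n \<and> warr (sssp_input n G w s) ''edge'' (x * n + y) \<noteq> 0}"
      using arcs_bounded[OF inst, of x y] input_edge[of x y G w] by (cases "(x, y) \<in> parcs G") auto
  qed
  show ?thesis
    unfolding wlp_Seq
  proof (rule wlp_conseq[OF d])
    fix \<tau>1 assume d1: "\<not> has_negative_cycle G w \<longrightarrow> (\<forall>x<n. rarr \<tau>1 ''dist'' x = h x)" and fr1: "fr DIST \<sigma> \<tau>1"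
    have b1: "loaded G w \<tau>1" by (rule loaded_fr[OF fr1 b]) (auto simp: cns_def)
    have ok1: "ok \<tau>1" using b1 by (simp add: loaded_def)
    have v1: "wvar \<tau>1 ''negative_cycle'' = 0" "warr \<tau>1 ''edge'' = warr (sssp_input n G w s) ''edge''"
      "rarr \<tau>1 ''weight'' = rarr (sssp_input n G w s) ''weight''" "\<And>x. warr \<tau>1 ''reachable'' x = 0" "\<And>x. warr \<tau>1 ''D'' x = 0"
      using b1 by (simp_all add: loaded_def)
    have E1: "parcs G = {(x, y). x < n \<and> y < n \<and> warr \<tau>1 ''edge'' (x * n + y) \<noteq> 0}" unfolding v1 by (rule E)
    show "wlp MM SEARCH (wlp MM VERIFY (\<lambda>\<sigma>'. correct_answer G w s (sssp_output \<sigma>'))) \<tau>1"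
    proof (rule wlp_conseq[OF wlp_SEARCH[OF ok1 v1(4,5) E1]])
      fix \<tau>2 assume r2: "\<forall>x<n. warr \<tau>2 ''reachable'' x \<noteq> 0 \<longleftrightarrow> (s, x) \<in> (parcs G)\<^sup>*" and fr2: "fr SEARCH \<tau>1 \<tau>2"
      have ok2: "ok \<tau>2" by (rule ok_fr[OF fr2 ok1]) (auto simp: cns_def)
      have v2: "wvar \<tau>2 ''negative_cycle'' = 0" "warr \<tau>2 ''edge'' = warr (sssp_input n G w s) ''edge''"
        "rarr \<tau>2 ''weight'' = rarr (sssp_input n G w s) ''weight''" "rarr \<tau>2 ''dist'' = rarr \<tau>1 ''dist''"
        by (simp_all add: frw[OF fr2] frwa[OF fr2] frra[OF fr2] v1)
      show "wlp MM VERIFY (\<lambda>\<sigma>'. correct_answer G w s (sssp_output \<sigma>')) \<tau>2"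
      proof (rule wlp_conseq[OF wlp_VERIFY[OF ok2 v2(1)]])
        fix \<tau>3 assume n3: "wvar \<tau>3 ''negative_cycle'' = 0 \<longleftrightarrow> (\<forall>x<n. \<forall>y<n. warr \<tau>2 ''edge'' (x * n + y) \<noteq> 0 \<longrightarrow>
            rarr \<tau>2 ''dist'' y \<le> rarr \<tau>2 ''dist'' x + rarr \<tau>2 ''weight'' (x * n + y))" and fr3: "fr VERIFY \<tau>2 \<tau>3"
        have v3: "rarr \<tau>3 ''dist'' = rarr \<tau>1 ''dist''" "warr \<tau>3 ''reachable'' = warr \<tau>2 ''reachable''"
          by (simp_all add: frwa[OF fr3] frra[OF fr3] v2)
        have iff: "(warr \<tau>2 ''edge'' (x * n + y) \<noteq> 0 \<longrightarrow> rarr \<tau>2 ''dist'' y \<le> rarr \<tau>2 ''dist'' x + rarr \<tau>2 ''weight'' (x * n + y)) \<longleftrightarrow>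
            ((x, y) \<in> parcs G \<longrightarrow> rarr \<tau>1 ''dist'' y \<le> rarr \<tau>1 ''dist'' x + w (x, y))" if "x < n" "y < n" for x y
          using that by (simp add: v2 input_edge input_weight)
        have n4: "wvar \<tau>3 ''negative_cycle'' = 0 \<longleftrightarrow> (\<forall>x<n. \<forall>y<n. (x, y) \<in> parcs G \<longrightarrow> rarr \<tau>1 ''dist'' y \<le> rarr \<tau>1 ''dist'' x + w (x, y))"
          unfolding n3 using iff by blast
        show "correct_answer G w s (sssp_output \<tau>3)"
        proof (rule correct_output[OF inst h])
          show "wvar \<tau>3 ''negative_cycle'' = 0 \<longleftrightarrow> (\<forall>(x, y)\<in>parcs G. rarr \<tau>3 ''dist'' y \<le> rarr \<tau>3 ''dist'' x + w (x, y))"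
            unfolding n4 v3 using arcs_bounded[OF inst] by blast
        qed (use d1 r2 in \<open>simp_all add: v3\<close>)
      qed
    qed
  qed
qed

definition wrong :: "nat pair_pre_digraph \<Rightarrow> (nat \<times> nat \<Rightarrow> real) \<Rightarrow> machine_state \<Rightarrow> ennreal" where
  "wrong G w \<sigma> = (if correct_answer G w s (sssp_output \<sigma>) then 0 else 1)"

lemma ebound_after_SIZES:
  assumes inst: "sssp_instance n G s" and small: "real l * err \<le> 1"
  shows "ebound MM (Seq (Seq LOAD BASE) (Seq (FOR ''g'' ''l'' PASS) (Seq DIST (Seq SEARCH VERIFY))))
     (201 * q ^ 4 * l ^ 2 + 1 + (3 + l * (3 + q * 7 + 1 + ((5000 + 150 * C) * q ^ 5 * l ^ 3 + 1 + 1) + 4) + 1 + 1202 * q ^ 4 * l ^ 2))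
     (\<lambda>\<sigma>. loaded G w \<sigma> \<and> rarr \<sigma> ''P'' = (\<lambda>_. 0)) (\<lambda>_. True) (\<lambda>_. ennreal (real l * err)) (wrong G w)"
proof -
  obtain h where h: "\<not> has_negative_cycle G w \<Longrightarrow> spot G w h" using spot_exists[OF inst] by blast
  have wg: "loaded G w (wset ''g'' v \<sigma>) = loaded G w \<sigma>" for v \<sigma> by (simp add: loaded_def ok_def)
  have rg: "risk G w h k (wset ''g'' v \<sigma>) = risk G w h k \<sigma>" for k v \<sigma>
    unfolding risk_def using Good_cong[of "wset ''g'' v \<sigma>" \<sigma>] by simp
  have "ebound MM (Seq LOAD BASE) (201 * q ^ 4 * l ^ 2) (\<lambda>\<sigma>. loaded G w \<sigma> \<and> rarr \<sigma> ''P'' = (\<lambda>_. 0)) (\<lambda>\<sigma>. loaded G w (wset ''g'' 0 \<sigma>))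
     (\<lambda>_. ennreal (real l * err)) (\<lambda>\<sigma>. risk G w h 0 (wset ''g'' 0 \<sigma>))"
  proof (rule ebound_det)
    fix \<sigma> assume a: "loaded G w \<sigma> \<and> rarr \<sigma> ''P'' = (\<lambda>_. 0)"
    then have ok: "ok \<sigma>" and f: "wvar \<sigma> ''f'' = 0" by (auto simp: loaded_def)
    have T: "TM 201 4 2 (Seq LOAD BASE)" using TM_Seq[OF TM_LOAD TM_BASE] by simp
    have "wlp MM (Seq LOAD BASE) (\<lambda>\<tau>. \<not> has_negative_cycle G w \<longrightarrow> IM h n \<tau>) \<sigma>"
    proof (cases "has_negative_cycle G w")
      case False
      then show ?thesis using wlp_LOAD_BASE[OF inst _ _ h[OF False]] a by simp
    qed (simp add: wlp_def)
    from TM_wlp[OF T ok this] obtain t \<sigma>' where t: "bs MM (Seq LOAD BASE) \<sigma> t \<sigma>'" "t \<le> 201 * q ^ 4 * l ^ 2"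
      and im: "\<not> has_negative_cycle G w \<Longrightarrow> IM h n \<sigma>'" and fr: "fr (Seq LOAD BASE) \<sigma> \<sigma>'" using f by auto
    have L: "loaded G w \<sigma>'" by (rule loaded_fr[OF fr]) (use a in \<open>auto simp: cns_def\<close>)
    have "Good G w h 0 \<sigma>'" using im IM_mono[OF im, of "2 ^ (l - 2)"] n_pow by (auto simp: Good_def)
    then have "risk G w h 0 (wset ''g'' 0 \<sigma>') \<le> ennreal (real l * err)" unfolding rg by (simp add: risk_def)
    then show "\<exists>u \<sigma>'. bs MM (Seq LOAD BASE) \<sigma> u \<sigma>' \<and> u \<le> 201 * q ^ 4 * l ^ 2 \<and> loaded G w (wset ''g'' 0 \<sigma>') \<and>
      risk G w h 0 (wset ''g'' 0 \<sigma>') \<le> ennreal (real l * err)"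
      using t L unfolding wg by (intro exI[of _ t] exI[of _ \<sigma>'] conjI)
  qed
  moreover have "ebound MM (FOR ''g'' ''l'' PASS) (3 + l * (3 + q * 7 + 1 + ((5000 + 150 * C) * q ^ 5 * l ^ 3 + 1 + 1) + 4))
     (\<lambda>\<sigma>. loaded G w (wset ''g'' 0 \<sigma>)) (loaded G w) (\<lambda>\<sigma>. risk G w h 0 (wset ''g'' 0 \<sigma>)) (risk G w h l)"
    using ebound_FOR[where Inv = "\<lambda>_. loaded G w" and G = "risk G w h" and E = l and X = "''l''" and i = "''g''",
      OF ebound_PASS[OF small] _ l_less] by (simp add: loaded_def ok_def)
  moreover have "ebound MM (Seq DIST (Seq SEARCH VERIFY)) (1202 * q ^ 4 * l ^ 2) (loaded G w) (\<lambda>_. True) (risk G w h l) (wrong G w)"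
  proof (rule ebound_det)
    fix \<sigma> assume b: "loaded G w \<sigma>"
    then have ok: "ok \<sigma>" and f: "wvar \<sigma> ''f'' = 0" by (auto simp: loaded_def)
    have T: "TM 1202 4 2 (Seq DIST (Seq SEARCH VERIFY))"
      using TM_Seq[OF TM_DIST TM_Seq[OF TM_SEARCH TM_VERIFY]] by simp
    have "wlp MM (Seq DIST (Seq SEARCH VERIFY)) (\<lambda>\<tau>. wrong G w \<tau> \<le> risk G w h l \<sigma>) \<sigma>"
    proof (cases "Good G w h l \<sigma>")
      case True
      then show ?thesis by (intro wlp_conseq[OF wlp_answer[OF inst h b]]) (auto simp: wrong_def)
    next
      case False
      then show ?thesis by (auto simp: wlp_def wrong_def risk_def)
    qed
    from TM_wlp[OF T ok this] show "\<exists>u \<sigma>'. bs MM (Seq DIST (Seq SEARCH VERIFY)) \<sigma> u \<sigma>' \<and> u \<le> 1202 * q ^ 4 * l ^ 2 \<and> True \<and> wrong G w \<sigma>' \<le> risk G w h l \<sigma>"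
      using f by auto
  qed
  ultimately show ?thesis by (intro ebound_Seq)
qed

lemma total_time:
  "50 + 20 * n + 1 + (201 * q ^ 4 * l ^ 2 + 1 + (3 + l * (3 + q * 7 + 1 + ((5000 + 150 * C) * q ^ 5 * l ^ 3 + 1 + 1) + 4) + 1 + 1202 * q ^ 4 * l ^ 2))
     \<le> (10000 + 150 * C) * q ^ 5 * l ^ 4"
proof -
  define X where "X = q ^ 5 * l ^ 4"
  have le: "q ^ i * l ^ j \<le> X" if "i \<le> 5" "j \<le> 4" for i j
    unfolding X_def using that q1 l2 by (intro mult_mono power_increasing) auto
  have "1 \<le> X" "q ^ 4 * l ^ 2 \<le> X" "l \<le> X" "q * l \<le> X" "q * q \<le> X"
    using le[of 0 0] le[of 4 2] le[of 0 1] le[of 1 1] le[of 2 0] by (auto simp: power2_eq_square)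
  moreover have "n \<le> q * q" by (rule n_le)
  moreover have "l * (3 + q * 7 + 1 + ((5000 + 150 * C) * q ^ 5 * l ^ 3 + 1 + 1) + 4) = 10 * l + 7 * (q * l) + (5000 + 150 * C) * X"
    by (simp add: X_def algebra_simps power_numeral_reduce)
  moreover have "201 * q ^ 4 * l ^ 2 = 201 * (q ^ 4 * l ^ 2)" "1202 * q ^ 4 * l ^ 2 = 1202 * (q ^ 4 * l ^ 2)" by simp_all
  moreover have "(10000 + 150 * C) * q ^ 5 * l ^ 4 = 10000 * X + 150 * (C * X)" "(5000 + 150 * C) * X = 5000 * X + 150 * (C * X)"
    by (simp_all add: X_def algebra_simps)
  ultimately show ?thesis by linarith
qed

text \<open>Every unit by which \<open>C\<close> exceeds 7 contributes a factor
  \<open>exp (- real l)\<close>, which is at most \<open>1 / n\<close>. The 7 compensates for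
  \<open>2 ^ (7 * l)\<close>, the number of rounds and pairs in the union bound.\<close>

lemma err_le:
  assumes C: "7 + c \<le> real C" and c: "0 < c"
  shows "real l * err \<le> 1 / real n powr c" "real l * err \<le> 1"
proof -
  have "(2::real) ^ (7 * l) \<le> exp 1 ^ (7 * l)" using exp_ge_add_one_self[of 1] by (intro power_mono) auto
  also have "\<dots> = exp (7 * real l)" using exp_of_nat_mult[of "7 * l" "1::real"] by simp
  finally have "real l * err \<le> exp (7 * real l) * exp (- (real C * real l))"
    using order_trans[OF failure_bound mult_right_mono[of "2 ^ (7 * l)" "exp (7 * real l)" "exp (- (real C * real l))"]]
    unfolding err_def by simp
  also have "\<dots> = exp (7 * real l - real C * real l)" by (simp add: exp_add[symmetric])
  also have "\<dots> \<le> exp (- (c * real l))"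
  proof -
    have "(7 + c) * real l \<le> real C * real l" using C by (intro mult_right_mono) auto
    then show ?thesis by (simp add: algebra_simps)
  qed
  finally have e: "real l * err \<le> exp (- (c * real l))" .
  have "real n \<le> exp (real l)"
  proof -
    have "(2::nat) ^ (l - 2) \<le> 2 ^ l" by (rule power_increasing) auto
    then have "n \<le> 2 ^ l" by (rule order_trans[OF n_pow])
    then have "real n \<le> 2 ^ l" by (metis of_nat_le_iff of_nat_numeral of_nat_power)
    also have "\<dots> \<le> exp 1 ^ l" using exp_ge_add_one_self[of 1] by (intro power_mono) auto
    also have "\<dots> = exp (real l)" using exp_of_nat_mult[of l "1::real"] by simp
    finally show ?thesis .
  qed
  then have "real n powr c \<le> exp (real l) powr c" using c by (intro powr_mono2) auto
  then have "real n powr c \<le> exp (c * real l)" by (simp add: powr_def)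
  moreover have "0 < real n powr c" using n1 by simp
  ultimately have "1 / exp (c * real l) \<le> 1 / real n powr c" by (intro divide_left_mono) auto
  then show "real l * err \<le> 1 / real n powr c" using e by (simp add: exp_minus inverse_eq_divide)
  have "exp (- (c * real l)) \<le> 1" using c by simp
  with e show "real l * err \<le> 1" by (rule order_trans)
qed

end

section \<open>Error probability and running time of the whole program\<close>

definition prog_time :: "nat \<Rightarrow> nat \<Rightarrow> nat" where
  "prog_time C n = (10000 + 150 * C) * qf n ^ 5 * lf n ^ 4"

lemma SSSP_correct:
  assumes inst: "sssp_instance n G s" and C: "7 + c \<le> real C" and c: "0 < c"
  shows "\<exists>p. halts (mmf C n) (prog_time C n) (SSSP C) (sssp_input n G w s) p \<and>
     1 - 1 / real n powr c \<le> measure_pmf.prob p {\<sigma>. correct_answer G w s (sssp_output \<sigma>)}"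
proof -
  have s: "s < n" using inst by (auto simp: sssp_instance_def)
  then have n: "1 \<le> n" by simp
  interpret sizes "mmf C n" n s "qf n" "lf n" C by (rule sizes_inst[OF n s])
  let ?\<sigma> = "sssp_input n G w s"
  have v: "wvar ?\<sigma> ''n'' = n" "wvar ?\<sigma> ''s'' = s" by (simp_all add: sssp_input_def)
  have w: "ww (SIZES C) = {''p'', ''l'', ''x'', ''q'', ''B'', ''N'', ''E'', ''m'', ''ce'', ''cf''}" "wa (SIZES C) = {}" "rv (SIZES C) = {}" "ra (SIZES C) = {}"
    by (auto simp: SIZES_def)
  have "ebound (mmf C n) (SIZES C) (50 + 20 * n) (\<lambda>\<sigma>. \<sigma> = ?\<sigma>) (\<lambda>\<sigma>. loaded G w \<sigma> \<and> rarr \<sigma> ''P'' = (\<lambda>_. 0)) (\<lambda>_. ennreal (real (lf n) * err)) (\<lambda>_. ennreal (real (lf n) * err))"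
  proof (rule ebound_det)
    fix \<sigma> assume \<sigma>: "\<sigma> = ?\<sigma>"
    obtain t \<sigma>' where t: "t \<le> 50 + 20 * n" "bs (mmf C n) (SIZES C) ?\<sigma> t \<sigma>'"
      using hn_SIZES[OF n_less] v(1) unfolding hn_def by blast
    have ok: "ok \<sigma>'" using wlp_SIZES[OF n s v] t(2) unfolding wlp_def by blast
    note fr = bs_fr[OF t(2)]
    have "loaded G w \<sigma>' \<and> rarr \<sigma>' ''P'' = (\<lambda>_. 0)"
      using ok by (simp add: loaded_def frw[OF fr] frwa[OF fr] frra[OF fr] w) (simp add: sssp_input_def)
    then show "\<exists>u \<sigma>'. bs (mmf C n) (SIZES C) \<sigma> u \<sigma>' \<and> u \<le> 50 + 20 * n \<and> (loaded G w \<sigma>' \<and> rarr \<sigma>' ''P'' = (\<lambda>_. 0)) \<and>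
      ennreal (real (lf n) * err) \<le> ennreal (real (lf n) * err)" using t unfolding \<sigma> by (intro exI[of _ t] exI[of _ \<sigma>'] conjI) simp_all
  qed
  from ebound_Seq[OF this ebound_after_SIZES[OF inst err_le(2)[OF C c]]]
  have eb: "ebound (mmf C n) (SSSP C) (prog_time C n) (\<lambda>\<sigma>. \<sigma> = ?\<sigma>) (\<lambda>_. True) (\<lambda>_. ennreal (real (lf n) * err)) (wrong G w)"
    unfolding SSSP_def PASS_def prog_time_def by (rule ebound_mono) (use total_time in auto)
  obtain p where p: "halts (mmf C n) (prog_time C n) (SSSP C) ?\<sigma> p" "(\<integral>\<^sup>+x. wrong G w x \<partial>measure_pmf p) \<le> ennreal (real (lf n) * err)"
    using eb unfolding ebound_def by blast
  let ?A = "{\<sigma>. correct_answer G w s (sssp_output \<sigma>)}"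
  \<comment> \<open>\<open>wrong\<close> is the indicator of failure, so its expectation is the
    probability of a wrong answer.\<close>
  have "(\<integral>\<^sup>+x. wrong G w x \<partial>measure_pmf p) = (\<integral>\<^sup>+x. indicator (- ?A) x \<partial>measure_pmf p)"
    by (intro nn_integral_cong) (simp add: wrong_def indicator_def)
  then have "emeasure (measure_pmf p) (- ?A) \<le> ennreal (real (lf n) * err)" using p(2) by simp
  then have "measure_pmf.prob p (- ?A) \<le> real (lf n) * err"
    using err_nonneg by (simp add: measure_pmf.emeasure_eq_measure)
  also have "\<dots> \<le> 1 / real n powr c" by (rule err_le(1)[OF C c])
  finally have "1 - 1 / real n powr c \<le> measure_pmf.prob p ?A"
    using measure_pmf.prob_compl[of ?A p] by (simp add: Compl_eq_Diff_UNIV)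
  then show ?thesis using p(1) by blast
qed

text \<open>The \<open>l\<close> rounds of order \<open>q ^ 5 * l ^ 3\<close> give the exponents 2.5
  and 4; the latter is weakened to 4.5. The factors \<open>2 ^ 5\<close> and \<open>4 ^ 4\<close>
  stem from \<open>q \<le> 2 * sqrt n\<close> and \<open>l \<le> 4 * log 2 n\<close>, valid from
  \<open>n = 2\<close> on.\<close>

lemma prog_time_bigo: "(\<lambda>n. real (prog_time C n)) \<in> O(\<lambda>n. real n powr 2.5 * log 2 (real n) powr 4.5)"
proof (rule bigoI[where c = "real (10000 + 150 * C) * 2 ^ 5 * 4 ^ 4"], rule eventually_at_top_linorderI[of 2])
  fix n :: nat assume n: "2 \<le> n"
  have L1: "1 \<le> log 2 (real n)" using n by (simp add: le_log_iff)
  have "real (qf n) \<le> sqrt (real n) + 1"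
  proof (cases "qf n")
    case (Suc i)
    then have "i * i < n" using qf_props(3)[of i n] by simp
    then have "(real i)\<^sup>2 \<le> real n" unfolding power2_eq_square by (metis less_imp_le of_nat_le_iff of_nat_mult)
    then have "real i \<le> sqrt (real n)" by (rule real_le_rsqrt)
    then show ?thesis using Suc by simp
  qed simp
  also have "\<dots> \<le> 2 * sqrt (real n)" using n by simp
  finally have q: "real (qf n) \<le> 2 * sqrt (real n)" .
  have "real (lf n) \<le> log 2 (real n) + 3"
  proof (cases "lf n - 2")
    case (Suc i)
    then have "2 ^ i < n" using lf_props(3)[of i n] by simp
    then have "real (2 ^ i) \<le> real n" by simp
    then have "2 powr real i \<le> real n" by (simp add: powr_realpow)
    then have "real i \<le> log 2 (real n)" using n by (simp add: le_log_iff)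
    then show ?thesis using Suc by simp
  qed (use L1 in simp)
  then have l: "real (lf n) \<le> 4 * log 2 (real n)" using L1 by simp
  have s5: "sqrt (real n) ^ 5 = real n powr 2.5"
    using n by (simp add: powr_half_sqrt[symmetric] powr_power)
  have l4: "log 2 (real n) ^ 4 \<le> log 2 (real n) powr 4.5"
  proof -
    have "log 2 (real n) ^ 4 = log 2 (real n) powr 4" using L1 powr_realpow[of "log 2 (real n)" 4] by simp
    also have "\<dots> \<le> log 2 (real n) powr 4.5" using L1 by (intro powr_mono) auto
    finally show ?thesis .
  qed
  have "real (prog_time C n) = real (10000 + 150 * C) * real (qf n) ^ 5 * real (lf n) ^ 4" by (simp add: prog_time_def)
  also have "\<dots> \<le> real (10000 + 150 * C) * (2 * sqrt (real n)) ^ 5 * (4 * log 2 (real n)) ^ 4"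
    using q l by (intro mult_mono power_mono) auto
  also have "\<dots> = real (10000 + 150 * C) * 2 ^ 5 * 4 ^ 4 * (sqrt (real n) ^ 5 * log 2 (real n) ^ 4)" by (simp add: power_mult_distrib)
  also have "\<dots> \<le> real (10000 + 150 * C) * 2 ^ 5 * 4 ^ 4 * (real n powr 2.5 * log 2 (real n) powr 4.5)"
    unfolding s5 using l4 by (intro mult_left_mono) auto
  finally show "norm (real (prog_time C n)) \<le> real (10000 + 150 * C) * 2 ^ 5 * 4 ^ 4 * norm (real n powr 2.5 * log 2 (real n) powr 4.5)"
    by simp
qed

theorem theorem1p1:
  shows "\<forall>c>0. \<exists>(P :: com) (k :: nat) (T :: nat \<Rightarrow> nat).
    runs_in_time k P T \<and>
    solves_sssp_whp k P T c \<and>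
    (\<lambda>n. real (T n)) \<in> O(\<lambda>n. real n powr 2.5 * log 2 (real n) powr 4.5)"
proof (intro allI impI)
  fix c :: real assume c: "0 < c"
  \<comment> \<open>\<open>C\<close> is a constant in the program text. It scales \<open>m\<close>
    and hence the running time, and through \<open>C + 12\<close> it also fixes the word
    size.\<close>
  define C where "C = 7 + nat \<lceil>c\<rceil>"
  have C: "7 + c \<le> real C" using c by (simp add: C_def)
  have main: "\<exists>p. run (word_bound (C + 12) n) (prog_time C n) (SSSP C) (sssp_input n G w s) = map_pmf (Pair Skip) p \<and>
     1 - 1 / real n powr c \<le> measure_pmf.prob p {\<sigma>. correct_answer G w s (sssp_output \<sigma>)}" if "sssp_instance n G s" for n G w s
    using SSSP_correct[OF that C c, of w] unfolding halts_def mmf_def .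
  have "runs_in_time (C + 12) (SSSP C) (prog_time C)"
    unfolding runs_in_time_def
  proof (intro allI impI)
    fix n G w s assume "sssp_instance n G s"
    from main[OF this, of w] obtain p where p: "run (word_bound (C + 12) n) (prog_time C n) (SSSP C) (sssp_input n G w s) = map_pmf (Pair Skip) p" by blast
    show "\<forall>(d, \<sigma>)\<in>set_pmf (run (word_bound (C + 12) n) (prog_time C n) (SSSP C) (sssp_input n G w s)). d = Skip"
      unfolding p by auto
  qed
  moreover have "solves_sssp_whp (C + 12) (SSSP C) (prog_time C) c"
    unfolding solves_sssp_whp_def
  proof (intro allI impI)
    fix n G w s assume "sssp_instance n G s"
    from main[OF this, of w] obtain p where p: "run (word_bound (C + 12) n) (prog_time C n) (SSSP C) (sssp_input n G w s) = map_pmf (Pair Skip) p"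
      "1 - 1 / real n powr c \<le> measure_pmf.prob p {\<sigma>. correct_answer G w s (sssp_output \<sigma>)}" by blast
    have "Pair Skip -` {(D, \<sigma>). D = Skip \<and> correct_answer G w s (sssp_output \<sigma>)} = {\<sigma>. correct_answer G w s (sssp_output \<sigma>)}" by auto
    then show "1 - 1 / real n powr c \<le> measure_pmf.prob (run (word_bound (C + 12) n) (prog_time C n) (SSSP C) (sssp_input n G w s))
      {(D, \<sigma>). D = Skip \<and> correct_answer G w s (sssp_output \<sigma>)}"
      unfolding p(1) using p(2) by simp
  qed
  ultimately show "\<exists>(P :: com) (k :: nat) (T :: nat \<Rightarrow> nat). runs_in_time k P T \<and> solves_sssp_whp k P T c \<and>
    (\<lambda>n. real (T n)) \<in> O(\<lambda>n. real n powr 2.5 * log 2 (real n) powr 4.5)"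
    using prog_time_bigo by blast
qed

end
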